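(* Let $\gamma$ be the fundamental corepresentation of $A_u(I_N)$, $N\neq2$, let $c_g$ be the path cocycle of its quantum Cayley graph, and consider for $n\ge1$ the corepresentations $\gamma^n=\gamma^{\otimes n}\in B(H_{\gamma^n})\otimes\mathcal{S}$. Then the norm of $C_n:=(\mathrm{id}\otimes c_g)(\gamma^n)$ as an element of $B(H_{\gamma^n},H_{\gamma^n}\otimes K_g)$ is bounded below by $C\sqrt{n+1}$ for some constant $C>0$ depending only on $m_1=\dim_q\gamma$. In particular the path cocycle $c_g:\mathcal{S}\to\mathcal{K}'_g$ is not trivial in the non-orthogonal case, i.e. for free products $\mathcal{S}$ of universal discrete quantum groups which do not consist of a single copy of some $\mathcal{A}_o(Q)$ (and all of whose directions have quantum dimension different from $2$).
   Context: Free products of universal discrete quantum groups. For $Q\in GL_n(\mathbb{C})$, $\mathcal{A}_u(Q)$ is the unital $*$-algebra generated by $n^2$ elements $u_{ij}$ subject to the relations making $u=(u_{ij})$ and $Q(u_{ij}^* )_{ij}Q^{-1}$ unitary; if $Q\bar Q\in\mathbb{C}I_n$, $\mathcal{A}_o(Q)$ is the quotient of $\mathcal{A}_u(Q)$ by the relations $u=Q(u_{ij}^* )_{ij}Q^{-1}$. Both have the coproduct $\delta(u_{ij})=\sum_k u_{ik}\otimes u_{kj}$. Let $\mathcal{S}$ be a free product of finitely many Hopf $*$-algebras of the form $\mathcal{A}_o(Q)$ or $\mathcal{A}_u(Q)$ (at least one factor). The set of directions $\mathcal{D}$ is the set of fundamental corepresentations of the factors: one self-dual direction $\gamma=\bar\gamma=u$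 for each factor $\mathcal{A}_o(Q)$ and two directions $\gamma=u,\bar\gamma=\bar u$ for each factor $\mathcal{A}_u(Q)$. The quantum dimension of $\gamma$ is $\dim_q\gamma=\mathrm{Tr}(F_\gamma)$, where $F_\gamma\in L(H_\gamma)$ is the unique positive invertible operator with $(\mathrm{id}\otimes\kappa^2)(\gamma)=(F_\gamma\otimes1)\gamma(F_\gamma^{-1}\otimes1)$ and $\mathrm{Tr}(F_\gamma)=\mathrm{Tr}(F_\gamma^{-1})$ ($\gamma\in L(H_\gamma)\otimes\mathcal{S}$ being taken unitary); for $A_u(I_N)$ it equals $N$. For $A_u(I_N)$ the tensor powers $\gamma^{\otimes n}$ act on $H_{\gamma^n}=H_\gamma^{\otimes n}$ and are irreducible. General notation. $\mathcal{S}$ has coproduct $\delta$, counit $\epsilon$, antipode $\kappa$, Haar state $h$. Let $\Lambda_h:\mathcal{S}\to H$ be the GNS map of $h$, $\lambda:\mathcal{S}\to B(H)$ the GNS representation (left multiplication), $\mathcal{H}=\Lambda_h(\mathcal{S})$. Let $V\in B(H\otimes H)$ be the unitary $V(\Lambda_h\otimes\Lambda_h)(x\otimes y)=(\Lambda_h\otimes\Lambda_h)(\delta(x)(1\otimes y))$, $\Sigma$ the flip of $H\otimes H$, and $U=J\hat J\in B(H)$ the unitary of the associated Kac system $(H,V,U)$: $J$ is the modular conjugation of $h$ and $\hat J\Lambda_h(x)=\Lambda_h(R(x)^* )$ with $R$ the unitary antipode. For an irreducible finite-dimensional corepresentation $\alpha$, $p_\alpha\in B(H)$ is the orthogonal projection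 onto the image by $\Lambda_h$ of the span of the coefficients of $\alpha$. Quantum Cayley graph. Put $p_1=\sum_{\gamma\in\mathcal{D}}p_\gamma$, $K=H\otimes p_1H$, on which $\mathcal{S}$ acts by $\lambda\otimes\mathrm{id}$; $\Theta=\Sigma(1\otimes U)V(U\otimes U)\Sigma\in B(K)$; $E_2:K\to H$ the bounded operator with $E_2(\Lambda_h(x)\otimes\Lambda_h(y))=\Lambda_h(xy)$; $K_g=\ker(\Theta+\mathrm{id})$, $p_g\in B(K)$ the orthogonal projection onto $K_g$, $\mathcal{K}=\mathcal{H}\otimes p_1H$ and $\mathcal{K}'_g=p_g(\mathcal{K})$. Cocycles. A cocycle $c:\mathcal{S}\to K$ is a linear map with $c(xy)=x\cdot c(y)+c(x)\epsilon(y)$ for all $x,y\in\mathcal{S}$; it is trivial if there is $\xi\in K$ with $c(x)=x\cdot\xi-\xi\epsilon(x)$ for all $x$. A path cocycle is a cocycle $c_g:\mathcal{S}\to K$ such that $c_g(\mathcal{S})\subset\mathcal{K}'_g$ and $E_2(c_g(x))=\Lambda_h(x)-\epsilon(x)\Lambda_h(1)$ for all $x\in\mathcal{S}$. It is known that a unique path cocycle exists as soon as all directions have quantum dimension different from $2$; $c_g$ denotes this path cocycle. *)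

theory Defs
  imports
    "HOL-Library.Poly_Mapping"
    "HOL-Analysis.Inner_Product"
    "HOL-Analysis.Product_Vector"
    "HOL-Analysis.Elementary_Topology"
    "HOL-Analysis.L2_Norm"
    "Jordan_Normal_Form.Gauss_Jordan_Elimination"
begin

section \<open>Complex Hilbert spaces\<close>

text \<open>The complex structure is put on top of the library's complete real inner product spaces, so
  that norm, topology and bounded (real-)linear maps are those of the library.
  The inner product is antilinear in the first variable.\<close>

class complex_hilbert = real_inner + complete_space +
  fixes scaleC :: "complex \<Rightarrow> 'a \<Rightarrow> 'a"
    and cinner :: "'a \<Rightarrow> 'a \<Rightarrow> complex"
  assumes scaleC_add_right: "scaleC a (x + y) = scaleC a x + scaleC a y"
    and scaleC_add_left: "scaleC (a + b) x = scaleC a x + scaleC b x"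
    and scaleC_scaleC: "scaleC a (scaleC b x) = scaleC (a * b) x"
    and scaleC_of_real: "scaleC (complex_of_real r) x = scaleR r x"
    and cinner_add_right: "cinner x (y + z) = cinner x y + cinner x z"
    and cinner_scaleC_right: "cinner x (scaleC a y) = a * cinner x y"
    and cinner_commute: "cinner x y = cnj (cinner y x)"
    and Re_cinner: "Re (cinner x y) = inner x y"

abbreviation cspan :: "'a::complex_hilbert set \<Rightarrow> 'a set"
  where "cspan \<equiv> Modules.module.span scaleC"

definition bounded_clinear :: "('a::complex_hilbert \<Rightarrow> 'b::complex_hilbert) \<Rightarrow> bool"
  where "bounded_clinear T \<longleftrightarrow> bounded_linear T \<and> (\<forall>a x. T (scaleC a x) = scaleC a (T x))"

definition unitary_op :: "('a::complex_hilbert \<Rightarrow> 'b::complex_hilbert) \<Rightarrow> bool"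
  where "unitary_op T \<longleftrightarrow> bounded_clinear T \<and> (\<forall>x. norm (T x) = norm x) \<and> surj T"

definition antiunitary_op :: "('a::complex_hilbert \<Rightarrow> 'b::complex_hilbert) \<Rightarrow> bool"
  where "antiunitary_op T \<longleftrightarrow> bounded_linear T \<and> (\<forall>a x. T (scaleC a x) = scaleC (cnj a) (T x)) \<and>
    (\<forall>x. norm (T x) = norm x) \<and> surj T"

definition orth_proj :: "'a::complex_hilbert set \<Rightarrow> 'a \<Rightarrow> 'a"
  where "orth_proj M \<xi> = (THE \<eta>. \<eta> \<in> M \<and> (\<forall>\<mu>\<in>M. cinner \<mu> (\<xi> - \<eta>) = 0))"

text \<open>Possibly unbounded, densely defined operators are represented by their graphs. Density of the
  domain together with the equality of the graph with its adjoint relation makes it single-valued.\<close>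

definition positive_selfadjoint :: "('a::complex_hilbert \<times> 'a) set \<Rightarrow> bool"
  where "positive_selfadjoint T \<longleftrightarrow> closure (Domain T) = UNIV \<and>
    T = {(\<xi>', \<eta>'). \<forall>(\<xi>, \<eta>)\<in>T. cinner \<eta> \<xi>' = cinner \<xi> \<eta>'} \<and>
    (\<forall>(\<xi>, \<eta>)\<in>T. 0 \<le> cinner \<xi> \<eta>)"

section \<open>The free star-algebra\<close>

text \<open>\<open>Gen k i j\<close> and \<open>StarGen k i j\<close> stand for the entry \<open>(i,j)\<close> of the fundamental
  corepresentation of the \<open>k\<close>-th factor and for its adjoint. The free algebra is the
  algebra of the free monoid (written additively, as required by \<open>Poly_Mapping\<close>).\<close>

datatype gen = Gen nat nat nat | StarGen nat nat nat

datatype gword = Word (letters: "gen list")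

instantiation gword :: monoid_add
begin
definition zero_gword :: gword where "zero_gword = Word []"
definition plus_gword :: "gword \<Rightarrow> gword \<Rightarrow> gword" where "plus_gword v w = Word (letters v @ letters w)"
instance by standard (auto simp: zero_gword_def plus_gword_def)
end

type_synonym falg = "gword \<Rightarrow>\<^sub>0 complex"

text \<open>The algebraic tensor square of the free algebra, with its componentwise product.\<close>

type_synonym falg2 = "(gword \<times> gword) \<Rightarrow>\<^sub>0 complex"

definition cst :: "complex \<Rightarrow> falg"
  where "cst a = Poly_Mapping.single 0 a"

definition scaleF :: "complex \<Rightarrow> falg \<Rightarrow> falg"
  where "scaleF a x = cst a * x"

definition mon :: "gword \<Rightarrow> falg"
  where "mon w = Poly_Mapping.single w 1"

fun star_gen :: "gen \<Rightarrow> gen" where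
  "star_gen (Gen k i j) = StarGen k i j"
| "star_gen (StarGen k i j) = Gen k i j"

definition starF :: "falg \<Rightarrow> falg"
  where "starF x = (\<Sum>w\<in>Poly_Mapping.keys x.
    Poly_Mapping.single (Word (rev (map star_gen (letters w)))) (cnj (Poly_Mapping.lookup x w)))"

definition tensF :: "falg \<Rightarrow> falg \<Rightarrow> falg2"
  where "tensF x y = (\<Sum>v\<in>Poly_Mapping.keys x. \<Sum>w\<in>Poly_Mapping.keys y.
    Poly_Mapping.single (v, w) (Poly_Mapping.lookup x v * Poly_Mapping.lookup y w))"

text \<open>The linear map on the tensor square induced by a bilinear map \<open>B\<close> (with \<open>sc\<close> the scalar
  multiplication of the target).\<close>

definition bilin_ext ::
    "(complex \<Rightarrow> 'a \<Rightarrow> 'a) \<Rightarrow> (falg \<Rightarrow> falg \<Rightarrow> 'a) \<Rightarrow> falg2 \<Rightarrow> 'a::comm_monoid_add"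
  where "bilin_ext sc B t =
    (\<Sum>p\<in>Poly_Mapping.keys t. sc (Poly_Mapping.lookup t p) (B (mon (fst p)) (mon (snd p))))"

section \<open>Free products of universal discrete quantum groups\<close>

datatype factor = AO "complex mat" | AU "complex mat"

fun fmat :: "factor \<Rightarrow> complex mat" where
  "fmat (AO Q) = Q"
| "fmat (AU Q) = Q"

fun valid_factor :: "factor \<Rightarrow> bool" where
  "valid_factor (AU Q) \<longleftrightarrow> 0 < dim_row Q \<and> invertible_mat Q"
| "valid_factor (AO Q) \<longleftrightarrow> 0 < dim_row Q \<and> invertible_mat Q \<and>
     (\<exists>a. Q * map_mat cnj Q = a \<cdot>\<^sub>m 1\<^sub>m (dim_row Q))"

definition fdim :: "factor list \<Rightarrow> nat \<Rightarrow> nat"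
  where "fdim fs k = (if k < length fs then dim_row (fmat (fs ! k)) else 0)"

definition inv_mat :: "complex mat \<Rightarrow> complex mat"
  where "inv_mat A = the (mat_inverse A)"

definition mtrace :: "complex mat \<Rightarrow> complex"
  where "mtrace A = (\<Sum>i<dim_row A. A $$ (i, i))"

definition pos_mat :: "nat \<Rightarrow> complex mat \<Rightarrow> bool"
  where "pos_mat n A \<longleftrightarrow> A \<in> carrier_mat n n \<and> (\<forall>v\<in>carrier_vec n. 0 \<le> (A *\<^sub>v v) \<bullet>c v)"

abbreviation cmat :: "complex mat \<Rightarrow> falg mat"
  where "cmat \<equiv> map_mat cst"

definition adjF :: "falg mat \<Rightarrow> falg mat"
  where "adjF A = map_mat starF (transpose_mat A)"

definition umat :: "factor list \<Rightarrow> nat \<Rightarrow> falg mat"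
  where "umat fs k = mat (fdim fs k) (fdim fs k) (\<lambda>(i, j). mon (Word [Gen k i j]))"

definition vmat :: "factor list \<Rightarrow> nat \<Rightarrow> falg mat"
  where "vmat fs k = cmat (fmat (fs ! k)) * map_mat starF (umat fs k) * cmat (inv_mat (fmat (fs ! k)))"

definition relations :: "factor list \<Rightarrow> nat \<Rightarrow> (falg mat \<times> falg mat) set"
  where "relations fs k =
    (let u = umat fs k; v = vmat fs k; e = 1\<^sub>m (fdim fs k) in
      {(u * adjF u, e), (adjF u * u, e), (v * adjF v, e), (adjF v * v, e)} \<union>
      (case fs ! k of AO Q \<Rightarrow> {(u, v)} | AU Q \<Rightarrow> {}))"

text \<open>The two-sided star-ideal of relations. Rule \<open>unused\<close> kills the generator symbols whose
  indices are out of range. The free product \<open>\<S>\<close> of the factors is the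
  free algebra modulo this ideal. It is not introduced as a separate type: its elements are represented
  by elements of the free algebra, equality in \<open>\<S>\<close> is congruence modulo the ideal, and a linear
  map on \<open>\<S>\<close> is a linear map on the free algebra vanishing on the ideal.\<close>

inductive_set rel_ideal :: "factor list \<Rightarrow> falg set" for fs :: "factor list" where
  unused: "\<not> (i < fdim fs k \<and> j < fdim fs k) \<Longrightarrow> mon (Word [Gen k i j]) \<in> rel_ideal fs"
| relator: "k < length fs \<Longrightarrow> (A, B) \<in> relations fs k \<Longrightarrow> i < fdim fs k \<Longrightarrow> j < fdim fs k \<Longrightarrow>
    A $$ (i, j) - B $$ (i, j) \<in> rel_ideal fs"
| zero: "0 \<in> rel_ideal fs"
| add: "x \<in> rel_ideal fs \<Longrightarrow> y \<in> rel_ideal fs \<Longrightarrow> x + y \<in> rel_ideal fs"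
| mult_left: "x \<in> rel_ideal fs \<Longrightarrow> y * x \<in> rel_ideal fs"
| mult_right: "x \<in> rel_ideal fs \<Longrightarrow> x * y \<in> rel_ideal fs"
| star: "x \<in> rel_ideal fs \<Longrightarrow> starF x \<in> rel_ideal fs"

definition eqS :: "factor list \<Rightarrow> falg \<Rightarrow> falg \<Rightarrow> bool"
  where "eqS fs x y \<longleftrightarrow> x - y \<in> rel_ideal fs"

definition mat_eqS :: "factor list \<Rightarrow> falg mat \<Rightarrow> falg mat \<Rightarrow> bool"
  where "mat_eqS fs A B \<longleftrightarrow> dim_row A = dim_row B \<and> dim_col A = dim_col B \<and>
    (\<forall>i<dim_row A. \<forall>j<dim_col A. eqS fs (A $$ (i, j)) (B $$ (i, j)))"

text \<open>The kernel of the projection onto the tensor square of \<open>\<S>\<close>.\<close>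

inductive_set rel_ideal2 :: "factor list \<Rightarrow> falg2 set" for fs :: "factor list" where
  zero2: "0 \<in> rel_ideal2 fs"
| add2: "s \<in> rel_ideal2 fs \<Longrightarrow> t \<in> rel_ideal2 fs \<Longrightarrow> s + t \<in> rel_ideal2 fs"
| left2: "x \<in> rel_ideal fs \<Longrightarrow> tensF x y \<in> rel_ideal2 fs"
| right2: "y \<in> rel_ideal fs \<Longrightarrow> tensF x y \<in> rel_ideal2 fs"

definition linear_on_S ::
    "factor list \<Rightarrow> (complex \<Rightarrow> 'a \<Rightarrow> 'a) \<Rightarrow> (falg \<Rightarrow> 'a::ab_group_add) \<Rightarrow> bool"
  where "linear_on_S fs sc f \<longleftrightarrow> Vector_Spaces.linear scaleF sc f \<and> (\<forall>x\<in>rel_ideal fs. f x = 0)"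

text \<open>As \<open>linear_on_S\<close>, for maps from \<open>\<S>\<close> to \<open>\<S>\<close>.\<close>

definition linear_S_S :: "factor list \<Rightarrow> (falg \<Rightarrow> falg) \<Rightarrow> bool"
  where "linear_S_S fs f \<longleftrightarrow> Vector_Spaces.linear scaleF scaleF f \<and> (\<forall>x\<in>rel_ideal fs. f x \<in> rel_ideal fs)"

subsection \<open>Hopf algebra structure\<close>

fun delta_gen :: "factor list \<Rightarrow> gen \<Rightarrow> falg2" where
  "delta_gen fs (Gen k i j) =
     (\<Sum>l<fdim fs k. tensF (mon (Word [Gen k i l])) (mon (Word [Gen k l j])))"
| "delta_gen fs (StarGen k i j) =
     (\<Sum>l<fdim fs k. tensF (mon (Word [StarGen k i l])) (mon (Word [StarGen k l j])))"

definition delta :: "factor list \<Rightarrow> falg \<Rightarrow> falg2"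
  where "delta fs x = (\<Sum>w\<in>Poly_Mapping.keys x.
    Poly_Mapping.single 0 (Poly_Mapping.lookup x w) * prod_list (map (delta_gen fs) (letters w)))"

fun eps_gen :: "factor list \<Rightarrow> gen \<Rightarrow> complex" where
  "eps_gen fs (Gen k i j) = (if i = j \<and> i < fdim fs k then 1 else 0)"
| "eps_gen fs (StarGen k i j) = (if i = j \<and> i < fdim fs k then 1 else 0)"

definition eps :: "factor list \<Rightarrow> falg \<Rightarrow> complex"
  where "eps fs x = (\<Sum>w\<in>Poly_Mapping.keys x.
    Poly_Mapping.lookup x w * prod_list (map (eps_gen fs) (letters w)))"

definition is_antipode :: "factor list \<Rightarrow> (falg \<Rightarrow> falg) \<Rightarrow> bool"
  where "is_antipode fs \<kappa> \<longleftrightarrow> linear_S_S fs \<kappa> \<and>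
    (\<forall>x. eqS fs (bilin_ext scaleF (\<lambda>a b. \<kappa> a * b) (delta fs x)) (cst (eps fs x)) \<and>
         eqS fs (bilin_ext scaleF (\<lambda>a b. a * \<kappa> b) (delta fs x)) (cst (eps fs x)))"

definition is_haar_state :: "factor list \<Rightarrow> (falg \<Rightarrow> complex) \<Rightarrow> bool"
  where "is_haar_state fs h \<longleftrightarrow> linear_on_S fs (*) h \<and> h 1 = 1 \<and> (\<forall>x. 0 \<le> h (starF x * x)) \<and>
    (\<forall>x. eqS fs (bilin_ext scaleF (\<lambda>a b. scaleF (h b) a) (delta fs x)) (cst (h x)) \<and>
         eqS fs (bilin_ext scaleF (\<lambda>a b. scaleF (h a) b) (delta fs x)) (cst (h x)))"

subsection \<open>Corepresentations and quantum dimension\<close>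

definition is_unitary_corep :: "factor list \<Rightarrow> falg mat \<Rightarrow> bool"
  where "is_unitary_corep fs \<alpha> \<longleftrightarrow> dim_row \<alpha> = dim_col \<alpha> \<and>
    mat_eqS fs (\<alpha> * adjF \<alpha>) (1\<^sub>m (dim_row \<alpha>)) \<and> mat_eqS fs (adjF \<alpha> * \<alpha>) (1\<^sub>m (dim_row \<alpha>)) \<and>
    (\<forall>i<dim_row \<alpha>. \<forall>j<dim_row \<alpha>.
      delta fs (\<alpha> $$ (i, j)) - (\<Sum>l<dim_row \<alpha>. tensF (\<alpha> $$ (i, l)) (\<alpha> $$ (l, j))) \<in> rel_ideal2 fs)"

text \<open>Irreducibility: the range of the orthogonal projection \<open>P\<close> is an invariant subspace iff
  \<open>\<alpha>(P \<otimes> 1) = (P \<otimes> 1)\<alpha>(P \<otimes> 1)\<close>.\<close>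

definition is_irreducible :: "factor list \<Rightarrow> falg mat \<Rightarrow> bool"
  where "is_irreducible fs \<alpha> \<longleftrightarrow> 0 < dim_row \<alpha> \<and>
    (\<forall>P\<in>carrier_mat (dim_row \<alpha>) (dim_row \<alpha>).
      P * P = P \<and> map_mat cnj (transpose_mat P) = P \<and> mat_eqS fs (\<alpha> * cmat P) (cmat P * \<alpha> * cmat P) \<longrightarrow>
      P = 0\<^sub>m (dim_row \<alpha>) (dim_row \<alpha>) \<or> P = 1\<^sub>m (dim_row \<alpha>))"

text \<open>\<open>F\<close> is the operator \<open>F\<^sub>\<alpha>\<close> of the (irreducible, unitary) corepresentation \<open>\<alpha>\<close>.\<close>

definition is_modular_mat :: "factor list \<Rightarrow> (falg \<Rightarrow> falg) \<Rightarrow> falg mat \<Rightarrow> complex mat \<Rightarrow> bool"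
  where "is_modular_mat fs \<kappa> \<alpha> F \<longleftrightarrow> pos_mat (dim_row \<alpha>) F \<and> invertible_mat F \<and>
    mtrace F = mtrace (inv_mat F) \<and>
    mat_eqS fs (map_mat (\<lambda>x. \<kappa> (\<kappa> x)) \<alpha>) (cmat F * \<alpha> * cmat (inv_mat F))"

definition qdim :: "factor list \<Rightarrow> (falg \<Rightarrow> falg) \<Rightarrow> falg mat \<Rightarrow> real"
  where "qdim fs \<kappa> \<alpha> = (THE d. \<exists>F. is_modular_mat fs \<kappa> \<alpha> F \<and> mtrace F = complex_of_real d)"

text \<open>The unitary antipode \<open>R\<close> comes from the polar decomposition \<open>\<kappa> = R \<circ> \<tau>\<close> of the antipode, where
  \<open>\<tau>\<close>, the scaling group at \<open>-i/2\<close>, is the positive square root of \<open>\<kappa>\<^sup>2\<close>: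
  \<open>(id \<otimes> \<tau>)(\<alpha>) = (F\<^sub>\<alpha>\<^bsup>1/2\<^esup> \<otimes> 1)\<alpha>(F\<^sub>\<alpha>\<^bsup>-1/2\<^esup> \<otimes> 1)\<close> for irreducible \<open>\<alpha>\<close>.\<close>

definition is_unitary_antipode :: "factor list \<Rightarrow> (falg \<Rightarrow> falg) \<Rightarrow> (falg \<Rightarrow> falg) \<Rightarrow> bool"
  where "is_unitary_antipode fs \<kappa> R \<longleftrightarrow> linear_S_S fs R \<and>
    (\<forall>x y. eqS fs (R (x * y)) (R y * R x)) \<and>
    (\<forall>x. eqS fs (R (starF x)) (starF (R x))) \<and>
    (\<forall>x. eqS fs (R (R x)) x) \<and>
    (\<forall>\<alpha> F G. is_unitary_corep fs \<alpha> \<and> is_irreducible fs \<alpha> \<and> is_modular_mat fs \<kappa> \<alpha> F \<and>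
       pos_mat (dim_row \<alpha>) G \<and> G * G = F \<longrightarrow>
       mat_eqS fs (map_mat R (cmat G * \<alpha> * cmat (inv_mat G))) (map_mat \<kappa> \<alpha>))"

text \<open>The second direction (the conjugate of \<open>u\<close>) of an \<open>AU\<close> factor is represented by the unitary matrix \<open>vmat\<close>,
  equivalent to the entrywise adjoint of \<open>u\<close>.\<close>

definition directions :: "factor list \<Rightarrow> falg mat list"
  where "directions fs = concat (map (\<lambda>k. case fs ! k of
      AO Q \<Rightarrow> [umat fs k] | AU Q \<Rightarrow> [umat fs k, vmat fs k]) [0..<length fs])"

text \<open>Entry of \<open>\<alpha>\<^bsup>\<otimes>n\<^esup>\<close> at the multi-indices \<open>v\<close>, \<open>w\<close> of length \<open>n\<close>.\<close>

definition tensor_power_entry :: "falg mat \<Rightarrow> nat list \<Rightarrow> nat list \<Rightarrow> falg"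
  where "tensor_power_entry \<alpha> v w = prod_list (map2 (\<lambda>i j. \<alpha> $$ (i, j)) v w)"

definition multi_indices :: "nat \<Rightarrow> nat \<Rightarrow> nat list set"
  where "multi_indices d n = {v. length v = n \<and> set v \<subseteq> {..<d}}"

section \<open>The quantum Cayley graph\<close>

text \<open>\<open>tens\<close>, \<open>tensop\<close> and \<open>flip\<close> are the Hilbert tensor product \<open>H \<otimes> H\<close>, realized on the
  type \<open>'k\<close>, the tensor product of bounded operators and the flip.\<close>

record ('h, 'k) cayley_data =
  antip :: "falg \<Rightarrow> falg"
  uantip :: "falg \<Rightarrow> falg"
  haar :: "falg \<Rightarrow> complex"
  gns :: "falg \<Rightarrow> 'h"
  lreg :: "falg \<Rightarrow> 'h \<Rightarrow> 'h"
  modconj :: "'h \<Rightarrow> 'h"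
  dualconj :: "'h \<Rightarrow> 'h"
  tens :: "'h \<Rightarrow> 'h \<Rightarrow> 'k"
  tensop :: "('h \<Rightarrow> 'h) \<Rightarrow> ('h \<Rightarrow> 'h) \<Rightarrow> 'k \<Rightarrow> 'k"
  flip :: "'k \<Rightarrow> 'k"
  multu :: "'k \<Rightarrow> 'k"
  target :: "'k \<Rightarrow> 'h"

definition proj_corep :: "('h::complex_hilbert, 'k::complex_hilbert) cayley_data \<Rightarrow> falg mat \<Rightarrow> 'h \<Rightarrow> 'h"
  where "proj_corep G \<alpha> = orth_proj (gns G ` Modules.module.span scaleF
    {\<alpha> $$ (i, j) | i j. i < dim_row \<alpha> \<and> j < dim_col \<alpha>})"

definition p1 :: "factor list \<Rightarrow> ('h::complex_hilbert, 'k::complex_hilbert) cayley_data \<Rightarrow> 'h \<Rightarrow> 'h"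
  where "p1 fs G \<xi> = (\<Sum>\<gamma>\<leftarrow>directions fs. proj_corep G \<gamma> \<xi>)"

text \<open>The last clause of \<open>gns_modconj\<close> is the polar decomposition of the closure of
  \<open>\<Lambda>(x) \<mapsto> \<Lambda>(x\<^sup>*)\<close> into the antiunitary \<open>J\<close> and a positive self-adjoint operator. In
  \<open>target_gns\<close>, \<open>E\<^sub>2\<close> is only determined (and only used) on \<open>K = H \<otimes> p\<^sub>1H\<close>; a bounded operator on
  \<open>K\<close> extends to \<open>H \<otimes> H\<close>.\<close>

locale quantum_cayley_graph =
  fixes fs :: "factor list" and G :: "('h::complex_hilbert, 'k::complex_hilbert) cayley_data"
  assumes antipode: "is_antipode fs (antip G)"
    and unitary_antipode: "is_unitary_antipode fs (antip G) (uantip G)"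
    and haar_state: "is_haar_state fs (haar G)"
    and gns_linear: "linear_on_S fs scaleC (gns G)"
    and gns_cinner: "cinner (gns G x) (gns G y) = haar G (starF x * y)"
    and gns_dense: "closure (range (gns G)) = UNIV"
    and lreg_bounded: "bounded_clinear (lreg G x)"
    and lreg_gns: "lreg G x (gns G y) = gns G (x * y)"
    and modconj_antiunitary: "antiunitary_op (modconj G)"
    and gns_modconj: "\<exists>T. positive_selfadjoint T \<and>
      closure {(gns G x, gns G (starF x)) | x. True} = {(\<xi>, modconj G \<eta>) | \<xi> \<eta>. (\<xi>, \<eta>) \<in> T}"
    and dualconj_antiunitary: "antiunitary_op (dualconj G)"
    and dualconj_gns: "dualconj G (gns G x) = gns G (starF (uantip G x))"
    and tens_linear_left: "bounded_clinear (\<lambda>\<xi>. tens G \<xi> \<eta>)"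
    and tens_linear_right: "bounded_clinear (\<lambda>\<eta>. tens G \<xi> \<eta>)"
    and tens_cinner: "cinner (tens G \<xi> \<eta>) (tens G \<xi>' \<eta>') = cinner \<xi> \<xi>' * cinner \<eta> \<eta>'"
    and tens_dense: "closure (cspan {tens G \<xi> \<eta> | \<xi> \<eta>. True}) = UNIV"
    and tensop_bounded: "bounded_clinear A \<Longrightarrow> bounded_clinear B \<Longrightarrow> bounded_clinear (tensop G A B)"
    and tensop_tens: "bounded_clinear A \<Longrightarrow> bounded_clinear B \<Longrightarrow>
      tensop G A B (tens G \<xi> \<eta>) = tens G (A \<xi>) (B \<eta>)"
    and flip_unitary: "unitary_op (flip G)"
    and flip_tens: "flip G (tens G \<xi> \<eta>) = tens G \<eta> \<xi>"
    and multu_unitary: "unitary_op (multu G)"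
    and multu_gns: "multu G (tens G (gns G x) (gns G y)) =
      bilin_ext scaleC (\<lambda>a b. tens G (gns G a) (gns G b)) (delta fs x * tensF 1 y)"
    and target_bounded: "bounded_clinear (target G)"
    and target_gns: "gns G y \<in> range (p1 fs G) \<Longrightarrow>
      target G (tens G (gns G x) (gns G y)) = gns G (x * y)"

definition Uop :: "('h::complex_hilbert, 'k::complex_hilbert) cayley_data \<Rightarrow> 'h \<Rightarrow> 'h"
  where "Uop G = modconj G \<circ> dualconj G"

definition Theta :: "('h::complex_hilbert, 'k::complex_hilbert) cayley_data \<Rightarrow> 'k \<Rightarrow> 'k"
  where "Theta G = flip G \<circ> tensop G id (Uop G) \<circ> multu G \<circ> tensop G (Uop G) (Uop G) \<circ> flip G"

definition act :: "('h::complex_hilbert, 'k::complex_hilbert) cayley_data \<Rightarrow> falg \<Rightarrow> 'k \<Rightarrow> 'k"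
  where "act G x = tensop G (lreg G x) id"

definition Kspace :: "factor list \<Rightarrow> ('h::complex_hilbert, 'k::complex_hilbert) cayley_data \<Rightarrow> 'k set"
  where "Kspace fs G = closure (cspan {tens G \<xi> \<eta> | \<xi> \<eta>. \<eta> \<in> range (p1 fs G)})"

definition Kalg :: "factor list \<Rightarrow> ('h::complex_hilbert, 'k::complex_hilbert) cayley_data \<Rightarrow> 'k set"
  where "Kalg fs G = cspan {tens G (gns G x) \<eta> | x \<eta>. \<eta> \<in> range (p1 fs G)}"

definition Kg :: "factor list \<Rightarrow> ('h::complex_hilbert, 'k::complex_hilbert) cayley_data \<Rightarrow> 'k set"
  where "Kg fs G = {\<zeta> \<in> Kspace fs G. Theta G \<zeta> + \<zeta> = 0}"

definition Kg' :: "factor list \<Rightarrow> ('h::complex_hilbert, 'k::complex_hilbert) cayley_data \<Rightarrow> 'k set"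
  where "Kg' fs G = orth_proj (Kg fs G) ` Kalg fs G"

definition is_cocycle ::
    "factor list \<Rightarrow> ('h::complex_hilbert, 'k::complex_hilbert) cayley_data \<Rightarrow> (falg \<Rightarrow> 'k) \<Rightarrow> bool"
  where "is_cocycle fs G c \<longleftrightarrow> linear_on_S fs scaleC c \<and> range c \<subseteq> Kspace fs G \<and>
    (\<forall>x y. c (x * y) = act G x (c y) + scaleC (eps fs y) (c x))"

definition trivial_cocycle ::
    "factor list \<Rightarrow> ('h::complex_hilbert, 'k::complex_hilbert) cayley_data \<Rightarrow> (falg \<Rightarrow> 'k) \<Rightarrow> bool"
  where "trivial_cocycle fs G c \<longleftrightarrow>
    (\<exists>\<xi>\<in>Kspace fs G. \<forall>x. c x = act G x \<xi> - scaleC (eps fs x) \<xi>)"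

definition path_cocycle ::
    "factor list \<Rightarrow> ('h::complex_hilbert, 'k::complex_hilbert) cayley_data \<Rightarrow> (falg \<Rightarrow> 'k) \<Rightarrow> bool"
  where "path_cocycle fs G c \<longleftrightarrow> is_cocycle fs G c \<and> range c \<subseteq> Kg' fs G \<and>
    (\<forall>x. target G (c x) = gns G x - scaleC (eps fs x) (gns G 1))"

text \<open>Operator norm of \<open>\<xi> \<mapsto> (\<Sum>\<^sub>j \<xi>\<^sub>j A\<^sub>i\<^sub>j)\<^sub>i\<close> from \<open>\<ell>\<^sup>2(I)\<close> to \<open>\<ell>\<^sup>2(I) \<otimes> K\<close>, for finite \<open>I\<close>.\<close>

definition vmat_norm :: "'i set \<Rightarrow> ('i \<Rightarrow> 'i \<Rightarrow> 'k::complex_hilbert) \<Rightarrow> real"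
  where "vmat_norm I A = (SUP \<xi>\<in>{\<xi>. L2_set (\<lambda>j. cmod (\<xi> j)) I \<le> 1}.
    L2_set (\<lambda>i. norm (\<Sum>j\<in>I. scaleC (\<xi> j) (A i j))) I)"

end

theory Submission
  imports Defs "Jordan_Normal_Form.Schur_Decomposition" "Jordan_Normal_Form.Spectral_Radius"
begin

text \<open>For a direction \<open>\<gamma>\<close> let \<open>\<omega>\<^sub>\<gamma>\<close> be the vector that implements the counit on the coefficients of \<open>\<gamma>\<close>;
  its norm is \<open>dim\<^sub>q \<gamma>\<close>. Since \<open>E\<^sub>2 \<Theta> = id \<otimes> (\<Sum>\<^sub>\<gamma> \<omega>\<^sub>\<gamma>)\<^sup>*\<close>, the component \<open>(id \<otimes> \<omega>\<^sub>\<gamma>\<^sup>*)c\<^sub>g(x)\<close> of the path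
  cocycle can be computed: it is \<open>\<Lambda>(a(x))\<close> for an explicit cocycle \<open>a\<close> with values in \<open>\<S>\<close>, given on the
  generators by \<open>\<epsilon>\<close>, \<open>- id\<close>, \<open>\<epsilon> - id\<close> or \<open>0\<close>. Hence \<open>dim\<^sub>q \<gamma> \<parallel>c\<^sub>g(x)\<parallel> \<ge> \<parallel>\<Lambda>(a(x))\<parallel>\<close>. Along a column of a product of
  fundamental corepresentations, the numbers \<open>\<parallel>\<Lambda>(a(x))\<parallel>\<^sup>2\<close> add up to a sum that grows by a constant with
  each factor, as the mixed terms vanish: for \<open>A\<^sub>u\<close> because \<open>u \<mapsto> 2u\<close> extends to an automorphism that
  preserves the Haar state, for two factors \<open>A\<^sub>o\<close> because the Haar state vanishes on alternating words.
  The latter is seen from representations by lower bidiagonal matrices. A trivial cocycle is bounded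
  along columns.\<close>

section \<open>The free star-algebra\<close>

text \<open>\<S> is known only by generators and relations, so even the linear independence of the
  u_ij has to be proved. Such facts come from explicit finite-dimensional representations, which
  need not respect the star and may thus contain nilpotent parts. Together with the invariance of
  the Haar state they give the orthogonality relations, the modular property and the operator U on
  the generators, hence \<Theta> on edges. The obstacle is that the path property is an identity
  between vectors \<Lambda>(x), whereas a is defined on \<S>. It is overcome by showing that linear
  maps defined on \<S> vanish on the kernel of \<Lambda>; the antipode serves for this. The cocycle
  a has its origin in the projection p_g. For b = \<Lambda>(z) \<otimes> \<omega>_\<gamma> one has
  \<Theta>(\<Theta> b) = b, so b - \<Theta> b lies in K_g, and for c = p_g(t) twice the inner
  product of b and c involves only t and \<Theta> t. On a single edge this is the prescribed value
  of a. One column of \<gamma>^n suffices for the bound, and the norm of \<omega>_\<gamma> is the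
  only datum that enters; hence C depends on m_1 alone.\<close>

lemma sum_monomials: "(\<Sum>w\<in>Poly_Mapping.keys x. Poly_Mapping.single w (Poly_Mapping.lookup x w)) = x"
proof (rule poly_mapping_eqI)
  fix k
  have "Poly_Mapping.lookup (\<Sum>w\<in>Poly_Mapping.keys x. Poly_Mapping.single w (Poly_Mapping.lookup x w)) k
     = (\<Sum>w\<in>Poly_Mapping.keys x. if w = k then Poly_Mapping.lookup x w else 0)"
    unfolding lookup_sum by (intro sum.cong) (auto simp: lookup_single when_def)
  also have "\<dots> = Poly_Mapping.lookup x k"
    by (auto simp: not_in_keys_iff_lookup_eq_zero)
  finally show "Poly_Mapping.lookup (\<Sum>w\<in>Poly_Mapping.keys x. Poly_Mapping.single w (Poly_Mapping.lookup x w)) k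
     = Poly_Mapping.lookup x k" .
qed

lemma poly_mapping_single_induct [case_names single add]:
  fixes x :: "'a \<Rightarrow>\<^sub>0 'b::comm_monoid_add"
  assumes s: "\<And>w a. P (Poly_Mapping.single w a)" and a: "\<And>x y. P x \<Longrightarrow> P y \<Longrightarrow> P (x + y)"
  shows "P x"
proof -
  have "P (\<Sum>w\<in>A. Poly_Mapping.single w (Poly_Mapping.lookup x w))" if "finite A" for A
    using that by (induction A) (use s[of _ 0] s a in auto)
  from this[of "Poly_Mapping.keys x"] show ?thesis by (simp add: sum_monomials)
qed

lemma keys_sum_single:
  assumes "F w 0 = 0"
  shows "(\<Sum>v\<in>Poly_Mapping.keys (Poly_Mapping.single w a). F v (Poly_Mapping.lookup (Poly_Mapping.single w a) v)) = F w a"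
  using assms by (cases "a = 0") auto

text \<open>The maps out of the free algebra are sums over \<open>keys\<close>, a set that may
  shrink under addition. All sums are extended to a common support, where \<open>F w 0 = 0\<close>
  removes the extra terms.\<close>

lemma keys_sum_add:
  fixes F :: "'a \<Rightarrow> 'b::comm_monoid_add \<Rightarrow> 'c::comm_monoid_add"
  assumes "\<And>w. F w 0 = 0" and "\<And>w a b. F w (a + b) = F w a + F w b"
  shows "(\<Sum>w\<in>Poly_Mapping.keys (x + y). F w (Poly_Mapping.lookup (x + y) w)) =
    (\<Sum>w\<in>Poly_Mapping.keys x. F w (Poly_Mapping.lookup x w)) + (\<Sum>w\<in>Poly_Mapping.keys y. F w (Poly_Mapping.lookup y w))"
proof -
  let ?A = "Poly_Mapping.keys x \<union> Poly_Mapping.keys y"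
  have ext: "(\<Sum>w\<in>Poly_Mapping.keys z. F w (Poly_Mapping.lookup z w)) = (\<Sum>w\<in>?A. F w (Poly_Mapping.lookup z w))"
    if "Poly_Mapping.keys z \<subseteq> ?A" for z
    by (rule sum.mono_neutral_left) (use that assms(1) in \<open>auto simp: in_keys_iff\<close>)
  have "Poly_Mapping.keys (x + y) \<subseteq> ?A" by (rule Poly_Mapping.keys_add)
  then show ?thesis
    by (simp only: ext[OF \<open>Poly_Mapping.keys (x + y) \<subseteq> ?A\<close>] ext[of x] ext[of y] Un_upper1 Un_upper2)
      (simp add: lookup_add assms(2) sum.distrib)
qed

lemma cst_mult: "cst (a * b) = cst a * cst b"
  by (simp add: cst_def mult_single)

lemma cst_add: "cst (a + b) = cst a + cst b"
  by (simp add: cst_def single_add)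

lemma cst_0 [simp]: "cst 0 = 0" and cst_1 [simp]: "cst 1 = 1"
  by (simp_all add: cst_def)

lemma cst_diff: "cst (a - b) = cst a - cst b"
  by (simp add: cst_def single_diff)

lemma cst_sum: "cst (\<Sum>i\<in>A. f i) = (\<Sum>i\<in>A. cst (f i))"
  by (induction A rule: infinite_finite_induct) (auto simp: cst_add)

lemma cst_commute: "x * cst a = cst a * x"
  by (induction x rule: poly_mapping_single_induct)
    (auto simp: cst_def mult_single distrib_left distrib_right mult.commute)

lemma cst_left_commute: "x * (cst a * y) = cst a * (x * y)"
  by (metis cst_commute mult.assoc)

interpretation F: vector_space scaleF
  by standard (simp_all add: scaleF_def cst_add cst_mult algebra_simps)

lemma mult_scaleF_left: "scaleF a x * y = scaleF a (x * y)"
  and mult_scaleF_right: "x * scaleF a y = scaleF a (x * y)"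
  by (simp_all add: scaleF_def mult.assoc cst_left_commute)

lemma scaleF_1_cst: "scaleF a 1 = cst a" and scaleF_cst: "scaleF a (cst b) = cst (a * b)"
  by (simp_all add: scaleF_def cst_mult)

lemma single_eq_scaleF: "Poly_Mapping.single w a = scaleF a (mon w)"
  by (simp add: scaleF_def cst_def mon_def mult_single)

lemma scaleF_single: "scaleF a (Poly_Mapping.single w b) = Poly_Mapping.single w (a * b)"
  by (simp add: scaleF_def cst_def mult_single)

lemma falg_induct [case_names mon scale add]:
  assumes "\<And>w. P (mon w)" "\<And>a x. P x \<Longrightarrow> P (scaleF a x)" "\<And>x y. P x \<Longrightarrow> P y \<Longrightarrow> P (x + y)"
  shows "P x"
  by (induction x rule: poly_mapping_single_induct) (simp_all add: single_eq_scaleF assms)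

lemma mon_mult: "mon v * mon w = mon (v + w)"
  by (simp add: mon_def mult_single)

lemma mon_Nil: "mon (Word []) = 1"
  by (simp add: mon_def flip: zero_gword_def)

lemma mon_append: "mon (Word (v @ w)) = mon (Word v) * mon (Word w)"
  by (simp add: mon_mult plus_gword_def)

lemma mon_Cons: "mon (Word (g # w)) = mon (Word [g]) * mon (Word w)"
  using mon_append[of "[g]" w] by simp

text \<open>\<open>linearF sc f\<close> is \<open>Vector_Spaces.linear scaleF sc f\<close> without the vector space axioms for \<open>sc\<close>.\<close>

definition linearF :: "(complex \<Rightarrow> 'a \<Rightarrow> 'a) \<Rightarrow> (falg \<Rightarrow> 'a::ab_group_add) \<Rightarrow> bool"
  where "linearF sc f \<longleftrightarrow> (\<forall>x y. f (x + y) = f x + f y) \<and> (\<forall>a x. f (scaleF a x) = sc a (f x))"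

lemma linearF_add: "linearF sc f \<Longrightarrow> f (x + y) = f x + f y"
  and linearF_scale: "linearF sc f \<Longrightarrow> f (scaleF a x) = sc a (f x)"
  by (auto simp: linearF_def)

lemma linearF_0: "linearF sc f \<Longrightarrow> f 0 = 0"
  using linearF_add[of sc f 0 0] by simp

lemma linearF_diff: "linearF sc f \<Longrightarrow> f (x - y) = f x - f y"
  by (metis add_diff_cancel diff_add_cancel linearF_add)

lemma linearF_minus: "linearF sc f \<Longrightarrow> f (- x) = - f x"
  by (metis diff_0 linearF_0 linearF_diff)

lemma linearF_sum: "linearF sc f \<Longrightarrow> f (\<Sum>i\<in>A. g i) = (\<Sum>i\<in>A. f (g i))"
  by (induction A rule: infinite_finite_induct) (auto simp: linearF_0 linearF_add)

lemma linear_imp_linearF: "Vector_Spaces.linear scaleF sc f \<Longrightarrow> linearF sc f"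
  by (simp add: Vector_Spaces.linear_iff linearF_def)

lemma linearF_eqI:
  assumes "linearF sc f" "linearF sc g" "\<And>w. f (mon w) = g (mon w)"
  shows "f x = g x"
  by (induction x rule: falg_induct) (simp_all add: assms linearF_add[of sc] linearF_scale[of sc])

lemma linearF_compose: "linearF sc f \<Longrightarrow> linearF scaleF g \<Longrightarrow> linearF sc (\<lambda>x. f (g x))"
  by (simp add: linearF_def)

lemma linearF_mult_left: "linearF scaleF (\<lambda>x. y * x)" and linearF_mult_right: "linearF scaleF (\<lambda>x. x * y)"
  by (simp_all add: linearF_def distrib_left distrib_right mult_scaleF_left mult_scaleF_right)

definition lext :: "(complex \<Rightarrow> 'a \<Rightarrow> 'a) \<Rightarrow> (gword \<Rightarrow> 'a) \<Rightarrow> falg \<Rightarrow> 'a::ab_group_add"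
  where "lext sc f x = (\<Sum>w\<in>Poly_Mapping.keys x. sc (Poly_Mapping.lookup x w) (f w))"

text \<open>One locale for the three kinds of target that occur, the scalars, the free algebra and
  the Hilbert spaces, so that linear and bilinear extension are set up only once.\<close>

locale cvector_space = vector_space scale
  for scale :: "complex \<Rightarrow> 'a \<Rightarrow> 'a::ab_group_add"

lemma (in cvector_space) linearF_lext: "linearF scale (lext scale f)"
proof -
  have add: "lext scale f (x + y) = lext scale f x + lext scale f y" for x y
    unfolding lext_def by (rule keys_sum_add) (simp_all add: scale_left_distrib)
  have single: "lext scale f (Poly_Mapping.single w a) = scale a (f w)" for w a
    unfolding lext_def by (rule keys_sum_single) simp
  have "lext scale f (scaleF a x) = scale a (lext scale f x)" for a x
    by (induction x rule: poly_mapping_single_induct)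
      (simp_all add: add single F.scale_right_distrib scale_right_distrib scaleF_single)
  then show ?thesis by (simp add: linearF_def add)
qed

lemma (in cvector_space) lext_mon: "lext scale f (mon w) = f w"
  unfolding lext_def mon_def by (subst keys_sum_single) simp_all

interpretation F: cvector_space scaleF ..

subsection \<open>Involution\<close>

definition srev :: "gword \<Rightarrow> gword"
  where "srev w = Word (rev (map star_gen (letters w)))"

lemma star_gen_star_gen [simp]: "star_gen (star_gen g) = g"
  by (cases g) auto

lemma starF_single: "starF (Poly_Mapping.single w a) = Poly_Mapping.single (srev w) (cnj a)"
  unfolding starF_def srev_def by (subst keys_sum_single) simp_all

lemma starF_add: "starF (x + y) = starF x + starF y"
  unfolding starF_def by (rule keys_sum_add) (simp_all add: single_add)

lemma starF_mon: "starF (mon w) = mon (srev w)"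
  by (simp add: mon_def starF_single)

lemma srev_plus: "srev (v + w) = srev w + srev v"
  by (simp add: srev_def plus_gword_def)

lemma starF_mult: "starF (x * y) = starF y * starF x"
proof (induction x rule: poly_mapping_single_induct)
  case (single v a)
  show ?case by (induction y rule: poly_mapping_single_induct)
      (simp_all add: mult_single starF_single srev_plus distrib_left distrib_right starF_add mult.commute)
qed (simp add: distrib_left distrib_right starF_add)

lemma starF_starF [simp]: "starF (starF x) = x"
  by (induction x rule: poly_mapping_single_induct)
    (simp_all add: starF_single starF_add srev_def o_def flip: rev_map)

lemma starF_cst [simp]: "starF (cst a) = cst (cnj a)"
  by (simp add: cst_def starF_single srev_def zero_gword_def)

lemma starF_scaleF: "starF (scaleF a x) = scaleF (cnj a) (starF x)"
  by (simp add: scaleF_def starF_mult cst_commute)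

lemma starF_0 [simp]: "starF 0 = 0" and starF_1 [simp]: "starF 1 = 1"
  using starF_cst[of 0] starF_cst[of 1] by simp_all

lemma starF_diff: "starF (x - y) = starF x - starF y"
  by (metis add_diff_cancel diff_add_cancel starF_add)

lemma starF_sum: "starF (\<Sum>i\<in>A. f i) = (\<Sum>i\<in>A. starF (f i))"
  by (induction A rule: infinite_finite_induct) (auto simp: starF_add)

subsection \<open>Counit\<close>

interpretation C: cvector_space "(*) :: complex \<Rightarrow> complex \<Rightarrow> complex"
  by standard (simp_all add: algebra_simps)

declare C.scale_scale [simp del]

lemma eps_lext: "eps fs = lext (*) (\<lambda>w. prod_list (map (eps_gen fs) (letters w)))"
  by (simp add: eps_def lext_def fun_eq_iff)

lemma linearF_eps: "linearF (*) (eps fs)"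
  by (simp add: eps_lext C.linearF_lext)

lemma eps_mon: "eps fs (mon w) = prod_list (map (eps_gen fs) (letters w))"
  by (simp add: eps_lext C.lext_mon)

lemmas eps_add = linearF_add[OF linearF_eps] and eps_scaleF = linearF_scale[OF linearF_eps]
  and eps_diff = linearF_diff[OF linearF_eps] and eps_sum = linearF_sum[OF linearF_eps]
  and eps_0 [simp] = linearF_0[OF linearF_eps]

lemma eps_mult: "eps fs (x * y) = eps fs x * eps fs y"
proof (induction x rule: falg_induct)
  case (mon v)
  show ?case by (induction y rule: falg_induct)
      (simp_all add: mon_mult eps_mon eps_add eps_scaleF distrib_left plus_gword_def mult_scaleF_right)
qed (simp_all add: eps_add eps_scaleF distrib_right mult_scaleF_left)

lemma eps_1 [simp]: "eps fs 1 = 1"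
  using eps_mon[of fs "Word []"] by (simp add: mon_Nil)

lemma eps_cst [simp]: "eps fs (cst a) = a"
  using eps_scaleF[of fs a 1] by (simp add: scaleF_def)

lemma eps_starF: "eps fs (starF x) = cnj (eps fs x)"
proof (induction x rule: falg_induct)
  case (mon w)
  have *: "eps_gen fs (star_gen g) = cnj (eps_gen fs g)" for g by (cases g) auto
  have "prod_list (map (eps_gen fs) (rev (map star_gen v))) = cnj (prod_list (map (eps_gen fs) v))" for v
    by (induction v) (simp_all add: *)
  then show ?case by (simp add: starF_mon eps_mon srev_def)
qed (simp_all add: eps_add eps_scaleF starF_add starF_scaleF)

subsection \<open>The tensor square and the coproduct\<close>

lemma tensF_single: "tensF (Poly_Mapping.single v a) (Poly_Mapping.single w b) = Poly_Mapping.single (v, w) (a * b)"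
  by (cases "a = 0"; cases "b = 0") (simp_all add: tensF_def)

lemma tensF_add_left: "tensF (x + x') y = tensF x y + tensF x' y"
  unfolding tensF_def
  by (rule keys_sum_add[where F = "\<lambda>u c. \<Sum>w\<in>Poly_Mapping.keys y.
      Poly_Mapping.single (u, w) (c * Poly_Mapping.lookup y w)"])
    (simp_all add: distrib_right single_add sum.distrib)

lemma tensF_add_right: "tensF x (y + y') = tensF x y + tensF x y'"
proof -
  have "(\<Sum>w\<in>Poly_Mapping.keys (y + y'). Poly_Mapping.single (v, w) (a * Poly_Mapping.lookup (y + y') w)) =
     (\<Sum>w\<in>Poly_Mapping.keys y. Poly_Mapping.single (v, w) (a * Poly_Mapping.lookup y w)) +
     (\<Sum>w\<in>Poly_Mapping.keys y'. Poly_Mapping.single (v, w) (a * Poly_Mapping.lookup y' w))" for v a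
    by (rule keys_sum_add[where F = "\<lambda>w c. Poly_Mapping.single (v, w) (a * c)"])
      (simp_all add: distrib_left single_add)
  then show ?thesis unfolding tensF_def sum.distrib[symmetric] by (intro sum.cong refl)
qed

lemma tensF_mult: "tensF x y * tensF x' y' = tensF (x * x') (y * y')"
proof (induction x rule: poly_mapping_single_induct)
  case (single v a)
  show ?case
  proof (induction y rule: poly_mapping_single_induct)
    case (single w b)
    show ?case
    proof (induction x' rule: poly_mapping_single_induct)
      case (single v' a')
      show ?case
      proof (induction y' rule: poly_mapping_single_induct)
        case (single w' b')
        have "a * b * (a' * b') = a * a' * (b * b')" by simp
        then show ?case by (simp only: tensF_single mult_single add_Pair)
      qed (simp only: distrib_left tensF_add_right)
    qed (simp only: tensF_add_left distrib_left)
  qed (simp only: tensF_add_right distrib_right)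
qed (simp only: tensF_add_left distrib_right)

lemma tensF_scaleF: "tensF (scaleF a x) (scaleF b y) = Poly_Mapping.single 0 (a * b) * tensF x y"
  unfolding scaleF_def tensF_mult[symmetric] by (simp add: cst_def tensF_single flip: zero_prod_def)

lemma single_pair: "Poly_Mapping.single (p :: gword \<times> gword) a = tensF (scaleF a (mon (fst p))) (mon (snd p))"
  by (simp add: mon_def scaleF_single tensF_single)

lemma falg2_induct [case_names tens add]:
  assumes "\<And>x y. P (tensF x y)" "\<And>s t. P s \<Longrightarrow> P t \<Longrightarrow> P (s + t)"
  shows "P t"
  by (induction t rule: poly_mapping_single_induct) (simp_all add: single_pair assms)

definition bilinF :: "(complex \<Rightarrow> 'a \<Rightarrow> 'a) \<Rightarrow> (falg \<Rightarrow> falg \<Rightarrow> 'a::ab_group_add) \<Rightarrow> bool"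
  where "bilinF sc B \<longleftrightarrow> (\<forall>y. linearF sc (\<lambda>x. B x y)) \<and> (\<forall>x. linearF sc (B x))"

lemma bilinF_left: "bilinF sc B \<Longrightarrow> linearF sc (\<lambda>x. B x y)"
  and bilinF_right: "bilinF sc B \<Longrightarrow> linearF sc (B x)"
  by (auto simp: bilinF_def)

context cvector_space begin

lemma bilin_ext_add: "bilin_ext scale B (s + t) = bilin_ext scale B s + bilin_ext scale B t"
  unfolding bilin_ext_def by (rule keys_sum_add) (simp_all add: scale_left_distrib)

lemma bilin_ext_0 [simp]: "bilin_ext scale B 0 = 0"
  by (simp add: bilin_ext_def)

lemma bilin_ext_sum: "bilin_ext scale B (\<Sum>i\<in>A. f i) = (\<Sum>i\<in>A. bilin_ext scale B (f i))"
  by (induction A rule: infinite_finite_induct) (auto simp: bilin_ext_add)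

lemma bilin_ext_tensF:
  assumes "bilinF scale B"
  shows "bilin_ext scale B (tensF x y) = B x y"
proof -
  note L = linearF_add[OF bilinF_left[OF assms]] linearF_scale[OF bilinF_left[OF assms]]
    linearF_add[OF bilinF_right[OF assms]] linearF_scale[OF bilinF_right[OF assms]]
  show ?thesis
  proof (induction x rule: poly_mapping_single_induct)
    case (single v a)
    show ?case
    proof (induction y rule: poly_mapping_single_induct)
      case (single w b)
      have "bilin_ext scale B (tensF (Poly_Mapping.single v a) (Poly_Mapping.single w b)) =
          scale (a * b) (B (mon v) (mon w))"
        unfolding tensF_single bilin_ext_def by (subst keys_sum_single) simp_all
      then show ?case by (simp add: single_eq_scaleF L)
    qed (simp add: tensF_add_right bilin_ext_add L)
  qed (simp add: tensF_add_left bilin_ext_add L)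
qed

end

lemma bilin_ext_uadd:
  assumes "\<And>x y. B x y = B1 x y + B2 x y" "vector_space sc"
  shows "bilin_ext sc B t = bilin_ext sc B1 t + bilin_ext sc B2 t"
  unfolding bilin_ext_def by (simp add: assms(1) vector_space.vector_space_assms(1)[OF assms(2)] sum.distrib)

lemma delta_single: "delta fs (Poly_Mapping.single w a) =
    Poly_Mapping.single 0 a * prod_list (map (delta_gen fs) (letters w))"
  unfolding delta_def by (subst keys_sum_single) simp_all

lemma delta_add: "delta fs (x + y) = delta fs x + delta fs y"
  unfolding delta_def by (rule keys_sum_add) (simp_all add: single_add distrib_right)

lemma falg2_central: "(t::falg2) * Poly_Mapping.single 0 a = Poly_Mapping.single 0 a * t"
  by (induction t rule: poly_mapping_single_induct)
    (auto simp: mult_single distrib_left distrib_right mult.commute)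

lemma delta_mult: "delta fs (x * y) = delta fs x * delta fs y"
proof (induction x rule: poly_mapping_single_induct)
  case (single v a)
  show ?case
  proof (induction y rule: poly_mapping_single_induct)
    case (single w b)
    let ?s = "\<lambda>a. Poly_Mapping.single (0::gword \<times> gword) (a::complex)"
      and ?p = "\<lambda>w. prod_list (map (delta_gen fs) (letters w))"
    have "delta fs (Poly_Mapping.single v a * Poly_Mapping.single w b) = ?s (a * b) * (?p v * ?p w)"
      by (simp only: mult_single delta_single plus_gword_def gword.sel map_append prod_list.append)
    also have "?s (a * b) = ?s a * ?s b" by (simp add: mult_single)
    also have "?s a * ?s b * (?p v * ?p w) = ?s a * (?s b * ?p v) * ?p w" by (simp only: mult.assoc)
    also have "?s b * ?p v = ?p v * ?s b" by (rule falg2_central[symmetric])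
    finally show ?case by (simp only: delta_single mult.assoc)
  qed (simp add: distrib_left delta_add)
qed (simp add: distrib_right delta_add)

lemma delta_gen_mon: "delta fs (mon (Word [g])) = delta_gen fs g"
  by (simp add: mon_def delta_single)

lemma delta_scaleF: "delta fs (scaleF a x) = Poly_Mapping.single 0 a * delta fs x"
  by (simp add: scaleF_def cst_def delta_mult delta_single zero_gword_def)

lemma delta_0 [simp]: "delta fs 0 = 0"
  by (simp add: delta_def)

lemma delta_sum: "delta fs (\<Sum>i\<in>A. f i) = (\<Sum>i\<in>A. delta fs (f i))"
  by (induction A rule: infinite_finite_induct) (auto simp: delta_add)

lemma single0_tensF: "Poly_Mapping.single 0 a * tensF x y = tensF (scaleF a x) y"
  using tensF_scaleF[of a x 1 y] by simp

lemma tensF_0_left [simp]: "tensF 0 y = 0" and tensF_0_right [simp]: "tensF x 0 = 0"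
  by (simp_all add: tensF_def)

lemma tensF_sum_left: "tensF (\<Sum>i\<in>A. f i) y = (\<Sum>i\<in>A. tensF (f i) y)"
  by (induction A rule: infinite_finite_induct) (auto simp: tensF_add_left)

lemma tensF_sum_right: "tensF x (\<Sum>i\<in>A. f i) = (\<Sum>i\<in>A. tensF x (f i))"
  by (induction A rule: infinite_finite_induct) (auto simp: tensF_add_right)

section \<open>The relations of the free product\<close>

text \<open>A scalar multiple is a product with \<open>cst a\<close>, so linearity has no clause of
  its own. Closure under the star is not demanded, because kernels of representations that ignore
  the star are to qualify.\<close>

definition ideal :: "falg set \<Rightarrow> bool"
  where "ideal J \<longleftrightarrow> 0 \<in> J \<and> (\<forall>x\<in>J. \<forall>y\<in>J. x + y \<in> J) \<and> (\<forall>x\<in>J. \<forall>y. y * x \<in> J \<and> x * y \<in> J)"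

lemma ideal_rel_ideal: "ideal (rel_ideal fs)"
  by (simp add: ideal_def rel_ideal.zero rel_ideal.add rel_ideal.mult_left rel_ideal.mult_right)

lemma ideal_0: "ideal J \<Longrightarrow> 0 \<in> J" and ideal_add: "ideal J \<Longrightarrow> x \<in> J \<Longrightarrow> y \<in> J \<Longrightarrow> x + y \<in> J"
  and ideal_left: "ideal J \<Longrightarrow> x \<in> J \<Longrightarrow> y * x \<in> J" and ideal_right: "ideal J \<Longrightarrow> x \<in> J \<Longrightarrow> x * y \<in> J"
  by (auto simp: ideal_def)

lemma ideal_minus: "ideal J \<Longrightarrow> x \<in> J \<Longrightarrow> - x \<in> J"
  using ideal_left[of J x "- 1"] by simp

lemma ideal_diff: "ideal J \<Longrightarrow> x \<in> J \<Longrightarrow> y \<in> J \<Longrightarrow> x - y \<in> J"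
  using ideal_add[of J x "- y"] ideal_minus[of J y] by simp

lemma ideal_sum: "ideal J \<Longrightarrow> (\<And>i. i \<in> A \<Longrightarrow> f i \<in> J) \<Longrightarrow> (\<Sum>i\<in>A. f i) \<in> J"
  by (induction A rule: infinite_finite_induct) (auto simp: ideal_0 ideal_add)

text \<open>Congruence modulo an arbitrary ideal: the same calculations run modulo
  \<open>rel_ideal\<close> and modulo ideals that are yet to be compared with it.\<close>

definition cong_mod :: "falg set \<Rightarrow> falg \<Rightarrow> falg \<Rightarrow> bool"
  where "cong_mod J x y \<longleftrightarrow> x - y \<in> J"

lemma eqS_cong_mod: "eqS fs = cong_mod (rel_ideal fs)"
  by (simp add: eqS_def cong_mod_def fun_eq_iff)

lemma cong_mod_refl [simp]: "ideal J \<Longrightarrow> cong_mod J x x"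
  by (simp add: cong_mod_def ideal_0)

lemma cong_mod_sym: "ideal J \<Longrightarrow> cong_mod J x y \<Longrightarrow> cong_mod J y x"
  using ideal_minus[of J "x - y"] by (simp add: cong_mod_def)

lemma cong_mod_trans: "ideal J \<Longrightarrow> cong_mod J x y \<Longrightarrow> cong_mod J y z \<Longrightarrow> cong_mod J x z"
  using ideal_add[of J "x - y" "y - z"] by (simp add: cong_mod_def)

lemma cong_mod_add: "ideal J \<Longrightarrow> cong_mod J x y \<Longrightarrow> cong_mod J x' y' \<Longrightarrow> cong_mod J (x + x') (y + y')"
  using ideal_add[of J "x - y" "x' - y'"] by (simp add: cong_mod_def algebra_simps)

lemma cong_mod_diff: "ideal J \<Longrightarrow> cong_mod J x y \<Longrightarrow> cong_mod J x' y' \<Longrightarrow> cong_mod J (x - x') (y - y')"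
  using ideal_diff[of J "x - y" "x' - y'"] by (simp add: cong_mod_def algebra_simps)

lemma cong_mod_mult:
  assumes "ideal J" "cong_mod J x y" "cong_mod J x' y'"
  shows "cong_mod J (x * x') (y * y')"
proof -
  have "x * x' - y * y' = (x - y) * x' + y * (x' - y')" by (simp add: algebra_simps)
  then show ?thesis
    using assms by (simp add: cong_mod_def ideal_add ideal_left ideal_right)
qed

lemma cong_mod_sum: "ideal J \<Longrightarrow> (\<And>i. i \<in> A \<Longrightarrow> cong_mod J (f i) (g i)) \<Longrightarrow> cong_mod J (\<Sum>i\<in>A. f i) (\<Sum>i\<in>A. g i)"
  using ideal_sum[of J A "\<lambda>i. f i - g i"] by (simp add: cong_mod_def sum_subtractf)

lemma cong_mod_scaleF: "ideal J \<Longrightarrow> cong_mod J x y \<Longrightarrow> cong_mod J (scaleF a x) (scaleF a y)"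
  by (simp add: scaleF_def cong_mod_mult)

lemmas eqS_refl [simp] = cong_mod_refl[OF ideal_rel_ideal, folded eqS_cong_mod]
  and eqS_sym = cong_mod_sym[OF ideal_rel_ideal, folded eqS_cong_mod]
  and eqS_trans [trans] = cong_mod_trans[OF ideal_rel_ideal, folded eqS_cong_mod]
  and eqS_add = cong_mod_add[OF ideal_rel_ideal, folded eqS_cong_mod]
  and eqS_diff = cong_mod_diff[OF ideal_rel_ideal, folded eqS_cong_mod]
  and eqS_mult = cong_mod_mult[OF ideal_rel_ideal, folded eqS_cong_mod]
  and eqS_sum = cong_mod_sum[OF ideal_rel_ideal, folded eqS_cong_mod]
  and eqS_scaleF = cong_mod_scaleF[OF ideal_rel_ideal, folded eqS_cong_mod]

lemma eqS_star: "eqS fs x y \<Longrightarrow> eqS fs (starF x) (starF y)"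
  using rel_ideal.star[of "x - y" fs] by (simp add: eqS_def starF_diff)

lemma eqS_0_iff: "eqS fs x 0 \<longleftrightarrow> x \<in> rel_ideal fs"
  by (simp add: eqS_def)

lemma linearF_eqS:
  assumes "linearF sc f" "\<And>x. x \<in> rel_ideal fs \<Longrightarrow> f x = 0" "eqS fs x y"
  shows "f x = f y"
  using assms(2)[of "x - y"] assms(1,3) by (simp add: eqS_def linearF_diff)

subsection \<open>Generators and matrices\<close>

text \<open>\<open>gx k s i j\<close> is the entry of the fundamental corepresentation (\<open>s = False\<close>) or of its
  entrywise adjoint (\<open>s = True\<close>).\<close>

definition gx :: "nat \<Rightarrow> bool \<Rightarrow> nat \<Rightarrow> nat \<Rightarrow> falg"
  where "gx k s i j = mon (Word [if s then StarGen k i j else Gen k i j])"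

lemma starF_gx [simp]: "starF (gx k s i j) = gx k (\<not> s) i j"
  by (simp add: gx_def starF_mon srev_def)

lemma eps_gx: "eps fs (gx k s i j) = (if i = j \<and> i < fdim fs k then 1 else 0)"
  by (simp add: gx_def eps_mon)

lemma delta_gx: "delta fs (gx k s i j) = (\<Sum>l<fdim fs k. tensF (gx k s i l) (gx k s l j))"
  by (simp add: gx_def delta_gen_mon)

lemma gx_unused: "\<not> (i < fdim fs k \<and> j < fdim fs k) \<Longrightarrow> gx k s i j \<in> rel_ideal fs"
  using rel_ideal.unused[of i fs k j] rel_ideal.star[OF rel_ideal.unused, of i fs k j]
  by (cases s) (simp_all add: gx_def starF_mon srev_def)

abbreviation adjC :: "complex mat \<Rightarrow> complex mat"
  where "adjC A \<equiv> map_mat cnj (transpose_mat A)"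

lemma semiring_hom_cst: "semiring_hom cst"
  by unfold_locales (simp_all add: cst_add cst_mult)

lemma cmat_mult: "A \<in> carrier_mat a b \<Longrightarrow> B \<in> carrier_mat b c \<Longrightarrow> cmat (A * B) = cmat A * cmat B"
  by (rule semiring_hom.mat_hom_mult[OF semiring_hom_cst])

lemma cmat_one [simp]: "cmat (1\<^sub>m n) = 1\<^sub>m n"
  by (rule eq_matI) auto

lemma adjF_carrier [simp]: "A \<in> carrier_mat a b \<Longrightarrow> adjF A \<in> carrier_mat b a"
  by (auto simp: adjF_def)

lemma adjF_dim [simp]: "dim_row (adjF A) = dim_col A" "dim_col (adjF A) = dim_row A"
  by (auto simp: adjF_def)

lemma adjF_index [simp]: "i < dim_col A \<Longrightarrow> j < dim_row A \<Longrightarrow> adjF A $$ (i, j) = starF (A $$ (j, i))"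
  by (simp add: adjF_def)

lemma adjF_cmat: "adjF (cmat A) = cmat (adjC A)"
  by (rule eq_matI) auto

lemma mult_mat_index: "i < dim_row A \<Longrightarrow> j < dim_col B \<Longrightarrow>
    (A * B) $$ (i, j) = (\<Sum>l<dim_row B. A $$ (i, l) * B $$ (l, j))"
  if "dim_col A = dim_row B"
  using that by (simp add: scalar_prod_def atLeast0LessThan)

lemma adjF_mult: "A \<in> carrier_mat a b \<Longrightarrow> B \<in> carrier_mat b c \<Longrightarrow> adjF (A * B) = adjF B * adjF A"
  by (rule eq_matI) (auto simp: mult_mat_index starF_sum starF_mult simp del: index_mult_mat(1))

definition in_mat :: "falg set \<Rightarrow> falg mat \<Rightarrow> bool"
  where "in_mat J X \<longleftrightarrow> (\<forall>i<dim_row X. \<forall>j<dim_col X. X $$ (i, j) \<in> J)"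

lemma in_mat_mult:
  assumes "ideal J" "X \<in> carrier_mat b c" "A \<in> carrier_mat a b" "B \<in> carrier_mat c d" "in_mat J X"
  shows "in_mat J (A * X * B)"
  unfolding in_mat_def
proof (intro allI impI)
  fix i j assume "i < dim_row (A * X * B)" "j < dim_col (A * X * B)"
  then have ij: "i < a" "j < d" using assms by auto
  have "(A * X) $$ (i, l) \<in> J" if "l < c" for l
    using that assms ij by (auto simp: mult_mat_index in_mat_def simp del: index_mult_mat(1)
        intro!: ideal_sum ideal_left)
  then show "(A * X * B) $$ (i, j) \<in> J"
    using assms ij
    by (subst mult_mat_index) (auto intro!: ideal_sum ideal_right simp del: index_mult_mat(1))
qed

lemma invertible_inv_mat:
  assumes "invertible_mat A" "A \<in> carrier_mat n n"
  shows "inv_mat A \<in> carrier_mat n n" "A * inv_mat A = 1\<^sub>m n" "inv_mat A * A = 1\<^sub>m n"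
proof -
  obtain B where B: "A * B = 1\<^sub>m n" "B * A = 1\<^sub>m (dim_row B)"
    using assms by (auto simp: invertible_mat_def inverts_mat_def)
  have BC: "B \<in> carrier_mat n n"
  proof
    show "dim_col B = n" using arg_cong[OF B(1), of dim_col] by simp
    show "dim_row B = n" using arg_cong[OF B(2), of dim_col] assms(2) by simp
  qed
  have "mat_inverse A \<noteq> None"
  proof
    assume "mat_inverse A = None"
    from mat_inverse(1)[OF assms(2) this, of "()"]
    have "A \<notin> Units (ring_mat TYPE(complex) n ())" .
    moreover have "A \<in> Units (ring_mat TYPE(complex) n ())"
      using B BC assms(2) by (auto simp: Units_def ring_mat_def)
    ultimately show False by simp
  qed
  then obtain C where "mat_inverse A = Some C" by auto
  from mat_inverse(2)[OF assms(2) this] this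
  show "inv_mat A \<in> carrier_mat n n" "A * inv_mat A = 1\<^sub>m n" "inv_mat A * A = 1\<^sub>m n"
    by (auto simp: inv_mat_def)
qed

lemma inv_mat_eqI:
  assumes "A \<in> carrier_mat n n" "B \<in> carrier_mat n n" "A * B = 1\<^sub>m n" "B * A = 1\<^sub>m n"
  shows "invertible_mat A" "inv_mat A = B"
proof -
  show inv: "invertible_mat A"
    using assms unfolding invertible_mat_def inverts_mat_def by auto
  have "inv_mat A = inv_mat A * (A * B)"
    using assms(3) invertible_inv_mat(1)[OF inv assms(1)] by simp
  also have "\<dots> = B"
    using assms invertible_inv_mat[OF inv assms(1)] assoc_mult_mat[of "inv_mat A" n n A n B n] by auto
  finally show "inv_mat A = B" .
qed

definition gmat :: "factor list \<Rightarrow> nat \<Rightarrow> bool \<Rightarrow> falg mat"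
  where "gmat fs k s = mat (fdim fs k) (fdim fs k) (\<lambda>(i, j). gx k s i j)"

lemma gmat_carrier [simp]: "gmat fs k s \<in> carrier_mat (fdim fs k) (fdim fs k)"
  and gmat_dim [simp]: "dim_row (gmat fs k s) = fdim fs k" "dim_col (gmat fs k s) = fdim fs k"
  and gmat_index [simp]: "i < fdim fs k \<Longrightarrow> j < fdim fs k \<Longrightarrow> gmat fs k s $$ (i, j) = gx k s i j"
  by (auto simp: gmat_def)

lemma umat_gmat: "umat fs k = gmat fs k False"
  by (rule eq_matI) (auto simp: umat_def gx_def)

lemma starF_gmat: "map_mat starF (gmat fs k s) = gmat fs k (\<not> s)"
  by (rule eq_matI) auto

lemma adjF_gmat: "adjF (gmat fs k s) = transpose_mat (gmat fs k (\<not> s))"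
  by (rule eq_matI) auto

lemma vmat_gmat: "vmat fs k = cmat (fmat (fs ! k)) * gmat fs k True * cmat (inv_mat (fmat (fs ! k)))"
  by (simp add: vmat_def umat_gmat starF_gmat)

lemma valid_fmat:
  assumes "k < length fs" "valid_factor (fs ! k)"
  shows "fmat (fs ! k) \<in> carrier_mat (fdim fs k) (fdim fs k)" "invertible_mat (fmat (fs ! k))" "0 < fdim fs k"
  using assms by (cases "fs ! k"; auto simp: fdim_def invertible_mat_def square_mat.simps)+

text \<open>The unitarity of v depends on Q only through this positive matrix and its inverse
  \<open>qinv\<close>. Its eigenvalues carry all modular data of the factor.\<close>

definition qmat :: "factor list \<Rightarrow> nat \<Rightarrow> complex mat"
  where "qmat fs k = adjC (fmat (fs ! k)) * fmat (fs ! k)"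

definition qinv :: "factor list \<Rightarrow> nat \<Rightarrow> complex mat"
  where "qinv fs k = inv_mat (fmat (fs ! k)) * adjC (inv_mat (fmat (fs ! k)))"

lemma adjC_mult: "A \<in> carrier_mat a b \<Longrightarrow> B \<in> carrier_mat b c \<Longrightarrow> adjC (A * B) = adjC B * adjC A"
  by (rule eq_matI) (auto simp: mult_mat_index mult.commute simp del: index_mult_mat(1))

lemma adjC_one [simp]: "map_mat cnj (1\<^sub>m n) = 1\<^sub>m n"
  by (rule eq_matI) auto

context
  fixes fs k n Q
  assumes k: "k < length fs" and valid: "valid_factor (fs ! k)"
    and n: "n = fdim fs k" and Q: "Q = fmat (fs ! k)"
begin

private lemma C: "Q \<in> carrier_mat n n" "inv_mat Q \<in> carrier_mat n n" "Q * inv_mat Q = 1\<^sub>m n" "inv_mat Q * Q = 1\<^sub>m n"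
    "adjC Q \<in> carrier_mat n n" "adjC (inv_mat Q) \<in> carrier_mat n n"
    "adjC Q * adjC (inv_mat Q) = 1\<^sub>m n" "adjC (inv_mat Q) * adjC Q = 1\<^sub>m n"
    "qmat fs k = adjC Q * Q" "qinv fs k = inv_mat Q * adjC (inv_mat Q)"
    "qmat fs k \<in> carrier_mat n n" "qinv fs k \<in> carrier_mat n n"
    "gmat fs k s \<in> carrier_mat n n" "transpose_mat (gmat fs k s) \<in> carrier_mat n n"
proof -
  note v = valid_fmat[OF k valid, folded Q n]
  show *: "Q \<in> carrier_mat n n" "inv_mat Q \<in> carrier_mat n n" "Q * inv_mat Q = 1\<^sub>m n" "inv_mat Q * Q = 1\<^sub>m n"
    using v invertible_inv_mat[OF v(2,1)] by auto
  show **: "adjC Q \<in> carrier_mat n n" "adjC (inv_mat Q) \<in> carrier_mat n n" using * by auto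
  show "adjC Q * adjC (inv_mat Q) = 1\<^sub>m n"
    using adjC_mult[OF *(2,1)] unfolding *(4) by simp
  show "adjC (inv_mat Q) * adjC Q = 1\<^sub>m n"
    using adjC_mult[OF *(1,2)] unfolding *(3) by simp
  show ***: "qmat fs k = adjC Q * Q" "qinv fs k = inv_mat Q * adjC (inv_mat Q)"
    by (simp_all add: qmat_def qinv_def Q)
  show "qmat fs k \<in> carrier_mat n n" "qinv fs k \<in> carrier_mat n n"
    unfolding *** using * ** by auto
  show "gmat fs k s \<in> carrier_mat n n" "transpose_mat (gmat fs k s) \<in> carrier_mat n n"
    by (simp_all add: n)
qed

lemma qmat_qinv: "qmat fs k * qinv fs k = 1\<^sub>m n" "qinv fs k * qmat fs k = 1\<^sub>m n"
proof -
  have c: "Q * (inv_mat Q * x) = x" "adjC (inv_mat Q) * (adjC Q * x) = x" if "x \<in> carrier_mat n n" for x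
    using that C(1-8) by (simp_all flip: assoc_mult_mat[of _ n n _ n _ n])
  show "qmat fs k * qinv fs k = 1\<^sub>m n" "qinv fs k * qmat fs k = 1\<^sub>m n"
    unfolding C(9,10) using C(1-8)
    by (simp_all add: assoc_mult_mat[of _ n n _ n _ n] mult_carrier_mat[of _ n n _ n] c)
qed

text \<open>The unitarity of \<open>v = Q\<^bold>uQ\<^sup>-\<^sup>1\<close>, freed from \<open>Q\<close> on the outside.\<close>

definition "rel3 = gmat fs k True * cmat (qinv fs k) * transpose_mat (gmat fs k False) - cmat (qinv fs k)"
definition "rel4 = transpose_mat (gmat fs k False) * cmat (qmat fs k) * gmat fs k True - cmat (qmat fs k)"

text \<open>Multiplying by invertible scalar matrices on both sides carries one form of the
  relations into the other. The last two equations extract the simple form from the ideal; the first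
  two lead back when an ideal is to be shown to contain the relators.\<close>

lemma rel34:
  shows "vmat fs k * adjF (vmat fs k) - 1\<^sub>m n = cmat Q * rel3 * cmat (adjC Q)"
    and "adjF (vmat fs k) * vmat fs k - 1\<^sub>m n = cmat (adjC (inv_mat Q)) * rel4 * cmat (inv_mat Q)"
    and "rel3 = cmat (inv_mat Q) * (vmat fs k * adjF (vmat fs k) - 1\<^sub>m n) * cmat (adjC (inv_mat Q))"
    and "rel4 = cmat (adjC Q) * (adjF (vmat fs k) * vmat fs k - 1\<^sub>m n) * cmat Q"
proof -
  define u where "u = transpose_mat (gmat fs k False)"
  define w where "w = gmat fs k True"
  define a where "a = cmat Q" define b where "b = cmat (inv_mat Q)"
  define a' where "a' = cmat (adjC Q)" define b' where "b' = cmat (adjC (inv_mat Q))"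
  have c: "u \<in> carrier_mat n n" "w \<in> carrier_mat n n" "a \<in> carrier_mat n n" "b \<in> carrier_mat n n"
    "a' \<in> carrier_mat n n" "b' \<in> carrier_mat n n"
    using C by (auto simp: u_def w_def a_def b_def a'_def b'_def)
  have ab: "a * b = 1\<^sub>m n" "b * a = 1\<^sub>m n" "a' * b' = 1\<^sub>m n" "b' * a' = 1\<^sub>m n"
    using C by (simp_all add: a_def b_def a'_def b'_def flip: cmat_mult[of _ n n _ n])
  have abx: "a * (b * x) = x" "b * (a * x) = x" "a' * (b' * x) = x" "b' * (a' * x) = x" if "x \<in> carrier_mat n n" for x
    using that c by (simp_all add: ab flip: assoc_mult_mat[of _ n n _ n _ n])
  have v: "vmat fs k = a * w * b" by (simp add: vmat_gmat a_def b_def w_def Q)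
  have av: "adjF (vmat fs k) = b' * u * a'"
  proof -
    have "adjF w = u" by (simp add: w_def u_def adjF_gmat)
    then have "adjF (a * w * b) = b' * (u * a')"
      using c by (simp add: adjF_mult[of _ n n _ n]) (simp add: a_def b_def a'_def b'_def adjF_cmat)
    then show ?thesis using c by (simp add: v)
  qed
  have qm: "cmat (qmat fs k) = a' * a" "cmat (qinv fs k) = b * b'"
    using C by (simp_all add: a_def b_def a'_def b'_def cmat_mult[of _ n n _ n])
  have d: "rel3 = w * b * b' * u - b * b'" "rel4 = u * a' * a * w - a' * a"
    using c by (simp_all add: rel3_def rel4_def qm flip: u_def w_def)
  note mc = mult_carrier_mat[of _ n n _ n] and as = assoc_mult_mat[of _ n n _ n _ n]
  note ms = mult_minus_distrib_mat[of _ n n _ n] minus_mult_distrib_mat[of _ n n _ _ n]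
  show "vmat fs k * adjF (vmat fs k) - 1\<^sub>m n = cmat Q * rel3 * cmat (adjC Q)"
    unfolding av unfolding v d a_def[symmetric] a'_def[symmetric]
    using c by (simp add: as mc ms abx ab)
  show "adjF (vmat fs k) * vmat fs k - 1\<^sub>m n = cmat (adjC (inv_mat Q)) * rel4 * cmat (inv_mat Q)"
    unfolding av unfolding v d b_def[symmetric] b'_def[symmetric]
    using c by (simp add: as mc ms abx ab)
  show "rel3 = cmat (inv_mat Q) * (vmat fs k * adjF (vmat fs k) - 1\<^sub>m n) * cmat (adjC (inv_mat Q))"
    unfolding av unfolding v d b_def[symmetric] b'_def[symmetric]
    using c by (simp add: as mc ms abx ab)
  show "rel4 = cmat (adjC Q) * (adjF (vmat fs k) * vmat fs k - 1\<^sub>m n) * cmat Q"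
    unfolding av unfolding v d a_def[symmetric] a'_def[symmetric]
    using c by (simp add: as mc ms abx ab)
qed

end

lemma in_mat_relator:
  assumes "k < length fs" "(A, B) \<in> relations fs k" "A \<in> carrier_mat (fdim fs k) (fdim fs k)"
    "B \<in> carrier_mat (fdim fs k) (fdim fs k)"
  shows "in_mat (rel_ideal fs) (A - B)"
  using assms rel_ideal.relator[OF assms(1,2)] by (auto simp: in_mat_def)

abbreviation qm :: "factor list \<Rightarrow> nat \<Rightarrow> nat \<Rightarrow> nat \<Rightarrow> complex" where "qm fs k i j \<equiv> qmat fs k $$ (i, j)"
abbreviation qi :: "factor list \<Rightarrow> nat \<Rightarrow> nat \<Rightarrow> nat \<Rightarrow> complex" where "qi fs k i j \<equiv> qinv fs k $$ (i, j)"

text \<open>Entries of the four matrix relations, with the scalar matrices moved inside. They hold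
  for both kinds of factor, and for an \<open>AU\<close> factor they replace the original relators
  completely.\<close>

definition rels :: "factor list \<Rightarrow> nat \<Rightarrow> nat \<Rightarrow> nat \<Rightarrow> falg set"
  where "rels fs k i j = (let n = fdim fs k; d = if i = j then 1 else 0 in
    {(\<Sum>l<n. gx k False i l * gx k True j l) - d,
     (\<Sum>l<n. gx k True l i * gx k False l j) - d,
     (\<Sum>a<n. \<Sum>b<n. cst (qi fs k a b) * (gx k True i a * gx k False j b)) - cst (qi fs k i j),
     (\<Sum>a<n. \<Sum>b<n. cst (qm fs k a b) * (gx k False a i * gx k True b j)) - cst (qm fs k i j)})"

definition ao_rel :: "factor list \<Rightarrow> nat \<Rightarrow> nat \<Rightarrow> nat \<Rightarrow> falg"
  where "ao_rel fs k i j = gx k False i j - (\<Sum>a<fdim fs k. \<Sum>b<fdim fs k.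
    cst (fmat (fs ! k) $$ (i, a) * inv_mat (fmat (fs ! k)) $$ (b, j)) * gx k True a b)"

lemma uu_index:
  assumes "i < fdim fs k" "j < fdim fs k"
  shows "(gmat fs k False * adjF (gmat fs k False) - 1\<^sub>m (fdim fs k)) $$ (i, j) =
      (\<Sum>l<fdim fs k. gx k False i l * gx k True j l) - (if i = j then 1 else 0)"
    "(adjF (gmat fs k False) * gmat fs k False - 1\<^sub>m (fdim fs k)) $$ (i, j) =
      (\<Sum>l<fdim fs k. gx k True l i * gx k False l j) - (if i = j then 1 else 0)"
  using assms by (simp_all add: mult_mat_index adjF_gmat del: index_mult_mat(1))

lemma rel34_index:
  assumes "k < length fs" "valid_factor (fs ! k)" "i < fdim fs k" "j < fdim fs k"
  shows "rel3 fs k $$ (i, j) = (\<Sum>a<fdim fs k. \<Sum>b<fdim fs k. cst (qi fs k a b) * (gx k True i a * gx k False j b)) - cst (qi fs k i j)"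
    and "rel4 fs k $$ (i, j) = (\<Sum>a<fdim fs k. \<Sum>b<fdim fs k. cst (qm fs k a b) * (gx k False a i * gx k True b j)) - cst (qm fs k i j)"
proof -
  note v = valid_fmat[OF assms(1,2)] and vi = invertible_inv_mat[OF v(2,1)]
  let ?n = "fdim fs k"
  have [simp]: "qinv fs k \<in> carrier_mat ?n ?n" "qmat fs k \<in> carrier_mat ?n ?n"
    using v vi by (auto simp: qinv_def qmat_def)
  then have [simp]: "dim_row (qinv fs k) = ?n" "dim_col (qinv fs k) = ?n" "dim_row (qmat fs k) = ?n" "dim_col (qmat fs k) = ?n"
    by (metis carrier_matD)+
  have 1: "rel3 fs k $$ (i, j) = (\<Sum>b<?n. \<Sum>a<?n. gx k True i a * cst (qi fs k a b) * gx k False j b) - cst (qi fs k i j)"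
    using assms by (simp add: rel3_def[OF assms(1,2) refl refl] mult_mat_index sum_distrib_right del: index_mult_mat(1))
  show "rel3 fs k $$ (i, j) = (\<Sum>a<?n. \<Sum>b<?n. cst (qi fs k a b) * (gx k True i a * gx k False j b)) - cst (qi fs k i j)"
    unfolding 1 by (subst sum.swap) (simp only: cst_commute[of "gx _ _ _ _"] mult.assoc)
  have 2: "rel4 fs k $$ (i, j) = (\<Sum>b<?n. \<Sum>a<?n. gx k False a i * cst (qm fs k a b) * gx k True b j) - cst (qm fs k i j)"
    using assms by (simp add: rel4_def[OF assms(1,2) refl refl] mult_mat_index sum_distrib_right del: index_mult_mat(1))
  show "rel4 fs k $$ (i, j) = (\<Sum>a<?n. \<Sum>b<?n. cst (qm fs k a b) * (gx k False a i * gx k True b j)) - cst (qm fs k i j)"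
    unfolding 2 by (subst sum.swap) (simp only: cst_commute[of "gx _ _ _ _"] mult.assoc)
qed

lemma vmat_carrier:
  assumes "k < length fs" "valid_factor (fs ! k)"
  shows "vmat fs k \<in> carrier_mat (fdim fs k) (fdim fs k)"
  using valid_fmat[OF assms] invertible_inv_mat[OF valid_fmat(2,1)[OF assms]]
  by (auto simp: vmat_gmat)

lemma vmat_index:
  assumes "k < length fs" "valid_factor (fs ! k)" "i < fdim fs k" "j < fdim fs k"
  shows "gx k False i j - vmat fs k $$ (i, j) = ao_rel fs k i j"
proof -
  note v = valid_fmat[OF assms(1,2)] and vi = invertible_inv_mat[OF v(2,1)]
  let ?n = "fdim fs k" let ?Q = "fmat (fs ! k)"
  have [simp]: "dim_row (inv_mat ?Q) = ?n" "dim_col (inv_mat ?Q) = ?n" "dim_row ?Q = ?n" "dim_col ?Q = ?n"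
    using v vi by auto
  have "vmat fs k $$ (i, j) = (\<Sum>b<?n. \<Sum>a<?n. cst (?Q $$ (i, a)) * gx k True a b * cst (inv_mat ?Q $$ (b, j)))"
    using assms by (simp add: vmat_gmat mult_mat_index sum_distrib_right del: index_mult_mat(1))
  also have "\<dots> = (\<Sum>a<?n. \<Sum>b<?n. cst (?Q $$ (i, a) * inv_mat ?Q $$ (b, j)) * gx k True a b)"
    by (subst sum.swap) (simp only: mult.assoc cst_mult cst_commute[of "gx _ _ _ _"])
  finally show ?thesis by (simp add: ao_rel_def)
qed

lemma rels_in_ideal:
  assumes "k < length fs" "valid_factor (fs ! k)" "i < fdim fs k" "j < fdim fs k"
  shows "rels fs k i j \<subseteq> rel_ideal fs"
proof -
  note v = valid_fmat[OF assms(1,2)] and vi = invertible_inv_mat[OF v(2,1)]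
  note vc = vmat_carrier[OF assms(1,2)]
  let ?n = "fdim fs k"
  have 1: "in_mat (rel_ideal fs) (gmat fs k False * adjF (gmat fs k False) - 1\<^sub>m ?n)"
    "in_mat (rel_ideal fs) (adjF (gmat fs k False) * gmat fs k False - 1\<^sub>m ?n)"
    using assms(1) by (auto intro!: in_mat_relator simp: relations_def Let_def umat_gmat mult_carrier_mat[of _ ?n ?n _ ?n])
  have 2: "in_mat (rel_ideal fs) (vmat fs k * adjF (vmat fs k) - 1\<^sub>m ?n)"
    "in_mat (rel_ideal fs) (adjF (vmat fs k) * vmat fs k - 1\<^sub>m ?n)"
    using assms(1) vc by (auto intro!: in_mat_relator simp: relations_def Let_def mult_carrier_mat[of _ ?n ?n _ ?n])
  have c: "vmat fs k * adjF (vmat fs k) - 1\<^sub>m ?n \<in> carrier_mat ?n ?n" "adjF (vmat fs k) * vmat fs k - 1\<^sub>m ?n \<in> carrier_mat ?n ?n"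
    by auto
  have "in_mat (rel_ideal fs) (rel3 fs k)" "in_mat (rel_ideal fs) (rel4 fs k)"
    unfolding rel34(3,4)[OF assms(1,2) refl refl] using v vi
    by (auto intro!: in_mat_mult[OF ideal_rel_ideal c(1) _ _ 2(1)] in_mat_mult[OF ideal_rel_ideal c(2) _ _ 2(2)])
  moreover have "rel3 fs k \<in> carrier_mat ?n ?n" "rel4 fs k \<in> carrier_mat ?n ?n"
    unfolding rel34(3,4)[OF assms(1,2) refl refl] using v vi by auto
  ultimately have "rel3 fs k $$ (i, j) \<in> rel_ideal fs" "rel4 fs k $$ (i, j) \<in> rel_ideal fs"
    using assms(3,4) by (auto simp: in_mat_def)
  moreover have "(gmat fs k False * adjF (gmat fs k False) - 1\<^sub>m ?n) $$ (i, j) \<in> rel_ideal fs"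
      "(adjF (gmat fs k False) * gmat fs k False - 1\<^sub>m ?n) $$ (i, j) \<in> rel_ideal fs"
    using 1 assms(3,4) unfolding in_mat_def by auto
  ultimately show ?thesis
    by (simp add: rels_def Let_def rel34_index[OF assms] uu_index[OF assms(3,4)])
qed

lemma ao_rel_in_ideal:
  assumes "k < length fs" "valid_factor (fs ! k)" "i < fdim fs k" "j < fdim fs k" "fs ! k = AO Q"
  shows "ao_rel fs k i j \<in> rel_ideal fs"
proof -
  have "in_mat (rel_ideal fs) (umat fs k - vmat fs k)"
    using assms(1,5) vmat_carrier[OF assms(1,2)]
    by (intro in_mat_relator) (simp_all add: relations_def umat_gmat Let_def)
  then show ?thesis
    using assms(3,4) vmat_carrier[OF assms(1,2)] by (simp add: in_mat_def umat_gmat flip: vmat_index[OF assms(1-4)])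
qed

text \<open>The universal property of the free product in the form used for every map out of \<S>:
  the kernel of the map is an ideal, and only these elements have to be tested. As \<open>J\<close>
  need not be closed under the star, the induction treats x and its adjoint together. The unitarity
  relators are permuted by the star, but \<open>ao_rel\<close> is not, so its adjoint has to be
  tested as well. For an \<open>AO\<close> factor the unitarity of v follows from that of u.\<close>

lemma rel_ideal_subset:
  assumes valid: "\<And>k. k < length fs \<Longrightarrow> valid_factor (fs ! k)" and J: "ideal J"
    and unused: "\<And>k s i j. \<not> (i < fdim fs k \<and> j < fdim fs k) \<Longrightarrow> gx k s i j \<in> J"
    and AU: "\<And>k Q i j. k < length fs \<Longrightarrow> fs ! k = AU Q \<Longrightarrow> i < fdim fs k \<Longrightarrow> j < fdim fs k \<Longrightarrow> rels fs k i j \<subseteq> J"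
    and AO1: "\<And>k Q i j. k < length fs \<Longrightarrow> fs ! k = AO Q \<Longrightarrow> i < fdim fs k \<Longrightarrow> j < fdim fs k \<Longrightarrow>
      (\<Sum>l<fdim fs k. gx k False i l * gx k True j l) - (if i = j then 1 else 0) \<in> J"
    and AO2: "\<And>k Q i j. k < length fs \<Longrightarrow> fs ! k = AO Q \<Longrightarrow> i < fdim fs k \<Longrightarrow> j < fdim fs k \<Longrightarrow>
      (\<Sum>l<fdim fs k. gx k True l i * gx k False l j) - (if i = j then 1 else 0) \<in> J"
    and AO3: "\<And>k Q i j. k < length fs \<Longrightarrow> fs ! k = AO Q \<Longrightarrow> i < fdim fs k \<Longrightarrow> j < fdim fs k \<Longrightarrow>
      ao_rel fs k i j \<in> J \<and> starF (ao_rel fs k i j) \<in> J"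
  shows "rel_ideal fs \<subseteq> J"
proof -
  have uu: "in_mat J (gmat fs k False * adjF (gmat fs k False) - 1\<^sub>m (fdim fs k))"
    "in_mat J (adjF (gmat fs k False) * gmat fs k False - 1\<^sub>m (fdim fs k))" if k: "k < length fs" for k
    unfolding in_mat_def using k AU[of k] AO1[of k] AO2[of k] uu_index[of _ fs k]
    by (cases "fs ! k"; auto simp: rels_def Let_def)+
  have vv: "in_mat J (vmat fs k * adjF (vmat fs k) - 1\<^sub>m (fdim fs k))"
    "in_mat J (adjF (vmat fs k) * vmat fs k - 1\<^sub>m (fdim fs k))" if k: "k < length fs" for k
  proof -
    note v = valid_fmat[OF k valid[OF k]] and vi = invertible_inv_mat[OF valid_fmat(2,1)[OF k valid[OF k]]]
    note vc = vmat_carrier[OF k valid[OF k]]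
    let ?n = "fdim fs k"
    have "in_mat J (vmat fs k * adjF (vmat fs k) - 1\<^sub>m ?n) \<and> in_mat J (adjF (vmat fs k) * vmat fs k - 1\<^sub>m ?n)"
    proof (cases "fs ! k")
      case (AO Q)
      have c: "cong_mod J (vmat fs k $$ (i, j)) (gmat fs k False $$ (i, j))"
        "cong_mod J (starF (vmat fs k $$ (i, j))) (starF (gmat fs k False $$ (i, j)))"
        if "i < ?n" "j < ?n" for i j
      proof -
        have "gx k False i j - vmat fs k $$ (i, j) \<in> J" "starF (gx k False i j - vmat fs k $$ (i, j)) \<in> J"
          using AO3[OF k AO that] vmat_index[OF k valid[OF k] that] by auto
        then show "cong_mod J (vmat fs k $$ (i, j)) (gmat fs k False $$ (i, j))"
          "cong_mod J (starF (vmat fs k $$ (i, j))) (starF (gmat fs k False $$ (i, j)))"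
          using that cong_mod_sym[OF J] by (auto simp: cong_mod_def starF_diff)
      qed
      \<comment> \<open>Modulo \<open>J\<close> the entries of v and of its adjoint may be replaced
        by those of u.\<close>
      have "cong_mod J ((vmat fs k * adjF (vmat fs k)) $$ (i, j)) ((gmat fs k False * adjF (gmat fs k False)) $$ (i, j))"
        "cong_mod J ((adjF (vmat fs k) * vmat fs k) $$ (i, j)) ((adjF (gmat fs k False) * gmat fs k False) $$ (i, j))"
        if "i < ?n" "j < ?n" for i j
        using that vc by (auto simp: mult_mat_index simp del: index_mult_mat(1) gmat_index
            intro!: cong_mod_sum cong_mod_mult J c)
      moreover have "cong_mod J ((gmat fs k False * adjF (gmat fs k False)) $$ (i, j)) (1\<^sub>m ?n $$ (i, j))"
        "cong_mod J ((adjF (gmat fs k False) * gmat fs k False) $$ (i, j)) (1\<^sub>m ?n $$ (i, j))"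
        if "i < ?n" "j < ?n" for i j
        using uu[OF k] that by (auto simp: cong_mod_def in_mat_def)
      ultimately have "cong_mod J ((vmat fs k * adjF (vmat fs k)) $$ (i, j)) (1\<^sub>m ?n $$ (i, j))"
        "cong_mod J ((adjF (vmat fs k) * vmat fs k) $$ (i, j)) (1\<^sub>m ?n $$ (i, j))"
        if "i < ?n" "j < ?n" for i j using that cong_mod_trans[OF J] by blast+
      then show ?thesis using vc by (auto simp: in_mat_def cong_mod_def)
    next
      case (AU Q)
      have "rel3 fs k \<in> carrier_mat ?n ?n" "rel4 fs k \<in> carrier_mat ?n ?n"
        unfolding rel34(3,4)[OF k valid[OF k] refl refl] using v vi by auto
      moreover from this have "in_mat J (rel3 fs k)" "in_mat J (rel4 fs k)"
        using AU assms(4)[OF k AU] by (auto simp: in_mat_def rel34_index[OF k valid[OF k]] rels_def Let_def)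
      ultimately show ?thesis
        unfolding rel34(1,2)[OF k valid[OF k] refl refl] using v vi
        by (intro conjI in_mat_mult[OF J, of _ ?n ?n _ ?n _ ?n]) simp_all
    qed
    then show "in_mat J (vmat fs k * adjF (vmat fs k) - 1\<^sub>m ?n)" "in_mat J (adjF (vmat fs k) * vmat fs k - 1\<^sub>m ?n)" by auto
  qed
  \<comment> \<open>The product of a matrix with its adjoint is self-adjoint, so the star only
    transposes the relators.\<close>
  have star1: "starF ((X * adjF X) $$ (i, j) - 1\<^sub>m n $$ (i, j)) = (X * adjF X) $$ (j, i) - 1\<^sub>m n $$ (j, i)"
    "starF ((adjF X * X) $$ (i, j) - 1\<^sub>m n $$ (i, j)) = (adjF X * X) $$ (j, i) - 1\<^sub>m n $$ (j, i)"
    if "X \<in> carrier_mat n n" "i < n" "j < n" for X i j n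
    using that by (auto simp: mult_mat_index starF_diff starF_sum starF_mult simp del: index_mult_mat(1))
  have "x \<in> J \<and> starF x \<in> J" if "x \<in> rel_ideal fs" for x
    using that
  proof induction
    case (unused i k j)
    then show ?case
      using assms(3)[of i k j False] assms(3)[of i k j True] by (simp add: gx_def starF_mon srev_def)
  next
    case (relator k A B i j)
    note k = relator(1) and ij = relator(3,4)
    have m: "X $$ (i, j) - 1\<^sub>m (fdim fs k) $$ (i, j) \<in> J" "X $$ (j, i) - 1\<^sub>m (fdim fs k) $$ (j, i) \<in> J"
      if "in_mat J (X - 1\<^sub>m (fdim fs k))" "X \<in> carrier_mat (fdim fs k) (fdim fs k)" for X
      using that ij by (auto simp: in_mat_def)
    consider "A = gmat fs k False * adjF (gmat fs k False)" "B = 1\<^sub>m (fdim fs k)"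
      | "A = adjF (gmat fs k False) * gmat fs k False" "B = 1\<^sub>m (fdim fs k)"
      | "A = vmat fs k * adjF (vmat fs k)" "B = 1\<^sub>m (fdim fs k)"
      | "A = adjF (vmat fs k) * vmat fs k" "B = 1\<^sub>m (fdim fs k)"
      | Q where "fs ! k = AO Q" "A = gmat fs k False" "B = vmat fs k"
      using relator(2) by (cases "fs ! k") (auto simp: relations_def Let_def umat_gmat)
    then show ?case
    proof cases
      case 1
      show ?thesis unfolding 1 star1(1)[OF gmat_carrier ij]
        by (intro conjI m uu(1)[OF k]) (simp_all add: mult_carrier_mat[of _ "fdim fs k" "fdim fs k"])
    next
      case 2
      show ?thesis unfolding 2 star1(2)[OF gmat_carrier ij]
        by (intro conjI m uu(2)[OF k]) (simp_all add: mult_carrier_mat[of _ "fdim fs k" "fdim fs k"])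
    next
      case 3
      note vc = vmat_carrier[OF k valid[OF k]]
      show ?thesis unfolding 3 star1(1)[OF vc ij]
        by (intro conjI m vv(1)[OF k]) (simp_all add: vc mult_carrier_mat[of _ "fdim fs k" "fdim fs k"])
    next
      case 4
      note vc = vmat_carrier[OF k valid[OF k]]
      show ?thesis unfolding 4 star1(2)[OF vc ij]
        by (intro conjI m vv(2)[OF k]) (simp_all add: vc mult_carrier_mat[of _ "fdim fs k" "fdim fs k"])
    next
      case 5
      then show ?thesis
        using AO3[OF k 5(1) ij] ij by (simp add: vmat_index[OF k valid[OF k] ij])
    qed
  qed (use J in \<open>auto simp: ideal_0 ideal_add ideal_left ideal_right starF_add starF_mult\<close>)
  then show ?thesis by auto
qed

section \<open>Representations of the free product\<close>

fun ent :: "nat \<Rightarrow> (gen \<Rightarrow> nat \<Rightarrow> nat \<Rightarrow> complex) \<Rightarrow> gen list \<Rightarrow> nat \<Rightarrow> nat \<Rightarrow> complex" where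
  "ent d G [] q p = (if q = p then 1 else 0)"
| "ent d G (g # w) q p = (\<Sum>r<d. G g q r * ent d G w r p)"

text \<open>\<open>Gen\<close> and \<open>StarGen\<close> receive unrelated matrices. This freedom
  admits non-diagonalisable images, which a star-representation would exclude.\<close>

definition rep :: "nat \<Rightarrow> (gen \<Rightarrow> nat \<Rightarrow> nat \<Rightarrow> complex) \<Rightarrow> falg \<Rightarrow> nat \<Rightarrow> nat \<Rightarrow> complex"
  where "rep d G x q p = lext (*) (\<lambda>w. ent d G (letters w) q p) x"

lemma linearF_rep: "linearF (*) (\<lambda>x. rep d G x q p)"
  unfolding rep_def by (rule C.linearF_lext)

lemmas rep_add = linearF_add[OF linearF_rep] and rep_scaleF = linearF_scale[OF linearF_rep]
  and rep_diff = linearF_diff[OF linearF_rep] and rep_sum = linearF_sum[OF linearF_rep]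
  and rep_0 [simp] = linearF_0[OF linearF_rep]

lemma rep_mon: "rep d G (mon w) q p = ent d G (letters w) q p"
  by (simp add: rep_def C.lext_mon)

lemma ent_append:
  assumes "q < d"
  shows "ent d G (v @ w) q p = (\<Sum>r<d. ent d G v q r * ent d G w r p)"
  using assms
proof (induction v arbitrary: q)
  case Nil
  have "(\<Sum>r<d. (if q = r then 1 else 0) * ent d G w r p) = (\<Sum>r<d. if q = r then ent d G w r p else 0)"
    by (rule sum.cong) auto
  with Nil show ?case by simp
next
  case (Cons g v)
  have "ent d G ((g # v) @ w) q p = (\<Sum>r<d. \<Sum>s<d. G g q r * (ent d G v r s * ent d G w s p))"
    unfolding append_Cons ent.simps
    by (rule sum.cong) (simp_all only: Cons.IH lessThan_iff sum_distrib_left)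
  also have "\<dots> = (\<Sum>s<d. \<Sum>r<d. G g q r * (ent d G v r s * ent d G w s p))" by (rule sum.swap)
  also have "\<dots> = (\<Sum>s<d. ent d G (g # v) q s * ent d G w s p)"
    by (simp only: ent.simps sum_distrib_right mult.assoc)
  finally show ?case .
qed

lemma rep_mult:
  assumes "q < d"
  shows "rep d G (x * y) q p = (\<Sum>r<d. rep d G x q r * rep d G y r p)"
proof (induction x rule: falg_induct)
  case (mon v)
  show ?case
  proof (induction y rule: falg_induct)
    case (mon w)
    show ?case using assms by (simp add: mon_mult rep_mon plus_gword_def ent_append)
  next
    case (scale a x)
    then show ?case
      by (simp only: mult_scaleF_right rep_scaleF mult.left_commute[of _ a] sum_distrib_left)
  next
    case (add x y)
    then show ?case by (simp only: distrib_left rep_add sum.distrib)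
  qed
next
  case (scale a x)
  then show ?case by (simp only: mult_scaleF_left rep_scaleF sum_distrib_left mult.assoc)
next
  case (add x y)
  then show ?case by (simp only: distrib_right rep_add sum.distrib)
qed

lemma rep_1: "rep d G 1 q p = (if q = p then 1 else 0)"
  using rep_mon[of d G "Word []"] by (simp add: mon_Nil)

lemma rep_cst: "rep d G (cst a) q p = (if q = p then a else 0)"
  using rep_scaleF[of d G a 1 q p] by (simp add: scaleF_1_cst rep_1)

lemma rep_cst_mult: "rep d G (cst a * x) q p = a * rep d G x q p"
  using rep_scaleF[of d G a x q p] by (simp add: scaleF_def)

lemma ideal_rep_kernel: "ideal {x. \<forall>q<d. \<forall>p<d. rep d G x q p = 0}"
  by (simp add: ideal_def rep_add rep_mult)

definition gen_fun :: "(nat \<Rightarrow> bool \<Rightarrow> nat \<Rightarrow> nat \<Rightarrow> 'a) \<Rightarrow> gen \<Rightarrow> 'a"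
  where "gen_fun f g = (case g of Gen k i j \<Rightarrow> f k False i j | StarGen k i j \<Rightarrow> f k True i j)"

lemma rep_gx: "p < d \<Longrightarrow> rep d (gen_fun f) (gx k s i j) q p = f k s i j q p"
proof -
  assume "p < d"
  have "(\<Sum>r<d. f k s i j q r * (if r = p then 1 else 0)) = (\<Sum>r<d. if r = p then f k s i j q r else 0)"
    by (rule sum.cong) auto
  with \<open>p < d\<close> show ?thesis by (cases s) (simp_all add: gx_def rep_mon gen_fun_def)
qed

section \<open>Bidiagonal representations\<close>

definition bidiag :: "(nat \<Rightarrow> complex) \<Rightarrow> (nat \<Rightarrow> complex) \<Rightarrow> nat \<Rightarrow> nat \<Rightarrow> complex"
  where "bidiag D L q p = (if q = p then D p else if q = Suc p then L p else 0)"

lemma bidiag_sum: "(\<Sum>l\<in>A. bidiag (D l) (L l) q p) = bidiag (\<lambda>p. \<Sum>l\<in>A. D l p) (\<lambda>p. \<Sum>l\<in>A. L l p) q p"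
  and bidiag_scale: "c * bidiag D' L' q p = bidiag (\<lambda>p. c * D' p) (\<lambda>p. c * L' p) q p"
  by (simp_all add: bidiag_def)

text \<open>A product of two such matrices could have a second subdiagonal, with entries
  \<open>L (Suc p) * L' p\<close>; the hypothesis removes it. The subdiagonal of the product then
  obeys a Leibniz rule twisted by the two neighbouring diagonal entries.\<close>

lemma bidiag_mult:
  assumes "q < d" "p < d" "\<And>p. L (Suc p) * L' p = 0"
  shows "(\<Sum>r<d. bidiag D L q r * bidiag D' L' r p) = bidiag (\<lambda>p. D p * D' p) (\<lambda>p. D (Suc p) * L' p + L p * D' p) q p"
proof -
  have "(\<Sum>r<d. bidiag D L q r * bidiag D' L' r p) = (\<Sum>r\<in>{p, Suc p} \<inter> {..<d}. bidiag D L q r * bidiag D' L' r p)"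
    by (rule sum.mono_neutral_right) (auto simp: bidiag_def)
  also have "\<dots> = bidiag D L q p * bidiag D' L' p p + (if Suc p < d then bidiag D L q (Suc p) * bidiag D' L' (Suc p) p else 0)"
    using assms by (auto simp: Int_insert_left)
  also have "\<dots> = bidiag (\<lambda>p. D p * D' p) (\<lambda>p. D (Suc p) * L' p + L p * D' p) q p"
    using assms by (auto simp: bidiag_def)
  finally show ?thesis .
qed

text \<open>\<open>charac\<close> and \<open>deriv\<close> express that \<open>u \<mapsto> g\<close> and \<open>u \<mapsto> (g, 0; X, g')\<close> define representations of the
  \<open>k\<close>-th factor (the argument \<open>True\<close> stands for the images of the adjoints).\<close>

definition charac :: "factor list \<Rightarrow> nat \<Rightarrow> (bool \<Rightarrow> nat \<Rightarrow> nat \<Rightarrow> complex) \<Rightarrow> bool"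
  where "charac fs k g \<longleftrightarrow> (let n = fdim fs k in \<forall>i<n. \<forall>j<n.
    (\<Sum>l<n. g False i l * g True j l) = (if i = j then 1 else 0) \<and>
    (\<Sum>l<n. g True l i * g False l j) = (if i = j then 1 else 0) \<and>
    (case fs ! k of
      AU Q \<Rightarrow> (\<Sum>a<n. \<Sum>b<n. qi fs k a b * (g True i a * g False j b)) = qi fs k i j \<and>
        (\<Sum>a<n. \<Sum>b<n. qm fs k a b * (g False a i * g True b j)) = qm fs k i j
    | AO Q \<Rightarrow>
        g False i j = (\<Sum>a<n. \<Sum>b<n. Q $$ (i, a) * inv_mat Q $$ (b, j) * g True a b) \<and>
        g True i j = (\<Sum>a<n. \<Sum>b<n. cnj (Q $$ (i, a) * inv_mat Q $$ (b, j)) * g False a b)))"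

definition deriv :: "factor list \<Rightarrow> nat \<Rightarrow> (bool \<Rightarrow> nat \<Rightarrow> nat \<Rightarrow> complex) \<Rightarrow>
    (bool \<Rightarrow> nat \<Rightarrow> nat \<Rightarrow> complex) \<Rightarrow> (bool \<Rightarrow> nat \<Rightarrow> nat \<Rightarrow> complex) \<Rightarrow> bool"
  where "deriv fs k g' g X \<longleftrightarrow> (let n = fdim fs k in \<forall>i<n. \<forall>j<n.
    (\<Sum>l<n. g' False i l * X True j l + X False i l * g True j l) = 0 \<and>
    (\<Sum>l<n. g' True l i * X False l j + X True l i * g False l j) = 0 \<and>
    (case fs ! k of
      AU Q \<Rightarrow> (\<Sum>a<n. \<Sum>b<n. qi fs k a b * (g' True i a * X False j b + X True i a * g False j b)) = 0 \<and>
        (\<Sum>a<n. \<Sum>b<n. qm fs k a b * (g' False a i * X True b j + X False a i * g True b j)) = 0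
    | AO Q \<Rightarrow>
        X False i j = (\<Sum>a<n. \<Sum>b<n. Q $$ (i, a) * inv_mat Q $$ (b, j) * X True a b) \<and>
        X True i j = (\<Sum>a<n. \<Sum>b<n. cnj (Q $$ (i, a) * inv_mat Q $$ (b, j)) * X False a b)))"

lemma
  fixes f :: "nat \<Rightarrow> complex"
  shows sum_delta_left: "i < n \<Longrightarrow> (\<Sum>a<n. (if i = a then 1 else 0) * f a) = f i"
  and sum_delta_right: "i < n \<Longrightarrow> (\<Sum>a<n. f a * (if a = i then 1 else 0)) = f i"
  and sum_delta_left': "i < n \<Longrightarrow> (\<Sum>a<n. (if a = i then 1 else 0) * f a) = f i"
  and sum_delta_right': "i < n \<Longrightarrow> (\<Sum>a<n. f a * (if i = a then 1 else 0)) = f i"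
proof -
  assume "i < n"
  have *: "(\<Sum>a<n. if a = i then f a else 0) = f i" using \<open>i < n\<close> by simp
  show "(\<Sum>a<n. (if i = a then 1 else 0) * f a) = f i" "(\<Sum>a<n. f a * (if a = i then 1 else 0)) = f i"
    "(\<Sum>a<n. (if a = i then 1 else 0) * f a) = f i" "(\<Sum>a<n. f a * (if i = a then 1 else 0)) = f i"
    by (rule trans[OF sum.cong[OF refl] *]; auto)+
qed

lemma sum_delta_diag:
  fixes f :: "nat \<Rightarrow> nat \<Rightarrow> complex"
  shows "(\<Sum>a<n. \<Sum>b<n. f a b * (if a = b then 1 else 0)) = (\<Sum>a<n. f a a)"
  by (rule sum.cong[OF refl], rule sum_delta_right', simp)

lemma inv_mat_sum:
  assumes "k < length fs" "valid_factor (fs ! k)" "i < fdim fs k" "j < fdim fs k"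
  shows "(\<Sum>a<fdim fs k. fmat (fs ! k) $$ (i, a) * inv_mat (fmat (fs ! k)) $$ (a, j)) = (if i = j then 1 else 0)"
    "(\<Sum>a<fdim fs k. inv_mat (fmat (fs ! k)) $$ (i, a) * fmat (fs ! k) $$ (a, j)) = (if i = j then 1 else 0)"
proof -
  let ?n = "fdim fs k" let ?Q = "fmat (fs ! k)"
  note v = valid_fmat[OF assms(1,2)] and vi = invertible_inv_mat[OF valid_fmat(2,1)[OF assms(1,2)]]
  have [simp]: "dim_row ?Q = ?n" "dim_col ?Q = ?n" "dim_row (inv_mat ?Q) = ?n" "dim_col (inv_mat ?Q) = ?n"
    using v vi by auto
  show "(\<Sum>a<?n. ?Q $$ (i, a) * inv_mat ?Q $$ (a, j)) = (if i = j then 1 else 0)"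
    using arg_cong[OF vi(2), of "\<lambda>A. A $$ (i, j)"] assms(3,4)
    by (simp only: mult_mat_index index_one_mat \<open>dim_row ?Q = ?n\<close> \<open>dim_col ?Q = ?n\<close>
        \<open>dim_row (inv_mat ?Q) = ?n\<close> \<open>dim_col (inv_mat ?Q) = ?n\<close>)
  show "(\<Sum>a<?n. inv_mat ?Q $$ (i, a) * ?Q $$ (a, j)) = (if i = j then 1 else 0)"
    using arg_cong[OF vi(3), of "\<lambda>A. A $$ (i, j)"] assms(3,4)
    by (simp only: mult_mat_index index_one_mat \<open>dim_row ?Q = ?n\<close> \<open>dim_col ?Q = ?n\<close>
        \<open>dim_row (inv_mat ?Q) = ?n\<close> \<open>dim_col (inv_mat ?Q) = ?n\<close>)
qed

lemma charac_triv:
  assumes "k < length fs" "valid_factor (fs ! k)"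
  shows "charac fs k (\<lambda>s i j. if i = j then 1 else 0)"
proof -
  let ?n = "fdim fs k" let ?Q = "fmat (fs ! k)"
  have "(\<Sum>a<?n. cnj (?Q $$ (i, a)) * cnj (inv_mat ?Q $$ (a, j))) = (if i = j then 1 else 0)" if "i < ?n" "j < ?n" for i j
    using arg_cong[OF inv_mat_sum(1)[OF assms that], of cnj] by (simp add: if_distrib cong: if_cong)
  then show ?thesis
    unfolding charac_def Let_def using inv_mat_sum(1)[OF assms]
    by (cases "fs ! k")
      (simp_all add: sum_delta_left sum_delta_left' sum_delta_right sum_delta_right' sum_delta_diag
        mult.assoc[symmetric])
qed

text \<open>All relators have degree at most two in the generators, so by \<open>bidiag_mult\<close>
  a relation between bidiagonal matrices splits into one condition per diagonal entry
  (\<open>charac\<close>) and one per subdiagonal entry (\<open>deriv\<close>). Hypothesis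
  \<open>LL\<close> states that one factor never moves a basis vector twice in a row.\<close>

lemma band_relations:
  assumes valid: "\<And>k. k < length fs \<Longrightarrow> valid_factor (fs ! k)"
    and D: "\<And>k p. k < length fs \<Longrightarrow> charac fs k (\<lambda>s i j. D k s i j p)"
    and L: "\<And>k p. k < length fs \<Longrightarrow> deriv fs k (\<lambda>s i j. D k s i j (Suc p)) (\<lambda>s i j. D k s i j p) (\<lambda>s i j. L k s i j p)"
    and LL: "\<And>k s i j s' i' j' p. k < length fs \<Longrightarrow> L k s i j (Suc p) * L k s' i' j' p = 0"
    and f: "\<And>k s i j. f k s i j = (if i < fdim fs k \<and> j < fdim fs k then bidiag (D k s i j) (L k s i j) else (\<lambda>q p. 0))"
    and x: "x \<in> rel_ideal fs" "q < d" "p < d"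
  shows "rep d (gen_fun f) x q p = 0"
proof -
  let ?r = "rep d (gen_fun f)"
  let ?J = "{x. \<forall>q<d. \<forall>p<d. ?r x q p = 0}"
  have fin: "f k s i j = bidiag (D k s i j) (L k s i j)" if "i < fdim fs k" "j < fdim fs k" for k s i j
    using that by (simp add: f)
  have pr: "?r (gx k s i j * gx k s' i' j') q p = bidiag (\<lambda>p. D k s i j p * D k s' i' j' p)
      (\<lambda>p. D k s i j (Suc p) * L k s' i' j' p + L k s i j p * D k s' i' j' p) q p"
    if "k < length fs" "i < fdim fs k" "j < fdim fs k" "i' < fdim fs k" "j' < fdim fs k" "q < d" "p < d" for k s i j s' i' j' q p
    using that by (simp add: rep_mult rep_gx fin bidiag_mult LL)
  have gr: "?r (gx k s i j) q p = bidiag (D k s i j) (L k s i j) q p"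
    if "k < length fs" "i < fdim fs k" "j < fdim fs k" "p < d" for k s i j q p
    using that by (simp add: rep_gx fin)
  have rel1: "(\<Sum>l<fdim fs k. gx k False i l * gx k True j l) - (if i = j then 1 else 0) \<in> ?J"
    and rel2: "(\<Sum>l<fdim fs k. gx k True l i * gx k False l j) - (if i = j then 1 else 0) \<in> ?J"
    if k: "k < length fs" and ij: "i < fdim fs k" "j < fdim fs k" for k i j
  proof -
    have "(\<Sum>l<fdim fs k. D k False i l p * D k True j l p) = (if i = j then 1 else 0)"
      "(\<Sum>l<fdim fs k. D k True l i p * D k False l j p) = (if i = j then 1 else 0)"
      "(\<Sum>l<fdim fs k. D k False i l (Suc p) * L k True j l p + L k False i l p * D k True j l p) = 0"
      "(\<Sum>l<fdim fs k. D k True l i (Suc p) * L k False l j p + L k True l i p * D k False l j p) = 0" for p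
      using D[OF k, of p] L[OF k, of p] ij by (simp_all add: charac_def deriv_def Let_def)
    then show "(\<Sum>l<fdim fs k. gx k False i l * gx k True j l) - (if i = j then 1 else 0) \<in> ?J"
      "(\<Sum>l<fdim fs k. gx k True l i * gx k False l j) - (if i = j then 1 else 0) \<in> ?J"
      using k ij by (auto simp: rep_diff rep_sum pr rep_1 bidiag_sum, auto simp: bidiag_def)
  qed
  have rel3: "(\<Sum>a<fdim fs k. \<Sum>b<fdim fs k. cst (qi fs k a b) * (gx k True i a * gx k False j b)) - cst (qi fs k i j) \<in> ?J"
    and rel4: "(\<Sum>a<fdim fs k. \<Sum>b<fdim fs k. cst (qm fs k a b) * (gx k False a i * gx k True b j)) - cst (qm fs k i j) \<in> ?J"
    if k: "k < length fs" and ij: "i < fdim fs k" "j < fdim fs k" and AU: "fs ! k = AU Q" for k i j Q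
  proof -
    have "(\<Sum>a<fdim fs k. \<Sum>b<fdim fs k. qi fs k a b * (D k True i a p * D k False j b p)) = qi fs k i j"
      "(\<Sum>a<fdim fs k. \<Sum>b<fdim fs k. qm fs k a b * (D k False a i p * D k True b j p)) = qm fs k i j"
      "(\<Sum>a<fdim fs k. \<Sum>b<fdim fs k. qi fs k a b * (D k True i a (Suc p) * L k False j b p + L k True i a p * D k False j b p)) = 0"
      "(\<Sum>a<fdim fs k. \<Sum>b<fdim fs k. qm fs k a b * (D k False a i (Suc p) * L k True b j p + L k False a i p * D k True b j p)) = 0" for p
      using D[OF k, of p] L[OF k, of p] ij AU by (simp_all add: charac_def deriv_def Let_def)
    then show "(\<Sum>a<fdim fs k. \<Sum>b<fdim fs k. cst (qi fs k a b) * (gx k True i a * gx k False j b)) - cst (qi fs k i j) \<in> ?J"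
      "(\<Sum>a<fdim fs k. \<Sum>b<fdim fs k. cst (qm fs k a b) * (gx k False a i * gx k True b j)) - cst (qm fs k i j) \<in> ?J"
      using k ij by (auto simp: rep_diff rep_sum pr rep_cst rep_cst_mult bidiag_sum bidiag_scale, auto simp: bidiag_def)
  qed
  have rel5: "ao_rel fs k i j \<in> ?J" "starF (ao_rel fs k i j) \<in> ?J"
    if k: "k < length fs" and ij: "i < fdim fs k" "j < fdim fs k" and AO: "fs ! k = AO Q" for k i j Q
  proof -
    let ?c = "\<lambda>a b. Q $$ (i, a) * inv_mat Q $$ (b, j)"
    have "D k False i j p = (\<Sum>a<fdim fs k. \<Sum>b<fdim fs k. ?c a b * D k True a b p)"
      "D k True i j p = (\<Sum>a<fdim fs k. \<Sum>b<fdim fs k. cnj (?c a b) * D k False a b p)" for p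
      using D[OF k, of p, unfolded charac_def Let_def AO factor.case, rule_format, OF ij] by blast+
    moreover have "L k False i j p = (\<Sum>a<fdim fs k. \<Sum>b<fdim fs k. ?c a b * L k True a b p)"
      "L k True i j p = (\<Sum>a<fdim fs k. \<Sum>b<fdim fs k. cnj (?c a b) * L k False a b p)" for p
      using L[OF k, of p, unfolded deriv_def Let_def AO factor.case, rule_format, OF ij] by blast+
    moreover have "starF (ao_rel fs k i j) = gx k True i j - (\<Sum>a<fdim fs k. \<Sum>b<fdim fs k. cst (cnj (?c a b)) * gx k False a b)"
      by (simp add: ao_rel_def AO starF_diff starF_sum starF_mult cst_commute[of "gx _ _ _ _"])
    ultimately show "ao_rel fs k i j \<in> ?J" "starF (ao_rel fs k i j) \<in> ?J"
      using k ij by (auto simp: ao_rel_def AO rep_diff rep_sum gr rep_cst_mult bidiag_sum bidiag_scale, auto simp: bidiag_def)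
  qed
  have "rel_ideal fs \<subseteq> ?J"
  proof (rule rel_ideal_subset[OF valid ideal_rep_kernel])
    show "gx k s i j \<in> ?J" if "\<not> (i < fdim fs k \<and> j < fdim fs k)" for k s i j
      using that by (auto simp: rep_gx f)
    show "rels fs k i j \<subseteq> ?J" if "k < length fs" "fs ! k = AU Q" "i < fdim fs k" "j < fdim fs k" for k Q i j
      unfolding rels_def Let_def insert_subset
      by (intro conjI rel1[OF that(1,3,4)] rel2[OF that(1,3,4)] rel3[OF that(1,3,4,2)] rel4[OF that(1,3,4,2)] empty_subsetI)
    fix k Q i j assume *: "k < length fs" "fs ! k = AO Q" "i < fdim fs k" "j < fdim fs k"
    show "(\<Sum>l<fdim fs k. gx k False i l * gx k True j l) - (if i = j then 1 else 0) \<in> ?J"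
      by (rule rel1[OF *(1,3,4)])
    show "(\<Sum>l<fdim fs k. gx k True l i * gx k False l j) - (if i = j then 1 else 0) \<in> ?J"
      by (rule rel2[OF *(1,3,4)])
    show "ao_rel fs k i j \<in> ?J \<and> starF (ao_rel fs k i j) \<in> ?J"
      by (intro conjI rel5[OF *(1,3,4,2)])
  qed
  then show ?thesis using x by auto
qed

section \<open>Admissible subdiagonal blocks for a single factor\<close>

lemma mat_minus_uminus: "A \<in> carrier_mat n m \<Longrightarrow> B \<in> carrier_mat n m \<Longrightarrow> (A + B = 0\<^sub>m n m) = (A = - B)" for A :: "'a::ring_1 mat"
  by (auto simp: mat_eq_iff add_eq_0_iff2)

lemma mat3_index:
  fixes A B C :: "complex mat"
  assumes "A \<in> carrier_mat n n" "B \<in> carrier_mat n n" "C \<in> carrier_mat n n" "i < n" "j < n"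
  shows "(A * C * B) $$ (i, j) = (\<Sum>a<n. \<Sum>b<n. A $$ (i, a) * B $$ (b, j) * C $$ (a, b))"
proof -
  have "(A * C * B) $$ (i, j) = (\<Sum>b<n. (\<Sum>a<n. A $$ (i, a) * C $$ (a, b)) * B $$ (b, j))"
  proof -
    have AC: "A * C \<in> carrier_mat n n" using assms by auto
    have "(A * C * B) $$ (i, j) = (\<Sum>b<n. (A * C) $$ (i, b) * B $$ (b, j))"
      using assms AC by (subst mult_mat_index) auto
    also have "\<dots> = (\<Sum>b<n. (\<Sum>a<n. A $$ (i, a) * C $$ (a, b)) * B $$ (b, j))"
      using assms by (intro sum.cong refl, subst mult_mat_index) auto
    finally show ?thesis .
  qed
  also have "\<dots> = (\<Sum>b<n. \<Sum>a<n. A $$ (i, a) * B $$ (b, j) * C $$ (a, b))"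
    by (simp only: sum_distrib_right) (simp only: mult_ac)
  also have "\<dots> = (\<Sum>a<n. \<Sum>b<n. A $$ (i, a) * B $$ (b, j) * C $$ (a, b))" by (rule sum.swap)
  finally show ?thesis .
qed

lemma
  fixes f :: "nat \<Rightarrow> nat \<Rightarrow> complex"
  assumes "i < n"
  shows sum_delta2: "(\<Sum>a<n. \<Sum>b<n. (if i = a then 1 else 0) * f a b) = (\<Sum>b<n. f i b)"
    and sum_delta2': "(\<Sum>a<n. \<Sum>b<n. (if a = i then 1 else 0) * f a b) = (\<Sum>b<n. f i b)"
  using assms by (simp_all add: sum_delta_left sum_delta_left' flip: sum_distrib_left)

context
  fixes fs k n
  assumes k: "k < length fs" and valid: "valid_factor (fs ! k)" and n: "n = fdim fs k"
begin

text \<open>Here the condition that Q times its entrywise conjugate is a scalar s enters: the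
  conjugate of Q is s times the inverse of Q, and s times the conjugate of the inverse is Q, so that
  s cancels in the product.\<close>

lemma ao_conj:
  assumes AO: "fs ! k = AO Q" and "i < n" "a < n" "b < n" "j < n"
  shows "cnj (Q $$ (i, a) * inv_mat Q $$ (b, j)) = inv_mat Q $$ (i, a) * Q $$ (b, j)"
proof -
  note v = valid_fmat[OF k valid, folded n] and vi = invertible_inv_mat[OF valid_fmat(2,1)[OF k valid], folded n]
  have QC: "Q \<in> carrier_mat n n" "inv_mat Q \<in> carrier_mat n n" "Q * inv_mat Q = 1\<^sub>m n" "inv_mat Q * Q = 1\<^sub>m n" "0 < n"
    using v vi AO by auto
  obtain s where s: "Q * map_mat cnj Q = s \<cdot>\<^sub>m 1\<^sub>m n"
    using valid AO QC by auto
  have c: "map_mat cnj Q \<in> carrier_mat n n" using QC by auto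
  have cm: "map_mat cnj (X * Y) = map_mat cnj X * map_mat cnj Y" if "X \<in> carrier_mat n n" "Y \<in> carrier_mat n n" for X Y
    using that by (intro eq_matI) (auto simp: mult_mat_index simp del: index_mult_mat(1))
  have "inv_mat Q * (Q * map_mat cnj Q) = map_mat cnj Q"
    using QC c assoc_mult_mat[OF QC(2,1) c] by simp
  then have 1: "map_mat cnj Q = s \<cdot>\<^sub>m inv_mat Q"
    using QC s by (simp add: mult_smult_distrib[of _ n n _ n])
  have "map_mat cnj Q * map_mat cnj (inv_mat Q) = 1\<^sub>m n"
    using cm[OF QC(1,2)] unfolding QC(3) by simp
  then have "Q * (s \<cdot>\<^sub>m (inv_mat Q * map_mat cnj (inv_mat Q))) = Q"
    unfolding 1 using QC by (simp add: mult_smult_assoc_mat[of _ n n _ n])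
  then have "s \<cdot>\<^sub>m (Q * (inv_mat Q * map_mat cnj (inv_mat Q))) = Q"
    using QC by (subst (asm) mult_smult_distrib[of _ n n _ n]) (auto intro: mult_carrier_mat)
  then have 2: "s \<cdot>\<^sub>m map_mat cnj (inv_mat Q) = Q"
    using QC assoc_mult_mat[of Q n n "inv_mat Q" n "map_mat cnj (inv_mat Q)" n] by simp
  have "cnj (Q $$ (i, a)) = s * inv_mat Q $$ (i, a)"
    using arg_cong[OF 1, of "\<lambda>A. A $$ (i, a)"] QC assms by simp
  moreover have "s * cnj (inv_mat Q $$ (b, j)) = Q $$ (b, j)"
    using arg_cong[OF 2, of "\<lambda>A. A $$ (b, j)"] QC assms by simp
  ultimately show ?thesis by (simp flip: mult.assoc)
qed

text \<open>For an \<open>AO\<close> factor a single matrix equation is asked for: solving it for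
  \<open>GT\<close> conjugates with Q the other way round, which by \<open>ao_conj\<close> is the
  adjoint relation in \<open>charac\<close>.\<close>

lemma charac_matI:
  assumes c: "GF \<in> carrier_mat n n" "GT \<in> carrier_mat n n"
    and 1: "GF * transpose_mat GT = 1\<^sub>m n" "transpose_mat GT * GF = 1\<^sub>m n"
    and AU: "\<And>Q. fs ! k = AU Q \<Longrightarrow> GT * qinv fs k * transpose_mat GF = qinv fs k \<and> transpose_mat GF * qmat fs k * GT = qmat fs k"
    and AO: "\<And>Q. fs ! k = AO Q \<Longrightarrow> GF = Q * GT * inv_mat Q"
  shows "charac fs k (\<lambda>s i j. (if s then GT else GF) $$ (i, j))"
proof -
  note v = valid_fmat[OF k valid, folded n] and vi = invertible_inv_mat[OF valid_fmat(2,1)[OF k valid], folded n]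
  have m: "qmat fs k \<in> carrier_mat n n" "qinv fs k \<in> carrier_mat n n" "transpose_mat GF \<in> carrier_mat n n" "transpose_mat GT \<in> carrier_mat n n"
    using v vi c by (auto simp: qmat_def qinv_def)
  have 2: "(\<Sum>l<n. GF $$ (i, l) * GT $$ (j, l)) = (if i = j then 1 else 0)"
    "(\<Sum>l<n. GT $$ (l, i) * GF $$ (l, j)) = (if i = j then 1 else 0)" if "i < n" "j < n" for i j
    using arg_cong[OF 1(1), of "\<lambda>A. A $$ (i, j)"] arg_cong[OF 1(2), of "\<lambda>A. A $$ (i, j)"] c that
    by (simp_all add: mult_mat_index del: index_mult_mat(1))
  show ?thesis
  proof (cases "fs ! k")
    case (AU Q)
    have "(\<Sum>a<n. \<Sum>b<n. qi fs k a b * (GT $$ (i, a) * GF $$ (j, b))) = qi fs k i j"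
      "(\<Sum>a<n. \<Sum>b<n. qm fs k a b * (GF $$ (a, i) * GT $$ (b, j))) = qm fs k i j" if "i < n" "j < n" for i j
      using assms(5)[OF AU] mat3_index[OF c(2) m(3,2) that] mat3_index[OF m(3) c(2) m(1) that] c that
      by (simp_all add: mult_ac del: index_mult_mat(1))
    with 2 AU show ?thesis by (simp add: charac_def Let_def flip: n)
  next
    case (AO Q)
    have Q: "Q \<in> carrier_mat n n" "inv_mat Q \<in> carrier_mat n n" "Q * inv_mat Q = 1\<^sub>m n" "inv_mat Q * Q = 1\<^sub>m n"
      using v vi AO by auto
    have g: "GF = Q * GT * inv_mat Q" by (rule assms(6)[OF AO])
    have "GT = inv_mat Q * Q * GT * (inv_mat Q * Q)" using c Q by simp
    also have "\<dots> = inv_mat Q * (Q * GT * inv_mat Q) * Q"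
      using c Q(1,2) by (simp add: assoc_mult_mat[of _ n n _ n _ n] mult_carrier_mat[of _ n n _ n] del: Q(3,4))
    finally have "GT = inv_mat Q * GF * Q" unfolding g .
    then have "GT $$ (i, j) = (\<Sum>a<n. \<Sum>b<n. inv_mat Q $$ (i, a) * Q $$ (b, j) * GF $$ (a, b))" if "i < n" "j < n" for i j
      using mat3_index[OF Q(2,1) c(1) that] by simp
    then have "GT $$ (i, j) = (\<Sum>a<n. \<Sum>b<n. cnj (Q $$ (i, a) * inv_mat Q $$ (b, j)) * GF $$ (a, b))" if "i < n" "j < n" for i j
      using that by (simp add: ao_conj[OF AO] del: complex_cnj_mult)
    moreover have "GF $$ (i, j) = (\<Sum>a<n. \<Sum>b<n. Q $$ (i, a) * inv_mat Q $$ (b, j) * GT $$ (a, b))" if "i < n" "j < n" for i j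
      using mat3_index[OF Q(1,2) c(2) that] g by simp
    ultimately show ?thesis
      unfolding charac_def Let_def AO factor.case n[symmetric] if_True if_False
      by (intro allI impI conjI 2)
  qed
qed

text \<open>The relations for the lower left corner of u \<mapsto> (g, 0; X, 1), that is, with the
  counit in the lower right corner.\<close>

lemma deriv_matI:
  assumes c: "GF \<in> carrier_mat n n" "GT \<in> carrier_mat n n" "XF \<in> carrier_mat n n" "XT \<in> carrier_mat n n"
    and 1: "transpose_mat XT + XF * transpose_mat GT = 0\<^sub>m n n" "XF + transpose_mat XT * GF = 0\<^sub>m n n"
    and AU: "\<And>Q. fs ! k = AU Q \<Longrightarrow> qinv fs k * transpose_mat XF + XT * qinv fs k * transpose_mat GF = 0\<^sub>m n n \<and>
      qmat fs k * XT + transpose_mat XF * qmat fs k * GT = 0\<^sub>m n n"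
    and AO: "\<And>Q. fs ! k = AO Q \<Longrightarrow> XF = Q * XT * inv_mat Q"
  shows "deriv fs k (\<lambda>s i j. if i = j then 1 else 0) (\<lambda>s i j. (if s then GT else GF) $$ (i, j)) (\<lambda>s i j. (if s then XT else XF) $$ (i, j))"
proof -
  note v = valid_fmat[OF k valid, folded n] and vi = invertible_inv_mat[OF valid_fmat(2,1)[OF k valid], folded n]
  have m: "qmat fs k \<in> carrier_mat n n" "qinv fs k \<in> carrier_mat n n" "transpose_mat GF \<in> carrier_mat n n" "transpose_mat GT \<in> carrier_mat n n"
    "transpose_mat XF \<in> carrier_mat n n" "transpose_mat XT \<in> carrier_mat n n"
    using v vi c by (auto simp: qmat_def qinv_def)
  have 2: "XT $$ (j, i) + (\<Sum>l<n. XF $$ (i, l) * GT $$ (j, l)) = 0"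
    "XF $$ (i, j) + (\<Sum>l<n. XT $$ (l, i) * GF $$ (l, j)) = 0" if "i < n" "j < n" for i j
    using arg_cong[OF 1(1), of "\<lambda>A. A $$ (i, j)"] arg_cong[OF 1(2), of "\<lambda>A. A $$ (i, j)"] c that
    by (simp_all add: mult_mat_index del: index_mult_mat(1))
  have 3: "(\<Sum>l<n. (if i = l then 1 else 0) * XT $$ (j, l)) + (\<Sum>l<n. XF $$ (i, l) * GT $$ (j, l)) = 0"
    "(\<Sum>l<n. (if l = i then 1 else 0) * XF $$ (l, j)) + (\<Sum>l<n. XT $$ (l, i) * GF $$ (l, j)) = 0" if "i < n" "j < n" for i j
    using that by (simp_all add: sum_delta_left sum_delta_left' 2)
  show ?thesis
  proof (cases "fs ! k")
    case (AU Q)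
    have "(\<Sum>b<n. qi fs k i b * XF $$ (j, b)) + (\<Sum>a<n. \<Sum>b<n. qi fs k a b * (XT $$ (i, a) * GF $$ (j, b))) = 0"
      "(\<Sum>b<n. qm fs k i b * XT $$ (b, j)) + (\<Sum>a<n. \<Sum>b<n. qm fs k a b * (XF $$ (a, i) * GT $$ (b, j))) = 0" if ij: "i < n" "j < n" for i j
    proof -
      have "(qinv fs k * transpose_mat XF) $$ (i, j) + (XT * qinv fs k * transpose_mat GF) $$ (i, j) = 0"
        "(qmat fs k * XT) $$ (i, j) + (transpose_mat XF * qmat fs k * GT) $$ (i, j) = 0"
        using arg_cong[OF conjunct1[OF assms(7)[OF AU]], of "\<lambda>A. A $$ (i, j)"]
          arg_cong[OF conjunct2[OF assms(7)[OF AU]], of "\<lambda>A. A $$ (i, j)"] c m ij by (simp_all del: index_mult_mat(1))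
      then show "(\<Sum>b<n. qi fs k i b * XF $$ (j, b)) + (\<Sum>a<n. \<Sum>b<n. qi fs k a b * (XT $$ (i, a) * GF $$ (j, b))) = 0"
        "(\<Sum>b<n. qm fs k i b * XT $$ (b, j)) + (\<Sum>a<n. \<Sum>b<n. qm fs k a b * (XF $$ (a, i) * GT $$ (b, j))) = 0"
        using mat3_index[OF c(4) m(3,2) ij] mat3_index[OF m(5) c(2) m(1) ij] c m ij
        by (simp_all add: mult_mat_index mult_ac del: index_mult_mat(1))
    qed
    with 2 AU show ?thesis
      by (simp add: deriv_def Let_def sum.distrib distrib_left sum_delta_left sum_delta_left' sum_delta2 sum_delta2' mult.left_commute[of _ "if _ then _ else _"]
        flip: n)
  next
    case (AO Q)
    have Q: "Q \<in> carrier_mat n n" "inv_mat Q \<in> carrier_mat n n" "Q * inv_mat Q = 1\<^sub>m n" "inv_mat Q * Q = 1\<^sub>m n"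
      using v vi AO by auto
    have g: "XF = Q * XT * inv_mat Q" by (rule assms(8)[OF AO])
    have "XT = inv_mat Q * Q * XT * (inv_mat Q * Q)" using c Q by simp
    also have "\<dots> = inv_mat Q * (Q * XT * inv_mat Q) * Q"
      using c Q(1,2) by (simp add: assoc_mult_mat[of _ n n _ n _ n] mult_carrier_mat[of _ n n _ n] del: Q(3,4))
    finally have "XT = inv_mat Q * XF * Q" unfolding g .
    then have "XT $$ (i, j) = (\<Sum>a<n. \<Sum>b<n. inv_mat Q $$ (i, a) * Q $$ (b, j) * XF $$ (a, b))" if "i < n" "j < n" for i j
      using mat3_index[OF Q(2,1) c(3) that] by simp
    then have "XT $$ (i, j) = (\<Sum>a<n. \<Sum>b<n. cnj (Q $$ (i, a) * inv_mat Q $$ (b, j)) * XF $$ (a, b))" if "i < n" "j < n" for i j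
      using that by (simp add: ao_conj[OF AO] del: complex_cnj_mult)
    moreover have "XF $$ (i, j) = (\<Sum>a<n. \<Sum>b<n. Q $$ (i, a) * inv_mat Q $$ (b, j) * XT $$ (a, b))" if "i < n" "j < n" for i j
      using mat3_index[OF Q(1,2) c(4) that] g by simp
    ultimately show ?thesis
      unfolding deriv_def Let_def AO factor.case n[symmetric] if_True if_False sum.distrib
      by (intro allI impI conjI 3)
  qed
qed

text \<open>X is the corner of some representation u \<mapsto> (g, 0; X, 1). The counit stands in
  one diagonal corner because a factor acts by it wherever it does not move the basis vector; the
  character g in the other corner may be chosen to suit X.\<close>

definition stepX :: "complex mat \<Rightarrow> bool"
  where "stepX X \<longleftrightarrow> (\<exists>g Y. charac fs k g \<and> deriv fs k (\<lambda>s i j. if i = j then 1 else 0) g Y \<and>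
    (\<forall>i<n. \<forall>j<n. Y False i j = X $$ (i, j)))"

text \<open>For an \<open>AU\<close> factor take \<open>g = M\<^sup>T\<close> with \<open>M = Q\<^sup>*Q\<close>; then the conditions on \<open>X\<close> are void.\<close>

lemma stepX_AU:
  assumes AU: "fs ! k = AU Q" and X: "X \<in> carrier_mat n n"
  shows "stepX X"
proof -
  note v = valid_fmat[OF k valid, folded n] and vi = invertible_inv_mat[OF valid_fmat(2,1)[OF k valid], folded n]
  define M where "M = qmat fs k" define N where "N = qinv fs k"
  have MN: "M * N = 1\<^sub>m n" "N * M = 1\<^sub>m n"
    using qmat_qinv[OF k valid n refl] by (simp_all add: M_def N_def)
  have c: "M \<in> carrier_mat n n" "N \<in> carrier_mat n n"
    using v vi by (auto simp: M_def N_def qmat_def qinv_def)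
  let ?m = "transpose_mat M" let ?n = "transpose_mat N" let ?x = "transpose_mat X"
  have c': "?m \<in> carrier_mat n n" "?n \<in> carrier_mat n n" "?x \<in> carrier_mat n n" using c X by auto
  have mn: "?m * ?n = 1\<^sub>m n" "?n * ?m = 1\<^sub>m n"
    using transpose_mult[OF c(2,1)] transpose_mult[OF c] unfolding MN transpose_one by (simp_all only:)
  define XT where "XT = - (N * ?x)"
  have XT: "XT \<in> carrier_mat n n" using c c' by (simp add: XT_def)
  have XTt: "transpose_mat XT = - (X * ?n)"
    using transpose_mult[OF c(2) c'(3)] c c' X by (simp add: XT_def transpose_uminus)
  have "charac fs k (\<lambda>s i j. (if s then N else ?m) $$ (i, j))"
    using c c' mn MN AU by (intro charac_matI) (auto simp: M_def[symmetric] N_def[symmetric])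
  moreover have "deriv fs k (\<lambda>s i j. if i = j then 1 else 0) (\<lambda>s i j. (if s then N else ?m) $$ (i, j)) (\<lambda>s i j. (if s then XT else X) $$ (i, j))"
  proof (rule deriv_matI[OF c'(1) c(2) X XT])
    show "transpose_mat XT + X * transpose_mat N = 0\<^sub>m n n"
      unfolding XTt using X c' by (auto simp: mat_minus_uminus[of _ n n])
    show "X + transpose_mat XT * ?m = 0\<^sub>m n n"
      unfolding XTt using X c' mn by (simp add: mat_minus_uminus[of _ n n] uminus_mult_left_mat assoc_mult_mat[of _ n n _ n _ n])
    show "qinv fs k * ?x + XT * qinv fs k * transpose_mat ?m = 0\<^sub>m n n \<and> qmat fs k * XT + ?x * qmat fs k * N = 0\<^sub>m n n" for R
      unfolding M_def[symmetric] N_def[symmetric] XT_def using X c c' MN assoc_mult_mat[OF c c'(3)]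
      by (simp add: mat_minus_uminus[of _ n n] assoc_mult_mat[of _ n n _ n _ n])
  qed (use AU in simp)
  ultimately show ?thesis unfolding stepX_def
    by (intro exI[of _ "\<lambda>s i j. (if s then N else ?m) $$ (i, j)"] exI[of _ "\<lambda>s i j. (if s then XT else X) $$ (i, j)"]) simp
qed

text \<open>For an \<open>AO\<close> factor take \<open>g = \<plusminus>Q\<^sup>TQ\<^sup>-\<^sup>1\<close>; then \<open>X\<close> only has to be \<open>AQ\<^sup>-\<^sup>1\<close> with \<open>A\<close> antisymmetric,
  respectively symmetric.\<close>

lemma stepX_AO:
  assumes AO: "fs ! k = AO Q" and A: "A \<in> carrier_mat n n" "transpose_mat A = \<sigma> \<cdot>\<^sub>m A" and \<sigma>: "\<sigma> = 1 \<or> \<sigma> = - 1"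
  shows "stepX (A * inv_mat Q)"
proof -
  note v = valid_fmat[OF k valid, folded n] and vi = invertible_inv_mat[OF valid_fmat(2,1)[OF k valid], folded n]
  define P where "P = inv_mat Q"
  have c: "Q \<in> carrier_mat n n" "P \<in> carrier_mat n n" and QP: "Q * P = 1\<^sub>m n" "P * Q = 1\<^sub>m n"
    using v vi AO by (auto simp: P_def)
  let ?q = "transpose_mat Q" let ?p = "transpose_mat P"
  have c': "?q \<in> carrier_mat n n" "?p \<in> carrier_mat n n" using c by auto
  have qp: "?q * ?p = 1\<^sub>m n" "?p * ?q = 1\<^sub>m n"
    using transpose_mult[OF c(2,1)] transpose_mult[OF c] unfolding QP transpose_one by (simp_all only:)
  have canc: "Q * (P * x) = x" "P * (Q * x) = x" "?q * (?p * x) = x" "?p * (?q * x) = x" if "x \<in> carrier_mat n n" for x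
    using that c c' by (simp_all add: QP qp flip: assoc_mult_mat[of _ n n _ n _ n])
  note as = assoc_mult_mat[of _ n n _ n _ n] and mc = mult_carrier_mat[of _ n n _ n]
    and sm = mult_smult_distrib[of _ n n _ n] mult_smult_assoc_mat[of _ n n _ n]
  have sq: "\<sigma> * \<sigma> = 1" using \<sigma> by auto
  have ss: "\<sigma> \<cdot>\<^sub>m (\<sigma> \<cdot>\<^sub>m x) = x" for x
    using sq by (intro eq_matI) (auto simp flip: mult.assoc)
  have ts: "transpose_mat (a \<cdot>\<^sub>m x) = a \<cdot>\<^sub>m transpose_mat x" for a and x :: "complex mat" by (intro eq_matI) auto
  define GF where "GF = (- \<sigma>) \<cdot>\<^sub>m (?q * P)" define GT where "GT = (- \<sigma>) \<cdot>\<^sub>m (P * ?q)"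
  define XF where "XF = A * P" define XT where "XT = P * A"
  have C: "GF \<in> carrier_mat n n" "GT \<in> carrier_mat n n" "XF \<in> carrier_mat n n" "XT \<in> carrier_mat n n"
    using c c' A by (auto simp: GF_def GT_def XF_def XT_def)
  have tr: "transpose_mat GF = (- \<sigma>) \<cdot>\<^sub>m (?p * Q)" "transpose_mat GT = (- \<sigma>) \<cdot>\<^sub>m (Q * ?p)" "transpose_mat XT = \<sigma> \<cdot>\<^sub>m (A * ?p)"
    using c c' A by (simp_all add: GF_def GT_def XT_def transpose_mult[of _ n n _ n] ts mult_smult_assoc_mat[of _ n n _ n])
  have neg: "- (a \<cdot>\<^sub>m x) = (- a) \<cdot>\<^sub>m x" for a :: complex and x :: "complex mat" by (intro eq_matI) auto
  have sm2: "a \<cdot>\<^sub>m (b \<cdot>\<^sub>m x) = (a * b) \<cdot>\<^sub>m x" for a b :: complex and x :: "complex mat" by (intro eq_matI) auto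
  have one: "1 \<cdot>\<^sub>m x = x" for x :: "complex mat" by (intro eq_matI) auto
  have nAU: "fs ! k \<noteq> AU R" for R using AO by simp
  have "charac fs k (\<lambda>s i j. (if s then GT else GF) $$ (i, j))"
  proof (rule charac_matI[OF C(1,2)])
    show "GF * transpose_mat GT = 1\<^sub>m n" "transpose_mat GT * GF = 1\<^sub>m n"
      unfolding tr unfolding GF_def using c c' by (simp_all add: as mc sm canc QP qp sm2 sq one)
    show "GF = R * GT * inv_mat R" if "fs ! k = AO R" for R
    proof -
      have R: "R = Q" using that AO by simp
      show ?thesis unfolding R P_def[symmetric] GF_def GT_def using c c' by (simp add: as mc sm canc)
    qed
  qed (use nAU in auto)
  moreover have "deriv fs k (\<lambda>s i j. if i = j then 1 else 0) (\<lambda>s i j. (if s then GT else GF) $$ (i, j)) (\<lambda>s i j. (if s then XT else XF) $$ (i, j))"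
  proof (rule deriv_matI[OF C])
    show "transpose_mat XT + XF * transpose_mat GT = 0\<^sub>m n n"
      unfolding tr unfolding XF_def using A c c' by (simp add: mat_minus_uminus[of _ n n] as mc sm canc neg)
    show "XF + transpose_mat XT * GF = 0\<^sub>m n n"
      unfolding tr unfolding XF_def GF_def using A c c'
      by (simp add: mat_minus_uminus[of _ n n] as mc sm canc neg sm2 sq one)
    show "XF = R * XT * inv_mat R" if "fs ! k = AO R" for R
    proof -
      have R: "R = Q" using that AO by simp
      show ?thesis unfolding R P_def[symmetric] XF_def XT_def using A c c' by (simp add: as mc canc)
    qed
  qed (use nAU in auto)
  ultimately show ?thesis unfolding stepX_def XF_def[symmetric] P_def[symmetric]
    by (intro exI[of _ "\<lambda>s i j. (if s then GT else GF) $$ (i, j)"] exI[of _ "\<lambda>s i j. (if s then XT else XF) $$ (i, j)"]) (simp add: XF_def)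
qed

text \<open>No nonzero row vector is annihilated by all admissible X. For an \<open>AO\<close>
  factor the symmetric rank one matrices already suffice, once the factor inverse to Q has been
  cancelled on the right.\<close>

lemma stepX_separating:
  assumes "\<And>X j. stepX X \<Longrightarrow> X \<in> carrier_mat n n \<Longrightarrow> j < n \<Longrightarrow> (\<Sum>a<n. q a * X $$ (a, j)) = 0" and "a < n"
  shows "q a = 0"
proof (cases "fs ! k")
  case (AU Q)
  from assms(1)[OF stepX_AU[OF AU], of "1\<^sub>m n" a] \<open>a < n\<close> have "(\<Sum>b<n. q b * (if b = a then 1 else 0)) = 0" by simp
  with \<open>a < n\<close> show ?thesis by (simp add: sum_delta_right)
next
  case (AO Q)
  note v = valid_fmat[OF k valid, folded n] and vi = invertible_inv_mat[OF valid_fmat(2,1)[OF k valid], folded n]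
  have Q: "Q \<in> carrier_mat n n" "inv_mat Q \<in> carrier_mat n n" "inv_mat Q * Q = 1\<^sub>m n" using v vi AO by auto
  have z: "(\<Sum>b<n. q b * A $$ (b, j)) = 0"
    if A: "A \<in> carrier_mat n n" "transpose_mat A = \<sigma> \<cdot>\<^sub>m A" "\<sigma> = 1 \<or> \<sigma> = - 1" and j: "j < n" for A \<sigma> j
  proof -
    have "A = (A * inv_mat Q) * Q" using A Q by (simp add: assoc_mult_mat[of _ n n _ n _ n])
    then have "A $$ (b, j) = (\<Sum>l<n. (A * inv_mat Q) $$ (b, l) * Q $$ (l, j))" if "b < n" for b
      using that j A Q mult_mat_index[of "A * inv_mat Q" Q b j] by (simp del: index_mult_mat(1))
    then have "(\<Sum>b<n. q b * A $$ (b, j)) = (\<Sum>b<n. \<Sum>l<n. q b * (A * inv_mat Q) $$ (b, l) * Q $$ (l, j))"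
      by (simp add: sum_distrib_left mult.assoc)
    also have "\<dots> = (\<Sum>l<n. (\<Sum>b<n. q b * (A * inv_mat Q) $$ (b, l)) * Q $$ (l, j))"
      by (subst sum.swap) (simp add: sum_distrib_right)
    also have "\<dots> = 0"
      using assms(1)[OF stepX_AO[OF AO A]] A Q by (simp del: index_mult_mat(1))
    finally show ?thesis .
  qed
  \<comment> \<open>The entry is 2 in the only case used, \<sigma> = 1; the matrix is then a
    multiple of a diagonal matrix unit.\<close>
  define E where "E \<sigma> = mat n n (\<lambda>(b, j). if b = a \<and> j = a then 1 + \<sigma> else 0 :: complex)" for \<sigma>
  have "(\<Sum>b<n. q b * E 1 $$ (b, a)) = 0"
    by (rule z[of _ 1]) (auto simp: E_def \<open>a < n\<close> intro!: eq_matI)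
  moreover have "(\<Sum>b<n. q b * E 1 $$ (b, a)) = (\<Sum>b<n. (q b * 2) * (if b = a then 1 else 0))"
    by (rule sum.cong) (auto simp: E_def \<open>a < n\<close>)
  ultimately show ?thesis using \<open>a < n\<close> by (simp add: sum_delta_right)
qed

end

subsection \<open>Words in the fundamental corepresentations\<close>

fun idx :: "factor list \<Rightarrow> nat list \<Rightarrow> nat list set" where
  "idx fs [] = {[]}"
| "idx fs (k # t) = (\<lambda>(i, I). i # I) ` ({..<fdim fs k} \<times> idx fs t)"

fun wmat :: "nat list \<Rightarrow> nat list \<Rightarrow> nat list \<Rightarrow> falg" where
  "wmat (k # t) (i # I) (j # J) = gx k False i j * wmat t I J"
| "wmat _ _ _ = 1"

fun pmat :: "complex mat list \<Rightarrow> nat list \<Rightarrow> nat list \<Rightarrow> complex" where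
  "pmat (X # Xs) (i # I) (j # J) = X $$ (i, j) * pmat Xs I J"
| "pmat _ _ _ = 1"

lemma finite_idx [simp]: "finite (idx fs t)"
  by (induction t) auto

lemma Cons_in_idx [simp]: "i # I \<in> idx fs (k # t) \<longleftrightarrow> i < fdim fs k \<and> I \<in> idx fs t"
  by auto

lemma sum_idx_Cons: "(\<Sum>I\<in>idx fs (k # t). f I) = (\<Sum>i<fdim fs k. \<Sum>I\<in>idx fs t. f (i # I))"
proof -
  have "inj_on (\<lambda>(i, I). i # I) ({..<fdim fs k} \<times> idx fs t)" by (auto simp: inj_on_def)
  then show ?thesis
    by (simp add: idx.simps(2) sum.reindex sum.cartesian_product case_prod_unfold)
qed

lemma idx_ConsE:
  assumes "I \<in> idx fs (k # t)"
  obtains i I' where "I = i # I'" "i < fdim fs k" "I' \<in> idx fs t"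
  using assms by auto

lemma length_idx: "I \<in> idx fs t \<Longrightarrow> length I = length t"
  by (induction t arbitrary: I) auto

declare idx.simps(2) [simp del]

text \<open>A letter raises the index of a basis vector by at most one, so a word climbs at most its
  length.\<close>

lemma rep_wmat_zero:
  assumes "\<And>k s i j. \<exists>D L. f k s i j = bidiag D L" "I \<in> idx fs t" "J \<in> idx fs t" "p + length t < q" "q < d" "p < d"
  shows "rep d (gen_fun f) (wmat t I J) q p = 0"
  using assms(2-)
proof (induction t arbitrary: I J q)
  case Nil
  then show ?case by (simp add: rep_1)
next
  case (Cons k t)
  obtain i I' j J' where IJ: "I = i # I'" "J = j # J'" "I' \<in> idx fs t" "J' \<in> idx fs t"
    using Cons.prems(1,2) by (meson idx_ConsE)
  obtain D L where f: "f k False i j = bidiag D L" using assms(1) by blast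
  have "rep d (gen_fun f) (gx k False i j) q r * rep d (gen_fun f) (wmat t I' J') r p = 0" if "r < d" for r
  proof (cases "p + length t < r")
    case True
    then show ?thesis using Cons.IH[OF IJ(3,4)] that Cons.prems by simp
  next
    case False
    then show ?thesis using that Cons.prems by (simp add: rep_gx f bidiag_def)
  qed
  then have "(\<Sum>r<d. rep d (gen_fun f) (gx k False i j) q r * rep d (gen_fun f) (wmat t I' J') r p) = 0"
    by (intro sum.neutral) blast
  then show ?case using Cons.prems by (simp add: IJ rep_mult)
qed

definition kills :: "factor list \<Rightarrow> (falg \<Rightarrow> complex) \<Rightarrow> bool"
  where "kills fs f \<longleftrightarrow> linearF (*) f \<and> (\<forall>x\<in>rel_ideal fs. f x = 0)"

lemma deriv_0:
  assumes "k < length fs"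
  shows "deriv fs k g' g (\<lambda>s i j. 0)"
  by (cases "fs ! k") (simp_all add: deriv_def Let_def)

text \<open>In the representation on \<open>\<complex>\<^bsup>n+1\<^esup>\<close> where the factor \<open>t ! (n - 1 - p)\<close> maps the basis vector \<open>p\<close> to
  \<open>p + 1\<close>, only words of length at least \<open>n\<close> can move \<open>0\<close> to \<open>n\<close>.\<close>

lemma word_functional:
  assumes valid: "\<And>k. k < length fs \<Longrightarrow> valid_factor (fs ! k)"
    and t: "set t \<subseteq> {..<length fs}" "\<And>i. Suc i < length t \<Longrightarrow> t ! i \<noteq> t ! Suc i"
    and Xs: "length Xs = length t" "\<And>i. i < length t \<Longrightarrow> stepX fs (t ! i) (fdim fs (t ! i)) (Xs ! i)"
  shows "\<exists>f. kills fs f \<and> (\<forall>I\<in>idx fs t. \<forall>J\<in>idx fs t. f (wmat t I J) = pmat Xs I J) \<and>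
    (\<forall>t' I J. length t' < length t \<longrightarrow> I \<in> idx fs t' \<longrightarrow> J \<in> idx fs t' \<longrightarrow> f (wmat t' I J) = 0)"
proof -
  define n where "n = length t"
  have tk: "t ! i < length fs" if "i < n" for i using t(1) that unfolding n_def by (auto simp: subset_iff)
  have "\<forall>m. \<exists>g X. m < n \<longrightarrow> charac fs (t ! m) g \<and> deriv fs (t ! m) (\<lambda>s i j. if i = j then 1 else 0) g X \<and>
    (\<forall>i<fdim fs (t ! m). \<forall>j<fdim fs (t ! m). X False i j = Xs ! m $$ (i, j))"
    using Xs(2) tk valid unfolding n_def by (auto simp: stepX_def)
  then obtain g X where gX: "\<And>m. m < n \<Longrightarrow> charac fs (t ! m) (g m)"
    "\<And>m. m < n \<Longrightarrow> deriv fs (t ! m) (\<lambda>s i j. if i = j then 1 else 0) (g m) (X m)"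
    "\<And>m i j. m < n \<Longrightarrow> i < fdim fs (t ! m) \<Longrightarrow> j < fdim fs (t ! m) \<Longrightarrow> X m False i j = Xs ! m $$ (i, j)"
    by metis
  \<comment> \<open>The rightmost letter acts first, hence the reversed position: the step from p to
    p + 1 belongs to letter n - 1 - p.\<close>
  define on where "on k p \<longleftrightarrow> p < n \<and> t ! (n - 1 - p) = k" for k p
  define D where "D k s i j p = (if on k p then g (n - 1 - p) s i j else if i = j then 1 else 0)" for k s i j p
  define L where "L k s i j p = (if on k p then X (n - 1 - p) s i j else 0)" for k s i j p
  define f where "f k s i j = (if i < fdim fs k \<and> j < fdim fs k then bidiag (D k s i j) (L k s i j) else (\<lambda>q p. 0))" for k s i j
  \<comment> \<open>Neighbouring letters come from different factors, so no factor is responsible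
    for two consecutive steps. This is what \<open>band_relations\<close> asks for.\<close>
  have onon: "\<not> (on k p \<and> on k (Suc p))" for k p
  proof
    assume *: "on k p \<and> on k (Suc p)"
    then have "t ! (n - 1 - Suc p) \<noteq> t ! Suc (n - 1 - Suc p)" by (intro t(2)) (auto simp: on_def n_def)
    moreover have "Suc (n - 1 - Suc p) = n - 1 - p" using * by (auto simp: on_def)
    ultimately show False using * by (simp add: on_def)
  qed
  let ?r = "rep (Suc n) (gen_fun f)"
  have kill: "?r x q p = 0" if "x \<in> rel_ideal fs" "q < Suc n" "p < Suc n" for x q p
  proof (rule band_relations[OF valid _ _ _ f_def that])
    fix k p assume k: "k < length fs"
    show "charac fs k (\<lambda>s i j. D k s i j p)"
    proof (cases "on k p")
      case True
      then have "charac fs k (g (n - 1 - p))" using gX(1)[of "n - 1 - p"] by (auto simp: on_def)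
      with True show ?thesis by (simp add: D_def)
    qed (simp add: D_def charac_triv[OF k valid[OF k]])
    show "deriv fs k (\<lambda>s i j. D k s i j (Suc p)) (\<lambda>s i j. D k s i j p) (\<lambda>s i j. L k s i j p)"
    proof (cases "on k p")
      case True
      then have "\<not> on k (Suc p)" using onon by blast
      moreover have "deriv fs k (\<lambda>s i j. if i = j then 1 else 0) (g (n - 1 - p)) (X (n - 1 - p))"
        using True gX(2)[of "n - 1 - p"] by (auto simp: on_def)
      ultimately show ?thesis using True by (simp add: D_def L_def)
    qed (simp add: L_def deriv_0[OF k])
    show "L k s i j (Suc p) * L k s' i' j' p = 0" for s i j s' i' j'
      using onon[of k p] by (auto simp: L_def)
  qed
  have bd: "\<exists>D L. f k s i j = bidiag D L" for k s i j
    by (cases "i < fdim fs k \<and> j < fdim fs k") (auto simp: f_def bidiag_def fun_eq_iff)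
  have main: "?r (wmat (drop m t) I J) (n - m) 0 = pmat (drop m Xs) I J"
    if "m \<le> n" "I \<in> idx fs (drop m t)" "J \<in> idx fs (drop m t)" for m I J
    using that
  proof (induction "n - m" arbitrary: m I J)
    case 0
    then show ?case using Xs(1) by (simp add: n_def rep_1)
  next
    case (Suc l)
    then have m: "m < n" by simp
    have d: "drop m t = t ! m # drop (Suc m) t" "drop m Xs = Xs ! m # drop (Suc m) Xs"
      using m Xs(1) by (simp_all add: n_def Cons_nth_drop_Suc)
    obtain i I' j J' where IJ: "I = i # I'" "J = j # J'" "i < fdim fs (t ! m)" "j < fdim fs (t ! m)"
      "I' \<in> idx fs (drop (Suc m) t)" "J' \<in> idx fs (drop (Suc m) t)"
      using Suc.prems(2,3) unfolding d by (meson idx_ConsE)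
    let ?w = "wmat (drop (Suc m) t) I' J'"
    have on: "on (t ! m) (n - Suc m)" using m by (auto simp: on_def)
    \<comment> \<open>The n - m - 1 letters that remain cannot climb n - m steps. This removes the
      diagonal term, and the letter at position m is forced to make its step.\<close>
    have z: "?r ?w (n - m) 0 = 0"
      by (rule rep_wmat_zero[OF bd IJ(5,6)]) (use m in \<open>auto simp: n_def\<close>)
    have "?r (gx (t ! m) False i j * ?w) (n - m) 0 = (\<Sum>r<Suc n. f (t ! m) False i j (n - m) r * ?r ?w r 0)"
      by (simp add: rep_mult rep_gx)
    also have "\<dots> = (\<Sum>r\<in>{n - m, n - Suc m}. f (t ! m) False i j (n - m) r * ?r ?w r 0)"
      by (rule sum.mono_neutral_right) (use m in \<open>auto simp: f_def bidiag_def\<close>)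
    also have "\<dots> = f (t ! m) False i j (n - m) (n - Suc m) * ?r ?w (n - Suc m) 0"
      using m z by (simp add: insert_absorb)
    also have "f (t ! m) False i j (n - m) (n - Suc m) = Xs ! m $$ (i, j)"
    proof -
      have "n - m = Suc (n - Suc m)" "n - 1 - (n - Suc m) = m" using m by auto
      with on IJ gX(3)[OF m] show ?thesis by (simp add: f_def bidiag_def L_def)
    qed
    also have "?r ?w (n - Suc m) 0 = pmat (drop (Suc m) Xs) I' J'"
      using Suc m IJ by (intro Suc.hyps(1)) auto
    finally show ?case by (simp add: d IJ)
  qed
  have "kills fs (\<lambda>x. ?r x n 0)" by (simp add: kills_def linearF_rep kill)
  moreover have "?r (wmat t I J) n 0 = pmat Xs I J" if "I \<in> idx fs t" "J \<in> idx fs t" for I J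
    using main[of 0 I J] that by simp
  moreover have "?r (wmat t' I J) n 0 = 0" if "length t' < length t" "I \<in> idx fs t'" "J \<in> idx fs t'" for t' I J
    by (rule rep_wmat_zero[OF bd that(2,3)]) (use that in \<open>auto simp: n_def\<close>)
  ultimately show ?thesis by blast
qed

text \<open>Separation passes from single factors to tensor products: with all legs but the first
  kept fixed, \<open>stepX_separating\<close> applies to the first leg, and the rest is an induction
  on the word.\<close>

lemma pmat_separating:
  assumes valid: "\<And>k. k < length fs \<Longrightarrow> valid_factor (fs ! k)"
    and t: "set t \<subseteq> {..<length fs}"
    and z: "\<And>Xs J. length Xs = length t \<Longrightarrow> (\<And>i. i < length t \<Longrightarrow> stepX fs (t ! i) (fdim fs (t ! i)) (Xs ! i)) \<Longrightarrow>
      J \<in> idx fs t \<Longrightarrow> (\<Sum>P\<in>idx fs t. F P * pmat Xs P J) = 0"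
    and P: "P \<in> idx fs t"
  shows "F P = 0"
  using t z P
proof (induction t arbitrary: F P)
  case Nil
  from Nil(2)[of "[]" "[]"] Nil(3) show ?case by simp
next
  case (Cons k t)
  obtain a P' where P: "P = a # P'" "a < fdim fs k" "P' \<in> idx fs t" using Cons.prems(3) by (rule idx_ConsE)
  have k: "k < length fs" using Cons.prems(1) by simp
  have "F (a # P') = 0"
  proof (rule Cons.IH[where F = "\<lambda>P'. F (a # P')"])
    fix Xs J assume *: "length Xs = length t" "\<And>i. i < length t \<Longrightarrow> stepX fs (t ! i) (fdim fs (t ! i)) (Xs ! i)" "J \<in> idx fs t"
    show "(\<Sum>P\<in>idx fs t. F (a # P) * pmat Xs P J) = 0"
    proof (rule stepX_separating[OF k valid[OF k] refl, where q = "\<lambda>a. \<Sum>P\<in>idx fs t. F (a # P) * pmat Xs P J"])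
      fix X j assume X: "stepX fs k (fdim fs k) X" "j < fdim fs k"
      have "(\<Sum>P\<in>idx fs (k # t). F P * pmat (X # Xs) P (j # J)) = 0"
      proof (rule Cons.prems(2))
        show "stepX fs ((k # t) ! i) (fdim fs ((k # t) ! i)) ((X # Xs) ! i)" if "i < length (k # t)" for i
          using that X * by (cases i) auto
      qed (use X * in auto)
      then have "(\<Sum>a<fdim fs k. \<Sum>P\<in>idx fs t. F (a # P) * (X $$ (a, j) * pmat Xs P J)) = 0"
        by (simp only: sum_idx_Cons pmat.simps)
      moreover have "(\<Sum>a<fdim fs k. \<Sum>P\<in>idx fs t. F (a # P) * (X $$ (a, j) * pmat Xs P J)) =
          (\<Sum>a<fdim fs k. (\<Sum>P\<in>idx fs t. F (a # P) * pmat Xs P J) * X $$ (a, j))"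
        unfolding sum_distrib_right by (intro sum.cong refl) simp
      ultimately show "(\<Sum>a<fdim fs k. (\<Sum>P\<in>idx fs t. F (a # P) * pmat Xs P J) * X $$ (a, j)) = 0"
        by simp
    qed (rule P)
  qed (use Cons.prems P in auto)
  then show ?case by (simp add: P)
qed

text \<open>This is the linear independence of the u_ij in \<S>: they can be given arbitrary values
  by a functional. Words of length one realise every admissible matrix, and sums of admissible
  matrices exhaust all matrices.\<close>

lemma gen_functional:
  assumes valid: "\<And>k. k < length fs \<Longrightarrow> valid_factor (fs ! k)" and k: "k < length fs"
  shows "\<exists>f. kills fs f \<and> (\<forall>i<fdim fs k. \<forall>j<fdim fs k. f (gx k False i j) = Y i j)"
proof -
  let ?n = "fdim fs k"
  have one: "\<exists>f. kills fs f \<and> (\<forall>i<?n. \<forall>j<?n. f (gx k False i j) = X $$ (i, j))" if "stepX fs k ?n X" for X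
  proof -
    have "\<exists>f. kills fs f \<and> (\<forall>I\<in>idx fs [k]. \<forall>J\<in>idx fs [k]. f (wmat [k] I J) = pmat [X] I J) \<and>
      (\<forall>t' I J. length t' < length [k] \<longrightarrow> I \<in> idx fs t' \<longrightarrow> J \<in> idx fs t' \<longrightarrow> f (wmat t' I J) = 0)"
      by (rule word_functional[OF valid]) (use that k in auto)
    then obtain f where f: "kills fs f" "\<forall>I\<in>idx fs [k]. \<forall>J\<in>idx fs [k]. f (wmat [k] I J) = pmat [X] I J" by blast
    have "f (gx k False i j) = X $$ (i, j)" if "i < ?n" "j < ?n" for i j
      using f(2)[rule_format, of "[i]" "[j]"] that by simp
    with f(1) show ?thesis by blast
  qed
  define Ym where "Ym = mat ?n ?n (\<lambda>(i, j). Y i j)"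
  have Ym: "Ym \<in> carrier_mat ?n ?n" by (simp add: Ym_def)
  show ?thesis
  proof (cases "fs ! k")
    case (AU Q)
    from one[OF stepX_AU[OF k valid[OF k] refl AU Ym]] show ?thesis by (auto simp: Ym_def)
  next
    case (AO Q)
    have Q: "Q \<in> carrier_mat ?n ?n" "inv_mat Q \<in> carrier_mat ?n ?n" "Q * inv_mat Q = 1\<^sub>m ?n"
      using valid_fmat[OF k valid[OF k]] invertible_inv_mat[OF valid_fmat(2,1)[OF k valid[OF k]]] AO by auto
    \<comment> \<open>An \<open>AO\<close> block has the form A times the inverse of Q with A
      symmetric or antisymmetric, so \<open>Ym * Q\<close> is split into its two symmetry
      types.\<close>
    define B where "B = Ym * Q"
    define A where "A \<sigma> = (1 / 2) \<cdot>\<^sub>m (B + \<sigma> \<cdot>\<^sub>m transpose_mat B)" for \<sigma> :: complex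
    have Bc: "B \<in> carrier_mat ?n ?n" using Ym Q by (auto simp: B_def)
    then have A: "A \<sigma> \<in> carrier_mat ?n ?n" for \<sigma> by (simp add: A_def)
    have "transpose_mat (A \<sigma>) = \<sigma> \<cdot>\<^sub>m A \<sigma>" if "\<sigma> = 1 \<or> \<sigma> = - 1" for \<sigma>
      by (rule eq_matI) (use Bc that in \<open>auto simp: A_def\<close>)
    then have st: "stepX fs k ?n (A \<sigma> * inv_mat Q)" if "\<sigma> = 1 \<or> \<sigma> = - 1" for \<sigma>
      using that by (intro stepX_AO[OF k valid[OF k] refl AO A])
    have AB: "A 1 + A (- 1) = B" by (rule eq_matI) (use Bc in \<open>auto simp: A_def field_simps\<close>)
    have "A 1 * inv_mat Q + A (- 1) * inv_mat Q = B * inv_mat Q"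
      using add_mult_distrib_mat[OF A A Q(2), of 1 "- 1"] unfolding AB by simp
    also have "\<dots> = Ym"
      unfolding B_def assoc_mult_mat[OF Ym Q(1,2)] Q(3) using Ym by simp
    finally have "A 1 * inv_mat Q + A (- 1) * inv_mat Q = Ym" .
    moreover have "A (- 1) * inv_mat Q \<in> carrier_mat ?n ?n" by (rule mult_carrier_mat[OF A Q(2)])
    ultimately have Y: "(A 1 * inv_mat Q) $$ (i, j) + (A (- 1) * inv_mat Q) $$ (i, j) = Y i j" if "i < ?n" "j < ?n" for i j
      using that carrier_matD[OF A] carrier_matD[OF Q(2)]
        index_add_mat(1)[of i "A (- 1) * inv_mat Q" j "A 1 * inv_mat Q"]
      by (simp add: Ym_def del: index_mult_mat(1) index_add_mat(1))
    have s1: "\<exists>f. kills fs f \<and> (\<forall>i<?n. \<forall>j<?n. f (gx k False i j) = (A 1 * inv_mat Q) $$ (i, j))"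
      and s2: "\<exists>f. kills fs f \<and> (\<forall>i<?n. \<forall>j<?n. f (gx k False i j) = (A (- 1) * inv_mat Q) $$ (i, j))"
      by (rule one[OF st], simp)+
    from s1 obtain f1 where f1: "kills fs f1" "\<forall>i<?n. \<forall>j<?n. f1 (gx k False i j) = (A 1 * inv_mat Q) $$ (i, j)"
      by (elim exE conjE)
    from s2 obtain f2 where f2: "kills fs f2" "\<forall>i<?n. \<forall>j<?n. f2 (gx k False i j) = (A (- 1) * inv_mat Q) $$ (i, j)"
      by (elim exE conjE)
    have "kills fs (\<lambda>x. f1 x + f2 x)" using f1(1) f2(1) by (auto simp: kills_def linearF_def distrib_left)
    moreover have "f1 (gx k False i j) + f2 (gx k False i j) = Y i j" if "i < ?n" "j < ?n" for i j
      by (simp only: f1(2)[rule_format, OF that] f2(2)[rule_format, OF that] Y[OF that])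
    ultimately show ?thesis by (intro exI[of _ "\<lambda>x. f1 x + f2 x"] conjI) simp_all
  qed
qed

text \<open>Each \<open>AU\<close> relation pairs an entry of u with an adjoint, and the opposite
  weights cancel; c need not have modulus one. An \<open>AO\<close> relation equates entries of u
  with adjoints, for which the weight -1, being its own inverse, is suitable.\<close>

lemma charac_scaled:
  assumes g: "charac fs k g" and c: "c \<noteq> 0" "\<And>Q. fs ! k = AO Q \<Longrightarrow> c = - 1"
  shows "charac fs k (\<lambda>s i j. (if s then 1 / c else c) * g s i j)"
proof -
  let ?n = "fdim fs k"
  have sc: "a * (1 / c * x * (c * y)) = a * (x * y)" "a * (c * x * (1 / c * y)) = a * (x * y)"
    "1 / c * x * (c * y) = x * y" "c * x * (1 / c * y) = x * y" for a x y using c by simp_all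
  show ?thesis
  proof (cases "fs ! k")
    case (AU Q)
    with g show ?thesis
      by (simp only: charac_def Let_def if_True if_False AU sc factor.case)
  next
    case (AO Q)
    have 1: "(if s then 1 / c else c) = - 1" for s using c(2)[OF AO] by simp
    have "- 1 * g False i j = (\<Sum>a<?n. \<Sum>b<?n. Q $$ (i, a) * inv_mat Q $$ (b, j) * (- 1 * g True a b))"
      "- 1 * g True i j = (\<Sum>a<?n. \<Sum>b<?n. cnj (Q $$ (i, a) * inv_mat Q $$ (b, j)) * (- 1 * g False a b))"
      if "i < ?n" "j < ?n" for i j
    proof -
      have e: "g False i j = (\<Sum>a<?n. \<Sum>b<?n. Q $$ (i, a) * inv_mat Q $$ (b, j) * g True a b)"
        "g True i j = (\<Sum>a<?n. \<Sum>b<?n. cnj (Q $$ (i, a) * inv_mat Q $$ (b, j)) * g False a b)"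
        using g[unfolded charac_def Let_def AO factor.case, rule_format, OF that] by blast+
      show "- 1 * g False i j = (\<Sum>a<?n. \<Sum>b<?n. Q $$ (i, a) * inv_mat Q $$ (b, j) * (- 1 * g True a b))"
        by (subst e(1)) (simp add: sum_negf)
      show "- 1 * g True i j = (\<Sum>a<?n. \<Sum>b<?n. cnj (Q $$ (i, a) * inv_mat Q $$ (b, j)) * (- 1 * g False a b))"
        by (subst e(2)) (simp add: sum_negf)
    qed
    moreover have "(\<Sum>l<?n. - 1 * g False i l * (- 1 * g True j l)) = (if i = j then 1 else 0)"
      "(\<Sum>l<?n. - 1 * g True l i * (- 1 * g False l j)) = (if i = j then 1 else 0)" if "i < ?n" "j < ?n" for i j
      using g that by (simp_all add: charac_def Let_def)
    ultimately show ?thesis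
      unfolding charac_def Let_def AO factor.case 1 by blast
  qed
qed

lemma scaling_character:
  assumes valid: "\<And>k. k < length fs \<Longrightarrow> valid_factor (fs ! k)"
    and c: "c \<noteq> 0" "\<And>Q. fs ! k = AO Q \<Longrightarrow> c = - 1"
  shows "\<exists>\<chi>. kills fs \<chi> \<and> \<chi> 1 = 1 \<and> (\<forall>x y. \<chi> (x * y) = \<chi> x * \<chi> y) \<and>
    (\<forall>k' s i j. i < fdim fs k' \<longrightarrow> j < fdim fs k' \<longrightarrow> \<chi> (gx k' s i j) =
      (if i = j then if k' = k then if s then 1 / c else c else 1 else 0))"
proof -
  define D where "D k' s i j (p::nat) = (if k' = k then if s then 1 / c else c else 1) * (if i = j then 1 else 0)"
    for k' s and i j :: nat and p
  define f where "f k' s i j = (if i < fdim fs k' \<and> j < fdim fs k' then bidiag (D k' s i j) (\<lambda>p. 0) else (\<lambda>q p. 0))" for k' s i j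
  let ?r = "\<lambda>x. rep 1 (gen_fun f) x 0 0"
  have "?r x = 0" if "x \<in> rel_ideal fs" for x
  proof (rule band_relations[OF valid _ _ _ f_def that])
    fix k' p assume k': "k' < length fs"
    let ?n = "fdim fs k'" and ?\<delta> = "\<lambda>(s::bool) (i::nat) (j::nat). if i = j then 1 else 0 :: complex"
    have triv: "charac fs k' ?\<delta>" by (rule charac_triv[OF k' valid[OF k']])
    show "charac fs k' (\<lambda>s i j. D k' s i j p)"
    proof (cases "k' = k")
      case False
      with triv show ?thesis by (simp add: D_def)
    next
      case True
      show ?thesis using charac_scaled[OF triv c(1)] c(2) by (simp add: D_def True)
    qed
    show "deriv fs k' (\<lambda>s i j. D k' s i j (Suc p)) (\<lambda>s i j. D k' s i j p) (\<lambda>s i j. 0)" by (rule deriv_0[OF k'])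
  qed auto
  then have "kills fs ?r" by (simp add: kills_def linearF_rep)
  moreover have "?r (gx k' s i j) = (if i = j then if k' = k then if s then 1 / c else c else 1 else 0)"
    if "i < fdim fs k'" "j < fdim fs k'" for k' s i j
    using that by (simp add: rep_gx f_def bidiag_def D_def)
  ultimately show ?thesis by (intro exI[of _ ?r]) (simp add: rep_mult rep_1)
qed

section \<open>Diagonalisation of the modular matrices\<close>

abbreviation dmat :: "nat \<Rightarrow> (nat \<Rightarrow> complex) \<Rightarrow> complex mat"
  where "dmat n d \<equiv> mat n n (\<lambda>(i, j). if i = j then d i else 0)"

lemma corthogonal_basis_exists:
  fixes v :: "complex vec"
  assumes v: "v \<in> carrier_vec n" "v \<noteq> 0\<^sub>v n"
  shows "\<exists>ws. set ws \<subseteq> carrier_vec n \<and> length ws = n \<and> corthogonal ws \<and> hd ws = v"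
proof -
  interpret cof_vec_space n "TYPE(complex)" .
  define b where "b = basis_completion v"
  note bc = basis_completion[OF v, folded b_def]
  define ws where "ws = gram_schmidt n b"
  note gs = gram_schmidt_result[OF bc(2,4,5) refl, folded ws_def]
  have "n > 0" using v by (cases n) auto
  then have "b = v # tl b" using bc(6,7) by (cases b) auto
  then have "hd ws = v" using gram_schmidt_hd[OF v(1), of "tl b"] by (simp add: ws_def)
  with gs bc(6) show ?thesis by auto
qed

lemma unitary_first_column:
  fixes v :: "complex vec"
  assumes v: "v \<in> carrier_vec n" "v \<noteq> 0\<^sub>v n"
  shows "\<exists>W r. W \<in> carrier_mat n n \<and> adjC W * W = 1\<^sub>m n \<and> W * adjC W = 1\<^sub>m n \<and> r \<noteq> 0 \<and> col W 0 = r \<cdot>\<^sub>v v"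
proof -
  obtain ws where ws: "set ws \<subseteq> carrier_vec n" "length ws = n" "corthogonal ws" "hd ws = v"
    using corthogonal_basis_exists[OF v] by blast
  have n: "n > 0" using v by (cases n) auto
  have wc: "ws ! i \<in> carrier_vec n" if "i < n" for i using ws that by auto
  have ip: "ws ! j \<bullet>c ws ! i = (\<Sum>l<n. ws ! j $ l * cnj (ws ! i $ l))" if "i < n" "j < n" for i j
    using wc[OF that(1)] by (simp add: scalar_prod_def atLeast0LessThan)
  define s where "s i = (\<Sum>l<n. (cmod (ws ! i $ l))\<^sup>2)" for i
  have ss: "ws ! i \<bullet>c ws ! i = complex_of_real (s i)" if "i < n" for i
    using that by (simp only: ip s_def complex_norm_square of_real_sum)
  have s0: "s i > 0" if "i < n" for i
  proof -
    have "ws ! i \<bullet>c ws ! i \<noteq> 0" using ws(2,3) that by (auto simp: corthogonal_def)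
    then have "s i \<noteq> 0" using ss[OF that] by auto
    moreover have "s i \<ge> 0" by (simp add: s_def sum_nonneg)
    ultimately show ?thesis by simp
  qed
  define W where "W = mat n n (\<lambda>(i, j). ws ! j $ i / complex_of_real (sqrt (s j)))"
  have W: "W \<in> carrier_mat n n" by (simp add: W_def)
  have 1: "adjC W * W = 1\<^sub>m n"
  proof (rule eq_matI)
    fix i j assume ij: "i < dim_row (1\<^sub>m n :: complex mat)" "j < dim_col (1\<^sub>m n :: complex mat)"
    then have ij': "i < n" "j < n" by auto
    have "(adjC W * W) $$ (i, j) = (\<Sum>l<n. cnj (W $$ (l, i)) * W $$ (l, j))"
      using ij' W by (subst mult_mat_index) auto
    also have "\<dots> = (\<Sum>l<n. ws ! j $ l * cnj (ws ! i $ l)) / (complex_of_real (sqrt (s i)) * complex_of_real (sqrt (s j)))"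
      using ij' by (simp add: W_def sum_divide_distrib mult.commute)
    also have "\<dots> = (if i = j then 1 else 0)"
    proof (cases "i = j")
      case True
      have "complex_of_real (sqrt (s j)) * complex_of_real (sqrt (s j)) = complex_of_real (s j)"
        using s0[OF ij'(2)] by (simp flip: of_real_mult)
      with True s0[OF ij'(2)] show ?thesis by (simp add: ss[OF ij'(2)] flip: ip[OF ij'(2,2)])
    next
      case False
      then have "ws ! j \<bullet>c ws ! i = 0" using ws(2,3) ij' by (auto simp: corthogonal_def)
      with False show ?thesis by (simp flip: ip[OF ij'])
    qed
    finally show "(adjC W * W) $$ (i, j) = 1\<^sub>m n $$ (i, j)" using ij' by simp
  qed (use W in auto)
  have aW: "adjC W \<in> carrier_mat n n" using W by simp
  have 2: "W * adjC W = 1\<^sub>m n" by (rule mat_mult_left_right_inverse[OF aW W 1])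
  have "ws ! 0 = v" using ws(2,4) n by (cases ws) auto
  then have "col W 0 = complex_of_real (1 / sqrt (s 0)) \<cdot>\<^sub>v v"
    using n v by (intro eq_vecI) (auto simp: W_def)
  moreover have "complex_of_real (1 / sqrt (s 0)) \<noteq> 0" using s0[OF n] by simp
  ultimately show ?thesis using W 1 2 by blast
qed

lemma adjC_carrier: "A \<in> carrier_mat n m \<Longrightarrow> adjC A \<in> carrier_mat m n" by auto

lemma adjC_adjC: "adjC (adjC A) = A" by (intro eq_matI) auto

text \<open>Spectral theorem by deflation: conjugation with a unitary whose first column is an
  eigenvector makes the first column a multiple of the first basis vector; self-adjointness does the
  same for the first row, and the induction hypothesis diagonalises the remaining block.\<close>

theorem hermitian_diag:
  assumes "A \<in> carrier_mat n n" "adjC A = A"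
  shows "\<exists>S d. S \<in> carrier_mat n n \<and> adjC S * S = 1\<^sub>m n \<and> S * adjC S = 1\<^sub>m n \<and> A = S * dmat n d * adjC S"
  using assms
proof (induction n arbitrary: A)
  case 0
  then show ?case by (intro exI[of _ "1\<^sub>m 0"]) (auto intro!: eq_matI)
next
  case (Suc m)
  let ?n = "Suc m"
  note A = Suc.prems
  obtain e v where v: "v \<in> carrier_vec ?n" "v \<noteq> 0\<^sub>v ?n" "A *\<^sub>v v = e \<cdot>\<^sub>v v"
    using spectrum_non_empty[OF A(1)] A(1) by (auto simp: spectrum_def eigenvalue_def eigenvector_def)
  obtain W r where W: "W \<in> carrier_mat ?n ?n" "adjC W * W = 1\<^sub>m ?n" "W * adjC W = 1\<^sub>m ?n" and r: "r \<noteq> 0" "col W 0 = r \<cdot>\<^sub>v v"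
    using unitary_first_column[OF v(1,2)] by blast
  have aW: "adjC W \<in> carrier_mat ?n ?n" using W by simp
  define B where "B = adjC W * A * W"
  have B: "B \<in> carrier_mat ?n ?n" using W A by (simp add: B_def)
  note as = assoc_mult_mat[of _ ?n ?n _ ?n _ ?n] and mc = mult_carrier_mat[of _ ?n ?n _ ?n]
  have aB: "adjC B = B"
    unfolding B_def using W aW A
    by (simp only: adjC_mult[of _ ?n ?n _ ?n] mc as adjC_adjC)
  have AB: "A = W * B * adjC W"
  proof -
    have "W * B * adjC W = (W * adjC W) * A * (W * adjC W)"
      unfolding B_def using W(1) aW A(1) by (simp only: as mc)
    then show ?thesis using W A by simp
  qed
  have AW: "A * W \<in> carrier_mat ?n ?n" using A W by simp
  have "col B 0 = col (adjC W * (A * W)) 0"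
    unfolding B_def using W(1) aW A(1) by (simp only: as)
  also have "\<dots> = adjC W *\<^sub>v (A *\<^sub>v col W 0)"
    by (simp only: col_mult2[OF aW AW] col_mult2[OF A(1) W(1)] zero_less_Suc)
  also have "\<dots> = e \<cdot>\<^sub>v (adjC W *\<^sub>v col W 0)"
    unfolding r(2) using v A aW by (simp add: mult_mat_vec[of _ ?n ?n] smult_smult_assoc mult.commute)
  also have "adjC W *\<^sub>v col W 0 = col (adjC W * W) 0"
    by (simp only: col_mult2[OF aW W(1)] zero_less_Suc)
  finally have c0: "col B 0 = e \<cdot>\<^sub>v unit_vec ?n 0" using W(2) by simp
  have col0: "B $$ (i, 0) = (if i = 0 then e else 0)" if "i < ?n" for i
    using arg_cong[OF c0, of "\<lambda>v. v $ i"] that B by (auto simp: unit_vec_def)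
  have row0: "B $$ (0, j) = (if j = 0 then e else 0)" if "j < ?n" for j
  proof (cases "j = 0")
    case False
    have "B $$ (0, j) = cnj (B $$ (j, 0))"
      using arg_cong[OF aB, of "\<lambda>X. X $$ (0, j)"] that B by simp
    then show ?thesis using False col0[OF that] by simp
  qed (use col0 in simp)
  define C where "C = mat m m (\<lambda>(i, j). B $$ (Suc i, Suc j))"
  have C: "C \<in> carrier_mat m m" by (simp add: C_def)
  have "cnj (B $$ (Suc j, Suc i)) = B $$ (Suc i, Suc j)" if "i < m" "j < m" for i j
    using arg_cong[OF aB, of "\<lambda>X. X $$ (Suc i, Suc j)"] that B by simp
  then have "adjC C = C" by (intro eq_matI) (auto simp: C_def)
  from Suc.IH[OF C this] obtain S d where S: "S \<in> carrier_mat m m" "adjC S * S = 1\<^sub>m m" "S * adjC S = 1\<^sub>m m"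
    "C = S * dmat m d * adjC S" by blast
  let ?f = "\<lambda>a X. four_block_mat (a \<cdot>\<^sub>m 1\<^sub>m 1) (0\<^sub>m 1 m) (0\<^sub>m m 1) X :: complex mat"
  have f: "?f a X \<in> carrier_mat ?n ?n" if "X \<in> carrier_mat m m" for a X using that by auto
  have fm: "?f a X * ?f b Y = ?f (a * b) (X * Y)" if "X \<in> carrier_mat m m" "Y \<in> carrier_mat m m" for a b X Y
  proof -
    have c: "c \<cdot>\<^sub>m 1\<^sub>m 1 \<in> carrier_mat 1 1" for c :: complex by simp
    have "a \<cdot>\<^sub>m 1\<^sub>m 1 * (b \<cdot>\<^sub>m 1\<^sub>m 1) + 0\<^sub>m 1 m * 0\<^sub>m m 1 = (a * b) \<cdot>\<^sub>m (1\<^sub>m 1 :: complex mat)"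
      by (intro eq_matI) (auto simp: scalar_prod_def)
    moreover have "a \<cdot>\<^sub>m 1\<^sub>m 1 * 0\<^sub>m 1 m + 0\<^sub>m 1 m * Y = 0\<^sub>m 1 m" "0\<^sub>m m 1 * (b \<cdot>\<^sub>m 1\<^sub>m 1) + X * 0\<^sub>m m 1 = 0\<^sub>m m 1"
      "0\<^sub>m m 1 * 0\<^sub>m 1 m + X * Y = X * Y"
      using that by simp_all
    ultimately show ?thesis
      using mult_four_block_mat[OF c zero_carrier_mat zero_carrier_mat that(1) c zero_carrier_mat zero_carrier_mat that(2), of a b]
      by (simp only:)
  qed
  have fadj: "adjC (?f 1 X) = ?f 1 (adjC X)" if "X \<in> carrier_mat m m" for X
    using that by (intro eq_matI) auto
  have fone: "?f 1 (1\<^sub>m m) = 1\<^sub>m ?n" by (intro eq_matI) auto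
  have fd: "?f e (dmat m d) = dmat ?n (case_nat e d)" by (intro eq_matI) (auto split: nat.split)
  have fB: "B = ?f e C"
    using B col0 row0 by (intro eq_matI) (auto simp: C_def)
  have dm: "dmat m d \<in> carrier_mat m m" by simp
  have SC: "adjC S \<in> carrier_mat m m" using S by simp
  define T where "T = W * ?f 1 S"
  have T: "T \<in> carrier_mat ?n ?n" using W f[OF S(1)] by (simp add: T_def)
  have aT: "adjC T = ?f 1 (adjC S) * adjC W"
    unfolding T_def using adjC_mult[OF W(1) f[OF S(1)]] fadj[OF S(1)] by simp
  have "adjC T * T = ?f 1 (adjC S) * ((adjC W * W) * ?f 1 S)"
    unfolding aT unfolding T_def using W(1) aW f[OF S(1)] f[OF SC] by (simp only: as mc)
  also have "\<dots> = 1\<^sub>m ?n"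
    using S W f[OF S(1)] fm[OF SC S(1), of 1 1] fone by simp
  finally have 1: "adjC T * T = 1\<^sub>m ?n" .
  have 2: "T * adjC T = 1\<^sub>m ?n"
    using mat_mult_left_right_inverse[OF _ T 1] T by simp
  have "T * dmat ?n (case_nat e d) * adjC T = W * (?f 1 S * ?f e (dmat m d) * ?f 1 (adjC S)) * adjC W"
    unfolding aT unfolding T_def fd[symmetric] using W(1) aW f[OF S(1)] f[OF SC] f[OF dm] by (simp only: as mc)
  also have "?f 1 S * ?f e (dmat m d) * ?f 1 (adjC S) = ?f e C"
    by (simp only: fm[OF S(1) dm] fm[OF mult_carrier_mat[OF S(1) dm] SC] S(4) mult_1 mult_1_right)
  finally have "A = T * dmat ?n (case_nat e d) * adjC T" using AB fB by simp
  with T 1 2 show ?case by (intro exI[of _ T] exI[of _ "case_nat e d"] conjI)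
qed

lemma dmat_inv:
  assumes "\<And>i. i < n \<Longrightarrow> d i \<noteq> 0"
  shows "dmat n d * dmat n (\<lambda>i. inverse (d i)) = 1\<^sub>m n" "dmat n (\<lambda>i. inverse (d i)) * dmat n d = 1\<^sub>m n"
  using assms by (auto intro!: eq_matI simp: scalar_prod_def if_distrib[of "\<lambda>x. _ * x"] if_distrib[of "\<lambda>x. x * _"] cong: if_cong)

text \<open>The conjugate of S, not S, diagonalises \<open>qmat\<close>: this matrix stands next to
  the entrywise adjoint and the transpose of u, and both are conjugated by the transpose and the
  conjugate of S when u is replaced by its conjugate under S.\<close>

definition diag_basis :: "factor list \<Rightarrow> nat \<Rightarrow> complex mat \<Rightarrow> (nat \<Rightarrow> real) \<Rightarrow> bool"
  where "diag_basis fs k S \<mu> \<longleftrightarrow> (let n = fdim fs k in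
    S \<in> carrier_mat n n \<and> adjC S * S = 1\<^sub>m n \<and> S * adjC S = 1\<^sub>m n \<and> (\<forall>i<n. 0 < \<mu> i) \<and>
    qmat fs k = map_mat cnj S * dmat n (\<lambda>i. of_real (\<mu> i)) * transpose_mat S)"

text \<open>For a diagonalising unitary W the eigenvalues are the squared norms of the columns of
  QW, and they are nonzero since Q is invertible. The matrix S is the entrywise conjugate of
  W.\<close>

lemma diag_basis_exists:
  assumes "k < length fs" "valid_factor (fs ! k)"
  shows "\<exists>S \<mu>. diag_basis fs k S \<mu>"
proof -
  let ?n = "fdim fs k" let ?Q = "fmat (fs ! k)"
  note v = valid_fmat[OF assms] and vi = invertible_inv_mat[OF valid_fmat(2,1)[OF assms]]
  have q: "qmat fs k = adjC ?Q * ?Q" by (simp add: qmat_def)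
  have aQ: "adjC ?Q \<in> carrier_mat ?n ?n" by (rule adjC_carrier[OF v(1)])
  have qc: "qmat fs k \<in> carrier_mat ?n ?n" unfolding q by (rule mult_carrier_mat[OF aQ v(1)])
  have "adjC (qmat fs k) = qmat fs k"
    unfolding q adjC_mult[OF aQ v(1)] adjC_adjC ..
  from hermitian_diag[OF qc this] obtain W d where W: "W \<in> carrier_mat ?n ?n" "adjC W * W = 1\<^sub>m ?n" "W * adjC W = 1\<^sub>m ?n"
    and d: "qmat fs k = W * dmat ?n d * adjC W" by blast
  have aW: "adjC W \<in> carrier_mat ?n ?n" using W by simp
  have dc: "dmat ?n d \<in> carrier_mat ?n ?n" by simp
  note as = assoc_mult_mat[of _ ?n ?n _ ?n _ ?n] and mc = mult_carrier_mat[of _ ?n ?n _ ?n]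
  define X where "X = ?Q * W"
  have X: "X \<in> carrier_mat ?n ?n" using v W by (simp add: X_def)
  have aX: "adjC X = adjC W * adjC ?Q" unfolding X_def by (rule adjC_mult[OF v(1) W(1)])
  have "adjC X * X = adjC W * qmat fs k * W"
    unfolding aX unfolding X_def q using aW aQ v(1) W(1) by (simp only: as mc)
  also have "\<dots> = (adjC W * W) * dmat ?n d * (adjC W * W)"
    unfolding d using aW W(1) dc by (simp only: as mc)
  also have "\<dots> = dmat ?n d" using W dc by simp
  finally have XX: "adjC X * X = dmat ?n d" .
  have di: "d i = complex_of_real (\<Sum>l<?n. (cmod (X $$ (l, i)))\<^sup>2)" if "i < ?n" for i
  proof -
    have "d i = (adjC X * X) $$ (i, i)" using that by (simp add: XX)
    also have "\<dots> = (\<Sum>l<?n. cnj (X $$ (l, i)) * X $$ (l, i))"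
      using that X by (subst mult_mat_index) auto
    finally show ?thesis by (simp only: complex_norm_square of_real_sum mult.commute)
  qed
  define \<mu> where "\<mu> i = (\<Sum>l<?n. (cmod (X $$ (l, i)))\<^sup>2)" for i
  have dm: "dmat ?n d = dmat ?n (\<lambda>i. complex_of_real (\<mu> i))"
    by (intro eq_matI) (auto simp: di \<mu>_def)
  have \<mu>0: "0 < \<mu> i" if i: "i < ?n" for i
  proof (rule ccontr)
    assume "\<not> 0 < \<mu> i"
    moreover have "\<mu> i \<ge> 0" by (simp add: \<mu>_def sum_nonneg)
    ultimately have "\<mu> i = 0" by simp
    then have z: "X $$ (l, i) = 0" if "l < ?n" for l
      using that unfolding \<mu>_def by (subst (asm) sum_nonneg_eq_0_iff) auto
    have "adjC W * (inv_mat ?Q * X) = 1\<^sub>m ?n"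
      unfolding X_def using vi v W aW assoc_mult_mat[OF vi(1) v(1) W(1)] by simp
    then have "(adjC W * inv_mat ?Q) * X = 1\<^sub>m ?n" using vi v W aW X by (simp only: as)
    then have "1 = ((adjC W * inv_mat ?Q) * X) $$ (i, i)" using i by simp
    also have "\<dots> = (\<Sum>l<?n. (adjC W * inv_mat ?Q) $$ (i, l) * X $$ (l, i))"
      using i X vi aW by (subst mult_mat_index) auto
    also have "\<dots> = 0" using z by simp
    finally show False by simp
  qed
  define S where "S = map_mat cnj W"
  have s: "adjC S = transpose_mat W" "map_mat cnj S = W" "transpose_mat S = adjC W"
    unfolding S_def by (rule eq_matI; simp)+
  have Sc: "S \<in> carrier_mat ?n ?n" using W by (simp add: S_def)
  have "transpose_mat (adjC W * W) = transpose_mat W * S" "transpose_mat (W * adjC W) = S * transpose_mat W"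
    using W(1) unfolding S_def by (intro eq_matI; auto simp: mult_mat_index mult.commute simp del: index_mult_mat(1))+
  then have SW: "transpose_mat W * S = 1\<^sub>m ?n" "S * transpose_mat W = 1\<^sub>m ?n"
    unfolding W(2,3) transpose_one by (simp_all only:)
  have "diag_basis fs k S \<mu>"
    unfolding diag_basis_def Let_def s(1) unfolding s(2,3)
    by (intro conjI Sc SW allI impI \<mu>0 d[unfolded dm])
  then show ?thesis by blast
qed

text \<open>A unitary change of basis after which \<open>M = Q\<^sup>*Q\<close> becomes diagonal, with eigenvalues \<open>hmu\<close>.\<close>

definition hS :: "factor list \<Rightarrow> nat \<Rightarrow> complex mat"
  where "hS fs k = fst (SOME p. diag_basis fs k (fst p) (snd p))"

definition hmu :: "factor list \<Rightarrow> nat \<Rightarrow> nat \<Rightarrow> real"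
  where "hmu fs k = snd (SOME p. diag_basis fs k (fst p) (snd p))"

definition hmat :: "factor list \<Rightarrow> nat \<Rightarrow> falg mat"
  where "hmat fs k = cmat (adjC (hS fs k)) * gmat fs k False * cmat (hS fs k)"

definition hx :: "factor list \<Rightarrow> nat \<Rightarrow> bool \<Rightarrow> nat \<Rightarrow> nat \<Rightarrow> falg"
  where "hx fs k s i j = (if s then starF (hmat fs k $$ (i, j)) else hmat fs k $$ (i, j))"

lemma starF_hx [simp]: "starF (hx fs k s i j) = hx fs k (\<not> s) i j"
  by (simp add: hx_def)

lemma sum_single0: "(\<Sum>l\<in>A. Poly_Mapping.single k (f l)) = Poly_Mapping.single k (\<Sum>l\<in>A. f l)"
  by (induction A rule: infinite_finite_induct) (auto simp: single_add)

lemma tensF_contract: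
  fixes n :: nat
  assumes pq: "\<And>b c. b < n \<Longrightarrow> c < n \<Longrightarrow> (\<Sum>l<n. q b l * p c l) = (if b = c then 1 else 0)"
  shows "(\<Sum>l<n. tensF (\<Sum>b<n. scaleF (q b l) (A b)) (\<Sum>c<n. scaleF (p c l) (B c))) = (\<Sum>b<n. tensF (A b) (B b))"
proof -
  have "(\<Sum>l<n. tensF (\<Sum>b<n. scaleF (q b l) (A b)) (\<Sum>c<n. scaleF (p c l) (B c))) =
    (\<Sum>l<n. \<Sum>b<n. \<Sum>c<n. Poly_Mapping.single 0 (q b l * p c l) * tensF (A b) (B c))"
    by (intro sum.cong refl, simp only: tensF_sum_left tensF_sum_right tensF_scaleF, rule sum.swap)
  also have "\<dots> = (\<Sum>b<n. \<Sum>l<n. \<Sum>c<n. Poly_Mapping.single 0 (q b l * p c l) * tensF (A b) (B c))"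
    by (rule sum.swap)
  also have "\<dots> = (\<Sum>b<n. \<Sum>c<n. \<Sum>l<n. Poly_Mapping.single 0 (q b l * p c l) * tensF (A b) (B c))"
    by (intro sum.cong refl sum.swap)
  also have "\<dots> = (\<Sum>b<n. \<Sum>c<n. if b = c then tensF (A b) (B c) else 0)"
  proof (intro sum.cong refl)
    fix b c assume "b \<in> {..<n}" "c \<in> {..<n}"
    then have "(\<Sum>l<n. Poly_Mapping.single 0 (q b l * p c l)) = Poly_Mapping.single (0 :: gword \<times> gword) (if b = c then 1 else 0)"
      by (simp add: pq sum_single0)
    then show "(\<Sum>l<n. Poly_Mapping.single 0 (q b l * p c l) * tensF (A b) (B c)) = (if b = c then tensF (A b) (B c) else 0)"
      by (simp flip: sum_distrib_right)
  qed
  also have "\<dots> = (\<Sum>b<n. tensF (A b) (B b))" by (intro sum.cong refl) simp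
  finally show ?thesis .
qed

text \<open>Change of basis in a matrix coproduct: the two scalar matrices that meet at the
  contracted index are inverse to each other and cancel.\<close>

lemma tensF_sandwich:
  fixes n :: nat
  assumes H: "\<And>i j. i < n \<Longrightarrow> j < n \<Longrightarrow> H i j = (\<Sum>a<n. \<Sum>b<n. scaleF (p a i * q b j) (g a b))"
    and pq: "\<And>b c. b < n \<Longrightarrow> c < n \<Longrightarrow> (\<Sum>l<n. q b l * p c l) = (if b = c then 1 else 0)"
    and ij: "i < n" "j < n"
  shows "(\<Sum>l<n. tensF (H i l) (H l j)) = (\<Sum>a<n. \<Sum>d<n. Poly_Mapping.single 0 (p a i * q d j) * (\<Sum>b<n. tensF (g a b) (g b d)))"
proof -
  define A where "A b = (\<Sum>a<n. scaleF (p a i) (g a b))" for b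
  define B where "B c = (\<Sum>d<n. scaleF (q d j) (g c d))" for c
  have 1: "H i l = (\<Sum>b<n. scaleF (q b l) (A b))" if "l < n" for l
    unfolding H[OF ij(1) that] A_def F.scale_sum_right
    by (subst sum.swap) (simp add: mult.commute)
  have 2: "H l j = (\<Sum>c<n. scaleF (p c l) (B c))" if "l < n" for l
    unfolding H[OF that ij(2)] B_def F.scale_sum_right by simp
  have "(\<Sum>l<n. tensF (H i l) (H l j)) = (\<Sum>l<n. tensF (\<Sum>b<n. scaleF (q b l) (A b)) (\<Sum>c<n. scaleF (p c l) (B c)))"
    by (intro sum.cong refl) (simp add: 1 2)
  also have "\<dots> = (\<Sum>b<n. tensF (A b) (B b))" by (rule tensF_contract[OF pq])
  also have "\<dots> = (\<Sum>b<n. \<Sum>a<n. \<Sum>d<n. Poly_Mapping.single 0 (p a i * q d j) * tensF (g a b) (g b d))"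
    by (intro sum.cong refl, simp only: A_def B_def tensF_sum_left tensF_sum_right tensF_scaleF, rule sum.swap)
  also have "\<dots> = (\<Sum>a<n. \<Sum>b<n. \<Sum>d<n. Poly_Mapping.single 0 (p a i * q d j) * tensF (g a b) (g b d))"
    by (rule sum.swap)
  also have "\<dots> = (\<Sum>a<n. \<Sum>d<n. \<Sum>b<n. Poly_Mapping.single 0 (p a i * q d j) * tensF (g a b) (g b d))"
    by (intro sum.cong refl sum.swap)
  finally show ?thesis by (simp only: sum_distrib_left)
qed

lemma mult_cmat_dmat_index:
  assumes "A \<in> carrier_mat n n" "i < n" "l < n"
  shows "(A * cmat (dmat n d)) $$ (i, l) = cst (d l) * A $$ (i, l)"
proof -
  have "(A * cmat (dmat n d)) $$ (i, l) = (\<Sum>a<n. A $$ (i, a) * cmat (dmat n d) $$ (a, l))"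
    using assms by (subst mult_mat_index) auto
  also have "\<dots> = (\<Sum>a<n. if a = l then A $$ (i, a) * cst (d a) else 0)"
    using assms by (intro sum.cong) auto
  also have "\<dots> = cst (d l) * A $$ (i, l)" using assms by (simp add: cst_commute)
  finally show ?thesis .
qed

section \<open>The fundamental corepresentation in the diagonalising basis\<close>

context
  fixes fs k n S
  assumes k: "k < length fs" and valid: "valid_factor (fs ! k)"
    and n: "n = fdim fs k" and S: "S = hS fs k"
begin

lemma diag_basis_hS: "diag_basis fs k S (hmu fs k)"
proof -
  obtain S0 \<mu> where "diag_basis fs k S0 \<mu>" using diag_basis_exists[OF k valid] by blast
  then have "diag_basis fs k (fst (S0, \<mu>)) (snd (S0, \<mu>))" by simp
  then show ?thesis unfolding S hS_def hmu_def by (rule someI)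
qed

lemma hS_unitary: "S \<in> carrier_mat n n" "adjC S * S = 1\<^sub>m n" "S * adjC S = 1\<^sub>m n" "adjC S \<in> carrier_mat n n"
  "map_mat cnj S \<in> carrier_mat n n" "transpose_mat S \<in> carrier_mat n n"
  "transpose_mat S * map_mat cnj S = 1\<^sub>m n" "map_mat cnj S * transpose_mat S = 1\<^sub>m n"
proof -
  show 1: "S \<in> carrier_mat n n" "adjC S * S = 1\<^sub>m n" "S * adjC S = 1\<^sub>m n"
    using diag_basis_hS by (simp_all add: diag_basis_def Let_def n)
  then show "adjC S \<in> carrier_mat n n" "map_mat cnj S \<in> carrier_mat n n" "transpose_mat S \<in> carrier_mat n n" by simp_all
  have "transpose_mat (adjC S * S) = transpose_mat S * map_mat cnj S" "transpose_mat (S * adjC S) = map_mat cnj S * transpose_mat S"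
    using 1(1) by (intro eq_matI; auto simp: mult_mat_index mult.commute simp del: index_mult_mat(1))+
  then show "transpose_mat S * map_mat cnj S = 1\<^sub>m n" "map_mat cnj S * transpose_mat S = 1\<^sub>m n"
    unfolding 1 transpose_one by (simp_all only:)
qed

lemma hmu_pos: "i < n \<Longrightarrow> 0 < hmu fs k i"
  using diag_basis_hS by (simp add: diag_basis_def Let_def n)

private abbreviation "dm \<equiv> dmat n (\<lambda>i. of_real (hmu fs k i))"
private abbreviation "di \<equiv> dmat n (\<lambda>i. inverse (of_real (hmu fs k i)))"

lemma qmat_diag: "qmat fs k = map_mat cnj S * dm * transpose_mat S"
  using diag_basis_hS by (simp add: diag_basis_def Let_def n)

lemma qinv_diag: "qinv fs k = map_mat cnj S * di * transpose_mat S"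
proof -
  note u = hS_unitary
  have d: "dm * di = 1\<^sub>m n" by (rule dmat_inv) (use hmu_pos in force)
  have dc: "dm \<in> carrier_mat n n" "di \<in> carrier_mat n n" by auto
  note as = assoc_mult_mat[of _ n n _ n _ n] and mc = mult_carrier_mat[of _ n n _ n]
  let ?x = "map_mat cnj S * di * transpose_mat S"
  have xc: "?x \<in> carrier_mat n n" using u dc by (simp add: mc)
  have "qmat fs k * ?x = map_mat cnj S * (dm * ((transpose_mat S * map_mat cnj S) * (di * transpose_mat S)))"
    unfolding qmat_diag using u(1,5,6) dc by (simp only: as mc)
  also have "(transpose_mat S * map_mat cnj S) * (di * transpose_mat S) = di * transpose_mat S"
    unfolding u(7) using u dc by simp
  also have "dm * (di * transpose_mat S) = transpose_mat S"
    using d u dc by (simp flip: assoc_mult_mat[of _ n n _ n _ n])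
  finally have e: "qmat fs k * ?x = 1\<^sub>m n" using u by simp
  have qc: "qmat fs k \<in> carrier_mat n n" "qinv fs k \<in> carrier_mat n n"
    using valid_fmat[OF k valid] invertible_inv_mat[OF valid_fmat(2,1)[OF k valid]]
    by (auto simp: qmat_def qinv_def n)
  have "?x = (qinv fs k * qmat fs k) * ?x"
    unfolding qmat_qinv(2)[OF k valid n refl] by (rule left_mult_one_mat[OF xc, symmetric])
  also have "\<dots> = qinv fs k * (qmat fs k * ?x)" using qc xc by (simp only: as)
  also have "\<dots> = qinv fs k" using e qc by simp
  finally show ?thesis ..
qed

lemma hmat_carrier: "hmat fs k \<in> carrier_mat n n"
  using hS_unitary by (auto simp: hmat_def n S intro!: mult_carrier_mat)

lemma hx_index: "i < n \<Longrightarrow> j < n \<Longrightarrow> hx fs k False i j = (\<Sum>a<n. \<Sum>b<n. scaleF (cnj (S $$ (a, i)) * S $$ (b, j)) (gx k False a b))"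
proof -
  assume ij: "i < n" "j < n"
  have c: "gmat fs k False \<in> carrier_mat n n" "cmat S \<in> carrier_mat n n" "cmat (adjC S) \<in> carrier_mat n n"
    using hS_unitary by (auto simp: n)
  have "hmat fs k $$ (i, j) = (\<Sum>b<n. (\<Sum>a<n. cst (cnj (S $$ (a, i))) * gx k False a b) * cst (S $$ (b, j)))"
  proof -
    have "hmat fs k $$ (i, j) = (\<Sum>b<n. (cmat (adjC S) * gmat fs k False) $$ (i, b) * cmat S $$ (b, j))"
      unfolding hmat_def S[symmetric] using ij c by (subst mult_mat_index) auto
    also have "\<dots> = (\<Sum>b<n. (\<Sum>a<n. cst (cnj (S $$ (a, i))) * gx k False a b) * cst (S $$ (b, j)))"
      using ij c hS_unitary by (intro sum.cong refl, subst mult_mat_index) (auto simp: n)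
    finally show ?thesis .
  qed
  also have "\<dots> = (\<Sum>b<n. \<Sum>a<n. scaleF (cnj (S $$ (a, i)) * S $$ (b, j)) (gx k False a b))"
    by (simp add: sum_distrib_right scaleF_def cst_mult cst_commute[of "_ * gx _ _ _ _"] mult.assoc[symmetric])
      (simp add: cst_mult[symmetric] mult.commute)
  also have "\<dots> = (\<Sum>a<n. \<Sum>b<n. scaleF (cnj (S $$ (a, i)) * S $$ (b, j)) (gx k False a b))"
    by (rule sum.swap)
  finally show ?thesis by (simp add: hx_def)
qed

lemma hx_index_star: "i < n \<Longrightarrow> j < n \<Longrightarrow> hx fs k True i j = (\<Sum>a<n. \<Sum>b<n. scaleF (S $$ (a, i) * cnj (S $$ (b, j))) (gx k True a b))"
proof -
  assume ij: "i < n" "j < n"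
  have "hx fs k True i j = starF (hx fs k False i j)" by simp
  then show ?thesis unfolding hx_index[OF ij] by (simp add: starF_sum starF_scaleF)
qed

lemma gx_hx: "a < n \<Longrightarrow> b < n \<Longrightarrow> gx k False a b = (\<Sum>i<n. \<Sum>j<n. scaleF (S $$ (a, i) * cnj (S $$ (b, j))) (hx fs k False i j))"
proof -
  assume ab: "a < n" "b < n"
  have c: "gmat fs k False \<in> carrier_mat n n" "cmat S \<in> carrier_mat n n" "cmat (adjC S) \<in> carrier_mat n n" "hmat fs k \<in> carrier_mat n n"
    using hS_unitary hmat_carrier by (auto simp: n)
  note as = assoc_mult_mat[of _ n n _ n _ n] and mc = mult_carrier_mat[of _ n n _ n]
  have SS: "cmat S * cmat (adjC S) = 1\<^sub>m n"
    using hS_unitary by (simp flip: cmat_mult[of _ n n _ n])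
  have "cmat S * hmat fs k * cmat (adjC S) = (cmat S * cmat (adjC S)) * gmat fs k False * (cmat S * cmat (adjC S))"
    unfolding hmat_def S[symmetric] using c(1-3) by (simp only: as mc)
  then have g: "gmat fs k False = cmat S * hmat fs k * cmat (adjC S)"
    unfolding SS left_mult_one_mat[OF c(1)] right_mult_one_mat[OF c(1)] ..
  have "gx k False a b = (cmat S * hmat fs k * cmat (adjC S)) $$ (a, b)"
    unfolding g[symmetric] using ab by (simp add: n)
  also have "\<dots> = (\<Sum>j<n. (cmat S * hmat fs k) $$ (a, j) * cmat (adjC S) $$ (j, b))"
    using ab c by (subst mult_mat_index) auto
  also have "\<dots> = (\<Sum>j<n. (\<Sum>i<n. cst (S $$ (a, i)) * hx fs k False i j) * cst (cnj (S $$ (b, j))))"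
    using ab c hS_unitary by (intro sum.cong refl, subst mult_mat_index) (auto simp: hx_def)
  also have "\<dots> = (\<Sum>j<n. \<Sum>i<n. scaleF (S $$ (a, i) * cnj (S $$ (b, j))) (hx fs k False i j))"
    by (simp add: sum_distrib_right scaleF_def cst_mult cst_commute[of "_ * hx _ _ _ _ _"] mult.assoc[symmetric])
      (simp add: cst_mult[symmetric] mult.commute)
  also have "\<dots> = (\<Sum>i<n. \<Sum>j<n. scaleF (S $$ (a, i) * cnj (S $$ (b, j))) (hx fs k False i j))"
    by (rule sum.swap)
  finally show ?thesis .
qed

lemma gx_hx_star: "a < n \<Longrightarrow> b < n \<Longrightarrow> gx k True a b = (\<Sum>i<n. \<Sum>j<n. scaleF (cnj (S $$ (a, i)) * S $$ (b, j)) (hx fs k True i j))"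
proof -
  assume ab: "a < n" "b < n"
  have "gx k True a b = starF (gx k False a b)" by simp
  then show ?thesis unfolding gx_hx[OF ab] by (simp add: starF_sum starF_scaleF)
qed

lemma S_sum: "i < n \<Longrightarrow> j < n \<Longrightarrow> (\<Sum>a<n. cnj (S $$ (a, i)) * S $$ (a, j)) = (if i = j then 1 else 0)"
  "i < n \<Longrightarrow> j < n \<Longrightarrow> (\<Sum>a<n. S $$ (i, a) * cnj (S $$ (j, a))) = (if i = j then 1 else 0)"
proof -
  assume ij: "i < n" "j < n"
  have "(adjC S * S) $$ (i, j) = (\<Sum>a<n. cnj (S $$ (a, i)) * S $$ (a, j))"
    "(S * adjC S) $$ (i, j) = (\<Sum>a<n. S $$ (i, a) * cnj (S $$ (j, a)))"
    using ij hS_unitary(1) by (subst mult_mat_index; auto)+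
  then show "(\<Sum>a<n. cnj (S $$ (a, i)) * S $$ (a, j)) = (if i = j then 1 else 0)"
    "(\<Sum>a<n. S $$ (i, a) * cnj (S $$ (j, a))) = (if i = j then 1 else 0)"
    using ij by (simp_all add: hS_unitary)
qed

lemma eps_hx: "i < n \<Longrightarrow> j < n \<Longrightarrow> eps fs (hx fs k s i j) = (if i = j then 1 else 0)"
proof -
  assume ij: "i < n" "j < n"
  have "eps fs (hx fs k False i j) = (\<Sum>a<n. \<Sum>b<n. cnj (S $$ (a, i)) * S $$ (b, j) * (if a = b then 1 else 0))"
    unfolding hx_index[OF ij] eps_sum eps_scaleF by (intro sum.cong refl) (auto simp: eps_gx n)
  also have "\<dots> = (if i = j then 1 else 0)" by (simp add: sum_delta_diag S_sum ij)
  finally have e: "eps fs (hx fs k False i j) = (if i = j then 1 else 0)" .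
  then show ?thesis
    using eps_starF[of fs "hx fs k False i j"] by (cases s) auto
qed

lemma delta_hx: "i < n \<Longrightarrow> j < n \<Longrightarrow> delta fs (hx fs k s i j) = (\<Sum>l<n. tensF (hx fs k s i l) (hx fs k s l j))"
proof -
  assume ij: "i < n" "j < n"
  have S2: "(\<Sum>l<n. S $$ (c, l) * cnj (S $$ (b, l))) = (if b = c then 1 else 0)"
    "(\<Sum>l<n. cnj (S $$ (c, l)) * S $$ (b, l)) = (if b = c then 1 else 0)" if "b < n" "c < n" for b c
    using S_sum(2)[of c b] S_sum(2)[of b c] that by (auto simp: mult.commute)
  show ?thesis
  proof (cases s)
    case False
    have "delta fs (hx fs k s i j) = (\<Sum>a<n. \<Sum>b<n. Poly_Mapping.single 0 (cnj (S $$ (a, i)) * S $$ (b, j)) * (\<Sum>l<n. tensF (gx k False a l) (gx k False l b)))"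
      using ij by (simp add: False hx_index delta_sum delta_scaleF delta_gx n)
    also have "\<dots> = (\<Sum>l<n. tensF (hx fs k s i l) (hx fs k s l j))"
      by (rule tensF_sandwich[where p = "\<lambda>a i. cnj (S $$ (a, i))" and q = "\<lambda>b j. S $$ (b, j)", symmetric])
        (simp_all add: False hx_index S2 ij)
    finally show ?thesis .
  next
    case True
    have "delta fs (hx fs k s i j) = (\<Sum>a<n. \<Sum>b<n. Poly_Mapping.single 0 (S $$ (a, i) * cnj (S $$ (b, j))) * (\<Sum>l<n. tensF (gx k True a l) (gx k True l b)))"
      using ij by (simp add: True hx_index_star delta_sum delta_scaleF delta_gx n)
    also have "\<dots> = (\<Sum>l<n. tensF (hx fs k s i l) (hx fs k s l j))"
      by (rule tensF_sandwich[where p = "\<lambda>a i. S $$ (a, i)" and q = "\<lambda>b j. cnj (S $$ (b, j))", symmetric])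
        (simp_all add: True hx_index_star S2 ij mult.commute)
    finally show ?thesis .
  qed
qed

text \<open>Both forms of unitarity, after conjugation by S. As \<open>qmat\<close> has become
  diagonal, the relations for v turn into orthogonality relations for rows and columns with weights
  \<open>hmu\<close>; these say that the matrix of adjoints is invertible with a weighted transpose
  as inverse.\<close>

lemma hx_rels:
  assumes ij: "i < n" "j < n"
  shows "eqS fs (\<Sum>l<n. hx fs k False i l * hx fs k True j l) (if i = j then 1 else 0)"
    and "eqS fs (\<Sum>l<n. hx fs k True l i * hx fs k False l j) (if i = j then 1 else 0)"
    and "eqS fs (\<Sum>l<n. scaleF (inverse (of_real (hmu fs k l))) (hx fs k True i l * hx fs k False j l)) (if i = j then cst (inverse (of_real (hmu fs k i))) else 0)"
    and "eqS fs (\<Sum>l<n. scaleF (of_real (hmu fs k l)) (hx fs k False l i * hx fs k True l j)) (if i = j then cst (of_real (hmu fs k i)) else 0)"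
proof -
  let ?I = "rel_ideal fs" let ?u = "gmat fs k False" let ?w = "gmat fs k True" let ?H = "hmat fs k"
  define H' where "H' = map_mat starF ?H"
  define s where "s = cmat S" define t where "t = cmat (adjC S)"
  define s' where "s' = cmat (map_mat cnj S)" define t' where "t' = cmat (transpose_mat S)"
  have c: "?u \<in> carrier_mat n n" "?w \<in> carrier_mat n n" "s \<in> carrier_mat n n" "t \<in> carrier_mat n n" "s' \<in> carrier_mat n n" "t' \<in> carrier_mat n n"
    "?H \<in> carrier_mat n n" "H' \<in> carrier_mat n n" "transpose_mat ?u \<in> carrier_mat n n" "transpose_mat ?H \<in> carrier_mat n n" "adjF ?u \<in> carrier_mat n n"
    using hS_unitary hmat_carrier by (auto simp: n s_def t_def s'_def t'_def H'_def)
  have st: "s * t = 1\<^sub>m n" "t * s = 1\<^sub>m n" "s' * t' = 1\<^sub>m n" "t' * s' = 1\<^sub>m n"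
    using hS_unitary by (simp_all add: s_def t_def s'_def t'_def flip: cmat_mult[of _ n n _ n])
  have stx: "s * (t * x) = x" "t * (s * x) = x" "s' * (t' * x) = x" "t' * (s' * x) = x" if "x \<in> carrier_mat n n" for x
    using that c(3-6) by (simp_all add: st flip: assoc_mult_mat[of _ n n _ n _ n])
  note as = assoc_mult_mat[of _ n n _ n _ n] and mc = mult_carrier_mat[of _ n n _ n]
  note ms = mult_minus_distrib_mat[of _ n n _ n] minus_mult_distrib_mat[of _ n n _ _ n]
  have H: "?H = t * ?u * s" by (simp add: hmat_def t_def s_def S)
  have aH: "adjF ?H = t * adjF ?u * s"
  proof -
    have "adjF (t * (?u * s)) = adjF s * adjF ?u * adjF t"
      using c by (simp only: adjF_mult[of _ n n _ n] mc)
    moreover have "adjF s = t" "adjF t = s" by (simp_all add: s_def t_def adjF_cmat adjC_adjC)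
    ultimately show ?thesis unfolding H using c by (simp only: as mc)
  qed
  have H': "H' = t' * ?w * s'"
  proof (rule eq_matI)
    fix i j assume "i < dim_row (t' * ?w * s')" "j < dim_col (t' * ?w * s')"
    then have ij: "i < n" "j < n" using c by auto
    have "(t' * ?w * s') $$ (i, j) = (\<Sum>b<n. (t' * ?w) $$ (i, b) * s' $$ (b, j))"
      using ij c by (subst mult_mat_index) auto
    also have "\<dots> = (\<Sum>b<n. (\<Sum>a<n. t' $$ (i, a) * ?w $$ (a, b)) * s' $$ (b, j))"
      using ij c by (intro sum.cong refl, subst mult_mat_index) auto
    also have "\<dots> = (\<Sum>b<n. \<Sum>a<n. scaleF (S $$ (a, i) * cnj (S $$ (b, j))) (gx k True a b))"
      using ij hS_unitary by (simp add: t'_def s'_def sum_distrib_right scaleF_def cst_mult cst_commute[of "_ * gx _ _ _ _"] mult.assoc[symmetric] flip: n)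
        (simp add: cst_mult[symmetric] mult.commute)
    also have "\<dots> = hx fs k True i j"
      unfolding hx_index_star[OF ij] by (rule sum.swap)
    finally show "H' $$ (i, j) = (t' * ?w * s') $$ (i, j)" using ij c by (simp add: H'_def hx_def)
  qed (use c in auto)
  have tH: "transpose_mat ?H = t' * transpose_mat ?u * s'"
  proof -
    have "transpose_mat ?H = transpose_mat (map_mat starF H')" unfolding H'_def by (intro eq_matI) auto
    also have "transpose_mat (map_mat starF H') = adjF H'" by (simp add: adjF_def map_mat_transpose)
    also have "\<dots> = adjF (t' * (?w * s'))" unfolding H' using c by (simp only: as mc)
    also have "\<dots> = adjF s' * adjF ?w * adjF t'" using c by (simp only: adjF_mult[of _ n n _ n] mc)
    also have "adjF s' = t'" by (simp add: s'_def t'_def adjF_cmat) (rule arg_cong[of _ _ cmat], rule eq_matI, auto)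
    also have "adjF t' = s'" by (simp add: s'_def t'_def adjF_cmat)
    also have "adjF ?w = transpose_mat ?u" by (simp add: adjF_gmat)
    finally show ?thesis .
  qed
  have uu: "in_mat ?I (?u * adjF ?u - 1\<^sub>m n)" "in_mat ?I (adjF ?u * ?u - 1\<^sub>m n)"
    using rels_in_ideal[OF k valid] uu_index[of _ fs k] unfolding in_mat_def
    by (auto simp: n rels_def Let_def)
  have r34c: "rel3 fs k \<in> carrier_mat n n" "rel4 fs k \<in> carrier_mat n n"
    unfolding rel34(3,4)[OF k valid refl refl] using valid_fmat[OF k valid] invertible_inv_mat[OF valid_fmat(2,1)[OF k valid]] by (auto simp: n)
  have r34: "in_mat ?I (rel3 fs k)" "in_mat ?I (rel4 fs k)"
    using rels_in_ideal[OF k valid] rel34_index[OF k valid] r34c unfolding in_mat_def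
    by (auto simp: n rels_def Let_def)
  have e: "eqS fs (X $$ (i, j)) (Y $$ (i, j))" if "in_mat ?I (X - Y)" "X \<in> carrier_mat n n" "Y \<in> carrier_mat n n" for X Y
    using that ij by (auto simp: in_mat_def eqS_def)
  have "?H * adjF ?H - 1\<^sub>m n = t * (?u * adjF ?u - 1\<^sub>m n) * s"
    unfolding aH unfolding H using c by (simp add: as mc ms stx st)
  then have "in_mat ?I (?H * adjF ?H - 1\<^sub>m n)"
    by (simp only: in_mat_mult[OF ideal_rel_ideal minus_carrier_mat[OF one_carrier_mat] c(4,3) uu(1)])
  from e[OF this] show "eqS fs (\<Sum>l<n. hx fs k False i l * hx fs k True j l) (if i = j then 1 else 0)"
    using c ij by (simp add: mult_mat_index mc hx_def del: index_mult_mat(1))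
  have "adjF ?H * ?H - 1\<^sub>m n = t * (adjF ?u * ?u - 1\<^sub>m n) * s"
    unfolding aH unfolding H using c by (simp add: as mc ms stx st)
  then have "in_mat ?I (adjF ?H * ?H - 1\<^sub>m n)"
    by (simp only: in_mat_mult[OF ideal_rel_ideal minus_carrier_mat[OF one_carrier_mat] c(4,3) uu(2)])
  from e[OF this] show "eqS fs (\<Sum>l<n. hx fs k True l i * hx fs k False l j) (if i = j then 1 else 0)"
    using c ij by (simp add: mult_mat_index mc hx_def del: index_mult_mat(1))
  define d where "d = cmat dm" define f where "f = cmat di"
  have dc: "d \<in> carrier_mat n n" "f \<in> carrier_mat n n" by (auto simp: d_def f_def)
  have qq: "cmat (qmat fs k) = s' * d * t'" "cmat (qinv fs k) = s' * f * t'"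
    using hS_unitary unfolding qmat_diag qinv_diag
    by (simp_all add: s'_def d_def t'_def f_def cmat_mult[of _ n n _ n] mc)
  have "H' * f * transpose_mat ?H - f = t' * rel3 fs k * s'"
    unfolding tH H' rel3_def[OF k valid refl refl] qq using c dc by (simp add: as mc ms stx st)
  then have "in_mat ?I (H' * f * transpose_mat ?H - f)"
    by (simp only: in_mat_mult[OF ideal_rel_ideal r34c(1) c(6,5) r34(1)])
  from e[OF this] have 3: "eqS fs ((H' * f * transpose_mat ?H) $$ (i, j)) (f $$ (i, j))" using c dc by (simp add: mc)
  have Hf: "(H' * f) $$ (i, l) = cst (inverse (of_real (hmu fs k l))) * hx fs k True i l" if "l < n" for l
    unfolding f_def mult_cmat_dmat_index[OF c(8) ij(1) that] using c(7) ij that by (simp add: H'_def hx_def)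
  have E3: "(H' * f * transpose_mat ?H) $$ (i, j) = (\<Sum>l<n. scaleF (inverse (of_real (hmu fs k l))) (hx fs k True i l * hx fs k False j l))"
    using ij c dc by (subst mult_mat_index) (auto simp: Hf scaleF_def mult.assoc hx_def simp del: index_mult_mat(1))
  have fij: "f $$ (i, j) = (if i = j then cst (inverse (of_real (hmu fs k i))) else 0)" using ij by (auto simp: f_def)
  from 3 show "eqS fs (\<Sum>l<n. scaleF (inverse (of_real (hmu fs k l))) (hx fs k True i l * hx fs k False j l)) (if i = j then cst (inverse (of_real (hmu fs k i))) else 0)"
    unfolding E3 fij .
  have "transpose_mat ?H * d * H' - d = t' * rel4 fs k * s'"
    unfolding tH H' rel4_def[OF k valid refl refl] qq using c dc by (simp add: as mc ms stx st)
  then have "in_mat ?I (transpose_mat ?H * d * H' - d)"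
    by (simp only: in_mat_mult[OF ideal_rel_ideal r34c(2) c(6,5) r34(2)])
  from e[OF this] have 4: "eqS fs ((transpose_mat ?H * d * H') $$ (i, j)) (d $$ (i, j))" using c dc by (simp add: mc)
  have Hd: "(transpose_mat ?H * d) $$ (i, l) = cst (of_real (hmu fs k l)) * hx fs k False l i" if "l < n" for l
    unfolding d_def mult_cmat_dmat_index[OF c(10) ij(1) that] using c(7) ij that by (simp add: hx_def)
  have E4: "(transpose_mat ?H * d * H') $$ (i, j) = (\<Sum>l<n. scaleF (of_real (hmu fs k l)) (hx fs k False l i * hx fs k True l j))"
    using ij c dc by (subst mult_mat_index) (auto simp: Hd scaleF_def mult.assoc hx_def H'_def simp del: index_mult_mat(1))
  have dij: "d $$ (i, j) = (if i = j then cst (of_real (hmu fs k i)) else 0)" using ij by (auto simp: d_def)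
  from 4 show "eqS fs (\<Sum>l<n. scaleF (of_real (hmu fs k l)) (hx fs k False l i * hx fs k True l j)) (if i = j then cst (of_real (hmu fs k i)) else 0)"
    unfolding E4 dij .
qed

end

section \<open>Independence of the coefficients and irreducibility\<close>

lemma hx_functional:
  assumes valid: "\<And>k. k < length fs \<Longrightarrow> valid_factor (fs ! k)" and k: "k < length fs"
    and n: "n = fdim fs k" and "i0 < n" "j0 < n"
  shows "\<exists>f. kills fs f \<and> (\<forall>i<n. \<forall>j<n. f (hx fs k False i j) = (if i = i0 \<and> j = j0 then 1 else 0))"
proof -
  define S where "S = hS fs k"
  note S_sum = S_sum[OF k valid[OF k] n S_def] and hx_index = hx_index[OF k valid[OF k] n S_def]
  obtain f where f: "kills fs f" "\<forall>a<n. \<forall>b<n. f (gx k False a b) = S $$ (a, i0) * cnj (S $$ (b, j0))"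
    using gen_functional[OF valid k, of "\<lambda>a b. S $$ (a, i0) * cnj (S $$ (b, j0))"] by (auto simp: n)
  have "f (hx fs k False i j) = (if i = i0 \<and> j = j0 then 1 else 0)" if ij: "i < n" "j < n" for i j
  proof -
    have "f (hx fs k False i j) = (\<Sum>a<n. \<Sum>b<n. (cnj (S $$ (a, i)) * S $$ (b, j)) * (S $$ (a, i0) * cnj (S $$ (b, j0))))"
      using f unfolding hx_index[OF ij] by (simp add: kills_def linearF_sum[of "(*)"] linearF_scale[of "(*)"])
    also have "\<dots> = (\<Sum>a<n. \<Sum>b<n. (cnj (S $$ (a, i)) * S $$ (a, i0)) * (cnj (S $$ (b, j0)) * S $$ (b, j)))"
      by (intro sum.cong refl) (simp add: mult_ac)
    also have "\<dots> = (if i = i0 then 1 else 0) * (if j0 = j then 1 else 0)"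
      unfolding sum_product[symmetric] using assms(4,5) ij by (simp only: S_sum)
    finally show ?thesis by auto
  qed
  with f(1) show ?thesis by blast
qed

lemma kills_eqS: "kills fs f \<Longrightarrow> eqS fs x y \<Longrightarrow> f x = f y"
  by (rule linearF_eqS[of "(*)"]) (auto simp: kills_def)

lemma umat_unitary_corep:
  assumes k: "k < length fs" and valid: "valid_factor (fs ! k)"
  shows "is_unitary_corep fs (umat fs k)"
proof -
  have "mat_eqS fs (umat fs k * adjF (umat fs k)) (1\<^sub>m (fdim fs k))"
    "mat_eqS fs (adjF (umat fs k) * umat fs k) (1\<^sub>m (fdim fs k))"
    using rels_in_ideal[OF k valid] uu_index[of _ fs k]
    by (auto simp: mat_eqS_def umat_gmat eqS_def rels_def Let_def simp del: index_mult_mat(1))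
  moreover have "delta fs (umat fs k $$ (i, j)) - (\<Sum>l<fdim fs k. tensF (umat fs k $$ (i, l)) (umat fs k $$ (l, j))) = 0"
    if "i < fdim fs k" "j < fdim fs k" for i j
    using that by (simp add: umat_gmat delta_gx)
  ultimately show ?thesis
    by (auto simp: is_unitary_corep_def umat_gmat rel_ideal2.zero2)
qed

text \<open>Comparing coefficients of the independent entries u_ab in u(P \<otimes> 1) = (P
  \<otimes> 1)u(P \<otimes> 1) gives P_bj if i = a, and 0 otherwise, equal to P_ia P_bj; a nonzero
  entry P_bj then makes P the identity. The lemma is needed because the unitary antipode is
  specified through irreducible corepresentations.\<close>

lemma umat_irreducible:
  assumes valid: "\<And>k. k < length fs \<Longrightarrow> valid_factor (fs ! k)" and k: "k < length fs"
  shows "is_irreducible fs (umat fs k)"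
proof -
  let ?n = "fdim fs k" let ?u = "gmat fs k False"
  have "P = 0\<^sub>m ?n ?n \<or> P = 1\<^sub>m ?n"
    if P: "P \<in> carrier_mat ?n ?n" and e: "mat_eqS fs (?u * cmat P) (cmat P * ?u * cmat P)" for P
  proof -
    have z: "(if i = a0 then P $$ (b0, j) else 0) = P $$ (i, a0) * P $$ (b0, j)"
      if ij: "i < ?n" "j < ?n" "a0 < ?n" "b0 < ?n" for i j a0 b0
    proof -
      obtain f where f: "kills fs f" "\<forall>a<?n. \<forall>b<?n. f (gx k False a b) = (if a = a0 \<and> b = b0 then 1 else 0)"
        using gen_functional[OF valid k, of "\<lambda>a b. if a = a0 \<and> b = b0 then 1 else 0"] by blast
      have lin: "linearF (*) f" using f(1) by (simp add: kills_def)
      have PC: "cmat P \<in> carrier_mat ?n ?n" using P by simp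
      have 1: "(?u * cmat P) $$ (i, j) = (\<Sum>b<?n. scaleF (P $$ (b, j)) (gx k False i b))"
        using ij P by (subst mult_mat_index) (auto simp: scaleF_def cst_commute)
      have 2: "(cmat P * ?u * cmat P) $$ (i, j) = (\<Sum>b<?n. scaleF (P $$ (b, j)) (\<Sum>a<?n. scaleF (P $$ (i, a)) (gx k False a b)))"
      proof -
        have "(cmat P * ?u * cmat P) $$ (i, j) = (\<Sum>b<?n. (cmat P * ?u) $$ (i, b) * cmat P $$ (b, j))"
          using ij P by (subst mult_mat_index) auto
        also have "\<dots> = (\<Sum>b<?n. scaleF (P $$ (b, j)) (\<Sum>a<?n. scaleF (P $$ (i, a)) (gx k False a b)))"
          using ij P by (intro sum.cong refl, subst mult_mat_index) (auto simp: scaleF_def cst_commute)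
        finally show ?thesis .
      qed
      have "eqS fs ((?u * cmat P) $$ (i, j)) ((cmat P * ?u * cmat P) $$ (i, j))"
        using e ij P by (auto simp: mat_eqS_def simp del: index_mult_mat(1))
      from kills_eqS[OF f(1) this] have "(\<Sum>b<?n. P $$ (b, j) * (if i = a0 \<and> b = b0 then 1 else 0)) =
        (\<Sum>b<?n. P $$ (b, j) * (\<Sum>a<?n. P $$ (i, a) * (if a = a0 \<and> b = b0 then 1 else 0)))"
        unfolding 1 2 using f(2) ij by (simp add: linearF_sum[OF lin] linearF_scale[OF lin])
      moreover have "(\<Sum>b<?n. P $$ (b, j) * (if i = a0 \<and> b = b0 then 1 else 0)) = (if i = a0 then P $$ (b0, j) else 0)"
        using ij by (auto simp: sum_delta_right)
      moreover have "(\<Sum>a<?n. P $$ (i, a) * (if a = a0 \<and> b = b0 then 1 else 0)) = (if b = b0 then P $$ (i, a0) else 0)" for b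
        using ij by (auto simp: sum_delta_right)
      moreover have "(\<Sum>b<?n. P $$ (b, j) * (if b = b0 then P $$ (i, a0) else 0)) = P $$ (i, a0) * P $$ (b0, j)"
        using ij by (simp add: if_distrib[of "\<lambda>x. _ * x"] mult.commute cong: if_cong)
      ultimately show ?thesis by simp
    qed
    show ?thesis
    proof (cases "P = 0\<^sub>m ?n ?n")
      case False
      then obtain b0 j where b0: "b0 < ?n" "j < ?n" "P $$ (b0, j) \<noteq> 0"
        using P by (auto simp: mat_eq_iff)
      have "P $$ (i, a) = (if i = a then 1 else 0)" if "i < ?n" "a < ?n" for i a
        using z[OF that(1) b0(2) that(2) b0(1)] b0(3) by (auto split: if_splits)
      then have "P = 1\<^sub>m ?n" using P by (intro eq_matI) auto
      then show ?thesis ..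
    qed simp
  qed
  then show ?thesis
    using valid_fmat(3)[OF k valid[OF k]] by (auto simp: is_irreducible_def umat_gmat)
qed

section \<open>Functional calculus in a fixed orthonormal basis\<close>

context
  fixes S :: "complex mat" and n
  assumes S: "S \<in> carrier_mat n n" "adjC S * S = 1\<^sub>m n" "S * adjC S = 1\<^sub>m n"
begin

definition "spec d = S * dmat n d * adjC S"

lemma spec_carrier: "spec d \<in> carrier_mat n n"
  unfolding spec_def using S(1) by (intro mult_carrier_mat[of _ n n _ n]) auto

lemma dmat_mult: "dmat n d * dmat n e = dmat n (\<lambda>i. d i * e i)"
proof (rule eq_matI)
  fix i j assume "i < dim_row (dmat n (\<lambda>i. d i * e i))" "j < dim_col (dmat n (\<lambda>i. d i * e i))"
  then have ij: "i < n" "j < n" by auto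
  have "(dmat n d * dmat n e) $$ (i, j) = (\<Sum>l<n. dmat n d $$ (i, l) * dmat n e $$ (l, j))"
    using ij by (subst mult_mat_index) auto
  also have "\<dots> = (\<Sum>l<n. if l = i then (if i = j then d i * e i else 0) else 0)"
    using ij by (intro sum.cong) auto
  finally show "(dmat n d * dmat n e) $$ (i, j) = dmat n (\<lambda>i. d i * e i) $$ (i, j)" using ij by simp
qed auto

lemma spec_mult: "spec d * spec e = spec (\<lambda>i. d i * e i)"
proof -
  have dc: "dmat n d \<in> carrier_mat n n" for d by simp
  have aS: "adjC S \<in> carrier_mat n n" using S by simp
  have "spec d * spec e = S * (dmat n d * ((adjC S * S) * (dmat n e * adjC S)))"
    unfolding spec_def using S(1) aS dc
    by (simp only: assoc_mult_mat[of _ n n _ n _ n] mult_carrier_mat[of _ n n _ n])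
  also have "(adjC S * S) * (dmat n e * adjC S) = dmat n e * adjC S"
    unfolding S(2) by (rule left_mult_one_mat[OF mult_carrier_mat[OF dc aS]])
  also have "S * (dmat n d * (dmat n e * adjC S)) = S * (dmat n d * dmat n e) * adjC S"
    using S(1) aS dc by (simp only: assoc_mult_mat[of _ n n _ n _ n] mult_carrier_mat[of _ n n _ n])
  finally show ?thesis by (simp only: dmat_mult spec_def)
qed

lemma spec_index:
  assumes "i < n" "j < n"
  shows "spec d $$ (i, j) = (\<Sum>l<n. S $$ (i, l) * d l * cnj (S $$ (j, l)))"
proof -
  have "spec d $$ (i, j) = (\<Sum>l<n. (S * dmat n d) $$ (i, l) * adjC S $$ (l, j))"
    unfolding spec_def using assms S by (subst mult_mat_index) auto
  also have "\<dots> = (\<Sum>l<n. S $$ (i, l) * d l * cnj (S $$ (j, l)))"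
  proof (intro sum.cong refl)
    fix l assume "l \<in> {..<n}"
    then have l: "l < n" by simp
    have "(S * dmat n d) $$ (i, l) = (\<Sum>a<n. S $$ (i, a) * dmat n d $$ (a, l))"
      using assms S l by (subst mult_mat_index) auto
    also have "\<dots> = (\<Sum>a<n. (S $$ (i, a) * d a) * (if a = l then 1 else 0))"
      using l by (intro sum.cong) auto
    also have "\<dots> = S $$ (i, l) * d l" using l by (rule sum_delta_right)
    finally show "(S * dmat n d) $$ (i, l) * adjC S $$ (l, j) = S $$ (i, l) * d l * cnj (S $$ (j, l))"
      using S l assms by simp
  qed
  finally show ?thesis .
qed

lemma S_cols: "a < n \<Longrightarrow> b < n \<Longrightarrow> (\<Sum>i<n. cnj (S $$ (i, a)) * S $$ (i, b)) = (if a = b then 1 else 0)"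
proof -
  assume ab: "a < n" "b < n"
  have "(adjC S * S) $$ (a, b) = (\<Sum>i<n. cnj (S $$ (i, a)) * S $$ (i, b))"
    using ab S(1) by (subst mult_mat_index) auto
  then show ?thesis using ab by (simp add: S(2))
qed

lemma spec_trace: "mtrace (spec d) = (\<Sum>i<n. d i)"
proof -
  have "mtrace (spec d) = (\<Sum>i<n. spec d $$ (i, i))"
    using spec_carrier[of d] by (simp add: mtrace_def)
  also have "\<dots> = (\<Sum>i<n. \<Sum>l<n. S $$ (i, l) * d l * cnj (S $$ (i, l)))"
    by (intro sum.cong refl) (simp add: spec_index)
  also have "\<dots> = (\<Sum>l<n. \<Sum>i<n. S $$ (i, l) * d l * cnj (S $$ (i, l)))" by (rule sum.swap)
  also have "\<dots> = (\<Sum>l<n. d l * (\<Sum>i<n. cnj (S $$ (i, l)) * S $$ (i, l)))"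
    by (simp add: sum_distrib_left mult_ac)
  also have "\<dots> = (\<Sum>l<n. d l)" by (intro sum.cong refl) (simp add: S_cols)
  finally show ?thesis .
qed

lemma spec_one: "spec (\<lambda>_. 1) = 1\<^sub>m n"
proof -
  have "dmat n (\<lambda>_. 1) = 1\<^sub>m n" by (rule eq_matI) auto
  then show ?thesis using S by (simp add: spec_def)
qed

lemma spec_inv:
  assumes "\<And>i. i < n \<Longrightarrow> d i \<noteq> 0"
  shows "invertible_mat (spec d)" "inv_mat (spec d) = spec (\<lambda>i. inverse (d i))"
proof -
  have "dmat n (\<lambda>i. d i * inverse (d i)) = dmat n (\<lambda>_. 1)" "dmat n (\<lambda>i. inverse (d i) * d i) = dmat n (\<lambda>_. 1)"
    using assms by (auto intro!: eq_matI)
  then have "spec d * spec (\<lambda>i. inverse (d i)) = 1\<^sub>m n" "spec (\<lambda>i. inverse (d i)) * spec d = 1\<^sub>m n"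
    unfolding spec_mult spec_one[symmetric] by (simp_all add: spec_def)
  from inv_mat_eqI[OF spec_carrier spec_carrier this]
  show "invertible_mat (spec d)" "inv_mat (spec d) = spec (\<lambda>i. inverse (d i))" .
qed

lemma spec_pos:
  assumes "\<And>i. i < n \<Longrightarrow> 0 \<le> d i"
  shows "pos_mat n (spec (\<lambda>i. complex_of_real (d i)))"
  unfolding pos_mat_def
proof (intro conjI ballI spec_carrier)
  fix v :: "complex vec" assume v: "v \<in> carrier_vec n"
  let ?A = "spec (\<lambda>i. complex_of_real (d i))"
  define w where "w l = (\<Sum>j<n. cnj (S $$ (j, l)) * v $ j)" for l
  have "(?A *\<^sub>v v) \<bullet>c v = (\<Sum>i<n. (\<Sum>j<n. ?A $$ (i, j) * v $ j) * cnj (v $ i))"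
    using v spec_carrier[of "\<lambda>i. complex_of_real (d i)"] by (simp add: scalar_prod_def atLeast0LessThan)
  also have "\<dots> = (\<Sum>i<n. \<Sum>j<n. \<Sum>l<n. d l * ((cnj (S $$ (j, l)) * v $ j) * cnj (cnj (S $$ (i, l)) * v $ i)))"
    by (intro sum.cong refl) (simp add: spec_index sum_distrib_left sum_distrib_right mult_ac)
  also have "\<dots> = (\<Sum>i<n. \<Sum>l<n. \<Sum>j<n. d l * ((cnj (S $$ (j, l)) * v $ j) * cnj (cnj (S $$ (i, l)) * v $ i)))"
    by (intro sum.cong refl sum.swap)
  also have "\<dots> = (\<Sum>l<n. \<Sum>i<n. \<Sum>j<n. d l * ((cnj (S $$ (j, l)) * v $ j) * cnj (cnj (S $$ (i, l)) * v $ i)))"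
    by (rule sum.swap)
  also have "\<dots> = (\<Sum>l<n. d l * (w l * cnj (w l)))"
    unfolding w_def cnj_sum sum_product by (intro sum.cong refl) (subst sum.swap, simp only: sum_distrib_left)
  also have "\<dots> = complex_of_real (\<Sum>l<n. d l * (cmod (w l))\<^sup>2)"
    by (simp only: of_real_sum of_real_mult complex_norm_square)
  finally have e: "(?A *\<^sub>v v) \<bullet>c v = complex_of_real (\<Sum>l<n. d l * (cmod (w l))\<^sup>2)" .
  have "0 \<le> (\<Sum>l<n. d l * (cmod (w l))\<^sup>2)" using assms by (intro sum_nonneg) auto
  then show "0 \<le> (?A *\<^sub>v v) \<bullet>c v" unfolding e by (simp add: less_eq_complex_def)
qed

end

section \<open>Complex Hilbert spaces\<close>

lemma scaleC_1 [simp]: "scaleC 1 x = (x :: 'a::complex_hilbert)"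
  using scaleC_of_real[of 1 x] by simp

interpretation H: cvector_space "scaleC :: complex \<Rightarrow> 'a::complex_hilbert \<Rightarrow> 'a"
  by unfold_locales (simp_all add: scaleC_add_right scaleC_add_left scaleC_scaleC)

lemma cinner_add_left: "cinner (x + y) z = cinner x z + cinner y z"
  using cinner_add_right[of z x y] by (subst (1 2 3) cinner_commute) simp

lemma cinner_scaleC_left: "cinner (scaleC a x) y = cnj a * cinner x y"
  by (subst (1 2) cinner_commute) (simp add: cinner_scaleC_right)

lemma cinner_0_right [simp]: "cinner x 0 = 0" and cinner_0_left [simp]: "cinner 0 x = 0"
  using cinner_scaleC_right[of x 0 x] cinner_scaleC_left[of 0 x x] by simp_all

lemma cinner_minus_right: "cinner x (- y) = - cinner x y" and cinner_minus_left: "cinner (- x) y = - cinner x y"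
  using cinner_scaleC_right[of x "-1" y] cinner_scaleC_left[of "-1" x y] by simp_all

lemma cinner_diff_right: "cinner x (y - z) = cinner x y - cinner x z"
  and cinner_diff_left: "cinner (x - y) z = cinner x z - cinner y z"
  using cinner_add_right[of x y "- z"] cinner_add_left[of x "- y" z]
  by (simp_all add: cinner_minus_right cinner_minus_left)

lemma cinner_sum_right: "cinner x (\<Sum>i\<in>A. f i) = (\<Sum>i\<in>A. cinner x (f i))"
  and cinner_sum_left: "cinner (\<Sum>i\<in>A. f i) x = (\<Sum>i\<in>A. cinner (f i) x)"
  by (induction A rule: infinite_finite_induct) (simp_all add: cinner_add_right cinner_add_left)

lemma cinner_self: "cinner x x = complex_of_real ((norm x)\<^sup>2)"
proof -
  have "Im (cinner x x) = 0" using cinner_commute[of x x] by (metis complex_cnj_cancel_iff complex_is_Real_iff Reals_cnj_iff)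
  then show ?thesis by (simp add: complex_eq_iff Re_cinner power2_norm_eq_inner del: of_real_power)
qed

lemma cinner_eqI: "(\<And>z. cinner z x = cinner z y) \<Longrightarrow> x = y"
  using cinner_self[of "x - y"] by (simp add: cinner_diff_right)

lemma norm_scaleC: "norm (scaleC a x) = cmod a * norm x"
proof -
  have "complex_of_real ((norm (scaleC a x))\<^sup>2) = cinner (scaleC a x) (scaleC a x)"
    by (rule cinner_self[symmetric])
  also have "\<dots> = cnj a * (a * cinner x x)" by (simp add: cinner_scaleC_left cinner_scaleC_right)
  also have "\<dots> = complex_of_real ((cmod a * norm x)\<^sup>2)"
    unfolding cinner_self power_mult_distrib of_real_mult complex_norm_square[of a] by (simp only: mult_ac)
  finally have "complex_of_real ((norm (scaleC a x))\<^sup>2) = complex_of_real ((cmod a * norm x)\<^sup>2)" .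
  then have "(norm (scaleC a x))\<^sup>2 = (cmod a * norm x)\<^sup>2" by (simp only: of_real_eq_iff)
  then show ?thesis by simp
qed

text \<open>Expresses the complex inner product through the real one, so that real polarisation
  settles norm-preserving maps; multiplication by i is then preserved or reversed according to
  linearity or antilinearity.\<close>

lemma cinner_Complex: "cinner x y = Complex (inner x y) (inner (scaleC \<i> x) y)"
proof -
  have "cinner (scaleC \<i> x) y = - \<i> * cinner x y" by (simp add: cinner_scaleC_left)
  then have "inner (scaleC \<i> x) y = Im (cinner x y)" using Re_cinner[of "scaleC \<i> x" y] by simp
  then show ?thesis by (simp add: complex_eq_iff Re_cinner)
qed

lemma Cauchy_Schwarz_cinner: "cmod (cinner x y) \<le> norm x * norm y"
proof (cases "cinner x y = 0")
  case False
  define a where "a = cnj (cinner x y) / cmod (cinner x y)"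
  have "cinner x (scaleC a y) = complex_of_real ((cmod (cinner x y))\<^sup>2) / cmod (cinner x y)"
    unfolding complex_norm_square by (simp add: a_def cinner_scaleC_right mult.commute)
  also have "\<dots> = cmod (cinner x y)" using False by (simp add: power2_eq_square)
  finally have "cinner x (scaleC a y) = cmod (cinner x y)" .
  then have "cmod (cinner x y) = inner x (scaleC a y)" by (metis Re_cinner Re_complex_of_real)
  also have "\<dots> \<le> norm x * norm (scaleC a y)" by (rule norm_cauchy_schwarz)
  also have "\<dots> = norm x * norm y" using False by (simp add: norm_scaleC a_def norm_divide)
  finally show ?thesis .
qed simp

lemma bounded_linear_cinner_right: "bounded_linear (cinner x)"
  by (rule bounded_linear_intro[where K = "norm x"])
    (simp_all add: cinner_add_right Cauchy_Schwarz_cinner[THEN order_trans] cinner_scaleC_right mult.commute scaleR_conv_of_real flip: scaleC_of_real)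

lemma bounded_linear_cinner_left: "bounded_linear (\<lambda>x. cinner x y)"
  by (rule bounded_linear_intro[where K = "norm y"])
    (simp_all add: cinner_add_left Cauchy_Schwarz_cinner cinner_scaleC_left scaleR_conv_of_real flip: scaleC_of_real)

lemmas continuous_on_cinner_right [continuous_intros] = bounded_linear.continuous_on[OF bounded_linear_cinner_right]
  and continuous_on_cinner_left [continuous_intros] = bounded_linear.continuous_on[OF bounded_linear_cinner_left]

lemma bounded_linear_scaleC: "bounded_linear (scaleC a :: 'a::complex_hilbert \<Rightarrow> 'a)"
  by (rule bounded_linear_intro[where K = "cmod a"])
    (simp_all add: scaleC_add_right norm_scaleC scaleC_scaleC mult.commute flip: scaleC_of_real)

lemma dense_eqI:
  fixes f g :: "'a::topological_space \<Rightarrow> 'b::t2_space"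
  assumes "closure S = UNIV" "continuous_on UNIV f" "continuous_on UNIV g" "\<And>x. x \<in> S \<Longrightarrow> f x = g x"
  shows "f x = g x"
proof -
  have "closed {x. f x = g x}" using assms(2,3) by (rule closed_Collect_eq)
  then have "closure S \<subseteq> {x. f x = g x}" using assms(4) by (intro closure_minimal) auto
  then show ?thesis using assms(1) by auto
qed

lemma dense_cinner_zero:
  assumes "closure S = UNIV" "\<And>y. y \<in> S \<Longrightarrow> cinner y x = 0"
  shows "x = 0"
proof (rule cinner_eqI)
  show "cinner z x = cinner z 0" for z
    by (rule dense_eqI[of S "\<lambda>z. cinner z x" "\<lambda>z. cinner z 0"]) (use assms in \<open>auto intro!: continuous_intros\<close>)
qed

lemma bounded_clinear_add: "bounded_clinear T \<Longrightarrow> T (x + y) = T x + T y"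
  and bounded_clinear_scaleC: "bounded_clinear T \<Longrightarrow> T (scaleC a x) = scaleC a (T x)"
  and bounded_clinear_diff: "bounded_clinear T \<Longrightarrow> T (x - y) = T x - T y"
  and bounded_clinear_0: "bounded_clinear T \<Longrightarrow> T 0 = 0"
  and bounded_clinear_minus: "bounded_clinear T \<Longrightarrow> T (- x) = - T x"
  and bounded_clinear_sum: "bounded_clinear T \<Longrightarrow> T (\<Sum>i\<in>A. f i) = (\<Sum>i\<in>A. T (f i))"
  by (auto simp: bounded_clinear_def bounded_linear.linear linear_add linear_diff linear_0 linear_neg linear_sum)

lemma bounded_clinear_continuous: "bounded_clinear T \<Longrightarrow> continuous_on S T"
  using bounded_linear.continuous_on[of T S "\<lambda>x. x"] by (simp add: bounded_clinear_def)

lemma bounded_clinear_compose: "bounded_clinear S \<Longrightarrow> bounded_clinear T \<Longrightarrow> bounded_clinear (\<lambda>x. S (T x))"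
  by (auto simp: bounded_clinear_def intro: bounded_linear_compose)

lemma bounded_clinear_id: "bounded_clinear id" "bounded_clinear (\<lambda>x. x)"
  by (simp_all add: bounded_clinear_def bounded_linear_ident id_def)

lemma norm_preserving_inner:
  fixes T :: "'a::real_inner \<Rightarrow> 'b::real_inner"
  assumes "bounded_linear T" "\<And>x. norm (T x) = norm x"
  shows "inner (T x) (T y) = inner x y"
  by (simp only: dot_norm assms(2) linear_add[OF bounded_linear.linear[OF assms(1)], symmetric])

lemma unitary_op_cinner: "unitary_op T \<Longrightarrow> cinner (T x) (T y) = cinner x y"
proof -
  assume T: "unitary_op T"
  then have T': "bounded_linear T" "\<And>x. norm (T x) = norm x"
    by (auto simp: unitary_op_def bounded_clinear_def)
  note i = norm_preserving_inner[OF T']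
  have "scaleC a (T x) = T (scaleC a x)" for a x
    using T by (simp add: unitary_op_def bounded_clinear_def)
  then show "cinner (T x) (T y) = cinner x y" by (simp only: cinner_Complex i)
qed

lemma antiunitary_op_cinner: "antiunitary_op T \<Longrightarrow> cinner (T x) (T y) = cinner y x"
proof -
  assume T: "antiunitary_op T"
  then have T': "bounded_linear T" "\<And>x. norm (T x) = norm x"
    by (auto simp: antiunitary_op_def)
  note i = norm_preserving_inner[OF T']
  have e: "scaleC \<i> (T x) = - T (scaleC \<i> x)" using T
    by (auto simp: antiunitary_op_def)
  have "cinner (T x) (T y) = cnj (cinner x y)"
  proof (rule complex_eqI)
    show "Re (cinner (T x) (T y)) = Re (cnj (cinner x y))" by (simp add: Re_cinner i)
    have "Im (cinner (T x) (T y)) = inner (scaleC \<i> (T x)) (T y)" by (subst cinner_Complex) simp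
    also have "\<dots> = - inner (scaleC \<i> x) y" by (simp only: e inner_minus_left i)
    also have "\<dots> = - Im (cinner x y)" by (subst cinner_Complex[of x y]) simp
    finally show "Im (cinner (T x) (T y)) = Im (cnj (cinner x y))" by simp
  qed
  also have "\<dots> = cinner y x" by (rule cinner_commute[symmetric])
  finally show "cinner (T x) (T y) = cinner y x" .
qed

definition csubspace :: "'a::complex_hilbert set \<Rightarrow> bool"
  where "csubspace M \<longleftrightarrow> 0 \<in> M \<and> (\<forall>x\<in>M. \<forall>y\<in>M. x + y \<in> M) \<and> (\<forall>a. \<forall>x\<in>M. scaleC a x \<in> M)"

lemma csubspace_subspace: "csubspace M \<longleftrightarrow> H.subspace M"
  by (auto simp: csubspace_def H.subspace_def)

lemma csubspace_diff: "csubspace M \<Longrightarrow> x \<in> M \<Longrightarrow> y \<in> M \<Longrightarrow> x - y \<in> M"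
  by (auto simp: csubspace_subspace intro: H.subspace_diff)

lemma closure_csubspace:
  assumes M: "csubspace M" shows "csubspace (closure M)"
proof -
  have "x + y \<in> closure M" if x: "x \<in> closure M" and y: "y \<in> closure M" for x y
  proof -
    obtain f g where "\<forall>n. f n \<in> M" "f \<longlonglongrightarrow> x" "\<forall>n. g n \<in> M" "g \<longlonglongrightarrow> y"
      using x y unfolding closure_sequential by blast
    then show ?thesis using M unfolding closure_sequential
      by (intro exI[of _ "\<lambda>n. f n + g n"]) (auto simp: csubspace_def intro: tendsto_add)
  qed
  moreover have "scaleC a x \<in> closure M" if x: "x \<in> closure M" for a x
  proof -
    obtain f where "\<forall>n. f n \<in> M" "f \<longlonglongrightarrow> x" using x unfolding closure_sequential by blast
    then show ?thesis using M unfolding closure_sequential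
      by (intro exI[of _ "\<lambda>n. scaleC a (f n)"]) (auto simp: csubspace_def intro: bounded_linear.tendsto[OF bounded_linear_scaleC])
  qed
  ultimately show ?thesis using M by (auto simp: csubspace_def intro: closure_subset[THEN subsetD])
qed

text \<open>A minimising sequence for the distance is Cauchy by the parallelogram identity applied
  to the midpoint w. If its limit had a nonzero inner product with some \<mu>, a small move along
  \<mu> would bring it closer.\<close>

lemma projection_exists:
  fixes M :: "'a::complex_hilbert set"
  assumes M: "csubspace M" "closed M"
  shows "\<exists>\<eta>\<in>M. \<forall>\<mu>\<in>M. cinner \<mu> (\<xi> - \<eta>) = 0"
proof -
  define D where "D = (INF y\<in>M. (norm (\<xi> - y))\<^sup>2)"
  have M0: "M \<noteq> {}" using M(1) by (auto simp: csubspace_def)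
  have bdd: "bdd_below ((\<lambda>y. (norm (\<xi> - y))\<^sup>2) ` M)" by (intro bdd_belowI[of _ 0]) auto
  have D: "D \<le> (norm (\<xi> - y))\<^sup>2" if "y \<in> M" for y
    unfolding D_def using bdd that by (rule cINF_lower)
  have "\<exists>y\<in>M. (norm (\<xi> - y))\<^sup>2 < D + 1 / (real n + 1)" for n
    using cINF_less_iff[OF M0 bdd, of "D + 1 / (real n + 1)"] by (simp add: D_def add_pos_pos)
  then obtain y where y: "y n \<in> M" "(norm (\<xi> - y n))\<^sup>2 < D + 1 / (real n + 1)" for n by metis
  have par: "(norm (y n - y m))\<^sup>2 \<le> 2 * (1 / (real n + 1)) + 2 * (1 / (real m + 1))" for m n
  proof -
    define w where "w = scaleR (1/2) (y n + y m)"
    have "w = scaleC (1/2) (y n + y m)" using scaleC_of_real[of "1/2" "y n + y m"] by (simp add: w_def)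
    then have "w \<in> M" using M(1) y(1) by (auto simp: csubspace_def)
    then have "D \<le> (norm (\<xi> - w))\<^sup>2" by (rule D)
    moreover have "(norm (y n - y m))\<^sup>2 = 2 * (norm (\<xi> - y n))\<^sup>2 + 2 * (norm (\<xi> - y m))\<^sup>2 - 4 * (norm (\<xi> - w))\<^sup>2"
      by (simp add: power2_norm_eq_inner w_def inner_diff_left inner_diff_right inner_add_left inner_add_right inner_commute algebra_simps)
    ultimately show ?thesis using y(2)[of n] y(2)[of m] by linarith
  qed
  have "Cauchy y"
  proof (rule CauchyI)
    fix e :: real assume e: "0 < e"
    obtain N where N: "4 / e\<^sup>2 < real N" using reals_Archimedean2 by blast
    have "norm (y m - y n) < e" if "m \<ge> N" "n \<ge> N" for m n
    proof -
      have "0 < 4 / e\<^sup>2" using e by simp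
      then have N0: "0 < real N" using N by linarith
      have "1 / (real m + 1) \<le> 1 / real N" "1 / (real n + 1) \<le> 1 / real N"
        using that N0 by (auto intro!: divide_left_mono)
      then have "(norm (y m - y n))\<^sup>2 \<le> 4 * (1 / real N)" using par[of m n] by linarith
      also have "\<dots> < e\<^sup>2"
      proof -
        have "4 < real N * e\<^sup>2" using N e by (simp only: pos_divide_less_eq zero_less_power)
        then show ?thesis using N0 by (simp add: pos_divide_less_eq mult.commute)
      qed
      finally show ?thesis using e by (intro power2_less_imp_less[of _ e]) auto
    qed
    then show "\<exists>N. \<forall>m\<ge>N. \<forall>n\<ge>N. norm (y m - y n) < e" by blast
  qed
  then obtain \<eta> where \<eta>: "y \<longlonglongrightarrow> \<eta>" using Cauchy_convergent convergent_def by blast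
  have \<eta>M: "\<eta> \<in> M" using M(2) y(1) \<eta> by (metis closed_sequentially)
  have "(\<lambda>n. (norm (\<xi> - y n))\<^sup>2) \<longlonglongrightarrow> (norm (\<xi> - \<eta>))\<^sup>2" using \<eta> by (intro tendsto_intros)
  moreover have "(\<lambda>n. D + 1 / (real n + 1)) \<longlonglongrightarrow> D + 0"
    by (intro tendsto_intros) (use LIMSEQ_inverse_real_of_nat in \<open>simp add: inverse_eq_divide add.commute\<close>)
  ultimately have "(norm (\<xi> - \<eta>))\<^sup>2 \<le> D + 0"
    by (rule LIMSEQ_le) (use y(2) in \<open>auto intro: less_imp_le\<close>)
  then have le: "(norm (\<xi> - \<eta>))\<^sup>2 \<le> D" by simp
  have "cinner \<mu> (\<xi> - \<eta>) = 0" if \<mu>: "\<mu> \<in> M" for \<mu>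
  proof (rule ccontr)
    define c where "c = cinner \<mu> (\<xi> - \<eta>)"
    assume "cinner \<mu> (\<xi> - \<eta>) \<noteq> 0"
    then have c: "0 < (cmod c)\<^sup>2" by (simp add: c_def)
    \<comment> \<open>The step is small enough for the gain of order s to exceed the loss of order s
      squared; the summand 1 avoids a division by zero.\<close>
    define s where "s = 1 / ((norm \<mu>)\<^sup>2 + 1)"
    have "0 < (norm \<mu>)\<^sup>2 + 1" by (rule add_nonneg_pos) simp_all
    then have s: "0 < s" "s * (norm \<mu>)\<^sup>2 < 1" by (simp_all add: s_def)
    define v where "v = scaleC (s * c) \<mu>"
    have "\<eta> + v \<in> M" using \<eta>M \<mu> M(1) by (auto simp: csubspace_def v_def)
    then have "(norm (\<xi> - \<eta>))\<^sup>2 \<le> (norm (\<xi> - (\<eta> + v)))\<^sup>2" using D[of "\<eta> + v"] le by linarith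
    also have "\<dots> = (norm (\<xi> - \<eta>))\<^sup>2 - 2 * inner v (\<xi> - \<eta>) + (norm v)\<^sup>2"
      by (simp add: power2_norm_eq_inner inner_diff_left inner_diff_right inner_add_left inner_add_right inner_commute)
    finally have "2 * inner v (\<xi> - \<eta>) \<le> (norm v)\<^sup>2" by simp
    moreover have "cinner v (\<xi> - \<eta>) = complex_of_real (s * (cmod c)\<^sup>2)"
      unfolding of_real_mult complex_norm_square[of c] by (simp add: v_def cinner_scaleC_left c_def[symmetric] mult_ac)
    then have "inner v (\<xi> - \<eta>) = s * (cmod c)\<^sup>2" using Re_cinner[of v "\<xi> - \<eta>"] by simp
    moreover have "(norm v)\<^sup>2 = s * (cmod c)\<^sup>2 * (s * (norm \<mu>)\<^sup>2)"
    proof -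
      have "norm v = s * cmod c * norm \<mu>" using s by (simp add: v_def norm_scaleC norm_mult mult_ac)
      then show ?thesis by (simp only: power2_eq_square mult_ac)
    qed
    moreover have "s * (cmod c)\<^sup>2 * (s * (norm \<mu>)\<^sup>2) < s * (cmod c)\<^sup>2 * 1"
      using s c by (intro mult_strict_left_mono) auto
    moreover have "0 < s * (cmod c)\<^sup>2" using s c by simp
    ultimately show False by linarith
  qed
  then show ?thesis using \<eta>M by blast
qed

lemma orth_proj_eqI:
  assumes M: "csubspace M" and "\<eta> \<in> M" "\<And>\<mu>. \<mu> \<in> M \<Longrightarrow> cinner \<mu> (\<xi> - \<eta>) = 0"
  shows "orth_proj M \<xi> = \<eta>"
  unfolding orth_proj_def
proof (rule the_equality)
  fix \<eta>' assume *: "\<eta>' \<in> M \<and> (\<forall>\<mu>\<in>M. cinner \<mu> (\<xi> - \<eta>') = 0)"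
  have "\<eta> - \<eta>' \<in> M" using M assms(2) * by (auto intro: csubspace_diff)
  then have "cinner (\<eta> - \<eta>') (\<xi> - \<eta>') - cinner (\<eta> - \<eta>') (\<xi> - \<eta>) = 0" using * assms(3) by auto
  then have "cinner (\<eta> - \<eta>') (\<eta> - \<eta>') = 0" by (simp add: cinner_diff_right)
  then show "\<eta>' = \<eta>" by (simp add: cinner_self)
qed (use assms in auto)

lemma orth_proj:
  assumes M: "csubspace M" "closed M"
  shows "orth_proj M \<xi> \<in> M" "\<And>\<mu>. \<mu> \<in> M \<Longrightarrow> cinner \<mu> (orth_proj M \<xi>) = cinner \<mu> \<xi>"
proof -
  obtain \<eta> where \<eta>: "\<eta> \<in> M" "\<And>\<mu>. \<mu> \<in> M \<Longrightarrow> cinner \<mu> (\<xi> - \<eta>) = 0" using projection_exists[OF M] by blast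
  then have "orth_proj M \<xi> = \<eta>" by (intro orth_proj_eqI M)
  then show "orth_proj M \<xi> \<in> M" "\<And>\<mu>. \<mu> \<in> M \<Longrightarrow> cinner \<mu> (orth_proj M \<xi>) = cinner \<mu> \<xi>"
    using \<eta> by (auto simp: cinner_diff_right)
qed

section \<open>The Haar state\<close>

text \<open>Slicing by f on the left leg (\<open>sl\<close>) or on the right leg
  (\<open>sr\<close>); applied to a coproduct these are convolutions by f.\<close>

definition sl :: "(falg \<Rightarrow> complex) \<Rightarrow> falg2 \<Rightarrow> falg" where "sl f = bilin_ext scaleF (\<lambda>a b. scaleF (f a) b)"
definition sr :: "(falg \<Rightarrow> complex) \<Rightarrow> falg2 \<Rightarrow> falg" where "sr f = bilin_ext scaleF (\<lambda>a b. scaleF (f b) a)"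

lemma linearF_mult_left': "linearF sc f \<Longrightarrow> linearF sc (\<lambda>a. f (x * a))"
  and linearF_mult_right': "linearF sc f \<Longrightarrow> linearF sc (\<lambda>a. f (a * x))"
  using linearF_compose[OF _ linearF_mult_left] linearF_compose[OF _ linearF_mult_right] by auto

lemma bilinF_slice:
  assumes f: "linearF (*) f"
  shows "bilinF scaleF (\<lambda>a b. scaleF (f a) b)" "bilinF scaleF (\<lambda>a b. scaleF (f b) a)"
proof -
  have "linearF scaleF (\<lambda>x. scaleF (f x) y)" "linearF scaleF (\<lambda>x. scaleF a x)" for a y
    unfolding linearF_def
    by (simp_all add: linearF_add[OF f] linearF_scale[OF f] F.scale_left_distrib F.scale_right_distrib mult.commute)
  then show "bilinF scaleF (\<lambda>a b. scaleF (f a) b)" "bilinF scaleF (\<lambda>a b. scaleF (f b) a)"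
    by (simp_all add: bilinF_def)
qed

lemma sl_tensF: "linearF (*) f \<Longrightarrow> sl f (tensF x y) = scaleF (f x) y"
  and sr_tensF: "linearF (*) f \<Longrightarrow> sr f (tensF x y) = scaleF (f y) x"
  unfolding sl_def sr_def by (simp_all add: F.bilin_ext_tensF bilinF_slice)

lemma sl_add: "sl f (s + t) = sl f s + sl f t" and sr_add: "sr f (s + t) = sr f s + sr f t"
  and sl_sum: "sl f (\<Sum>i\<in>A. g i) = (\<Sum>i\<in>A. sl f (g i))" and sr_sum: "sr f (\<Sum>i\<in>A. g i) = (\<Sum>i\<in>A. sr f (g i))"
  unfolding sl_def sr_def by (simp_all add: F.bilin_ext_add F.bilin_ext_sum)

lemma slice_mult:
  assumes "linearF (*) f"
  shows "sl f (tensF x y * t) = y * sl (\<lambda>a. f (x * a)) t" "sr f (t * tensF x y) = sr (\<lambda>b. f (b * y)) t * x"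
    "sl f (t * tensF x y) = sl (\<lambda>a. f (a * x)) t * y" "sr f (tensF x y * t) = x * sr (\<lambda>b. f (y * b)) t"
  by (induction t rule: falg2_induct)
    (simp_all add: tensF_mult sl_tensF sr_tensF assms linearF_mult_left' linearF_mult_right' distrib_left distrib_right sl_add sr_add mult_scaleF_left mult_scaleF_right)

lemma sum_pick:
  fixes n :: nat and c :: "nat \<Rightarrow> 'a::semiring_1"
  assumes "a < n"
  shows "(\<Sum>q<n. c q * (if q = a \<and> P then 1 else 0)) = (if P then c a else 0)"
    "(\<Sum>q<n. c q * (if P \<and> q = a then 1 else 0)) = (if P then c a else 0)"
proof -
  have "(\<Sum>q<n. c q * (if q = a \<and> P then 1 else 0)) = (\<Sum>q<n. if q = a then (if P then c a else 0) else 0)"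
    by (intro sum.cong) auto
  then show *: "(\<Sum>q<n. c q * (if q = a \<and> P then 1 else 0)) = (if P then c a else 0)" using assms by simp
  then show "(\<Sum>q<n. c q * (if P \<and> q = a then 1 else 0)) = (if P then c a else 0)" by (simp only: conj_commute)
qed

text \<open>Solves a linear system with coefficients in \<S> by multiplying with a left inverse
  \<open>V\<close> of the coefficient matrix. The factor \<open>d\<close> allows \<open>V\<close> to
  be an inverse only up to a scalar, as in the weighted relations.\<close>

lemma eqS_contract_left:
  fixes n :: nat
  assumes 1: "\<And>j. j < n \<Longrightarrow> eqS fs (\<Sum>p<n. A p j * B p) (C j)" and m: "m < n"
    and 2: "\<And>p. p < n \<Longrightarrow> eqS fs (\<Sum>j<n. V j * A p j) (if m = p then d else 0)"
  shows "eqS fs (d * B m) (\<Sum>j<n. V j * C j)"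
proof -
  have "eqS fs (\<Sum>p<n. (\<Sum>j<n. V j * A p j) * B p) (\<Sum>p<n. (if m = p then d else 0) * B p)"
    by (intro eqS_sum eqS_mult eqS_refl 2) auto
  also have "(\<Sum>p<n. (if m = p then d else 0) * B p) = (\<Sum>p<n. if p = m then d * B m else 0)"
    by (intro sum.cong) auto
  also have "\<dots> = d * B m" using m by simp
  also have "(\<Sum>p<n. (\<Sum>j<n. V j * A p j) * B p) = (\<Sum>j<n. V j * (\<Sum>p<n. A p j * B p))"
    unfolding sum_distrib_left sum_distrib_right by (subst sum.swap) (simp add: mult.assoc)
  finally have "eqS fs (d * B m) (\<Sum>j<n. V j * (\<Sum>p<n. A p j * B p))" by (rule eqS_sym)
  also have "eqS fs \<dots> (\<Sum>j<n. V j * C j)"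
    by (intro eqS_sum eqS_mult eqS_refl 1) auto
  finally show ?thesis .
qed

lemma eqS_contract_right:
  fixes n :: nat
  assumes 1: "\<And>j. j < n \<Longrightarrow> eqS fs (\<Sum>p<n. B p * A j p) (C j)" and m: "m < n"
    and 2: "\<And>p. p < n \<Longrightarrow> eqS fs (\<Sum>j<n. A j p * V j) (if p = m then d else 0)"
  shows "eqS fs (B m * d) (\<Sum>j<n. C j * V j)"
proof -
  have "eqS fs (\<Sum>p<n. B p * (\<Sum>j<n. A j p * V j)) (\<Sum>p<n. B p * (if p = m then d else 0))"
    by (intro eqS_sum eqS_mult eqS_refl 2) auto
  also have "(\<Sum>p<n. B p * (if p = m then d else 0)) = (\<Sum>p<n. if p = m then B m * d else 0)"
    by (intro sum.cong) auto
  also have "\<dots> = B m * d" using m by simp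
  also have "(\<Sum>p<n. B p * (\<Sum>j<n. A j p * V j)) = (\<Sum>j<n. (\<Sum>p<n. B p * A j p) * V j)"
    unfolding sum_distrib_left sum_distrib_right by (subst sum.swap) (simp add: mult.assoc)
  finally have "eqS fs (B m * d) (\<Sum>j<n. (\<Sum>p<n. B p * A j p) * V j)" by (rule eqS_sym)
  also have "eqS fs \<dots> (\<Sum>j<n. C j * V j)"
    by (intro eqS_sum eqS_mult eqS_refl 1) auto
  finally show ?thesis .
qed

text \<open>The traces of \<open>qmat\<close> and, below, of its inverse. The quantum dimension is
  the geometric mean of the two.\<close>

definition hmusum :: "factor list \<Rightarrow> nat \<Rightarrow> real" where "hmusum fs k = (\<Sum>i<fdim fs k. hmu fs k i)"
definition hmuinv :: "factor list \<Rightarrow> nat \<Rightarrow> real" where "hmuinv fs k = (\<Sum>i<fdim fs k. inverse (hmu fs k i))"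

context quantum_cayley_graph begin

abbreviation "h \<equiv> haar G"
abbreviation "L \<equiv> gns G"

lemma linearF_h: "linearF (*) h"
  using haar_state by (auto simp: is_haar_state_def linear_on_S_def intro: linear_imp_linearF)

lemma h_eqS: "eqS fs x y \<Longrightarrow> h x = h y"
  using haar_state by (intro linearF_eqS[OF linearF_h]) (auto simp: is_haar_state_def linear_on_S_def)

lemmas h_add = linearF_add[OF linearF_h] and h_scaleF = linearF_scale[OF linearF_h] and h_0 = linearF_0[OF linearF_h]
  and h_sum = linearF_sum[OF linearF_h] and h_diff = linearF_diff[OF linearF_h]

lemma h_1: "h 1 = 1"
  using haar_state by (simp add: is_haar_state_def)

lemma h_cst: "h (cst a) = a"
  using h_scaleF[of a 1] by (simp add: scaleF_1_cst h_1)

lemma haar_invariance: "eqS fs (sl h (delta fs x)) (cst (h x))" "eqS fs (sr h (delta fs x)) (cst (h x))"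
  using haar_state by (auto simp: is_haar_state_def sl_def sr_def)

lemma linearF_L: "linearF scaleC L"
  using gns_linear by (auto simp: linear_on_S_def intro: linear_imp_linearF)

lemma L_eqS: "eqS fs x y \<Longrightarrow> L x = L y"
  using gns_linear by (intro linearF_eqS[OF linearF_L]) (auto simp: linear_on_S_def)

lemmas L_add = linearF_add[OF linearF_L] and L_scaleF = linearF_scale[OF linearF_L] and L_0 = linearF_0[OF linearF_L]
  and L_sum = linearF_sum[OF linearF_L] and L_diff = linearF_diff[OF linearF_L]

lemma h_starF: "h (starF x) = cnj (h x)"
  using gns_cinner[of x 1] gns_cinner[of 1 x] cinner_commute[of "L x" "L 1"] by simp

end

locale valid_cayley_graph = quantum_cayley_graph +
  assumes valid: "k < length fs \<Longrightarrow> valid_factor (fs ! k)"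
begin

section \<open>Orthogonality relations and modular property of the Haar state\<close>

context
  fixes k n
  assumes k: "k < length fs" and n: "n = fdim fs k"
begin

lemma n_pos: "0 < n"
  using valid_fmat(3)[OF k valid[OF k]] n by simp

private abbreviation "U \<equiv> hx fs k False"
private abbreviation "Ub \<equiv> hx fs k True"
private abbreviation "mu \<equiv> hmu fs k"

lemmas mu_pos = hmu_pos[OF k valid[OF k] n refl]

lemmas dlt = delta_hx[OF k valid[OF k] n refl]
lemmas rls = hx_rels[OF k valid[OF k] n refl]

text \<open>A form of Schur's lemma: for fixed row indices, invariance makes the matrix of the
  values h(u_im^* u_k'q), indexed by m and q, commute with u. A functional dual to u_ab reads off
  the coefficients, which gives the entries of a commutant that consists of scalars.\<close>

lemma haar_Ub_U_aux:
  assumes "i < n" "k' < n" "a < n" "m < n" "l < n" "b < n"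
  shows "(if l = b then h (Ub i m * U k' a) else 0) = (if a = m then h (Ub i b * U k' l) else 0)"
proof -
  obtain f where f: "kills fs f" "\<forall>i<n. \<forall>j<n. f (U i j) = (if i = a \<and> j = b then 1 else 0)"
    using hx_functional[OF valid k n \<open>a < n\<close> \<open>b < n\<close>] by blast
  have lf: "linearF (*) f" using f(1) by (simp add: kills_def)
  have inv: "eqS fs (\<Sum>p<n. Ub p j * (\<Sum>q<n. scaleF (h (Ub i p * U k' q)) (U q l))) (cst (h (Ub i j * U k' l)))" if "j < n" for j
    using haar_invariance(1)[of "Ub i j * U k' l"] assms that
    by (simp add: delta_mult dlt sum_distrib_right sl_sum slice_mult linearF_h linearF_mult_left' sl_tensF)
  have "eqS fs (1 * (\<Sum>q<n. scaleF (h (Ub i m * U k' q)) (U q l))) (\<Sum>j<n. U m j * cst (h (Ub i j * U k' l)))"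
    by (rule eqS_contract_left[where A = Ub, OF inv \<open>m < n\<close> rls(1)]) (use assms in auto)
  then have "eqS fs (\<Sum>q<n. scaleF (h (Ub i m * U k' q)) (U q l)) (\<Sum>j<n. scaleF (h (Ub i j * U k' l)) (U m j))"
    by (simp add: scaleF_def cst_commute[of "U m _"])
  from kills_eqS[OF f(1) this]
  have "(\<Sum>q<n. h (Ub i m * U k' q) * f (U q l)) = (\<Sum>j<n. h (Ub i j * U k' l) * f (U m j))"
    by (simp only: linearF_sum[OF lf] linearF_scale[OF lf])
  moreover have "(\<Sum>q<n. h (Ub i m * U k' q) * f (U q l)) = (\<Sum>q<n. h (Ub i m * U k' q) * (if q = a \<and> l = b then 1 else 0))"
    using f(2) assms by (intro sum.cong refl) simp
  moreover have "(\<Sum>j<n. h (Ub i j * U k' l) * f (U m j)) = (\<Sum>j<n. h (Ub i j * U k' l) * (if m = a \<and> j = b then 1 else 0))"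
    using f(2) assms by (intro sum.cong refl) simp
  ultimately show ?thesis using assms by (simp only: sum_pick) auto
qed

text \<open>The mirror image: invariance on the other side, with the column indices fixed.\<close>

lemma haar_U_Ub_aux:
  assumes "i < n" "j < n" "a < n" "m < n" "l < n" "b < n"
  shows "(if i = a then h (U b j * Ub m l) else 0) = (if m = b then h (U i j * Ub a l) else 0)"
proof -
  obtain f where f: "kills fs f" "\<forall>i<n. \<forall>j<n. f (U i j) = (if i = a \<and> j = b then 1 else 0)"
    using hx_functional[OF valid k n \<open>a < n\<close> \<open>b < n\<close>] by blast
  have lf: "linearF (*) f" using f(1) by (simp add: kills_def)
  have inv: "eqS fs (\<Sum>q<n. (\<Sum>p<n. scaleF (h (U p j * Ub q l)) (U i p)) * Ub k' q) (cst (h (U i j * Ub k' l)))" if "k' < n" for k'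
    using haar_invariance(2)[of "U i j * Ub k' l"] assms that
    by (simp add: delta_mult dlt sum_distrib_left sr_sum slice_mult linearF_h linearF_mult_right' sr_tensF flip: sum_distrib_right)
  have "eqS fs ((\<Sum>p<n. scaleF (h (U p j * Ub m l)) (U i p)) * 1) (\<Sum>k'<n. cst (h (U i j * Ub k' l)) * U k' m)"
    by (rule eqS_contract_right[where A = Ub, OF inv \<open>m < n\<close> rls(2)]) (use assms in auto)
  then have "eqS fs (\<Sum>p<n. scaleF (h (U p j * Ub m l)) (U i p)) (\<Sum>k'<n. scaleF (h (U i j * Ub k' l)) (U k' m))"
    by (simp add: scaleF_def)
  from kills_eqS[OF f(1) this]
  have "(\<Sum>p<n. h (U p j * Ub m l) * f (U i p)) = (\<Sum>k'<n. h (U i j * Ub k' l) * f (U k' m))"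
    by (simp only: linearF_sum[OF lf] linearF_scale[OF lf])
  moreover have "(\<Sum>p<n. h (U p j * Ub m l) * f (U i p)) = (\<Sum>p<n. h (U p j * Ub m l) * (if i = a \<and> p = b then 1 else 0))"
    using f(2) assms by (intro sum.cong refl) simp
  moreover have "(\<Sum>k'<n. h (U i j * Ub k' l) * f (U k' m)) = (\<Sum>k'<n. h (U i j * Ub k' l) * (if k' = a \<and> m = b then 1 else 0))"
    using f(2) assms by (intro sum.cong refl) simp
  ultimately show ?thesis using assms by (simp only: sum_pick)
qed

text \<open>What the commutation argument leaves undetermined: the dependence on the row indices for
  the one order of the factors, and on the column indices for the other. The index 0 exists since n
  is positive.\<close>

private definition "A i j = h (Ub i 0 * U j 0)"
private definition "B i j = h (U 0 i * Ub 0 j)"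

lemma haar_Ub_U_A:
  assumes "i < n" "j < n" "p < n" "l < n"
  shows "h (Ub i j * U p l) = (if j = l then A i p else 0)"
proof -
  have "h (Ub i 0 * U p 0) = h (Ub i j * U p j)" using haar_Ub_U_aux[of i p j j 0 0] haar_Ub_U_aux[of i p 0 0 j j] assms n_pos
    haar_Ub_U_aux[of i p 0 0 0 j] haar_Ub_U_aux[of i p j j j 0] haar_Ub_U_aux[of i p j j 0 0] by (auto split: if_splits)
  then show ?thesis using haar_Ub_U_aux[of i p l j 0 0] haar_Ub_U_aux[of i p l j l l] assms n_pos by (auto simp: A_def split: if_splits)
qed

lemma haar_U_Ub_B:
  assumes "i < n" "j < n" "p < n" "l < n"
  shows "h (U i j * Ub p l) = (if i = p then B j l else 0)"
  using haar_U_Ub_aux[of 0 j 0 p l i] haar_U_Ub_aux[of 0 j 0 0 l i] haar_U_Ub_aux[of i j i i l i] assms n_pos by (auto simp: B_def split: if_splits)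

text \<open>Invariance on u_il b gives a linear system for the slices of \<delta>(b), and the
  weighted row relation inverts its coefficient matrix. The weights mu_j / mu_l are the trace of the
  missing commutativity.\<close>

lemma slice_U:
  assumes "i < n" "j < n"
  shows "eqS fs (sl (\<lambda>a. h (U i j * a)) (delta fs b)) (\<Sum>l<n. scaleF (of_real (mu j / mu l) * h (U i l * b)) (Ub j l))"
proof -
  have inv: "eqS fs (\<Sum>p<n. U p l * sl (\<lambda>a. h (U i p * a)) (delta fs b)) (cst (h (U i l * b)))" if "l < n" for l
    using haar_invariance(1)[of "U i l * b"] assms that
    by (simp add: delta_mult dlt sum_distrib_right sl_sum slice_mult linearF_h)
  have "eqS fs (cst (inverse (of_real (mu j))) * sl (\<lambda>a. h (U i j * a)) (delta fs b))
    (\<Sum>l<n. scaleF (inverse (of_real (mu l))) (Ub j l) * cst (h (U i l * b)))"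
    by (rule eqS_contract_left[where A = U, OF inv \<open>j < n\<close>]) (use rls(3)[OF \<open>j < n\<close>] in \<open>auto simp: mult_scaleF_left\<close>)
  then have "eqS fs (scaleF (of_real (mu j)) (cst (inverse (of_real (mu j))) * sl (\<lambda>a. h (U i j * a)) (delta fs b)))
    (scaleF (of_real (mu j)) (\<Sum>l<n. scaleF (inverse (of_real (mu l))) (Ub j l) * cst (h (U i l * b))))"
    by (rule eqS_scaleF)
  moreover have "scaleF (of_real (mu j)) (cst (inverse (of_real (mu j))) * sl (\<lambda>a. h (U i j * a)) (delta fs b)) = sl (\<lambda>a. h (U i j * a)) (delta fs b)"
    using mu_pos[OF \<open>j < n\<close>] by (simp flip: scaleF_def)
  moreover have "scaleF (of_real (mu j)) (\<Sum>l<n. scaleF (inverse (of_real (mu l))) (Ub j l) * cst (h (U i l * b))) =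
    (\<Sum>l<n. scaleF (of_real (mu j / mu l) * h (U i l * b)) (Ub j l))"
    by (simp add: F.scale_sum_right cst_commute divide_inverse mult_ac flip: scaleF_def)
  ultimately show ?thesis by simp
qed

text \<open>The counterpart for multiplication on the right, solved with the weighted column
  relation.\<close>

lemma slice_U':
  assumes "i < n" "j < n"
  shows "eqS fs (sr (\<lambda>a. h (a * U i j)) (delta fs b)) (\<Sum>l<n. scaleF (of_real (mu l / mu i) * h (b * U l j)) (Ub l i))"
proof -
  have inv: "eqS fs (\<Sum>p<n. sr (\<lambda>a. h (a * U p j)) (delta fs b) * U l p) (cst (h (b * U l j)))" if "l < n" for l
    using haar_invariance(2)[of "b * U l j"] assms that
    by (simp add: delta_mult dlt sum_distrib_left sr_sum slice_mult linearF_h)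
  have "eqS fs (sr (\<lambda>a. h (a * U i j)) (delta fs b) * cst (of_real (mu i)))
    (\<Sum>l<n. cst (h (b * U l j)) * scaleF (of_real (mu l)) (Ub l i))"
    by (rule eqS_contract_right[where A = U, OF inv \<open>i < n\<close>]) (use rls(4)[OF _ \<open>i < n\<close>] in \<open>auto simp: mult_scaleF_right cong: if_cong\<close>)
  then have "eqS fs (scaleF (inverse (of_real (mu i))) (sr (\<lambda>a. h (a * U i j)) (delta fs b) * cst (of_real (mu i))))
    (scaleF (inverse (of_real (mu i))) (\<Sum>l<n. cst (h (b * U l j)) * scaleF (of_real (mu l)) (Ub l i)))"
    by (rule eqS_scaleF)
  moreover have "scaleF (inverse (of_real (mu i))) (sr (\<lambda>a. h (a * U i j)) (delta fs b) * cst (of_real (mu i))) = sr (\<lambda>a. h (a * U i j)) (delta fs b)"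
    using mu_pos[OF \<open>i < n\<close>] by (simp add: cst_commute flip: scaleF_def)
  moreover have "scaleF (inverse (of_real (mu i))) (\<Sum>l<n. cst (h (b * U l j)) * scaleF (of_real (mu l)) (Ub l i)) =
    (\<Sum>l<n. scaleF (of_real (mu l / mu i) * h (b * U l j)) (Ub l i))"
    by (simp add: F.scale_sum_right divide_inverse mult_ac flip: scaleF_def)
  ultimately show ?thesis by simp
qed

text \<open>Fubini: both sides are h \<otimes> h applied to (x \<otimes> 1) t (1 \<otimes>
  y).\<close>

lemma h_slices: "h (sl (\<lambda>a. h (x * a)) t * y) = h (x * sr (\<lambda>a. h (a * y)) t)"
  by (induction t rule: falg2_induct)
    (simp_all add: sl_tensF sr_tensF linearF_h linearF_mult_left' linearF_mult_right' sl_add sr_add distrib_left distrib_right h_add mult_scaleF_left mult_scaleF_right h_scaleF)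

text \<open>The Fubini identity for t = \<delta>(b), evaluated on either side by the slice formulas,
  compares h(u_ij b) with h(b u_ij). This is the modular property of the Haar state on generators,
  up to the constants A and B.\<close>

lemma haar_U_twist:
  assumes "i < n" "j < n" "p < n" "l < n"
  shows "of_real (mu l / mu j) * h (U i j * b) * A l p = of_real (mu i / mu p) * h (b * U i j) * B l p"
proof -
  have "h (sl (\<lambda>a. h (U i l * a)) (delta fs b) * U p j) = h ((\<Sum>q<n. scaleF (of_real (mu l / mu q) * h (U i q * b)) (Ub l q)) * U p j)"
    by (intro h_eqS eqS_mult eqS_refl slice_U) (use assms in auto)
  also have "\<dots> = (\<Sum>q<n. (of_real (mu l / mu q) * h (U i q * b)) * h (Ub l q * U p j))"
    by (simp add: sum_distrib_right h_sum mult_scaleF_left h_scaleF)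
  also have "\<dots> = (\<Sum>q<n. if q = j then of_real (mu l / mu j) * h (U i j * b) * A l p else 0)"
    using assms by (intro sum.cong) (auto simp: haar_Ub_U_A)
  also have "\<dots> = of_real (mu l / mu j) * h (U i j * b) * A l p" using assms by simp
  finally have 1: "h (sl (\<lambda>a. h (U i l * a)) (delta fs b) * U p j) = of_real (mu l / mu j) * h (U i j * b) * A l p" .
  have "h (U i l * sr (\<lambda>a. h (a * U p j)) (delta fs b)) = h (U i l * (\<Sum>q<n. scaleF (of_real (mu q / mu p) * h (b * U q j)) (Ub q p)))"
    by (intro h_eqS eqS_mult eqS_refl slice_U') (use assms in auto)
  also have "\<dots> = (\<Sum>q<n. (of_real (mu q / mu p) * h (b * U q j)) * h (U i l * Ub q p))"
    by (simp add: sum_distrib_left h_sum mult_scaleF_right h_scaleF)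
  also have "\<dots> = (\<Sum>q<n. if q = i then of_real (mu i / mu p) * h (b * U i j) * B l p else 0)"
    using assms by (intro sum.cong) (auto simp: haar_U_Ub_B)
  also have "\<dots> = of_real (mu i / mu p) * h (b * U i j) * B l p" using assms by simp
  finally show ?thesis using 1 h_slices[of "U i l" "delta fs b" "U p j"] by simp
qed

private lemma sum_A_B: "(\<Sum>l<n. A l l) = 1" "(\<Sum>l<n. B l l) = 1"
proof -
  have "h (\<Sum>l<n. Ub l 0 * U l 0) = h 1" using rls(2)[OF n_pos n_pos] by (intro h_eqS) simp
  then show "(\<Sum>l<n. A l l) = 1" by (simp add: h_sum A_def h_1)
  have "h (\<Sum>l<n. U 0 l * Ub 0 l) = h 1" using rls(1)[OF n_pos n_pos] by (intro h_eqS) simp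
  then show "(\<Sum>l<n. B l l) = 1" by (simp add: h_sum B_def h_1)
qed

private abbreviation "hm \<equiv> hmuinv fs k"
private abbreviation "hp \<equiv> hmusum fs k"

lemma hmuinv_pos: "0 < hm" and hmusum_pos: "0 < hp"
  unfolding hmuinv_def hmusum_def n[symmetric] using n_pos mu_pos by (auto intro!: sum_pos)

text \<open>The twist determines A and B up to a factor each, since inserting b = u_pl^* relates
  them to each other; the factors are fixed by the traces of A and B, both equal to 1 by
  unitarity.\<close>

lemma haar_values:
  assumes "i < n" "j < n"
  shows "h (U i j * b) = of_real (hm / hp * mu i * mu j) * h (b * U i j)"
    and "p < n \<Longrightarrow> l < n \<Longrightarrow> h (Ub i j * U p l) = (if i = p \<and> j = l then of_real (inverse (hm * mu i)) else 0)"
    and "p < n \<Longrightarrow> l < n \<Longrightarrow> h (U i j * Ub p l) = (if i = p \<and> j = l then of_real (mu j / hp) else 0)"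
proof -
  have mu0: "of_real (mu i) \<noteq> (0 :: complex)" if "i < n" for i using mu_pos[OF that] by simp
  obtain l0 where l0: "l0 < n" "A l0 l0 \<noteq> 0" using sum_A_B(1) by (metis (no_types, lifting) lessThan_iff sum.neutral zero_neq_one)
  \<comment> \<open>Read off from the twist at the indices l0; \<open>tw\<close> shows that the same
    r serves for all i and j.\<close>
  define r where "r = B l0 l0 / ((of_real (mu l0))\<^sup>2 * A l0 l0)"
  have tw: "h (U i j * b) = r * of_real (mu i) * of_real (mu j) * h (b * U i j)" if "i < n" "j < n" for i j b
    using haar_U_twist[OF that l0(1) l0(1), of b] l0 mu0[OF l0(1)] mu0[OF that(2)] mu0[OF that(1)]
    by (simp add: r_def field_simps power2_eq_square)
  \<comment> \<open>With distinct indices this forces both matrices to be diagonal; with equal ones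
    it makes A_ii proportional to 1 / mu_i and B_jj to mu_j.\<close>
  have BA: "(if i = p then B j l else 0) = r * of_real (mu i) * of_real (mu j) * (if l = j then A p i else 0)"
    if "i < n" "j < n" "p < n" "l < n" for i j p l
    using tw[of i j "Ub p l"] that by (simp add: haar_U_Ub_B haar_Ub_U_A)
  have r0: "r \<noteq> 0"
  proof
    assume "r = 0"
    then have "B l l = 0" if "l < n" for l using BA[OF n_pos that n_pos that] by simp
    then show False using sum_A_B(2) by simp
  qed
  have A0: "A p i = 0" if "p < n" "i < n" "p \<noteq> i" for p i
    using BA[of i 0 p 0] that n_pos r0 mu0 by simp
  have B0: "B j l = 0" if "j < n" "l < n" "j \<noteq> l" for j l
    using BA[of 0 j 0 l] that n_pos by simp
  define a where "a = A 0 0 * of_real (mu 0)"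
  have Aii: "A i i = a / of_real (mu i)" if "i < n" for i
    using BA[of i 0 i 0] BA[of 0 0 0 0] that n_pos r0 mu0[OF that] mu0[OF n_pos]
    by (simp add: a_def field_simps)
  have Bjj: "B j j = r * a * of_real (mu j)" if "j < n" for j
    using BA[of 0 j 0 j] that n_pos by (simp add: a_def mult_ac)
  have "a * of_real hm = (\<Sum>i<n. A i i)"
    unfolding hmuinv_def n[symmetric] of_real_sum sum_distrib_left by (intro sum.cong refl) (simp add: Aii divide_inverse)
  then have ahm: "a * of_real hm = 1" by (simp add: sum_A_B)
  have "r * a * of_real hp = (\<Sum>i<n. B i i)"
    unfolding hmusum_def n[symmetric] of_real_sum sum_distrib_left by (intro sum.cong refl) (simp add: Bjj)
  then have rahp: "r * a * of_real hp = 1" by (simp add: sum_A_B)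
  have hmp0: "of_real hm \<noteq> (0::complex)" "of_real hp \<noteq> (0::complex)" using hmuinv_pos hmusum_pos by simp_all
  have a: "a = 1 / of_real hm" using ahm hmp0 by (simp add: field_simps)
  have r: "r = of_real hm / of_real hp" using rahp hmp0 unfolding a by (simp add: field_simps)
  show "h (U i j * b) = of_real (hm / hp * mu i * mu j) * h (b * U i j)"
    using tw[OF assms] by (simp add: r)
  show "h (Ub i j * U p l) = (if i = p \<and> j = l then of_real (inverse (hm * mu i)) else 0)" if "p < n" "l < n"
    using that assms A0[of i p] by (auto simp: haar_Ub_U_A Aii a field_simps)
  show "h (U i j * Ub p l) = (if i = p \<and> j = l then of_real (mu j / hp) else 0)" if "p < n" "l < n"
    using that assms B0[of j l] hmp0 by (auto simp: haar_U_Ub_B Bjj a r)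
qed

end

end

section \<open>Modular conjugation and antipodes\<close>

context quantum_cayley_graph begin

text \<open>x is an eigenvector of the modular automorphism of h. Products and adjoints of
  eigenvectors are eigenvectors, so the generators \<open>hx\<close> provide enough of them.\<close>

definition meig :: "falg \<Rightarrow> real \<Rightarrow> bool"
  where "meig x a \<longleftrightarrow> 0 < a \<and> (\<forall>y. h (x * y) = of_real a * h (y * x))"

lemma meig_1: "meig 1 1"
  by (simp add: meig_def)

lemma meig_mult:
  assumes "meig x a" "meig y b" shows "meig (x * y) (a * b)"
proof -
  have "h (x * y * z) = of_real (a * b) * h (z * (x * y))" for z
  proof -
    have "h (x * y * z) = of_real a * h (y * (z * x))" using assms(1) by (simp add: meig_def mult.assoc)
    also have "\<dots> = of_real (a * b) * h (z * (x * y))" using assms(2) by (simp add: meig_def mult.assoc)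
    finally show ?thesis .
  qed
  then show ?thesis using assms by (simp add: meig_def)
qed

lemma meig_scaleF: "meig x a \<Longrightarrow> meig (scaleF c x) a"
  by (simp add: meig_def mult_scaleF_left mult_scaleF_right h_scaleF mult.left_commute)

lemma meig_eqS:
  assumes "meig x a" "eqS fs x y" shows "meig y a"
proof -
  have "h (y * z) = h (x * z)" "h (z * y) = h (z * x)" for z
    using assms(2) by (auto intro!: h_eqS eqS_mult intro: eqS_sym)
  then show ?thesis using assms(1) by (simp add: meig_def)
qed

lemma meig_star:
  assumes "meig x a" shows "meig (starF x) (inverse a)"
proof -
  have "h (starF x * y) = of_real (inverse a) * h (y * starF x)" for y
  proof -
    have "h (starF x * y) = cnj (h (starF y * x))" using h_starF[of "starF y * x"] by (simp add: starF_mult)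
    also have "h (starF y * x) = of_real (inverse a) * h (x * starF y)" using assms by (simp add: meig_def)
    also have "h (x * starF y) = cnj (h (y * starF x))" using h_starF[of "y * starF x"] by (simp add: starF_mult)
    finally show ?thesis by simp
  qed
  then show ?thesis using assms by (simp add: meig_def)
qed

lemma modconj_meig:
  assumes "meig x a"
  shows "modconj G (L x) = scaleC (of_real (inverse (sqrt a))) (L (starF x))"
proof -
  define s where "s = sqrt a"
  have a: "0 < a" using assms by (simp add: meig_def)
  then have s: "0 < s" "s * s = a" by (simp_all add: s_def)
  obtain T where T: "positive_selfadjoint T"
    and cl: "closure {(L x, L (starF x)) | x. True} = {(\<xi>, modconj G \<eta>) | \<xi> \<eta>. (\<xi>, \<eta>) \<in> T}"
    using gns_modconj by blast
  have T1: "T = {(\<xi>', \<eta>'). \<forall>(\<xi>, \<eta>)\<in>T. cinner \<eta> \<xi>' = cinner \<xi> \<eta>'}"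
    and T2: "\<forall>(\<xi>, \<eta>)\<in>T. 0 \<le> cinner \<xi> \<eta>" using T by (simp_all add: positive_selfadjoint_def)
  have TI: "(\<xi>', \<eta>') \<in> T" if "\<And>\<xi> \<eta>. (\<xi>, \<eta>) \<in> T \<Longrightarrow> cinner \<eta> \<xi>' = cinner \<xi> \<eta>'" for \<xi>' \<eta>'
    by (subst T1) (use that in auto)
  have TD: "cinner \<eta> \<xi>' = cinner \<xi> \<eta>'" if "(\<xi>', \<eta>') \<in> T" "(\<xi>, \<eta>) \<in> T" for \<xi>' \<eta>' \<xi> \<eta>
    using that by (subst (asm) (1) T1) auto
  have "(L x, L (starF x)) \<in> closure {(L x, L (starF x)) | x. True}"
    by (rule subsetD[OF closure_subset]) blast
  then obtain \<eta> where \<eta>: "(L x, \<eta>) \<in> T" "modconj G \<eta> = L (starF x)" unfolding cl by auto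
  \<comment> \<open>T is self-adjoint, so membership is tested against its graph. The required
    identity is the eigenvector property for the vectors \<Lambda>(y), and it survives passing to
    the closure.\<close>
  have "(\<eta>, scaleC (of_real a) (L x)) \<in> T"
  proof (rule TI)
    fix \<xi>' \<eta>' assume *: "(\<xi>', \<eta>') \<in> T"
    let ?C = "{p. cinner (L (starF x)) (snd p) = of_real a * cinner (fst p) (L x)}"
    have "closed ?C" by (intro closed_Collect_eq continuous_intros)
    moreover have "{(L x, L (starF x)) | x. True} \<subseteq> ?C"
      using assms by (auto simp: gns_cinner meig_def)
    ultimately have "closure {(L x, L (starF x)) | x. True} \<subseteq> ?C" by (rule closure_minimal[rotated])
    moreover have "(\<xi>', modconj G \<eta>') \<in> closure {(L x, L (starF x)) | x. True}" unfolding cl using * by blast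
    ultimately have "cinner (L (starF x)) (modconj G \<eta>') = of_real a * cinner \<xi>' (L x)" by auto
    then show "cinner \<eta>' \<eta> = cinner \<xi>' (scaleC (of_real a) (L x))"
      using antiunitary_op_cinner[OF modconj_antiunitary, of \<eta> \<eta>'] by (simp add: \<eta>(2) cinner_scaleC_right)
  qed
  note T' = TD[OF this] TD[OF \<eta>(1)]
  \<comment> \<open>An eigenvector of T for the eigenvalue -s, if it were nonzero.\<close>
  define e where "e = \<eta> - scaleC (of_real s) (L x)"
  have "(e, scaleC (of_real (- s)) e) \<in> T"
  proof (rule TI)
    fix \<xi>' \<eta>' assume *: "(\<xi>', \<eta>') \<in> T"
    show "cinner \<eta>' e = cinner \<xi>' (scaleC (of_real (- s)) e)"
    proof -
      have "cinner \<eta>' e = cinner \<xi>' (scaleC (of_real (s * s)) (L x)) - of_real s * cinner \<xi>' \<eta>"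
        using T'[OF *] by (simp only: e_def cinner_diff_right cinner_scaleC_right s(2))
      also have "\<dots> = cinner \<xi>' (scaleC (of_real (- s)) e)"
        by (simp add: e_def cinner_diff_right cinner_scaleC_right algebra_simps)
      finally show ?thesis .
    qed
  qed
  then have "0 \<le> cinner e (scaleC (of_real (- s)) e)" using T2 by auto
  moreover have "cinner e (scaleC (of_real (- s)) e) = of_real (- (s * (norm e)\<^sup>2))"
    by (simp only: cinner_scaleC_right cinner_self of_real_minus of_real_mult minus_mult_left)
  ultimately have "0 \<le> - (s * (norm e)\<^sup>2)" by (simp only: less_eq_complex_def Re_complex_of_real zero_complex.sel)
  then have "e = 0" using s(1) by (simp add: mult_le_0_iff)
  then have "scaleC (of_real s) (L x) = \<eta>" by (simp add: e_def)
  then have "scaleC (of_real s) (modconj G (L x)) = L (starF x)"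
    using \<eta>(2) modconj_antiunitary unfolding antiunitary_op_def by (metis complex_cnj_complex_of_real)
  then have "scaleC (of_real (inverse s)) (scaleC (of_real s) (modconj G (L x))) = scaleC (of_real (inverse s)) (L (starF x))" by simp
  then show ?thesis using s(1) by (simp add: scaleC_scaleC s_def flip: of_real_mult)
qed

text \<open>An algebraic certificate for U \<Lambda>(x) = \<Lambda>(x'). The dual conjugation sends
  \<Lambda>(x) to the vector of the adjoint of R(x); if this adjoint is a modular eigenvector, J
  returns \<Lambda>(R(x)) up to a known factor.\<close>

definition good :: "falg \<Rightarrow> falg \<Rightarrow> bool"
  where "good x x' \<longleftrightarrow> (\<exists>a. meig (starF (uantip G x)) a \<and> eqS fs x' (scaleF (of_real (inverse (sqrt a))) (uantip G x)))"

lemma R_props: "linearF scaleF (uantip G)" "x \<in> rel_ideal fs \<Longrightarrow> uantip G x \<in> rel_ideal fs"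
  "eqS fs (uantip G (x * y)) (uantip G y * uantip G x)" "eqS fs (uantip G (starF x)) (starF (uantip G x))"
  "eqS fs (uantip G (uantip G x)) x"
  using unitary_antipode by (auto simp: is_unitary_antipode_def linear_S_S_def intro: linear_imp_linearF)

lemma linear_S_S_eqS: "linearF scaleF f \<Longrightarrow> (\<And>x. x \<in> rel_ideal fs \<Longrightarrow> f x \<in> rel_ideal fs) \<Longrightarrow> eqS fs x y \<Longrightarrow> eqS fs (f x) (f y)"
  by (metis eqS_def linearF_diff)

lemma good_Uop:
  assumes "good x x'" shows "Uop G (L x) = L x'"
proof -
  obtain a where a: "meig (starF (uantip G x)) a" "eqS fs x' (scaleF (of_real (inverse (sqrt a))) (uantip G x))"
    using assms by (auto simp: good_def)
  show ?thesis by (simp add: Uop_def dualconj_gns modconj_meig[OF a(1)] L_eqS[OF a(2)] L_scaleF)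
qed

text \<open>On such representatives U reverses products, because R does and modular eigenvalues
  multiply.\<close>

lemma good_mult:
  assumes "good x x'" "good y y'" shows "good (x * y) (y' * x')"
proof -
  obtain a b where a: "meig (starF (uantip G x)) a" "eqS fs x' (scaleF (of_real (inverse (sqrt a))) (uantip G x))"
    and b: "meig (starF (uantip G y)) b" "eqS fs y' (scaleF (of_real (inverse (sqrt b))) (uantip G y))"
    using assms by (auto simp: good_def)
  have "meig (starF (uantip G (x * y))) (a * b)"
    by (rule meig_eqS[OF meig_mult[OF a(1) b(1)]]) (use eqS_star[OF eqS_sym[OF R_props(3)]] in \<open>simp add: starF_mult\<close>)
  moreover have "eqS fs (y' * x') (scaleF (of_real (inverse (sqrt (a * b)))) (uantip G (x * y)))"
  proof -
    have "eqS fs (y' * x') (scaleF (of_real (inverse (sqrt b))) (uantip G y) * scaleF (of_real (inverse (sqrt a))) (uantip G x))"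
      by (rule eqS_mult[OF b(2) a(2)])
    also have "scaleF (of_real (inverse (sqrt b))) (uantip G y) * scaleF (of_real (inverse (sqrt a))) (uantip G x) =
      scaleF (of_real (inverse (sqrt (a * b)))) (uantip G y * uantip G x)"
      by (simp add: mult_scaleF_left mult_scaleF_right real_sqrt_mult mult.commute)
    also have "eqS fs \<dots> (scaleF (of_real (inverse (sqrt (a * b)))) (uantip G (x * y)))"
      by (intro eqS_scaleF eqS_sym[OF R_props(3)])
    finally show ?thesis .
  qed
  ultimately show ?thesis by (auto simp: good_def)
qed

lemma good_scaleF: "good x x' \<Longrightarrow> good (scaleF c x) (scaleF c x')"
proof -
  assume "good x x'"
  then obtain a where a: "meig (starF (uantip G x)) a" "eqS fs x' (scaleF (of_real (inverse (sqrt a))) (uantip G x))"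
    by (auto simp: good_def)
  have "meig (starF (uantip G (scaleF c x))) a"
    using meig_scaleF[OF a(1)] by (simp add: linearF_scale[OF R_props(1)] starF_scaleF)
  moreover have "eqS fs (scaleF c x') (scaleF (of_real (inverse (sqrt a))) (uantip G (scaleF c x)))"
    using eqS_scaleF[OF a(2), of c] by (simp add: linearF_scale[OF R_props(1)] mult.commute)
  ultimately show ?thesis by (auto simp: good_def)
qed

text \<open>No clause of \<open>is_unitary_antipode\<close> mentions the unit; it is preserved
  because R is an involution that reverses products.\<close>

lemma R_1: "eqS fs (uantip G 1) 1"
proof -
  have "eqS fs (uantip G (1 * uantip G 1)) (uantip G (uantip G 1) * uantip G 1)" by (rule R_props(3))
  also have "eqS fs \<dots> (1 * uantip G 1)" by (intro eqS_mult R_props(5) eqS_refl)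
  finally have "eqS fs (uantip G (uantip G 1)) (uantip G 1)" by simp
  then show ?thesis using R_props(5)[of 1] eqS_sym eqS_trans by blast
qed

lemma good_1: "good 1 1"
proof -
  have "meig (starF (uantip G 1)) 1"
    by (rule meig_eqS[OF meig_1]) (use eqS_star[OF eqS_sym[OF R_1]] in simp)
  then show ?thesis unfolding good_def by (intro exI[of _ 1]) (simp add: eqS_sym[OF R_1])
qed

end

lemma sum_delta_mult:
  fixes n :: nat and f :: "nat \<Rightarrow> 'a::semiring_1"
  assumes "i < n"
  shows "(\<Sum>l<n. (if i = l then 1 else 0) * f l) = f i"
proof -
  have "(\<Sum>l<n. (if i = l then 1 else 0) * f l) = (\<Sum>l<n. if l = i then f i else 0)"
    by (intro sum.cong) auto
  then show ?thesis using assms by simp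
qed

lemma sum_swap4: "(\<Sum>a\<in>A. \<Sum>b\<in>B. \<Sum>c\<in>C. \<Sum>d\<in>D. f a b c d) = (\<Sum>c\<in>C. \<Sum>d\<in>D. \<Sum>a\<in>A. \<Sum>b\<in>B. f a b c d)"
proof -
  have "(\<Sum>a\<in>A. \<Sum>b\<in>B. \<Sum>c\<in>C. \<Sum>d\<in>D. f a b c d) = (\<Sum>a\<in>A. \<Sum>c\<in>C. \<Sum>b\<in>B. \<Sum>d\<in>D. f a b c d)"
    by (intro sum.cong refl sum.swap)
  also have "\<dots> = (\<Sum>c\<in>C. \<Sum>a\<in>A. \<Sum>b\<in>B. \<Sum>d\<in>D. f a b c d)" by (rule sum.swap)
  also have "\<dots> = (\<Sum>c\<in>C. \<Sum>a\<in>A. \<Sum>d\<in>D. \<Sum>b\<in>B. f a b c d)" by (intro sum.cong refl sum.swap)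
  also have "\<dots> = (\<Sum>c\<in>C. \<Sum>d\<in>D. \<Sum>a\<in>A. \<Sum>b\<in>B. f a b c d)" by (intro sum.cong refl sum.swap)
  finally show ?thesis .
qed

lemma cst_sandwich: "cst a * x * cst b = scaleF (a * b) x"
proof -
  have "cst a * x * cst b = cst b * (cst a * x)" by (rule cst_commute)
  then show ?thesis unfolding scaleF_def[symmetric] F.scale_scale by (simp add: mult.commute)
qed

context quantum_cayley_graph begin

lemma R_modular:
  assumes "is_unitary_corep fs \<alpha>" "is_irreducible fs \<alpha>" "is_modular_mat fs (antip G) \<alpha> F"
    "pos_mat (dim_row \<alpha>) D" "D * D = F"
  shows "mat_eqS fs (map_mat (uantip G) (cmat D * \<alpha> * cmat (inv_mat D))) (map_mat (antip G) \<alpha>)"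
proof -
  have "\<forall>\<alpha> F D. is_unitary_corep fs \<alpha> \<and> is_irreducible fs \<alpha> \<and> is_modular_mat fs (antip G) \<alpha> F \<and>
       pos_mat (dim_row \<alpha>) D \<and> D * D = F \<longrightarrow>
       mat_eqS fs (map_mat (uantip G) (cmat D * \<alpha> * cmat (inv_mat D))) (map_mat (antip G) \<alpha>)"
    using unitary_antipode unfolding is_unitary_antipode_def by (elim conjE) assumption
  from this[rule_format, of \<alpha> F D] assms show ?thesis by (elim meta_mp) (intro conjI)
qed

lemma antip_props: "linearF scaleF (antip G)" "x \<in> rel_ideal fs \<Longrightarrow> antip G x \<in> rel_ideal fs"
  "eqS fs (bilin_ext scaleF (\<lambda>a b. antip G a * b) (delta fs x)) (cst (eps fs x))"
  using antipode by (auto simp: is_antipode_def linear_S_S_def intro: linear_imp_linearF)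

lemma bilinF_antip: "bilinF scaleF (\<lambda>a b. antip G a * b)"
  unfolding bilinF_def linearF_def
  by (simp add: linearF_add[OF antip_props(1)] linearF_scale[OF antip_props(1)] mult_scaleF_left mult_scaleF_right distrib_left distrib_right)

lemma antip_eqS: "eqS fs x y \<Longrightarrow> eqS fs (antip G x) (antip G y)"
  by (rule linear_S_S_eqS[OF antip_props(1,2)])

end

section \<open>Antipode, modular matrix and unitary antipode on the generators\<close>

context valid_cayley_graph begin

context
  fixes k n
  assumes k: "k < length fs" and n: "n = fdim fs k"
begin

private abbreviation "Uh \<equiv> hx fs k False"
private abbreviation "Ubh \<equiv> hx fs k True"
private abbreviation "muh \<equiv> hmu fs k"
private abbreviation "Sh \<equiv> hS fs k"
private abbreviation "hmh \<equiv> hmuinv fs k"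
private abbreviation "hph \<equiv> hmusum fs k"

private lemmas muh_pos = mu_pos[OF k n] and dlth = dlt[OF k n] and rlsh = rls[OF k n]

lemma antip_hx_inv:
  assumes "i < n" "j < n"
  shows "eqS fs (\<Sum>l<n. antip G (hx fs k s i l) * hx fs k s l j) (if i = j then 1 else 0)"
  using antip_props(3)[of "hx fs k s i j"] assms eps_hx[OF k valid[OF k] n refl, of i j s]
  by (simp add: dlth F.bilin_ext_sum F.bilin_ext_tensF[OF bilinF_antip] if_distrib[of cst] cong: if_cong)

text \<open>The antipode identity makes \<kappa>(u) a left inverse of u, and it must agree with the
  right inverse known from the relations: the adjoint for u, a weighted transpose for the matrix of
  adjoints.\<close>

lemma antip_hx:
  assumes "i < n" "j < n"
  shows "eqS fs (antip G (Uh i j)) (Ubh j i)"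
    and "eqS fs (antip G (Ubh i j)) (scaleF (of_real (muh j / muh i)) (Uh j i))"
proof -
  have "eqS fs (antip G (Uh i j) * 1) (\<Sum>l<n. (if i = l then 1 else 0) * Ubh j l)"
    by (rule eqS_contract_right[where A = "\<lambda>j l. Uh l j", OF antip_hx_inv \<open>j < n\<close>])
      (use assms rlsh(1)[OF _ \<open>j < n\<close>] in auto)
  then show "eqS fs (antip G (Uh i j)) (Ubh j i)"
    using assms by (simp add: sum_delta_mult)
  have "eqS fs (antip G (Ubh i j) * cst (inverse (of_real (muh j)))) (\<Sum>l<n. (if i = l then 1 else 0) * scaleF (inverse (of_real (muh l))) (Uh j l))"
    by (rule eqS_contract_right[where A = "\<lambda>j l. Ubh l j", OF antip_hx_inv \<open>j < n\<close>])
      (use assms rlsh(3)[OF _ \<open>j < n\<close>] in \<open>auto simp: mult_scaleF_right cong: if_cong\<close>)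
  then have "eqS fs (scaleF (inverse (of_real (muh j))) (antip G (Ubh i j))) (scaleF (inverse (of_real (muh i))) (Uh j i))"
    using assms by (simp add: sum_delta_mult scaleF_def cst_commute[of "antip G _"])
  from eqS_scaleF[OF this, of "of_real (muh j)"]
  show "eqS fs (antip G (Ubh i j)) (scaleF (of_real (muh j / muh i)) (Uh j i))"
    using muh_pos[OF assms(2)] by (simp add: divide_inverse)
qed

lemma antip_antip_hx:
  assumes "i < n" "j < n"
  shows "eqS fs (antip G (antip G (Uh i j))) (scaleF (of_real (muh i / muh j)) (Uh i j))"
  using eqS_trans[OF antip_eqS[OF antip_hx(1)[OF assms]] antip_hx(2)[OF assms(2,1)]] .

private lemmas SS = hS_unitary[OF k valid[OF k] n refl]
private lemmas Sh_sum = S_sum[OF k valid[OF k] n refl]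

lemma spec_sums:
  assumes "a < n" "i < n"
  shows "(\<Sum>b<n. spec Sh n d $$ (a, b) * Sh $$ (b, i)) = Sh $$ (a, i) * d i"
    and "(\<Sum>b<n. cnj (Sh $$ (b, i)) * spec Sh n d $$ (b, a)) = d i * cnj (Sh $$ (a, i))"
proof -
  have "(\<Sum>b<n. spec Sh n d $$ (a, b) * Sh $$ (b, i)) = (\<Sum>b<n. \<Sum>l<n. Sh $$ (a, l) * d l * (cnj (Sh $$ (b, l)) * Sh $$ (b, i)))"
    using assms by (intro sum.cong refl) (simp add: spec_index[OF SS(1-3)] sum_distrib_right mult.assoc)
  also have "\<dots> = (\<Sum>l<n. Sh $$ (a, l) * d l * (\<Sum>b<n. cnj (Sh $$ (b, l)) * Sh $$ (b, i)))"
    by (subst sum.swap) (simp add: sum_distrib_left)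
  also have "\<dots> = (\<Sum>l<n. Sh $$ (a, l) * d l * (if l = i then 1 else 0))"
    using assms by (intro sum.cong refl) (simp only: Sh_sum lessThan_iff)
  also have "\<dots> = Sh $$ (a, i) * d i" using assms(2) by (rule sum_delta_right)
  finally show "(\<Sum>b<n. spec Sh n d $$ (a, b) * Sh $$ (b, i)) = Sh $$ (a, i) * d i" .
  have "(\<Sum>b<n. cnj (Sh $$ (b, i)) * spec Sh n d $$ (b, a)) = (\<Sum>b<n. \<Sum>l<n. d l * cnj (Sh $$ (a, l)) * (cnj (Sh $$ (b, i)) * Sh $$ (b, l)))"
    using assms by (intro sum.cong refl) (simp add: spec_index[OF SS(1-3)] sum_distrib_left mult_ac)
  also have "\<dots> = (\<Sum>l<n. d l * cnj (Sh $$ (a, l)) * (\<Sum>b<n. cnj (Sh $$ (b, i)) * Sh $$ (b, l)))"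
    by (subst sum.swap) (simp add: sum_distrib_left)
  also have "\<dots> = (\<Sum>l<n. d l * cnj (Sh $$ (a, l)) * (if i = l then 1 else 0))"
    using assms by (intro sum.cong refl) (simp only: Sh_sum lessThan_iff)
  also have "\<dots> = d i * cnj (Sh $$ (a, i))" using assms(2) by (rule sum_delta_right')
  finally show "(\<Sum>b<n. cnj (Sh $$ (b, i)) * spec Sh n d $$ (b, a)) = d i * cnj (Sh $$ (a, i))" .
qed

lemma spec_sandwich:
  assumes "a < n" "b < n"
  shows "(cmat (spec Sh n d) * umat fs k * cmat (spec Sh n e)) $$ (a, b) =
    (\<Sum>i<n. \<Sum>j<n. scaleF (Sh $$ (a, i) * cnj (Sh $$ (b, j))) (scaleF (d i * e j) (Uh i j)))"
proof -
  note sc = spec_carrier[OF SS(1-3)]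
  have u: "umat fs k \<in> carrier_mat n n" "\<And>i j. i < n \<Longrightarrow> j < n \<Longrightarrow> umat fs k $$ (i, j) = gx k False i j" by (auto simp: n umat_gmat)
  have du: "cmat (spec Sh n d) * umat fs k \<in> carrier_mat n n" using sc[of d] u by (intro mult_carrier_mat[of _ n n _ n]) auto
  define D where "D p q = spec Sh n d $$ (p, q)" for p q
  define E where "E p q = spec Sh n e $$ (p, q)" for p q
  have "(cmat (spec Sh n d) * umat fs k * cmat (spec Sh n e)) $$ (a, b) = (\<Sum>q<n. (cmat (spec Sh n d) * umat fs k) $$ (a, q) * cmat (spec Sh n e) $$ (q, b))"
    using assms sc[of e] du by (subst mult_mat_index) (auto simp del: index_mult_mat(1))
  also have "\<dots> = (\<Sum>q<n. (\<Sum>p<n. cst (D a p) * gx k False p q) * cst (E q b))"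
    using assms sc[of e] sc[of d] u by (intro sum.cong refl, subst mult_mat_index) (auto simp: D_def E_def)
  also have "\<dots> = (\<Sum>q<n. \<Sum>p<n. scaleF (D a p * E q b) (gx k False p q))"
    unfolding sum_distrib_right by (simp only: cst_sandwich)
  also have "\<dots> = (\<Sum>q<n. \<Sum>p<n. \<Sum>i<n. \<Sum>j<n. scaleF ((D a p * Sh $$ (p, i)) * (cnj (Sh $$ (q, j)) * E q b)) (Uh i j))"
    by (intro sum.cong refl) (simp add: gx_hx[OF k valid[OF k] n refl] F.scale_sum_right mult_ac)
  also have "\<dots> = (\<Sum>i<n. \<Sum>j<n. \<Sum>q<n. \<Sum>p<n. scaleF ((D a p * Sh $$ (p, i)) * (cnj (Sh $$ (q, j)) * E q b)) (Uh i j))"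
    by (rule sum_swap4)
  also have "\<dots> = (\<Sum>i<n. \<Sum>j<n. \<Sum>p<n. \<Sum>q<n. scaleF ((D a p * Sh $$ (p, i)) * (cnj (Sh $$ (q, j)) * E q b)) (Uh i j))"
    by (intro sum.cong refl sum.swap)
  also have "\<dots> = (\<Sum>i<n. \<Sum>j<n. scaleF ((\<Sum>p<n. D a p * Sh $$ (p, i)) * (\<Sum>q<n. cnj (Sh $$ (q, j)) * E q b)) (Uh i j))"
    by (simp only: sum_product F.scale_sum_left)
  also have "\<dots> = (\<Sum>i<n. \<Sum>j<n. scaleF (Sh $$ (a, i) * cnj (Sh $$ (b, j))) (scaleF (d i * e j) (Uh i j)))"
    unfolding D_def E_def using assms by (intro sum.cong refl) (simp only: spec_sums lessThan_iff F.scale_scale, simp add: mult_ac)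
  finally show ?thesis .
qed

lemma S_inversion:
  assumes "i < n" "j < n"
  shows "(\<Sum>a<n. \<Sum>b<n. scaleF (cnj (Sh $$ (a, i)) * Sh $$ (b, j)) (\<Sum>p<n. \<Sum>q<n. scaleF (Sh $$ (a, p) * cnj (Sh $$ (b, q))) (Y p q))) = Y i j"
proof -
  have "(\<Sum>a<n. \<Sum>b<n. scaleF (cnj (Sh $$ (a, i)) * Sh $$ (b, j)) (\<Sum>p<n. \<Sum>q<n. scaleF (Sh $$ (a, p) * cnj (Sh $$ (b, q))) (Y p q))) =
    (\<Sum>a<n. \<Sum>b<n. \<Sum>p<n. \<Sum>q<n. scaleF ((cnj (Sh $$ (a, i)) * Sh $$ (a, p)) * (cnj (Sh $$ (b, q)) * Sh $$ (b, j))) (Y p q))"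
    by (simp add: F.scale_sum_right mult_ac)
  also have "\<dots> = (\<Sum>p<n. \<Sum>q<n. \<Sum>a<n. \<Sum>b<n. scaleF ((cnj (Sh $$ (a, i)) * Sh $$ (a, p)) * (cnj (Sh $$ (b, q)) * Sh $$ (b, j))) (Y p q))"
    by (rule sum_swap4)
  also have "\<dots> = (\<Sum>p<n. \<Sum>q<n. scaleF ((\<Sum>a<n. cnj (Sh $$ (a, i)) * Sh $$ (a, p)) * (\<Sum>b<n. cnj (Sh $$ (b, q)) * Sh $$ (b, j))) (Y p q))"
    by (simp only: sum_product F.scale_sum_left)
  also have "\<dots> = (\<Sum>p<n. \<Sum>q<n. if p = i \<and> q = j then Y i j else 0)"
    using assms by (intro sum.cong refl) (simp only: Sh_sum lessThan_iff, auto)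
  also have "\<dots> = (\<Sum>p<n. if p = i then Y i j else 0)"
    using assms by (intro sum.cong refl) auto
  finally show ?thesis using assms by simp
qed

lemma spec_cong: "(\<And>i. i < n \<Longrightarrow> d i = e i) \<Longrightarrow> spec Sh n d = spec Sh n e"
  by (rule eq_matI) (insert spec_carrier[OF SS(1-3), of d] spec_carrier[OF SS(1-3), of e], auto simp: spec_index[OF SS(1-3)])

lemma spec_umat_carrier: "cmat (spec Sh n d) * umat fs k * cmat (spec Sh n e) \<in> carrier_mat n n"
  by (intro mult_carrier_mat[of _ n n _ n]) (auto simp: n umat_gmat map_carrier_mat spec_carrier[OF SS(1-3), unfolded n])

lemma umat_mat_eqS:
  assumes "X \<in> carrier_mat n n" "\<And>a b. a < n \<Longrightarrow> b < n \<Longrightarrow> eqS fs (f (gx k False a b)) (X $$ (a, b))"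
  shows "mat_eqS fs (map_mat f (umat fs k)) X"
  using assms by (auto simp: mat_eqS_def umat_gmat n)

lemma mat_eqS_umat:
  assumes "X \<in> carrier_mat n n" "mat_eqS fs (map_mat g X) (map_mat f (umat fs k))" "a < n" "b < n"
  shows "eqS fs (g (X $$ (a, b))) (f (gx k False a b))"
  using assms by (auto simp: mat_eqS_def umat_gmat n)

text \<open>The normalisation that gives the multiples \<open>cc * muh i\<close> and their inverses
  equal sums, as the condition on the trace of F requires.\<close>

private definition "cc = sqrt (hmh / hph)"

lemma modular_mat_umat: "is_modular_mat fs (antip G) (umat fs k) (spec Sh n (\<lambda>i. of_real (cc * muh i)))"
proof -
  have hmp: "0 < hmh" "0 < hph" using hmuinv_pos[OF k n] hmusum_pos[OF k n] by auto
  then have cc: "0 < cc" "cc * cc = hmh / hph" by (simp_all add: cc_def)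
  let ?d = "\<lambda>i. complex_of_real (cc * muh i)" let ?e = "\<lambda>i. inverse (?d i)"
  have d0: "?d i \<noteq> 0" if "i < n" for i using muh_pos[OF that] cc(1) by simp
  have dd: "complex_of_real (muh i / muh j) = ?d i * ?e j" if "i < n" "j < n" for i j
    using cc(1) muh_pos[OF that(2)] by (simp add: field_simps)
  note inv = spec_inv[OF SS(1-3), of ?d, OF d0]
  have "mtrace (spec Sh n ?d) = of_real (cc * hph)"
    unfolding spec_trace[OF SS(1-3)] hmusum_def n[symmetric] of_real_sum sum_distrib_left by simp
  moreover have "mtrace (spec Sh n ?e) = of_real (inverse cc * hmh)"
    unfolding spec_trace[OF SS(1-3)] hmuinv_def n[symmetric] of_real_sum sum_distrib_left by simp
  moreover have "cc * hph = inverse cc * hmh" using cc hmp by (simp add: field_simps)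
  ultimately have tr: "mtrace (spec Sh n ?d) = mtrace (inv_mat (spec Sh n ?d))" by (simp only: inv(2))
  have "eqS fs (antip G (antip G (gx k False a b))) ((cmat (spec Sh n ?d) * umat fs k * cmat (spec Sh n ?e)) $$ (a, b))"
    if ab: "a < n" "b < n" for a b
  proof -
    have e1: "antip G (antip G (gx k False a b)) = (\<Sum>i<n. \<Sum>j<n. scaleF (Sh $$ (a, i) * cnj (Sh $$ (b, j))) (antip G (antip G (Uh i j))))"
      using ab by (simp add: gx_hx[OF k valid[OF k] n refl] linearF_sum[OF antip_props(1)] linearF_scale[OF antip_props(1)])
    have e2: "eqS fs (scaleF c (antip G (antip G (Uh i j)))) (scaleF c (scaleF (?d i * ?e j) (Uh i j)))" if "i < n" "j < n" for i j c
      using eqS_scaleF[OF antip_antip_hx[OF that]] unfolding dd[OF that] .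
    show ?thesis unfolding spec_sandwich[OF ab] e1 by (intro eqS_sum e2) auto
  qed
  then have "mat_eqS fs (map_mat (\<lambda>x. antip G (antip G x)) (umat fs k)) (cmat (spec Sh n ?d) * umat fs k * cmat (spec Sh n ?e))"
    by (rule umat_mat_eqS[OF spec_umat_carrier])
  moreover have "pos_mat n (spec Sh n ?d)" using spec_pos[OF SS(1-3), of "\<lambda>i. cc * muh i"] cc(1) muh_pos by (simp add: less_imp_le)
  ultimately show ?thesis using tr inv by (simp add: is_modular_mat_def umat_gmat n)
qed

lemma modular_mat_exists:
  "\<exists>F. is_modular_mat fs (antip G) (umat fs k) F \<and> mtrace F = of_real (sqrt (hmh * hph))"
proof -
  have hmp: "0 < hmh" "0 < hph" using hmuinv_pos[OF k n] hmusum_pos[OF k n] by auto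
  have "mtrace (spec Sh n (\<lambda>i. complex_of_real (cc * muh i))) = of_real (cc * hph)"
    unfolding spec_trace[OF SS(1-3)] hmusum_def n[symmetric] of_real_sum sum_distrib_left by simp
  moreover have "cc * hph = sqrt (hmh * hph)"
  proof -
    have "sqrt hph \<noteq> 0" "hph = sqrt hph * sqrt hph" using hmp by simp_all
    then have "cc * hph = sqrt hmh / sqrt hph * (sqrt hph * sqrt hph)" by (simp only: cc_def real_sqrt_divide)
    also have "\<dots> = sqrt (hmh * hph)" using \<open>sqrt hph \<noteq> 0\<close> by (simp add: real_sqrt_mult del: real_sqrt_eq_0_iff real_sqrt_mult_self)
    finally show ?thesis .
  qed
  ultimately show ?thesis using modular_mat_umat by (intro exI conjI) auto
qed

text \<open>The square of \<kappa> scales the entries by mu_i / mu_j, so F is diagonal in this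
  basis, and so is its positive square root. The defining equation of R on the irreducible
  corepresentation u can then be solved entry by entry; \<open>cc\<close> drops out.\<close>

lemma R_hx:
  assumes "i < n" "j < n"
  shows "eqS fs (uantip G (hx fs k s i j)) (scaleF (of_real (sqrt (muh j / muh i))) (hx fs k (\<not> s) j i))"
proof -
  have hmp: "0 < hmh" "0 < hph" using hmuinv_pos[OF k n] hmusum_pos[OF k n] by auto
  then have cc: "0 < cc" by (simp add: cc_def)
  let ?F = "spec Sh n (\<lambda>i. of_real (cc * muh i))"
  let ?d = "\<lambda>i. complex_of_real (sqrt (cc * muh i))" let ?e = "\<lambda>i. inverse (?d i)"
  have d0: "?d i \<noteq> 0" if "i < n" for i using muh_pos[OF that] cc by simp
  have inv: "inv_mat (spec Sh n ?d) = spec Sh n ?e" by (rule spec_inv[OF SS(1-3)]) (rule d0)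
  have "spec Sh n ?d * spec Sh n ?d = ?F"
  proof -
    have "spec Sh n (\<lambda>i. ?d i * ?d i) = ?F"
      using cc muh_pos by (intro spec_cong) (simp add: less_imp_le flip: of_real_mult)
    then show ?thesis by (simp only: spec_mult[OF SS(1-3)])
  qed
  moreover have "pos_mat (dim_row (umat fs k)) (spec Sh n ?d)"
    using spec_pos[OF SS(1-3), of "\<lambda>i. sqrt (cc * muh i)"] cc muh_pos by (simp add: less_imp_le umat_gmat n)
  ultimately have "mat_eqS fs (map_mat (uantip G) (cmat (spec Sh n ?d) * umat fs k * cmat (inv_mat (spec Sh n ?d)))) (map_mat (antip G) (umat fs k))"
    by (intro R_modular[OF umat_unitary_corep[OF k valid[OF k]] umat_irreducible[OF valid k] modular_mat_umat])
  then have m: "mat_eqS fs (map_mat (uantip G) (cmat (spec Sh n ?d) * umat fs k * cmat (spec Sh n ?e))) (map_mat (antip G) (umat fs k))"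
    unfolding inv .
  define X where "X a b = (cmat (spec Sh n ?d) * umat fs k * cmat (spec Sh n ?e)) $$ (a, b)" for a b
  have e: "eqS fs (uantip G (X a b)) (antip G (gx k False a b))" if "a < n" "b < n" for a b
    unfolding X_def using that by (intro mat_eqS_umat[OF spec_umat_carrier m])
  have X: "X a b = (\<Sum>p<n. \<Sum>q<n. scaleF (Sh $$ (a, p) * cnj (Sh $$ (b, q))) (scaleF (?d p * ?e q) (Uh p q)))" if "a < n" "b < n" for a b
    unfolding X_def by (rule spec_sandwich[OF that])
  note lR = R_props(1)
  have RU: "eqS fs (uantip G (Uh i j)) (scaleF (of_real (sqrt (muh j / muh i))) (Ubh j i))" if ij: "i < n" "j < n" for i j
  proof -
    have s1: "scaleF (?d i * ?e j) (Uh i j) = (\<Sum>a<n. \<Sum>b<n. scaleF (cnj (Sh $$ (a, i)) * Sh $$ (b, j)) (X a b))"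
    proof -
      have "(\<Sum>a<n. \<Sum>b<n. scaleF (cnj (Sh $$ (a, i)) * Sh $$ (b, j)) (X a b)) = (\<Sum>a<n. \<Sum>b<n. scaleF (cnj (Sh $$ (a, i)) * Sh $$ (b, j)) (\<Sum>p<n. \<Sum>q<n. scaleF (Sh $$ (a, p) * cnj (Sh $$ (b, q))) (scaleF (?d p * ?e q) (Uh p q))))"
        by (intro sum.cong refl) (simp only: X lessThan_iff)
      then show ?thesis by (simp only: S_inversion[OF ij])
    qed
    have s2: "antip G (Uh i j) = (\<Sum>a<n. \<Sum>b<n. scaleF (cnj (Sh $$ (a, i)) * Sh $$ (b, j)) (antip G (gx k False a b)))"
      using ij by (simp only: hx_index[OF k valid[OF k] n refl] linearF_sum[OF antip_props(1)] linearF_scale[OF antip_props(1)])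
    have s3: "eqS fs (\<Sum>a<n. \<Sum>b<n. scaleF (cnj (Sh $$ (a, i)) * Sh $$ (b, j)) (uantip G (X a b)))
      (\<Sum>a<n. \<Sum>b<n. scaleF (cnj (Sh $$ (a, i)) * Sh $$ (b, j)) (antip G (gx k False a b)))"
      by (intro eqS_sum eqS_scaleF e) auto
    have s4: "uantip G (scaleF (?d i * ?e j) (Uh i j)) = (\<Sum>a<n. \<Sum>b<n. scaleF (cnj (Sh $$ (a, i)) * Sh $$ (b, j)) (uantip G (X a b)))"
      unfolding s1 by (simp only: linearF_sum[OF lR] linearF_scale[OF lR])
    have "eqS fs (uantip G (scaleF (?d i * ?e j) (Uh i j))) (Ubh j i)"
      by (rule eqS_trans[OF s3[folded s4 s2] antip_hx(1)[OF ij]])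
    then have "eqS fs (scaleF (?d i * ?e j) (uantip G (Uh i j))) (Ubh j i)" by (simp only: linearF_scale[OF lR])
    from eqS_scaleF[OF this, of "inverse (?d i * ?e j)"]
    have "eqS fs (uantip G (Uh i j)) (scaleF (inverse (?d i * ?e j)) (Ubh j i))"
      using d0 ij by (simp only: F.scale_scale left_inverse[of "?d i * ?e j"] F.scale_one mult_eq_0_iff inverse_nonzero_iff_nonzero simp_thms)
    moreover have "inverse (?d i * ?e j) = of_real (sqrt (muh j / muh i))"
    proof -
      have "sqrt cc \<noteq> 0" "sqrt (muh i) \<noteq> 0" "sqrt (muh j) \<noteq> 0"
        using cc muh_pos[OF ij(1)] muh_pos[OF ij(2)] by simp_all
      then have "inverse (sqrt (cc * muh i) * inverse (sqrt (cc * muh j))) = sqrt (muh j / muh i)"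
        unfolding real_sqrt_mult real_sqrt_divide by (simp add: field_simps del: real_sqrt_eq_0_iff)
      then show ?thesis by (simp only: of_real_inverse[symmetric] of_real_mult[symmetric])
    qed
    ultimately show ?thesis by simp
  qed
  show ?thesis
  proof (cases s)
    case True
    have "eqS fs (uantip G (starF (Uh i j))) (starF (uantip G (Uh i j)))" by (rule R_props(4))
    also have "eqS fs \<dots> (starF (scaleF (of_real (sqrt (muh j / muh i))) (Ubh j i)))" by (intro eqS_star RU assms)
    finally show ?thesis by (simp add: True starF_scaleF)
  qed (use RU assms in simp)
qed

end

end

context quantum_cayley_graph begin

lemma bounded_clinear_Uop: "bounded_clinear (Uop G)"
  using modconj_antiunitary dualconj_antiunitary
  unfolding Uop_def antiunitary_op_def bounded_clinear_def comp_def by (auto intro: bounded_linear_compose)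

lemmas tens_add_left = bounded_clinear_add[OF tens_linear_left]
  and tens_add_right = bounded_clinear_add[OF tens_linear_right]
  and tens_scaleC_left = bounded_clinear_scaleC[OF tens_linear_left]
  and tens_scaleC_right = bounded_clinear_scaleC[OF tens_linear_right]
  and tens_sum_left = bounded_clinear_sum[OF tens_linear_left]
  and tens_sum_right = bounded_clinear_sum[OF tens_linear_right]
  and tens_0_left = bounded_clinear_0[OF tens_linear_left]
  and tens_0_right = bounded_clinear_0[OF tens_linear_right]

text \<open>\<Theta> applies U to the first vertex and, after the multiplicative unitary, once more
  to a product containing the result. Both directions of the certificate are therefore
  needed.\<close>

definition good2 :: "falg \<Rightarrow> falg \<Rightarrow> bool"
  where "good2 x x' \<longleftrightarrow> good x x' \<and> good x' x"

lemma good2_mult: "good2 x x' \<Longrightarrow> good2 y y' \<Longrightarrow> good2 (x * y) (y' * x')"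
  by (simp add: good2_def good_mult)

text \<open>The kernel of the GNS map in terms of h. It contains \<open>rel_ideal\<close>; the
  converse amounts to faithfulness of h on \<S>, which is replaced below by a statement about linear
  maps.\<close>

definition null :: "falg \<Rightarrow> bool" where "null x \<longleftrightarrow> (\<forall>y. h (y * x) = 0)"

lemma null_iff: "null x \<longleftrightarrow> L x = 0"
proof
  assume "null x"
  then have "cinner (L x) (L x) = 0" by (simp add: gns_cinner null_def)
  then show "L x = 0" by (simp add: cinner_self)
next
  assume "L x = 0"
  then have "h (y * x) = 0" for y using gns_cinner[of "starF y" x] by simp
  then show "null x" by (simp add: null_def)
qed

lemma null_mult: "null x \<Longrightarrow> null (y * x)"
  by (simp add: null_def flip: mult.assoc)

end

section \<open>Linear maps on the algebra vanish on GNS-null elements\<close>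

lemma falg2_list: "\<exists>ts. t = (\<Sum>(a, b)\<leftarrow>ts. tensF a b)"
proof (induction t rule: falg2_induct)
  case (tens x y)
  show ?case by (rule exI[of _ "[(x, y)]"]) simp
next
  case (add s t)
  then obtain u v where "s = (\<Sum>(a, b)\<leftarrow>u. tensF a b)" "t = (\<Sum>(a, b)\<leftarrow>v. tensF a b)" by blast
  then show ?case by (intro exI[of _ "u @ v"]) simp
qed

lemma (in cvector_space) bilin_ext_list:
  assumes "bilinF scale B"
  shows "bilin_ext scale B (\<Sum>(a, b)\<leftarrow>ts. tensF a b) = (\<Sum>(a, b)\<leftarrow>ts. B a b)"
  by (induction ts) (auto simp: bilin_ext_add bilin_ext_tensF[OF assms])

lemma sr_list: "linearF (*) f \<Longrightarrow> sr f (\<Sum>(a, b)\<leftarrow>ts. tensF a b) = (\<Sum>(a, b)\<leftarrow>ts. scaleF (f b) a)"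
  unfolding sr_def by (rule F.bilin_ext_list[OF bilinF_slice(2)])

lemma sr_scale: "linearF (*) f \<Longrightarrow> sr f (Poly_Mapping.single 0 a * t) = scaleF a (sr f t)"
  by (induction t rule: falg2_induct) (simp_all add: single0_tensF sr_tensF sr_add distrib_left F.scale_right_distrib mult.commute)

text \<open>The equation is a congruence only, because of the generators with indices out of range,
  which \<delta> and \<epsilon> annihilate in part.\<close>

lemma counit: "eqS fs (sr (eps fs) (delta fs x)) x"
proof -
  have "eqS fs (sr (eps fs) (delta fs (mon (Word w)))) (mon (Word w))" for w
  proof (induction w rule: rev_induct)
    case Nil
    have "delta fs (mon (Word [])) = 1" by (simp add: mon_def delta_single)
    also have "(1 :: falg2) = tensF 1 1" using tensF_single[of 0 1 0 1] by (simp add: zero_prod_def flip: single_one)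
    finally show ?case by (simp add: mon_Nil sr_tensF linearF_eps)
  next
    case (snoc g w)
    obtain k s i j where g: "mon (Word [g]) = gx k s i j"
      by (cases g) (auto simp: gx_def intro: that[of _ False] that[of _ True])
    let ?n = "fdim fs k" and ?w = "mon (Word w)"
    have e: "sr (\<lambda>b. eps fs (b * gx k s l j)) t = (if l = j then sr (eps fs) t else 0)" if "l < ?n" for l t
    proof (induction t rule: falg2_induct)
      case (tens x y)
      show ?case using that by (subst sr_tensF[OF linearF_mult_right'[OF linearF_eps]]) (simp add: eps_mult eps_gx sr_tensF[OF linearF_eps])
    qed (auto simp: sr_add)
    have "sr (eps fs) (delta fs (?w * gx k s i j)) = (\<Sum>l<?n. sr (\<lambda>b. eps fs (b * gx k s l j)) (delta fs ?w) * gx k s i l)"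
      by (simp add: delta_mult delta_gx sum_distrib_left sr_sum slice_mult[OF linearF_eps])
    also have "\<dots> = (\<Sum>l<?n. if l = j then sr (eps fs) (delta fs ?w) * gx k s i j else 0)"
      by (intro sum.cong refl) (simp add: e)
    finally have 1: "sr (eps fs) (delta fs (?w * gx k s i j)) = (if j < ?n then sr (eps fs) (delta fs ?w) * gx k s i j else 0)" by simp
    have "eqS fs (?w * gx k s i j) (?w * 0)" if "\<not> j < ?n"
      using that by (intro eqS_mult eqS_refl) (simp add: eqS_0_iff gx_unused)
    then have "eqS fs (sr (eps fs) (delta fs (?w * gx k s i j))) (?w * gx k s i j)"
      unfolding 1 using eqS_mult[OF snoc eqS_refl] by (auto intro: eqS_sym)
    then show ?case by (simp only: mon_append g)
  qed
  then have "eqS fs (sr (eps fs) (delta fs (mon w))) (mon w)" for w by (cases w) simp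
  then show ?thesis
    by (induction x rule: falg_induct) (simp_all add: delta_scaleF sr_scale[OF linearF_eps] delta_add sr_add eqS_add eqS_scaleF)
qed

context quantum_cayley_graph begin

text \<open>If all slices by h(y \<cdot>) of a tensor vanish, its second legs are linearly dependent
  modulo null elements, or its first legs cancel. Instead of choosing a basis of the quotient by the
  null elements, the tensor is shortened one summand at a time, as in Gaussian elimination.\<close>

lemma elimination:
  assumes B: "cvector_space sc" "bilinF sc B" "\<And>a b. a \<in> rel_ideal fs \<Longrightarrow> B a b = 0" "\<And>a b. null b \<Longrightarrow> B a b = 0"
    and z: "\<And>y. eqS fs (\<Sum>(a, b)\<leftarrow>ts. scaleF (h (y * b)) a) 0"
  shows "(\<Sum>(a, b)\<leftarrow>ts. B a b) = 0"
  using z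
proof (induction "length ts" arbitrary: ts)
  case (Suc m)
  interpret cvector_space sc by (rule B(1))
  obtain a b us where ts: "ts = (a, b) # us" and m: "m = length us"
    using Suc(2) by (cases ts) auto
  note z = Suc.prems[unfolded ts, simplified]
  note L1 = linearF_add[OF bilinF_left[OF B(2)]] linearF_scale[OF bilinF_left[OF B(2)]] linearF_0[OF bilinF_left[OF B(2)]]
  note L2 = linearF_diff[OF bilinF_right[OF B(2)]] linearF_scale[OF bilinF_right[OF B(2)]]
  show ?case
  proof (cases "null b")
    case True
    have "eqS fs (\<Sum>(a, b)\<leftarrow>us. scaleF (h (y * b)) a) 0" for y
      using z[of y] True by (simp add: null_def)
    then have "(\<Sum>(a, b)\<leftarrow>us. B a b) = 0" by (rule Suc(1)[OF m])
    then show ?thesis using True B(4) by (simp add: ts)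
  next
    case False
    then obtain y0 where y0: "h (y0 * b) \<noteq> 0" by (auto simp: null_def)
    \<comment> \<open>The functional h(y1 \<cdot>) has the value 1 at the pivot b.\<close>
    define y1 where "y1 = scaleF (inverse (h (y0 * b))) y0"
    have y1: "h (y1 * b) = 1" using y0 by (simp add: y1_def mult_scaleF_left h_scaleF)
    \<comment> \<open>Every other second leg is made orthogonal to y1 by subtracting a multiple of
      b; the multiples are collected in front of b, where the slice by y1 shows that they cancel
      a.\<close>
    define f where "f = (\<lambda>(c, d). (c :: falg, d - scaleF (h (y1 * d)) b))"
    define A where "A = (\<Sum>(c, d)\<leftarrow>us. scaleF (h (y1 * d)) c)"
    have e1: "(\<Sum>(c, d)\<leftarrow>map f vs. scaleF (h (y * d)) c) = (\<Sum>(c, d)\<leftarrow>vs. scaleF (h (y * d)) c) - scaleF (h (y * b)) (\<Sum>(c, d)\<leftarrow>vs. scaleF (h (y1 * d)) c)" for y vs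
      by (induction vs) (auto simp: f_def h_diff h_scaleF right_diff_distrib mult_scaleF_right F.scale_left_diff_distrib F.scale_right_distrib mult.commute algebra_simps)
    have e2: "(\<Sum>(c, d)\<leftarrow>map f vs. B c d) = (\<Sum>(c, d)\<leftarrow>vs. B c d) - B (\<Sum>(c, d)\<leftarrow>vs. scaleF (h (y1 * d)) c) b" for vs
      by (induction vs) (auto simp: f_def L1 L2)
    have aA: "eqS fs (a + A) 0" using z[of y1] by (simp add: y1 A_def)
    have "eqS fs (\<Sum>(c, d)\<leftarrow>map f us. scaleF (h (y * d)) c) 0" for y
    proof -
      have "eqS fs (scaleF (h (y * b)) a + (\<Sum>(c, d)\<leftarrow>us. scaleF (h (y * d)) c) - scaleF (h (y * b)) (a + A)) (0 - scaleF (h (y * b)) 0)"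
        by (intro eqS_diff z eqS_scaleF aA)
      then show ?thesis unfolding e1 A_def[symmetric] by (simp add: F.scale_right_distrib algebra_simps)
    qed
    then have "(\<Sum>(c, d)\<leftarrow>map f us. B c d) = 0" using m by (intro Suc(1)) simp_all
    moreover have "B (a + A) b = 0" using aA B(3) by (simp add: eqS_def)
    ultimately show ?thesis unfolding e2 A_def[symmetric] by (simp add: ts L1)
  qed
qed simp

end

context valid_cayley_graph begin

lemma hx_induct [case_names one mult add scale cong]:
  assumes one: "P 1"
    and mult: "\<And>y k s i j. P y \<Longrightarrow> k < length fs \<Longrightarrow> i < fdim fs k \<Longrightarrow> j < fdim fs k \<Longrightarrow> P (y * hx fs k s i j)"
    and add: "\<And>x y. P x \<Longrightarrow> P y \<Longrightarrow> P (x + y)"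
    and scale: "\<And>a x. P x \<Longrightarrow> P (scaleF a x)"
    and cong: "\<And>x y. P x \<Longrightarrow> eqS fs x y \<Longrightarrow> P y"
  shows "P x"
proof -
  have P0: "P 0" using scale[OF one, of 0] by simp
  have Psum: "P (\<Sum>i\<in>A. f i)" if "\<And>i. i \<in> A \<Longrightarrow> P (f i)" for f :: "nat \<Rightarrow> falg" and A
    using that by (induction A rule: infinite_finite_induct) (auto intro: P0 add)
  have gen: "P (y * gx k s i j)" if y: "P y" for y k s i j
  proof (cases "i < fdim fs k \<and> j < fdim fs k")
    case True
    then have k: "k < length fs" by (auto simp: fdim_def split: if_splits)
    show ?thesis
      using True by (cases s)
        (simp_all add: gx_hx[OF k valid[OF k] refl refl] gx_hx_star[OF k valid[OF k] refl refl] sum_distrib_left mult_scaleF_right, (intro Psum scale mult y k, auto)+)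
  next
    case False
    then have "eqS fs (y * gx k s i j) (y * 0)" by (intro eqS_mult eqS_refl) (simp add: eqS_0_iff gx_unused)
    then show ?thesis using cong[OF P0] eqS_sym by simp
  qed
  have "P (mon (Word w))" for w
  proof (induction w rule: rev_induct)
    case (snoc g w)
    obtain k s i j where "mon (Word [g]) = gx k s i j"
      by (cases g) (auto simp: gx_def intro: that[of _ False] that[of _ True])
    then show ?case using gen[OF snoc] by (simp only: mon_append)
  qed (simp add: mon_Nil one)
  then have "P (mon w)" for w by (cases w) simp
  then show ?thesis by (induction x rule: falg_induct) (auto intro: add scale)
qed

lemma meig_hx:
  assumes k: "k < length fs" and ij: "i < fdim fs k" "j < fdim fs k"
  shows "meig (hx fs k False i j) (hmuinv fs k / hmusum fs k * hmu fs k i * hmu fs k j)"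
    and "meig (hx fs k True i j) (inverse (hmuinv fs k / hmusum fs k * hmu fs k i * hmu fs k j))"
proof -
  show 1: "meig (hx fs k False i j) (hmuinv fs k / hmusum fs k * hmu fs k i * hmu fs k j)"
    unfolding meig_def using haar_values(1)[OF k refl ij] hmuinv_pos[OF k refl] hmusum_pos[OF k refl] mu_pos[OF k refl] ij by simp
  show "meig (hx fs k True i j) (inverse (hmuinv fs k / hmusum fs k * hmu fs k i * hmu fs k j))"
    using meig_star[OF 1] by simp
qed

definition hr :: "nat \<Rightarrow> real" where "hr k = sqrt (hmuinv fs k / hmusum fs k)"

lemma hr_pos: "k < length fs \<Longrightarrow> 0 < hr k"
  using hmuinv_pos[OF _ refl] hmusum_pos[OF _ refl] by (simp add: hr_def)

text \<open>The factor sqrt(mu_j / mu_i) of R meets the square root of the modular eigenvalue, which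
  contains sqrt(mu_i mu_j), or its inverse; in both cases one of the two indices drops out.\<close>

lemma good_hx:
  assumes k: "k < length fs" and ij: "i < fdim fs k" "j < fdim fs k"
  shows "good (hx fs k False i j) (scaleF (of_real (inverse (hr k * hmu fs k i))) (hx fs k True j i))"
    and "good (hx fs k True i j) (scaleF (of_real (hr k * hmu fs k j)) (hx fs k False j i))"
proof -
  let ?q = "sqrt (hmu fs k j / hmu fs k i)" let ?a = "hmuinv fs k / hmusum fs k * hmu fs k j * hmu fs k i"
  have mu: "0 < hmu fs k i" "0 < hmu fs k j" using mu_pos[OF k refl] ij by auto
  note e = eqS_star[OF eqS_sym[OF R_hx[OF k refl ij]], unfolded starF_scaleF starF_hx]
  have e1: "eqS fs (scaleF (of_real ?q) (hx fs k False j i)) (starF (uantip G (hx fs k False i j)))"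
    using e[of False] by simp
  have e2: "eqS fs (scaleF (of_real ?q) (hx fs k True j i)) (starF (uantip G (hx fs k True i j)))"
    using e[of True] by simp
  have m1: "meig (starF (uantip G (hx fs k False i j))) ?a"
    by (rule meig_eqS[OF meig_scaleF[OF meig_hx(1)[OF k ij(2,1)]] e1])
  have m2: "meig (starF (uantip G (hx fs k True i j))) (inverse ?a)"
    by (rule meig_eqS[OF meig_scaleF[OF meig_hx(2)[OF k ij(2,1)]] e2])
  have ne: "sqrt (hmu fs k i) \<noteq> 0" "sqrt (hmu fs k j) \<noteq> 0" using mu by simp_all
  have sq: "sqrt (hmu fs k i) * sqrt (hmu fs k i) = hmu fs k i" "sqrt (hmu fs k j) * sqrt (hmu fs k j) = hmu fs k j"
    using mu by simp_all
  have sa: "sqrt ?a = hr k * sqrt (hmu fs k j) * sqrt (hmu fs k i)" by (simp only: real_sqrt_mult hr_def)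
  have c1: "inverse (sqrt ?a) * ?q = inverse (hr k * hmu fs k i)"
    unfolding sa real_sqrt_divide using ne by (subst sq(1)[symmetric]) (simp add: field_simps del: real_sqrt_eq_0_iff real_sqrt_mult_self)
  have c2: "inverse (sqrt (inverse ?a)) * ?q = hr k * hmu fs k j"
    unfolding real_sqrt_inverse inverse_inverse_eq sa real_sqrt_divide using ne
    by (subst sq(2)[symmetric]) (simp add: field_simps del: real_sqrt_eq_0_iff real_sqrt_mult_self)
  note e' = eqS_scaleF[OF eqS_sym[OF R_hx[OF k refl ij]]]
  have "eqS fs (scaleF (of_real (inverse (sqrt ?a) * ?q)) (hx fs k True j i)) (scaleF (of_real (inverse (sqrt ?a))) (uantip G (hx fs k False i j)))"
    using e'[of "of_real (inverse (sqrt ?a))" False] by (simp only: of_real_mult F.scale_scale not_False_eq_True)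
  then show "good (hx fs k False i j) (scaleF (of_real (inverse (hr k * hmu fs k i))) (hx fs k True j i))"
    unfolding good_def c1 using m1 by (intro exI[of _ ?a] conjI)
  have "eqS fs (scaleF (of_real (inverse (sqrt (inverse ?a)) * ?q)) (hx fs k False j i)) (scaleF (of_real (inverse (sqrt (inverse ?a)))) (uantip G (hx fs k True i j)))"
    using e'[of "of_real (inverse (sqrt (inverse ?a)))" True] by (simp only: of_real_mult F.scale_scale not_True_eq_False)
  then show "good (hx fs k True i j) (scaleF (of_real (hr k * hmu fs k j)) (hx fs k False j i))"
    unfolding good_def c2 using m2 by (intro exI[of _ "inverse ?a"] conjI)
qed

lemma good2_hx:
  assumes k: "k < length fs" and ij: "i < fdim fs k" "j < fdim fs k"
  shows "good2 (hx fs k False i j) (scaleF (of_real (inverse (hr k * hmu fs k i))) (hx fs k True j i))"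
    and "good2 (hx fs k True i j) (scaleF (of_real (hr k * hmu fs k j)) (hx fs k False j i))"
proof -
  have "hr k \<noteq> 0" "hmu fs k i \<noteq> 0" "hmu fs k j \<noteq> 0" using hr_pos[OF k] mu_pos[OF k refl] ij by (auto simp: less_le)
  then have c: "inverse (hr k * hmu fs k i) * (hr k * hmu fs k i) = 1" "hr k * hmu fs k j * inverse (hr k * hmu fs k j) = 1" by (simp_all add: field_simps)
  have sc: "scaleF (of_real c) (scaleF (of_real d) x) = x" if "c * d = 1" for c d x
    using that by (simp del: of_real_mult flip: of_real_mult)
  note g = good_scaleF[OF good_hx(2)[OF k ij(2,1)], of "of_real (inverse (hr k * hmu fs k i))", unfolded sc[OF c(1)]]
    good_scaleF[OF good_hx(1)[OF k ij(2,1)], of "of_real (hr k * hmu fs k j)", unfolded sc[OF c(2)]]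
  show "good2 (hx fs k False i j) (scaleF (of_real (inverse (hr k * hmu fs k i))) (hx fs k True j i))"
    unfolding good2_def by (intro conjI good_hx(1)[OF k ij] g(1))
  show "good2 (hx fs k True i j) (scaleF (of_real (hr k * hmu fs k j)) (hx fs k False j i))"
    unfolding good2_def by (intro conjI good_hx(2)[OF k ij] g(2))
qed

lemma good2_induct [case_names good add scale cong]:
  assumes good: "\<And>x x'. good2 x x' \<Longrightarrow> P x"
    and add: "\<And>x y. P x \<Longrightarrow> P y \<Longrightarrow> P (x + y)"
    and scale: "\<And>a x. P x \<Longrightarrow> P (scaleF a x)"
    and cong: "\<And>x y. P x \<Longrightarrow> eqS fs x y \<Longrightarrow> P y"
  shows "P x"
proof -
  \<comment> \<open>The induction strips letters from the right; the letters already removed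
    accumulate in z.\<close>
  have "\<forall>z z'. good2 z z' \<longrightarrow> P (x * z)"
  proof (induction x rule: hx_induct)
    case (mult y k s i j)
    have "\<exists>x'. good2 (hx fs k s i j) x'" using good2_hx[OF mult(2-4)] by (cases s) auto
    then obtain x' where x': "good2 (hx fs k s i j) x'" by blast
    show ?case
    proof (intro allI impI)
      fix z z' assume "good2 z z'"
      from mult(1)[rule_format, OF good2_mult[OF x' this]]
      show "P (y * hx fs k s i j * z)" by (simp only: mult.assoc)
    qed
  next
    case (cong x y)
    show ?case
    proof (intro allI impI)
      fix z z' assume "good2 z z'"
      then show "P (y * z)" by (intro assms(4)[OF cong(1)[rule_format] eqS_mult[OF cong(2) eqS_refl]])
    qed
  qed (auto simp: distrib_right mult_scaleF_left intro: good add scale)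
  moreover have "good2 1 1" by (simp add: good2_def good_1)
  ultimately have "P (x * 1)" by blast
  then show ?thesis by simp
qed

text \<open>Induction on y. For y = 1 this is invariance. To append a generator to y, the claim is
  used for the generator times x, which is null again, and the resulting system is solved by the
  inverse matrix.\<close>

lemma slice_null:
  assumes "null x"
  shows "eqS fs (sr (\<lambda>b. h (y * b)) (delta fs x)) 0"
proof -
  have "\<forall>x. null x \<longrightarrow> eqS fs (sr (\<lambda>b. h (y * b)) (delta fs x)) 0"
  proof (induction y rule: hx_induct)
    case one
    then show ?case using haar_invariance(2) by (simp add: null_def) (metis cst_0 mult.left_neutral)
  next
    case (mult y k s i j)
    show ?case
    proof (intro allI impI)
      fix x assume x: "null x"
      define B where "B q = sr (\<lambda>b. h (y * hx fs k s q j * b)) (delta fs x)" for q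
      let ?n = "fdim fs k"
      have 1: "eqS fs (\<Sum>q<?n. hx fs k s l q * B q) 0" if "l < ?n" for l
      proof -
        have "eqS fs (sr (\<lambda>b. h (y * b)) (delta fs (hx fs k s l j * x))) 0"
          using mult(1) null_mult[OF x] by blast
        moreover have "sr (\<lambda>b. h (y * b)) (delta fs (hx fs k s l j * x)) = (\<Sum>q<?n. hx fs k s l q * B q)"
          using that mult(4) by (simp add: delta_mult dlt[OF mult(2) refl] sum_distrib_right sr_sum slice_mult linearF_h linearF_mult_left' B_def mult.assoc)
        ultimately show ?thesis by simp
      qed
      show "eqS fs (sr (\<lambda>b. h (y * hx fs k s i j * b)) (delta fs x)) 0"
      proof (cases s)
        case False
        have "eqS fs (1 * B i) (\<Sum>l<?n. hx fs k True l i * 0)"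
          by (rule eqS_contract_left[where A = "\<lambda>q l. hx fs k s l q", OF 1 mult(3)])
            (use rls(2)[OF mult(2) refl mult(3)] False in auto)
        then show ?thesis by (simp add: B_def)
      next
        case True
        have "eqS fs (cst (of_real (hmu fs k i)) * B i) (\<Sum>l<?n. scaleF (of_real (hmu fs k l)) (hx fs k False l i) * 0)"
          by (rule eqS_contract_left[where A = "\<lambda>q l. hx fs k s l q", OF 1 mult(3)])
            (use rls(4)[OF mult(2) refl mult(3)] True in \<open>auto simp: mult_scaleF_left\<close>)
        then have "eqS fs (scaleF (of_real (inverse (hmu fs k i))) (scaleF (of_real (hmu fs k i)) (B i))) (scaleF (of_real (inverse (hmu fs k i))) 0)"
          by (intro eqS_scaleF) (simp add: scaleF_def)
        then show ?thesis using mu_pos[OF mult(2) refl mult(3)] by (simp add: B_def)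
      qed
    qed
  next
    case (add y z)
    have "sr (\<lambda>b. h ((y + z) * b)) t = sr (\<lambda>b. h (y * b)) t + sr (\<lambda>b. h (z * b)) t" for t
      unfolding sr_def by (rule bilin_ext_uadd) (simp_all add: distrib_right h_add F.scale_left_distrib F.vector_space_axioms)
    then show ?case using add eqS_add[of fs _ 0 _ 0] by simp
  next
    case (scale a y)
    have "sr (\<lambda>b. h (scaleF a y * b)) t = scaleF a (sr (\<lambda>b. h (y * b)) t)" for t
    proof (induction t rule: falg2_induct)
      case (tens p q)
      show ?case
        by (subst (1 2) sr_tensF[OF linearF_mult_left'[OF linearF_h]]) (simp add: mult_scaleF_left h_scaleF)
    qed (simp add: sr_add F.scale_right_distrib)
    then show ?case using scale eqS_scaleF[of fs _ 0 a] by simp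
  next
    case (cong y z)
    have "h (z * b) = h (y * b)" for b using cong(2) by (intro h_eqS eqS_mult eqS_refl) (rule eqS_sym)
    then show ?case using cong(1) by simp
  qed
  then show ?thesis using assms by blast
qed

lemma elimination_delta:
  assumes "null x" "delta fs x = (\<Sum>(a, b)\<leftarrow>ts. tensF a b)" "cvector_space sc" "bilinF sc B"
    "\<And>a b. a \<in> rel_ideal fs \<Longrightarrow> B a b = 0" "\<And>a b. null b \<Longrightarrow> B a b = 0"
  shows "(\<Sum>(a, b)\<leftarrow>ts. B a b) = 0"
proof (rule elimination[OF assms(3-6)])
  show "eqS fs (\<Sum>(a, b)\<leftarrow>ts. scaleF (h (y * b)) a) 0" for y
    using slice_null[OF assms(1), of y] unfolding assms(2) sr_list[OF linearF_mult_left'[OF linearF_h]] .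
qed

text \<open>By \<open>slice_null\<close> the coproduct of a null element vanishes once its second
  legs are taken modulo null elements. Multiplying \<kappa>(a) b respects this, so the antipode
  identity shows that \<epsilon> vanishes on null elements. Then \<phi>(x) is the value at the
  coproduct of \<phi> \<otimes> \<epsilon>, which again respects it.\<close>

lemma null_functional:
  assumes sc: "cvector_space sc" and \<phi>: "linearF sc \<phi>" "\<And>a. a \<in> rel_ideal fs \<Longrightarrow> \<phi> a = 0" and x: "null x"
  shows "\<phi> x = 0"
proof -
  interpret V: cvector_space sc by (rule sc)
  have eps0: "eps fs b = 0" if "null b" for b
  proof -
    obtain ts where ts: "delta fs b = (\<Sum>(a, b)\<leftarrow>ts. tensF a b)" using falg2_list by blast
    define B where "B a b = L (antip G a * b)" for a b
    have "bilinF scaleC B" unfolding B_def bilinF_def linearF_def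
      by (simp add: linearF_add[OF antip_props(1)] linearF_scale[OF antip_props(1)] distrib_left distrib_right mult_scaleF_left mult_scaleF_right L_add L_scaleF)
    moreover have "B a b = 0" if "a \<in> rel_ideal fs" for a b
      using L_eqS[of "antip G a * b" 0] rel_ideal.mult_right[OF antip_props(2)[OF that]] by (simp add: B_def eqS_0_iff L_0)
    moreover have "B a b = 0" if "null b" for a b
      using null_mult[OF that, of "antip G a"] by (simp add: B_def null_iff)
    ultimately have "(\<Sum>(a, b)\<leftarrow>ts. B a b) = 0" by (intro elimination_delta[OF that ts H.cvector_space_axioms])
    moreover have "(\<Sum>(a, b)\<leftarrow>us. B a b) = L (\<Sum>(a, b)\<leftarrow>us. antip G a * b)" for us
      by (induction us) (auto simp: B_def L_0 L_add)
    moreover have "(\<Sum>(a, b)\<leftarrow>ts. antip G a * b) = bilin_ext scaleF (\<lambda>a b. antip G a * b) (delta fs b)"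
      unfolding ts by (rule F.bilin_ext_list[OF bilinF_antip, symmetric])
    ultimately have "L (cst (eps fs b)) = 0" using L_eqS[OF antip_props(3)[of b]] by simp
    then have "h (cst (eps fs b)) = 0" using gns_cinner[of 1 "cst (eps fs b)"] by simp
    then show ?thesis by (simp add: h_cst)
  qed
  obtain ts where ts: "delta fs x = (\<Sum>(a, b)\<leftarrow>ts. tensF a b)" using falg2_list by blast
  have "bilinF sc (\<lambda>a b. sc (eps fs b) (\<phi> a))" unfolding bilinF_def linearF_def
    by (simp add: linearF_add[OF \<phi>(1)] linearF_scale[OF \<phi>(1)] V.scale_right_distrib V.scale_left_distrib eps_add eps_scaleF mult.commute)
  then have "(\<Sum>(a, b)\<leftarrow>ts. sc (eps fs b) (\<phi> a)) = 0" by (intro elimination_delta[OF x ts sc]) (simp_all add: \<phi>(2) eps0)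
  moreover have "(\<Sum>(a, b)\<leftarrow>us. sc (eps fs b) (\<phi> a)) = \<phi> (\<Sum>(a, b)\<leftarrow>us. scaleF (eps fs b) a)" for us
    by (induction us) (auto simp: linearF_0[OF \<phi>(1)] linearF_add[OF \<phi>(1)] linearF_scale[OF \<phi>(1)])
  moreover have "(\<Sum>(a, b)\<leftarrow>ts. scaleF (eps fs b) a) = sr (eps fs) (delta fs x)"
    unfolding ts by (rule sr_list[OF linearF_eps, symmetric])
  ultimately have "\<phi> (sr (eps fs) (delta fs x)) = 0" by simp
  then show ?thesis using linearF_eqS[OF \<phi> counit] by simp
qed

subsection \<open>The reversing operator\<close>

lemma Theta_eq: "Theta G \<zeta> = flip G (tensop G id (Uop G) (multu G (tensop G (Uop G) (Uop G) (flip G \<zeta>))))"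
  by (simp add: Theta_def)

text \<open>Tracing the factors of \<Theta>: the flip and U \<otimes> U give y' \<otimes> x', the
  multiplicative unitary gives the coproduct of y' times 1 \<otimes> x', and the last U reverses b_l
  x' to x b'_l.\<close>

lemma Theta_tens_good:
  assumes u: "good y y'" and d: "delta fs y' = (\<Sum>l<n. tensF (a l) (b l))" and x: "good2 x x'"
    and b: "\<And>l. l < n \<Longrightarrow> good (b l) (b' l)"
  shows "Theta G (tens G (L x) (L y)) = (\<Sum>l<n. tens G (L (x * b' l)) (L (a l)))"
proof -
  have bil: "bilinF scaleC (\<lambda>a b. tens G (L a) (L b))"
    unfolding bilinF_def linearF_def by (simp add: tens_add_left tens_add_right tens_scaleC_left tens_scaleC_right L_add L_scaleF)
  have ub: "bounded_clinear (flip G)" using flip_unitary by (simp add: unitary_op_def)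
  note tb = tensop_bounded[OF bounded_clinear_id(1) bounded_clinear_Uop]
  have x': "good x x'" "good x' x" using x by (auto simp: good2_def)
  have "multu G (tensop G (Uop G) (Uop G) (flip G (tens G (L x) (L y)))) = multu G (tens G (L y') (L x'))"
    by (simp add: flip_tens tensop_tens bounded_clinear_Uop good_Uop[OF u] good_Uop[OF x'(1)])
  also have "\<dots> = (\<Sum>l<n. tens G (L (a l)) (L (b l * x')))"
    by (simp add: multu_gns d sum_distrib_right tensF_mult H.bilin_ext_sum H.bilin_ext_tensF[OF bil])
  finally have "Theta G (tens G (L x) (L y)) = (\<Sum>l<n. flip G (tens G (L (a l)) (Uop G (L (b l * x')))))"
    by (simp add: Theta_eq bounded_clinear_sum[OF tb] bounded_clinear_sum[OF ub] tensop_tens bounded_clinear_id bounded_clinear_Uop)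
  also have "\<dots> = (\<Sum>l<n. tens G (L (x * b' l)) (L (a l)))"
    using good_Uop[OF good_mult[OF b x'(2)]] by (intro sum.cong refl) (simp add: flip_tens)
  finally show ?thesis .
qed

lemma bounded_clinear_Theta: "bounded_clinear (Theta G)"
proof -
  have ub: "bounded_clinear (flip G)" "bounded_clinear (multu G)" using flip_unitary multu_unitary by (auto simp: unitary_op_def)
  show ?thesis
    unfolding Theta_eq[abs_def]
    by (rule bounded_clinear_compose[OF ub(1)], rule bounded_clinear_compose[OF tensop_bounded[OF bounded_clinear_id(1) bounded_clinear_Uop]],
      rule bounded_clinear_compose[OF ub(2)], rule bounded_clinear_compose[OF tensop_bounded[OF bounded_clinear_Uop bounded_clinear_Uop] ub(1)])
qed

text \<open>Reversal of an edge: the start x is moved along the direction, and the direction is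
  replaced by its conjugate. The factors of the two applications of U cancel in the first formula
  and leave a quotient of eigenvalues in the second.\<close>

lemma Theta_hx:
  assumes k: "k < length fs" and ij: "i < fdim fs k" "j < fdim fs k"
  shows "Theta G (tens G (L x) (L (hx fs k False i j))) = (\<Sum>l<fdim fs k. tens G (L (x * hx fs k False i l)) (L (hx fs k True j l)))"
    and "Theta G (tens G (L x) (L (hx fs k True i j))) =
      (\<Sum>l<fdim fs k. scaleC (of_real (hmu fs k j / hmu fs k l)) (tens G (L (x * hx fs k True i l)) (L (hx fs k False j l))))"
proof -
  let ?n = "fdim fs k"
  note lin = bounded_clinear_add[OF bounded_clinear_Theta] bounded_clinear_scaleC[OF bounded_clinear_Theta] L_add L_scaleF tens_add_left tens_scaleC_left distrib_right
    mult_scaleF_left sum.distrib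
  have nz: "hr k \<noteq> 0" "hmu fs k l \<noteq> 0" if "l < ?n" for l using hr_pos[OF k] mu_pos[OF k refl that] by auto
  show "Theta G (tens G (L x) (L (hx fs k False i j))) = (\<Sum>l<?n. tens G (L (x * hx fs k False i l)) (L (hx fs k True j l)))"
  proof (induction x rule: good2_induct)
    case (good x x')
    have d: "delta fs (scaleF (of_real (inverse (hr k * hmu fs k i))) (hx fs k True j i)) =
      (\<Sum>l<?n. tensF (scaleF (of_real (inverse (hr k * hmu fs k i))) (hx fs k True j l)) (hx fs k True l i))"
      using ij by (simp add: delta_scaleF dlt[OF k refl] sum_distrib_left single0_tensF)
    have "Theta G (tens G (L x) (L (hx fs k False i j))) = (\<Sum>l<?n.
      tens G (L (x * scaleF (of_real (hr k * hmu fs k i)) (hx fs k False i l))) (L (scaleF (of_real (inverse (hr k * hmu fs k i))) (hx fs k True j l))))"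
      by (rule Theta_tens_good[OF good_hx(1)[OF k ij] d good]) (rule good_hx(2)[OF k _ ij(1)])
    moreover have "inverse (complex_of_real (hr k)) * inverse (complex_of_real (hmu fs k i)) * (complex_of_real (hr k) * complex_of_real (hmu fs k i)) = 1"
      using nz[OF ij(1)] by (simp add: field_simps)
    ultimately show ?case by (simp add: mult_scaleF_right L_scaleF tens_scaleC_left tens_scaleC_right)
  next
    case (cong x y)
    have "L (y * z) = L (x * z)" for z using cong(2) by (intro L_eqS eqS_mult eqS_refl) (rule eqS_sym)
    moreover have "L y = L x" using cong(2) by (intro L_eqS) (rule eqS_sym)
    ultimately show ?case using cong(1) by simp
  qed (simp_all add: lin H.scale_sum_right)
  show "Theta G (tens G (L x) (L (hx fs k True i j))) =
      (\<Sum>l<?n. scaleC (of_real (hmu fs k j / hmu fs k l)) (tens G (L (x * hx fs k True i l)) (L (hx fs k False j l))))"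
  proof (induction x rule: good2_induct)
    case (good x x')
    have d: "delta fs (scaleF (of_real (hr k * hmu fs k j)) (hx fs k False j i)) =
      (\<Sum>l<?n. tensF (scaleF (of_real (hr k * hmu fs k j)) (hx fs k False j l)) (hx fs k False l i))"
      using ij by (simp add: delta_scaleF dlt[OF k refl] sum_distrib_left single0_tensF)
    have "Theta G (tens G (L x) (L (hx fs k True i j))) = (\<Sum>l<?n.
      tens G (L (x * scaleF (of_real (inverse (hr k * hmu fs k l))) (hx fs k True i l))) (L (scaleF (of_real (hr k * hmu fs k j)) (hx fs k False j l))))"
      by (rule Theta_tens_good[OF good_hx(2)[OF k ij] d good]) (rule good_hx(1)[OF k _ ij(1)])
    also have "\<dots> = (\<Sum>l<?n. scaleC (of_real (hmu fs k j / hmu fs k l)) (tens G (L (x * hx fs k True i l)) (L (hx fs k False j l))))"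
      using nz by (intro sum.cong refl) (simp add: mult_scaleF_right L_scaleF tens_scaleC_left tens_scaleC_right field_simps)
    finally show ?case .
  next
    case (cong x y)
    have "L (y * z) = L (x * z)" for z using cong(2) by (intro L_eqS eqS_mult eqS_refl) (rule eqS_sym)
    moreover have "L y = L x" using cong(2) by (intro L_eqS) (rule eqS_sym)
    ultimately show ?case using cong(1) by simp
  qed (simp_all add: lin H.scale_sum_right scaleC_add_right mult.commute)
qed

end

section \<open>The edge space\<close>

lemma sr_mult:
  assumes "linearF (*) f" "\<And>x y. f (x * y) = f x * f y"
  shows "sr f (s * t) = sr f s * sr f t"
proof (induction s rule: falg2_induct)
  case (tens x y)
  show ?case
  proof (induction t rule: falg2_induct)
    case (tens x' y')
    show ?case by (simp add: tensF_mult sr_tensF assms mult_scaleF_left mult_scaleF_right mult.commute)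
  qed (simp add: distrib_left sr_add)
qed (simp add: distrib_right sr_add)

lemma delta_1 [simp]: "delta fs 1 = 1"
proof -
  have "delta fs (mon (Word [])) = 1" by (simp add: mon_def delta_single)
  then show ?thesis by (simp add: mon_Nil)
qed

lemma one_falg2: "(1 :: falg2) = tensF 1 1"
  using tensF_single[of 0 1 0 1] by (simp add: zero_prod_def flip: single_one)

lemma letter_gx: "\<exists>k s i j. mon (Word [g]) = gx k s i j"
  by (cases g) (auto simp: gx_def intro: exI[of _ False] exI[of _ True])

lemma word_induct [case_names Nil snoc]:
  assumes "P 1" "\<And>x k s i j. P x \<Longrightarrow> P (x * gx k s i j)"
  shows "P (mon w)"
proof -
  have "P (mon (Word u))" for u
  proof (induction u rule: rev_induct)
    case (snoc g u)
    obtain k s i j where "mon (Word [g]) = gx k s i j" using letter_gx by blast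
    then show ?case using assms(2)[OF snoc] by (simp only: mon_append)
  qed (simp add: mon_Nil assms(1))
  then show ?thesis by (cases w) simp
qed

text \<open>Both flags of an \<open>AO\<close> factor name the same self-dual direction.\<close>

definition sdir :: "factor list \<Rightarrow> nat \<times> bool \<Rightarrow> nat \<times> bool \<Rightarrow> bool"
  where "sdir fs d d' \<longleftrightarrow> fst d = fst d' \<and> (snd d = snd d' \<or> (\<exists>Q. fs ! fst d = AO Q))"

section \<open>Rescaling automorphisms and orthogonality of directions\<close>

context valid_cayley_graph begin

lemma scaling_obtain:
  assumes c: "c \<noteq> 0" "\<And>Q. fs ! k = AO Q \<Longrightarrow> c = - 1"
  obtains \<chi> where "kills fs \<chi>" "\<chi> 1 = 1" "\<And>x y. \<chi> (x * y) = \<chi> x * \<chi> y"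
    "\<And>k' s i j. i < fdim fs k' \<Longrightarrow> j < fdim fs k' \<Longrightarrow> \<chi> (gx k' s i j) = (if i = j then if k' = k then if s then 1 / c else c else 1 else 0)"
proof -
  have "\<exists>\<chi>. kills fs \<chi> \<and> \<chi> 1 = 1 \<and> (\<forall>x y. \<chi> (x * y) = \<chi> x * \<chi> y) \<and>
    (\<forall>k' s i j. i < fdim fs k' \<longrightarrow> j < fdim fs k' \<longrightarrow> \<chi> (gx k' s i j) =
      (if i = j then if k' = k then if s then 1 / c else c else 1 else 0))"
    by (rule scaling_character[OF valid c])
  then obtain \<chi> where \<chi>: "kills fs \<chi> \<and> \<chi> 1 = 1 \<and> (\<forall>x y. \<chi> (x * y) = \<chi> x * \<chi> y) \<and>
    (\<forall>k' s i j. i < fdim fs k' \<longrightarrow> j < fdim fs k' \<longrightarrow> \<chi> (gx k' s i j) =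
      (if i = j then if k' = k then if s then 1 / c else c else 1 else 0))" by (rule exE)
  show thesis by (rule that[of \<chi>]) (simp_all only: \<chi>)
qed

text \<open>The scaling character for the index \<open>length fs\<close>, which belongs to no
  factor, scales nothing and coincides with \<epsilon>. So the counit descends to \<S>.\<close>

lemma eps_kills: "kills fs (eps fs)"
proof -
  let ?k = "length fs"
  obtain \<chi> where \<chi>: "kills fs \<chi>" "\<chi> 1 = 1" "\<And>x y. \<chi> (x * y) = \<chi> x * \<chi> y"
    "\<And>k s i j. i < fdim fs k \<Longrightarrow> j < fdim fs k \<Longrightarrow> \<chi> (gx k s i j) = (if i = j then if k = ?k then if s then 1 / (- 1) else - 1 else 1 else 0)"
    by (rule scaling_obtain[of "- 1" ?k]) auto
  have "\<chi> (gx k s i j) = eps fs (gx k s i j)" for k s i j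
  proof (cases "i < fdim fs k \<and> j < fdim fs k")
    case True
    then have "k \<noteq> ?k" by (auto simp: fdim_def)
    then show ?thesis using \<chi>(4) True by (simp add: eps_gx)
  next
    case False
    then have "\<chi> (gx k s i j) = 0" using \<chi>(1) gx_unused[of i fs k j s] by (simp add: kills_def)
    then show ?thesis using False by (auto simp: eps_gx)
  qed
  then have e: "\<chi> (mon w) = eps fs (mon w)" for w
    by (induction rule: word_induct) (simp_all add: \<chi>(2,3) eps_mult)
  have lin: "linearF (*) \<chi>" using \<chi>(1) by (simp add: kills_def)
  have "\<chi> = eps fs" by (rule ext, rule linearF_eqI[OF lin linearF_eps e])
  then show ?thesis using \<chi>(1) by simp
qed

text \<open>The automorphism is convolution by the scaling character. It preserves h because
  applying h to it slices the coproduct by h, which leaves the scalar h(x).\<close>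

lemma haar_scaling:
  assumes c: "c \<noteq> 0" "\<And>Q. fs ! k = AO Q \<Longrightarrow> c = - 1"
  obtains \<sigma> where "linearF scaleF \<sigma>" "\<sigma> 1 = 1" "\<And>x y. \<sigma> (x * y) = \<sigma> x * \<sigma> y" "\<And>x. h (\<sigma> x) = h x"
    "\<And>k' s i j. i < fdim fs k' \<Longrightarrow> j < fdim fs k' \<Longrightarrow> \<sigma> (gx k' s i j) = scaleF (if k' = k then if s then 1 / c else c else 1) (gx k' s i j)"
proof -
  obtain \<chi> where \<chi>: "kills fs \<chi>" "\<chi> 1 = 1" "\<And>x y. \<chi> (x * y) = \<chi> x * \<chi> y"
    "\<And>k' s i j. i < fdim fs k' \<Longrightarrow> j < fdim fs k' \<Longrightarrow> \<chi> (gx k' s i j) = (if i = j then if k' = k then if s then 1 / c else c else 1 else 0)"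
    by (rule scaling_obtain[of c k], rule c(1), erule c(2)) (rule that; assumption)
  have lin: "linearF (*) \<chi>" using \<chi>(1) by (simp add: kills_def)
  define \<sigma> where "\<sigma> x = sr \<chi> (delta fs x)" for x
  have hs: "h (sr \<chi> t) = \<chi> (sl h t)" for t
    by (induction t rule: falg2_induct)
      (simp_all add: sr_tensF sl_tensF lin linearF_h sr_add sl_add h_add h_scaleF linearF_add[OF lin] linearF_scale[OF lin])
  show thesis
  proof
    show "linearF scaleF \<sigma>" unfolding linearF_def \<sigma>_def by (simp add: delta_add sr_add delta_scaleF sr_scale[OF lin])
    show "\<sigma> 1 = 1" by (simp add: \<sigma>_def one_falg2 sr_tensF[OF lin] \<chi>(2))
    show "\<sigma> (x * y) = \<sigma> x * \<sigma> y" for x y by (simp add: \<sigma>_def delta_mult sr_mult[OF lin \<chi>(3)])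
    show "h (\<sigma> x) = h x" for x
    proof -
      have "h (\<sigma> x) = \<chi> (cst (h x))" unfolding \<sigma>_def hs by (rule kills_eqS[OF \<chi>(1) haar_invariance(1)])
      also have "\<dots> = h x" using linearF_scale[OF lin, of "h x" 1] by (simp add: scaleF_1_cst \<chi>(2))
      finally show ?thesis .
    qed
    show "\<sigma> (gx k' s i j) = scaleF (if k' = k then if s then 1 / c else c else 1) (gx k' s i j)"
      if ij: "i < fdim fs k'" "j < fdim fs k'" for k' s i j
    proof -
      have "\<sigma> (gx k' s i j) = (\<Sum>l<fdim fs k'. scaleF (\<chi> (gx k' s l j)) (gx k' s i l))"
        by (simp add: \<sigma>_def delta_gx sr_sum sr_tensF[OF lin])
      also have "\<dots> = (\<Sum>l<fdim fs k'. if l = j then scaleF (if k' = k then if s then 1 / c else c else 1) (gx k' s i j) else 0)"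
        using ij by (intro sum.cong refl) (simp add: \<chi>(4))
      finally show ?thesis using ij by simp
    qed
  qed
qed

lemma linear_hx:
  assumes k: "k < length fs" and \<sigma>: "linearF scaleF \<sigma>" and ij: "i < fdim fs k" "j < fdim fs k"
    and g: "\<And>i j. i < fdim fs k \<Longrightarrow> j < fdim fs k \<Longrightarrow> \<sigma> (gx k s i j) = scaleF a (gx k s i j)"
  shows "\<sigma> (hx fs k s i j) = scaleF a (hx fs k s i j)"
  using hx_index[OF k valid[OF k] refl refl ij] hx_index_star[OF k valid[OF k] refl refl ij] g
  by (cases s) (simp_all add: linearF_sum[OF \<sigma>] linearF_scale[OF \<sigma>] F.scale_sum_right mult.commute)

text \<open>The rescaling automorphism preserves h but multiplies the product in question by a
  factor different from 1.\<close>

lemma hx_orthogonal: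
  assumes k: "k < length fs" "k' < length fs" and d: "\<not> sdir fs (k, s) (k', s')"
    and ij: "i < fdim fs k" "j < fdim fs k" "p < fdim fs k'" "q < fdim fs k'"
  shows "cinner (L (hx fs k s i j)) (L (hx fs k' s' p q)) = 0"
proof -
  \<comment> \<open>A sign suffices for an \<open>AO\<close> factor, as the other direction then
    lies in another factor. For \<open>AU\<close> the weight also has to separate u from its
    conjugate, so its square must not be 1.\<close>
  define c :: complex where "c = (if \<exists>Q. fs ! k = AO Q then - 1 else 2)"
  have c: "c \<noteq> 0" "fs ! k = AO Q \<Longrightarrow> c = - 1" for Q by (auto simp: c_def)
  obtain \<sigma> where \<sigma>: "linearF scaleF \<sigma>" "\<sigma> 1 = 1" "\<And>x y. \<sigma> (x * y) = \<sigma> x * \<sigma> y" "\<And>x. h (\<sigma> x) = h x"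
    "\<And>k' s i j. i < fdim fs k' \<Longrightarrow> j < fdim fs k' \<Longrightarrow> \<sigma> (gx k' s i j) = scaleF (if k' = k then if s then 1 / c else c else 1) (gx k' s i j)"
    by (rule haar_scaling[of c k], rule c(1), erule c(2)) (rule that; assumption)
  define w where "w k' s = (if k' = k then if s then 1 / c else c else 1)" for k' s
  have sc: "\<sigma> (hx fs k' s i j) = scaleF (w k' s) (hx fs k' s i j)" if "k' < length fs" "i < fdim fs k'" "j < fdim fs k'" for k' s i j
    using \<sigma>(5) by (intro linear_hx[OF that(1) \<sigma>(1) that(2,3)]) (auto simp: w_def)
  let ?x = "hx fs k (\<not> s) i j * hx fs k' s' p q"
  have "h ?x = h (\<sigma> ?x)" by (simp only: \<sigma>(4))
  also have "\<sigma> ?x = scaleF (w k (\<not> s) * w k' s') ?x" using sc k ij by (simp add: \<sigma>(3) mult_scaleF_left mult_scaleF_right mult.commute)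
  finally have "h ?x = w k (\<not> s) * w k' s' * h ?x" by (simp only: h_scaleF)
  moreover have "w k (\<not> s) * w k' s' \<noteq> 1"
    using d by (auto simp: w_def sdir_def c_def split: if_splits)
  ultimately have "h ?x = 0" by simp
  then show ?thesis by (simp add: gns_cinner)
qed

lemma hx_orthogonal':
  assumes k: "k < length fs" and ij: "i < fdim fs k" "j < fdim fs k" "p < fdim fs k" "q < fdim fs k"
  shows "cinner (L (hx fs k s i j)) (L (hx fs k s p q)) =
    (if i = p \<and> j = q then of_real (if s then hmu fs k j / hmusum fs k else inverse (hmuinv fs k * hmu fs k i)) else 0)"
  using haar_values(2,3)[OF k refl ij(1,2) ij(3,4)] by (cases s) (simp_all add: gns_cinner)

definition dspan :: "nat \<Rightarrow> bool \<Rightarrow> 'a set"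
  where "dspan k s = H.span ((\<lambda>(i, j). L (hx fs k s i j)) ` ({..<fdim fs k} \<times> {..<fdim fs k}))"

definition espan :: "'a set"
  where "espan = H.span {L (hx fs k s i j) | k s i j. k < length fs \<and> i < fdim fs k \<and> j < fdim fs k}"

lemma hx_in_dspan: "i < fdim fs k \<Longrightarrow> j < fdim fs k \<Longrightarrow> L (hx fs k s i j) \<in> dspan k s"
  unfolding dspan_def by (intro H.span_base) auto

lemma dspan_subset: "k < length fs \<Longrightarrow> dspan k s \<subseteq> espan"
  unfolding dspan_def espan_def by (intro H.span_mono) auto

end

section \<open>The coefficient spaces of the directions and the projection onto them\<close>

lemma orth_proj_orthogonal_span:
  fixes b :: "'i \<Rightarrow> 'a::complex_hilbert"
  assumes A: "finite A" and o: "\<And>i j. i \<in> A \<Longrightarrow> j \<in> A \<Longrightarrow> i \<noteq> j \<Longrightarrow> cinner (b i) (b j) = 0"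
  shows "orth_proj (H.span (b ` A)) \<xi> \<in> H.span (b ` A)"
proof -
  define \<eta> where "\<eta> = (\<Sum>i\<in>A. scaleC (cinner (b i) \<xi> / cinner (b i) (b i)) (b i))"
  have \<eta>: "\<eta> \<in> H.span (b ` A)" unfolding \<eta>_def by (intro H.span_sum H.span_scale H.span_base) auto
  have "cinner \<mu> (\<xi> - \<eta>) = 0" if "\<mu> \<in> H.span (b ` A)" for \<mu>
    using that
  proof (induction rule: H.span_induct_alt)
    case base
    then show ?case by simp
  next
    case (step c x y)
    then obtain i where i: "i \<in> A" "x = b i" by auto
    have "cinner (b i) \<eta> = (\<Sum>j\<in>A. if j = i then cinner (b i) \<xi> / cinner (b i) (b i) * cinner (b i) (b i) else 0)"
      unfolding \<eta>_def cinner_sum_right cinner_scaleC_right using o i by (intro sum.cong refl) auto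
    also have "\<dots> = cinner (b i) \<xi>" using A i by (auto simp: cinner_self)
    finally show ?case using step by (simp add: i cinner_add_left cinner_scaleC_left cinner_diff_right)
  qed
  with \<eta> have "orth_proj (H.span (b ` A)) \<xi> = \<eta>"
    by (intro orth_proj_eqI) (auto simp: csubspace_subspace)
  with \<eta> show ?thesis by simp
qed

lemma orth_proj_fix: "csubspace M \<Longrightarrow> \<xi> \<in> M \<Longrightarrow> orth_proj M \<xi> = \<xi>"
  by (rule orth_proj_eqI) auto

lemma orth_proj_0: "csubspace M \<Longrightarrow> (\<And>\<mu>. \<mu> \<in> M \<Longrightarrow> cinner \<mu> \<xi> = 0) \<Longrightarrow> orth_proj M \<xi> = 0"
  by (rule orth_proj_eqI) (auto simp: csubspace_def)

text \<open>Pairs of a factor and a conjugation flag, in the order of \<open>directions\<close>; an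
  \<open>AO\<close> factor is listed with the flag \<open>False\<close> only.\<close>

definition dirs :: "factor list \<Rightarrow> (nat \<times> bool) list"
  where "dirs fs = filter (\<lambda>(k, s). s \<longrightarrow> (\<exists>Q. fs ! k = AU Q)) (List.product [0..<length fs] [False, True])"

lemma directions_dirs: "directions fs = map (\<lambda>(k, s). if s then vmat fs k else umat fs k) (dirs fs)"
proof -
  let ?f = "\<lambda>(k, s). if s then vmat fs k else umat fs k"
  let ?P = "\<lambda>(k, s). s \<longrightarrow> (\<exists>Q. fs ! k = AU Q)"
  have "map ?f (filter ?P (List.product ks [False, True])) = concat (map (\<lambda>k. case fs ! k of AO Q \<Rightarrow> [umat fs k] | AU Q \<Rightarrow> [umat fs k, vmat fs k]) ks)" for ks
  proof (induction ks)
    case (Cons k ks)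
    then show ?case by (cases "fs ! k") simp_all
  qed simp
  then show ?thesis by (simp only: dirs_def directions_def)
qed

lemma set_dirs: "(k, s) \<in> set (dirs fs) \<longleftrightarrow> k < length fs \<and> (s \<longrightarrow> (\<exists>Q. fs ! k = AU Q))"
  by (auto simp: dirs_def)

lemma distinct_dirs: "distinct (dirs fs)"
  by (simp add: dirs_def distinct_product)

lemma sdir_dirs: "k < length fs \<Longrightarrow> \<exists>!d. d \<in> set (dirs fs) \<and> sdir fs d (k, s)"
  by (cases "fs ! k") (auto simp: sdir_def set_dirs intro!: ex1I[of _ "(k, if \<exists>Q. fs ! k = AO Q then False else s)"])

lemma double_inversion:
  fixes n :: nat
  assumes 1: "\<And>a. a < n \<Longrightarrow> (\<Sum>p<n. P i p * P' p a) = (if i = a then 1 else 0)"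
    and 2: "\<And>b. b < n \<Longrightarrow> (\<Sum>q<n. R' b q * R q j) = (if b = j then 1 else 0)"
    and ij: "i < n" "j < n"
  shows "(\<Sum>p<n. \<Sum>q<n. scaleF (P i p * R q j) (\<Sum>a<n. \<Sum>b<n. scaleF (P' p a * R' b q) (Y a b))) = Y i j"
proof -
  have "(\<Sum>p<n. \<Sum>q<n. scaleF (P i p * R q j) (\<Sum>a<n. \<Sum>b<n. scaleF (P' p a * R' b q) (Y a b))) =
    (\<Sum>p<n. \<Sum>q<n. \<Sum>a<n. \<Sum>b<n. scaleF ((P i p * P' p a) * (R' b q * R q j)) (Y a b))"
    by (simp add: F.scale_sum_right mult_ac)
  also have "\<dots> = (\<Sum>a<n. \<Sum>b<n. \<Sum>p<n. \<Sum>q<n. scaleF ((P i p * P' p a) * (R' b q * R q j)) (Y a b))"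
    by (rule sum_swap4)
  also have "\<dots> = (\<Sum>a<n. \<Sum>b<n. scaleF ((\<Sum>p<n. P i p * P' p a) * (\<Sum>q<n. R' b q * R q j)) (Y a b))"
    by (simp only: sum_product F.scale_sum_left)
  also have "\<dots> = (\<Sum>a<n. \<Sum>b<n. if a = i \<and> b = j then Y i j else 0)"
    by (intro sum.cong refl) (simp only: 1 2 lessThan_iff, auto)
  also have "\<dots> = (\<Sum>a<n. if a = i then Y i j else 0)"
    using ij by (intro sum.cong refl) auto
  finally show ?thesis using ij by simp
qed

context valid_cayley_graph begin

lemma vmat_sum:
  assumes k: "k < length fs" and ij: "i < fdim fs k" "j < fdim fs k"
  shows "vmat fs k $$ (i, j) = (\<Sum>a<fdim fs k. \<Sum>b<fdim fs k. scaleF (fmat (fs ! k) $$ (i, a) * inv_mat (fmat (fs ! k)) $$ (b, j)) (gx k True a b))"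
proof -
  have "vmat fs k $$ (i, j) = gx k False i j - ao_rel fs k i j" by (simp flip: vmat_index[OF k valid[OF k] ij])
  then show ?thesis by (simp add: ao_rel_def scaleF_def)
qed

lemma gx_vmat:
  assumes k: "k < length fs" and ij: "i < fdim fs k" "j < fdim fs k"
  shows "gx k True i j = (\<Sum>a<fdim fs k. \<Sum>b<fdim fs k. scaleF (inv_mat (fmat (fs ! k)) $$ (i, a) * fmat (fs ! k) $$ (b, j)) (vmat fs k $$ (a, b)))"
proof -
  let ?Q = "fmat (fs ! k)" and ?n = "fdim fs k"
  have "(\<Sum>p<?n. \<Sum>q<?n. scaleF (inv_mat ?Q $$ (i, p) * ?Q $$ (q, j)) (\<Sum>a<?n. \<Sum>b<?n. scaleF (?Q $$ (p, a) * inv_mat ?Q $$ (b, q)) (gx k True a b))) = gx k True i j"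
    by (rule double_inversion[OF _ _ ij, where P = "\<lambda>i p. inv_mat ?Q $$ (i, p)" and P' = "\<lambda>p a. ?Q $$ (p, a)" and R = "\<lambda>q j. ?Q $$ (q, j)" and R' = "\<lambda>b q. inv_mat ?Q $$ (b, q)"])
      (use inv_mat_sum[OF k valid[OF k]] ij in auto)
  moreover have "(\<Sum>p<?n. \<Sum>q<?n. scaleF (inv_mat ?Q $$ (i, p) * ?Q $$ (q, j)) (\<Sum>a<?n. \<Sum>b<?n. scaleF (?Q $$ (p, a) * inv_mat ?Q $$ (b, q)) (gx k True a b))) =
    (\<Sum>p<?n. \<Sum>q<?n. scaleF (inv_mat ?Q $$ (i, p) * ?Q $$ (q, j)) (vmat fs k $$ (p, q)))"
    by (intro sum.cong refl) (simp add: vmat_sum[OF k])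
  ultimately show ?thesis by simp
qed

text \<open>Membership in a linear span modulo the relations. The entries of u, of v and of the
  diagonalised matrix have to be exchanged for one another repeatedly, and the coefficients are
  irrelevant there.\<close>

definition comb :: "nat \<Rightarrow> falg \<Rightarrow> (nat \<Rightarrow> nat \<Rightarrow> falg) \<Rightarrow> bool"
  where "comb n x f \<longleftrightarrow> (\<exists>c. eqS fs x (\<Sum>a<n. \<Sum>b<n. scaleF (c a b) (f a b)))"

lemma combI: "x = (\<Sum>a<n. \<Sum>b<n. scaleF (c a b) (f a b)) \<Longrightarrow> comb n x f"
  unfolding comb_def by (rule exI[of _ c]) simp

lemma hx_comb_gx:
  assumes k: "k < length fs" and ij: "i < fdim fs k" "j < fdim fs k"
  shows "comb (fdim fs k) (hx fs k s i j) (gx k s)"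
proof (cases s)
  case True
  show ?thesis using True combI[OF hx_index_star[OF k valid[OF k] refl refl ij]] by simp
next
  case False
  show ?thesis using False combI[OF hx_index[OF k valid[OF k] refl refl ij]] by simp
qed

lemma gx_comb_hx:
  assumes k: "k < length fs" and ij: "i < fdim fs k" "j < fdim fs k"
  shows "comb (fdim fs k) (gx k s i j) (hx fs k s)"
proof (cases s)
  case True
  show ?thesis using True combI[OF gx_hx_star[OF k valid[OF k] refl refl ij]] by simp
next
  case False
  show ?thesis using False combI[OF gx_hx[OF k valid[OF k] refl refl ij]] by simp
qed

lemma comb_dspan:
  assumes "comb n x f" "\<And>a b. a < n \<Longrightarrow> b < n \<Longrightarrow> L (f a b) \<in> dspan k s"
  shows "L x \<in> dspan k s"
proof -
  obtain c where "eqS fs x (\<Sum>a<n. \<Sum>b<n. scaleF (c a b) (f a b))" using assms(1) unfolding comb_def by (rule exE)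
  then have "L x = (\<Sum>a<n. \<Sum>b<n. scaleC (c a b) (L (f a b)))" by (simp add: L_eqS L_sum L_scaleF)
  then show ?thesis
    using assms(2) unfolding dspan_def by (auto intro!: H.span_sum H.span_scale)
qed

lemma gx_in_dspan:
  assumes "k < length fs" "i < fdim fs k" "j < fdim fs k" shows "L (gx k s i j) \<in> dspan k s"
  using gx_comb_hx[OF assms] by (rule comb_dspan) (rule hx_in_dspan)

lemma linear_image_span:
  assumes 1: "\<And>x. x \<in> E \<Longrightarrow> L x \<in> H.span B" and 2: "\<And>y. y \<in> B \<Longrightarrow> \<exists>x\<in>F.span E. y = L x"
  shows "L ` F.span E = H.span B"
proof
  have "L x \<in> H.span B" if "x \<in> F.span E" for x
    using that by (induction rule: F.span_induct_alt) (auto simp: L_0 L_add L_scaleF intro: H.span_zero H.span_add H.span_scale 1)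
  then show "L ` F.span E \<subseteq> H.span B" by blast
  show "H.span B \<subseteq> L ` F.span E"
  proof
    fix y assume "y \<in> H.span B"
    then show "y \<in> L ` F.span E"
    proof (induction rule: H.span_induct_alt)
      case base
      show ?case by (intro image_eqI[of _ _ 0]) (auto simp: L_0 F.span_zero)
    next
      case (step c x y)
      then obtain u v where "u \<in> F.span E" "v \<in> F.span E" "x = L u" "y = L v" using 2 by blast
      then show ?case by (intro image_eqI[of _ _ "scaleF c u + v"]) (auto simp: L_add L_scaleF F.span_add F.span_scale)
    qed
  qed
qed

lemma direction_span:
  assumes k: "k < length fs" and \<alpha>: "\<alpha> = (if s then vmat fs k else umat fs k)"
  shows "L ` F.span {\<alpha> $$ (i, j) | i j. i < dim_row \<alpha> \<and> j < dim_col \<alpha>} = dspan k s"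
  unfolding dspan_def
proof (rule linear_image_span)
  let ?n = "fdim fs k"
  have dim: "dim_row \<alpha> = ?n" "dim_col \<alpha> = ?n"
    using vmat_carrier[OF k valid[OF k]] by (auto simp: \<alpha> umat_gmat)
  let ?E = "{\<alpha> $$ (i, j) | i j. i < dim_row \<alpha> \<and> j < dim_col \<alpha>}"
  show "L x \<in> H.span ((\<lambda>(i, j). L (hx fs k s i j)) ` ({..<?n} \<times> {..<?n}))" if "x \<in> ?E" for x
  proof -
    from that obtain i j where x: "x = \<alpha> $$ (i, j)" and ij: "i < ?n" "j < ?n" unfolding dim by blast
    have "L x \<in> dspan k s"
    proof (cases s)
      case True
      have "comb ?n (vmat fs k $$ (i, j)) (gx k True)" by (rule combI[OF vmat_sum[OF k ij]])
      then have "L (vmat fs k $$ (i, j)) \<in> dspan k True" by (rule comb_dspan) (rule gx_in_dspan[OF k])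
      then show ?thesis by (simp add: x \<alpha> True)
    next
      case False
      show ?thesis using gx_in_dspan[OF k ij, of False] ij by (simp add: x \<alpha> False umat_gmat)
    qed
    then show ?thesis by (simp only: dspan_def)
  qed
  show "\<exists>x\<in>F.span ?E. y = L x" if "y \<in> (\<lambda>(i, j). L (hx fs k s i j)) ` ({..<?n} \<times> {..<?n})" for y
  proof -
    from that obtain i j where y: "y = L (hx fs k s i j)" and ij: "i < ?n" "j < ?n" by auto
    have e: "\<alpha> $$ (a, b) \<in> F.span ?E" if "a < ?n" "b < ?n" for a b
      using that by (intro F.span_base) (auto simp: dim)
    have "gx k s a b \<in> F.span ?E" if ab: "a < ?n" "b < ?n" for a b
    proof (cases s)
      case True
      have a: "vmat fs k = \<alpha>" using True by (simp add: \<alpha>)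
      have "gx k True a b \<in> F.span ?E" unfolding gx_vmat[OF k ab] a by (intro F.span_sum F.span_scale e) auto
      then show ?thesis using True by simp
    next
      case False
      then have "gx k s a b = \<alpha> $$ (a, b)" using ab by (simp add: \<alpha> umat_gmat)
      then show ?thesis using e[OF ab] by simp
    qed
    moreover obtain c where c: "eqS fs (hx fs k s i j) (\<Sum>a<?n. \<Sum>b<?n. scaleF (c a b) (gx k s a b))"
      using hx_comb_gx[OF k ij] unfolding comb_def by (rule exE)
    ultimately have "(\<Sum>a<?n. \<Sum>b<?n. scaleF (c a b) (gx k s a b)) \<in> F.span ?E" by (auto intro!: F.span_sum F.span_scale)
    then show ?thesis using L_eqS[OF c] y by auto
  qed
qed

lemma csubspace_dspan: "csubspace (dspan k s)"
  by (simp add: csubspace_subspace dspan_def)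

lemma orth_proj_dspan:
  assumes "k < length fs" shows "orth_proj (dspan k s) \<xi> \<in> dspan k s"
  unfolding dspan_def
  by (rule orth_proj_orthogonal_span) (auto simp: hx_orthogonal'[OF assms] split: if_splits)

lemma p1_dirs: "p1 fs G \<xi> = (\<Sum>d\<in>set (dirs fs). orth_proj (dspan (fst d) (snd d)) \<xi>)"
proof -
  have "proj_corep G (if s then vmat fs k else umat fs k) = orth_proj (dspan k s)" if "k < length fs" for k s
    unfolding proj_corep_def direction_span[OF that refl] ..
  then have e: "proj_corep G (case d of (k, s) \<Rightarrow> if s then vmat fs k else umat fs k) = orth_proj (dspan (fst d) (snd d))"
    if "d \<in> set (dirs fs)" for d using that by (cases d) (auto simp: set_dirs)
  have "p1 fs G \<xi> = (\<Sum>d\<leftarrow>dirs fs. proj_corep G (case d of (k, s) \<Rightarrow> if s then vmat fs k else umat fs k) \<xi>)"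
    by (simp add: p1_def directions_dirs comp_def)
  also have "\<dots> = (\<Sum>d\<leftarrow>dirs fs. orth_proj (dspan (fst d) (snd d)) \<xi>)"
    by (intro arg_cong[of _ _ sum_list] map_cong refl) (simp only: e)
  also have "\<dots> = (\<Sum>d\<in>set (dirs fs). orth_proj (dspan (fst d) (snd d)) \<xi>)"
    by (rule sum_list_distinct_conv_sum_set[OF distinct_dirs])
  finally show ?thesis .
qed

lemma p1_in_espan: "p1 fs G \<xi> \<in> espan"
  unfolding p1_dirs espan_def
proof (rule H.span_sum)
  fix d assume "d \<in> set (dirs fs)"
  then have "fst d < length fs" using set_dirs[of "fst d" "snd d"] by simp
  then show "orth_proj (dspan (fst d) (snd d)) \<xi> \<in> H.span {L (hx fs k s i j) | k s i j. k < length fs \<and> i < fdim fs k \<and> j < fdim fs k}"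
    using orth_proj_dspan dspan_subset unfolding espan_def by blast
qed

lemma AO_star_comb:
  assumes k: "k < length fs" "fs ! k = AO Q" and ij: "i < fdim fs k" "j < fdim fs k"
  shows "comb (fdim fs k) (gx k True i j) (gx k False)"
proof -
  let ?c = "\<lambda>a b. cnj (fmat (fs ! k) $$ (i, a) * inv_mat (fmat (fs ! k)) $$ (b, j))"
  have "starF (ao_rel fs k i j) \<in> rel_ideal fs" by (rule rel_ideal.star[OF ao_rel_in_ideal[OF k(1) valid[OF k(1)] ij k(2)]])
  moreover have "starF (ao_rel fs k i j) = gx k True i j - (\<Sum>a<fdim fs k. \<Sum>b<fdim fs k. scaleF (?c a b) (gx k False a b))"
    unfolding ao_rel_def starF_diff starF_sum scaleF_def[symmetric] starF_scaleF starF_gx by (simp only: not_False_eq_True not_True_eq_False)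
  ultimately have "eqS fs (gx k True i j) (\<Sum>a<fdim fs k. \<Sum>b<fdim fs k. scaleF (?c a b) (gx k False a b))"
    by (simp only: eqS_def)
  then show ?thesis unfolding comb_def by (rule exI[of _ ?c])
qed

lemma hx_in_dspan_sdir:
  assumes k: "k < length fs" and ij: "i < fdim fs k" "j < fdim fs k" and d: "d \<in> set (dirs fs)" "sdir fs d (k, s)"
  shows "L (hx fs k s i j) \<in> dspan (fst d) (snd d)"
proof (cases "snd d = s")
  case True
  then show ?thesis using d(2) hx_in_dspan[OF ij] by (simp add: sdir_def)
next
  case False
  then obtain Q where Q: "fst d = k" "fs ! k = AO Q" using d by (auto simp: sdir_def)
  then have s: "snd d = False" "s = True" using d(1) False by (cases d; auto simp: set_dirs)+
  have "L (gx k True a b) \<in> dspan k False" if ab: "a < fdim fs k" "b < fdim fs k" for a b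
    using AO_star_comb[OF k Q(2) ab] by (rule comb_dspan) (rule gx_in_dspan[OF k])
  with hx_comb_gx[OF k ij] have "L (hx fs k True i j) \<in> dspan k False" by (rule comb_dspan)
  then show ?thesis by (simp add: s Q(1))
qed

text \<open>Exactly one listed direction contains the vector, and the remaining coefficient spaces
  are orthogonal to it.\<close>

lemma p1_hx:
  assumes k: "k < length fs" and ij: "i < fdim fs k" "j < fdim fs k"
  shows "p1 fs G (L (hx fs k s i j)) = L (hx fs k s i j)"
proof -
  let ?v = "L (hx fs k s i j)"
  obtain d where d: "d \<in> set (dirs fs)" "sdir fs d (k, s)" "\<And>d'. d' \<in> set (dirs fs) \<Longrightarrow> sdir fs d' (k, s) \<Longrightarrow> d' = d"
    using ex1_implies_ex[OF sdir_dirs[OF k, of s]] sdir_dirs[OF k, of s] by (metis (no_types, lifting))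
  have "orth_proj (dspan (fst d') (snd d')) ?v = (if d' = d then ?v else 0)" if d': "d' \<in> set (dirs fs)" for d'
  proof (cases "d' = d")
    case True
    then show ?thesis using hx_in_dspan_sdir[OF k ij d(1,2)] by (simp add: orth_proj_fix csubspace_dspan)
  next
    case False
    then have n: "\<not> sdir fs (fst d', snd d') (k, s)" using d(3)[OF d'] by (simp only: prod.collapse) blast
    have k': "fst d' < length fs" using d' set_dirs[of "fst d'" "snd d'"] by simp
    have "cinner \<mu> ?v = 0" if "\<mu> \<in> dspan (fst d') (snd d')" for \<mu>
      using that unfolding dspan_def
      by (induction rule: H.span_induct_alt) (auto simp: cinner_add_left cinner_scaleC_left hx_orthogonal[OF k' k n _ _ ij])
    then show ?thesis using False by (simp add: orth_proj_0 csubspace_dspan)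
  qed
  then have "p1 fs G ?v = (\<Sum>d'\<in>set (dirs fs). if d' = d then ?v else 0)" unfolding p1_dirs by (intro sum.cong refl) simp
  then show ?thesis using d(1) by simp
qed

lemma hx_range_p1:
  assumes "k < length fs" "i < fdim fs k" "j < fdim fs k"
  shows "L (hx fs k s i j) \<in> range (p1 fs G)"
  using rangeI[of "p1 fs G" "L (hx fs k s i j)"] by (simp only: p1_hx[OF assms])

end

section \<open>The edge space and the vectors that implement the counit\<close>

context valid_cayley_graph begin

lemma dense_span_eqI:
  fixes f g :: "_ \<Rightarrow> 'c::t2_space"
  assumes "continuous_on UNIV f" "continuous_on UNIV g" "\<And>z. z \<in> H.span {tens G \<xi> \<eta> | \<xi> \<eta>. True} \<Longrightarrow> f z = g z"
  shows "f z = g z"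
  by (rule dense_eqI[OF tens_dense assms(1,2)]) (rule assms(3))

text \<open>The property that the squares of a family of operators sum to the identity passes to
  tensor products, by density of the span of pure tensors. A single operator gives the isometry of
  \<Theta>; a column of a unitary matrix gives the bound for trivial cocycles.\<close>

lemma tensop_family:
  assumes A: "\<And>i. i \<in> I \<Longrightarrow> bounded_clinear (A i)" "\<And>x y. (\<Sum>i\<in>I. cinner (A i x) (A i y)) = cinner x y"
    and B: "bounded_clinear B" "\<And>x y. cinner (B x) (B y) = cinner x y"
  shows "(\<Sum>i\<in>I. cinner (tensop G (A i) B \<zeta>) (tensop G (A i) B \<zeta>')) = cinner \<zeta> \<zeta>'"
proof -
  define S where "S z z' = (\<Sum>i\<in>I. cinner (tensop G (A i) B z) (tensop G (A i) B z'))" for z z'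
  have T: "bounded_clinear (tensop G (A i) B)" if "i \<in> I" for i by (rule tensop_bounded[OF A(1)[OF that] B(1)])
  have add: "S (x + y) z = S x z + S y z" "S z (x + y) = S z x + S z y" for x y z
    unfolding S_def sum.distrib[symmetric]
    by (intro sum.cong refl; simp add: bounded_clinear_add[OF T] cinner_add_left cinner_add_right)+
  have sc: "S (scaleC c x) z = cnj c * S x z" "S z (scaleC c x) = c * S z x" for c x z
    unfolding S_def sum_distrib_left
    by (intro sum.cong refl; simp add: bounded_clinear_scaleC[OF T] cinner_scaleC_left cinner_scaleC_right)+
  have zero: "S 0 z = 0" "S z 0 = 0" for z using sc(1)[of 0 z z] sc(2)[of z 0 z] by simp_all
  have c1: "continuous_on UNIV (\<lambda>z. S w z)" for w unfolding S_def
    by (intro continuous_on_sum continuous_on_cinner_right bounded_clinear_continuous[OF T])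
  have c2: "continuous_on UNIV (\<lambda>z. S z w)" for w unfolding S_def
    by (intro continuous_on_sum continuous_on_cinner_left bounded_clinear_continuous[OF T])
  have "S (tens G \<xi> \<eta>) (tens G \<xi>' \<eta>') = (\<Sum>i\<in>I. cinner (A i \<xi>) (A i \<xi>') * cinner \<eta> \<eta>')" for \<xi> \<eta> \<xi>' \<eta>'
    unfolding S_def by (intro sum.cong refl) (simp add: tensop_tens A(1) B tens_cinner)
  then have pure: "S (tens G \<xi> \<eta>) (tens G \<xi>' \<eta>') = cinner (tens G \<xi> \<eta>) (tens G \<xi>' \<eta>')" for \<xi> \<eta> \<xi>' \<eta>'
    by (simp add: A(2) tens_cinner flip: sum_distrib_right)
  have 0: "S z z' = cinner z z'"
    if "z' \<in> H.span {tens G \<xi> \<eta> | \<xi> \<eta>. True}" "z \<in> H.span {tens G \<xi> \<eta> | \<xi> \<eta>. True}" for z z'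
    using that(2)
  proof (induction rule: H.span_induct_alt)
    case (step a x y)
    then obtain \<xi> \<eta> where x: "x = tens G \<xi> \<eta>" by blast
    have "S x z' = cinner x z'" using that(1)
    proof (induction rule: H.span_induct_alt)
      case (step a u v)
      then show ?case by (auto simp: x add sc cinner_add_right cinner_scaleC_right pure)
    qed (simp add: zero)
    then show ?case using step by (simp add: add sc cinner_add_left cinner_scaleC_left)
  qed (simp add: zero)
  have 1: "S z z' = cinner z z'" if "z' \<in> H.span {tens G \<xi> \<eta> | \<xi> \<eta>. True}" for z z'
    by (rule dense_span_eqI[OF c2 continuous_on_cinner_left[OF continuous_on_id]]) (rule 0[OF that])
  have "S \<zeta> \<zeta>' = cinner \<zeta> \<zeta>'" by (rule dense_span_eqI[OF c1 continuous_on_cinner_right[OF continuous_on_id]]) (rule 1)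
  then show ?thesis by (simp only: S_def)
qed

lemma tensop_isometry:
  assumes "bounded_clinear A" "\<And>x y. cinner (A x) (A y) = cinner x y"
    and "bounded_clinear B" "\<And>x y. cinner (B x) (B y) = cinner x y"
  shows "cinner (tensop G A B \<zeta>) (tensop G A B \<zeta>') = cinner \<zeta> \<zeta>'"
  using tensop_family[of "{()}" "\<lambda>_. A" B] assms by simp

lemma Uop_cinner: "cinner (Uop G x) (Uop G y) = cinner x y"
  by (simp add: Uop_def antiunitary_op_cinner[OF modconj_antiunitary] antiunitary_op_cinner[OF dualconj_antiunitary])

lemma Theta_cinner: "cinner (Theta G x) (Theta G y) = cinner x y"
  by (simp add: Theta_eq unitary_op_cinner[OF flip_unitary] unitary_op_cinner[OF multu_unitary]
    tensop_isometry bounded_clinear_id bounded_clinear_Uop Uop_cinner)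

lemma Kspace_props: "csubspace (Kspace fs G)" "closed (Kspace fs G)"
  unfolding Kspace_def by (rule closure_csubspace, simp add: csubspace_subspace) (rule closed_closure)

lemma Kg_props: "csubspace (Kg fs G)" "closed (Kg fs G)"
proof -
  note T = bounded_clinear_Theta
  show "csubspace (Kg fs G)"
    unfolding csubspace_def
  proof (intro conjI ballI allI)
    show "0 \<in> Kg fs G" using Kspace_props(1) by (simp add: Kg_def csubspace_def bounded_clinear_0[OF T])
    show "x + y \<in> Kg fs G" if "x \<in> Kg fs G" "y \<in> Kg fs G" for x y
    proof -
      have "Theta G (x + y) + (x + y) = (Theta G x + x) + (Theta G y + y)" by (simp only: bounded_clinear_add[OF T] ac_simps)
      also have "\<dots> = 0" using that unfolding Kg_def by simp
      finally show ?thesis using that Kspace_props(1) unfolding Kg_def csubspace_def by blast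
    qed
    show "scaleC a x \<in> Kg fs G" if "x \<in> Kg fs G" for a x
    proof -
      have "Theta G (scaleC a x) + scaleC a x = scaleC a (Theta G x + x)" by (simp only: bounded_clinear_scaleC[OF T] scaleC_add_right)
      also have "\<dots> = 0" using that unfolding Kg_def by simp
      finally show ?thesis using that Kspace_props(1) unfolding Kg_def csubspace_def by blast
    qed
  qed
  have "Kg fs G = Kspace fs G \<inter> {\<zeta>. Theta G \<zeta> + \<zeta> = 0}" by (auto simp: Kg_def)
  moreover have "closed {\<zeta>. Theta G \<zeta> + \<zeta> = 0}"
    by (intro closed_Collect_eq continuous_intros bounded_clinear_continuous[OF T])
  ultimately show "closed (Kg fs G)" using Kspace_props(2) by (simp add: closed_Int)
qed

definition hxs :: "'a set"
  where "hxs = {L (hx fs k s i j) | k s i j. k < length fs \<and> i < fdim fs k \<and> j < fdim fs k}"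

lemma espan_hxs: "espan = H.span hxs" by (simp add: espan_def hxs_def)

lemma tens_hx_Kspace:
  assumes "k < length fs" "i < fdim fs k" "j < fdim fs k"
  shows "tens G \<xi> (L (hx fs k s i j)) \<in> Kspace fs G"
  unfolding Kspace_def using hx_range_p1[OF assms, of s] by (intro subsetD[OF closure_subset] H.span_base) blast

text \<open>\<open>omega k s\<close> implements the counit on the coefficients of the direction: \<open>\<epsilon>(x) = \<langle>\<omega>, \<Lambda>(x)\<rangle>\<close>.\<close>

definition omega :: "nat \<Rightarrow> bool \<Rightarrow> 'a"
  where "omega k s = (\<Sum>i<fdim fs k. scaleC (of_real (if s then hmusum fs k / hmu fs k i else hmuinv fs k * hmu fs k i)) (L (hx fs k s i i)))"

lemma omega_hx_same:
  assumes k: "k < length fs" and ij: "i < fdim fs k" "j < fdim fs k"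
  shows "cinner (omega k s) (L (hx fs k s i j)) = (if i = j then 1 else 0)"
proof -
  have pos: "0 < hmu fs k l" if "l < fdim fs k" for l using mu_pos[OF k refl that] .
  have hp: "0 < hmusum fs k" "0 < hmuinv fs k" using hmusum_pos[OF k refl] hmuinv_pos[OF k refl] by auto
  let ?c = "\<lambda>l. if s then hmusum fs k / hmu fs k l else hmuinv fs k * hmu fs k l"
  have "cinner (omega k s) (L (hx fs k s i j)) = (\<Sum>l<fdim fs k. if l = i then (if i = j then 1 else 0) else 0)"
    unfolding omega_def cinner_sum_left cinner_scaleC_left
  proof (intro sum.cong refl)
    fix l assume "l \<in> {..<fdim fs k}"
    then have l: "l < fdim fs k" by simp
    show "cnj (of_real (?c l)) * cinner (L (hx fs k s l l)) (L (hx fs k s i j)) = (if l = i then if i = j then 1 else 0 else 0)"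
    proof (cases "l = i \<and> l = j")
      case True
      have "?c l * (if s then hmu fs k l / hmusum fs k else inverse (hmuinv fs k * hmu fs k l)) = 1"
        using pos[OF l] hp by (simp add: field_simps)
      then have "complex_of_real (?c l) * of_real (if s then hmu fs k l / hmusum fs k else inverse (hmuinv fs k * hmu fs k l)) = 1"
        by (simp only: of_real_mult[symmetric] of_real_1)
      then show ?thesis unfolding hx_orthogonal'[OF k l l ij] using True by simp
    qed (auto simp: hx_orthogonal'[OF k l l ij])
  qed
  then show ?thesis using ij by simp
qed

lemma kills_comb:
  assumes f: "kills fs f" and g: "kills fs g" and c: "comb n x u" "\<And>a b. a < n \<Longrightarrow> b < n \<Longrightarrow> f (u a b) = g (u a b)"
  shows "f x = g x"
proof -
  obtain c where c: "eqS fs x (\<Sum>a<n. \<Sum>b<n. scaleF (c a b) (u a b))" using c(1) unfolding comb_def by (rule exE)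
  have "linearF (*) f" "linearF (*) g" using f g by (auto simp: kills_def)
  then show ?thesis using kills_eqS[OF f c] kills_eqS[OF g c] assms(4)
    by (simp add: linearF_sum[of "(*)"] linearF_scale[of "(*)"])
qed

text \<open>The formula for \<open>omega\<close> only refers to one flag. For an \<open>AO\<close>
  factor the adjoints are combinations of entries of u, so agreement with \<epsilon> is carried over
  to them.\<close>

lemma omega_hx:
  assumes k: "k < length fs" "k0 < length fs" and ij: "i < fdim fs k" "j < fdim fs k" and d: "s0 \<longrightarrow> (\<exists>Q. fs ! k0 = AU Q)"
  shows "cinner (omega k0 s0) (L (hx fs k s i j)) = (if sdir fs (k0, s0) (k, s) \<and> i = j then 1 else 0)"
proof (cases "sdir fs (k0, s0) (k, s)")
  case False
  then show ?thesis unfolding omega_def cinner_sum_left cinner_scaleC_left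
    by (simp add: hx_orthogonal[OF k(2,1) False _ _ ij])
next
  case True
  show ?thesis
  proof (cases "s0 = s")
    case True
    then have "k0 = k" using \<open>sdir fs (k0, s0) (k, s)\<close> by (simp add: sdir_def)
    then show ?thesis using omega_hx_same[OF k(1) ij] True by (simp add: sdir_def)
  next
    case False
    then obtain Q where Q: "k0 = k" "fs ! k = AO Q" using True by (auto simp: sdir_def)
    then have s: "s0 = False" "s = True" using d False by auto
    define f where "f x = cinner (omega k0 s0) (L x)" for x
    have f: "kills fs f"
      unfolding kills_def linearF_def f_def using L_eqS[of _ 0]
      by (simp add: L_add L_scaleF cinner_add_right cinner_scaleC_right L_0 eqS_0_iff)
    have 1: "f (hx fs k False a b) = eps fs (hx fs k False a b)" if "a < fdim fs k" "b < fdim fs k" for a b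
      using omega_hx_same[OF k(1) that, of False] eps_hx[OF k(1) valid[OF k(1)] refl refl that, of False] by (simp add: f_def Q(1) s(1))
    have 2: "f (gx k False a b) = eps fs (gx k False a b)" if "a < fdim fs k" "b < fdim fs k" for a b
      by (rule kills_comb[OF f eps_kills gx_comb_hx[OF k(1) that]]) (rule 1)
    have 3: "f (gx k True a b) = eps fs (gx k True a b)" if "a < fdim fs k" "b < fdim fs k" for a b
      by (rule kills_comb[OF f eps_kills AO_star_comb[OF k(1) Q(2) that]]) (rule 2)
    have "f (hx fs k True i j) = eps fs (hx fs k True i j)"
      by (rule kills_comb[OF f eps_kills hx_comb_gx[OF k(1) ij]]) (rule 3)
    then show ?thesis using True by (simp add: f_def s eps_hx[OF k(1) valid[OF k(1)] refl refl ij])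
  qed
qed

definition dl :: "nat \<times> bool \<Rightarrow> nat \<Rightarrow> bool \<Rightarrow> nat \<Rightarrow> nat \<Rightarrow> complex"
  where "dl d k s i j = (if sdir fs d (k, s) \<and> i = j then 1 else 0)"

lemma Theta_omega:
  assumes d: "d \<in> set (dirs fs)" and k: "k < length fs" and ij: "i < fdim fs k" "j < fdim fs k"
  shows "cinner (tens G \<xi> (omega (fst d) (snd d))) (tens G (L x) (L (hx fs k s i j))) = dl d k s i j * cinner \<xi> (L x)"
    and "cinner (tens G \<xi> (omega (fst d) (snd d))) (Theta G (tens G (L x) (L (hx fs k s i j)))) =
      (if sdir fs d (k, \<not> s) then 1 else 0) * cinner \<xi> (L (x * hx fs k s i j))"
proof -
  have d': "fst d < length fs" "snd d \<longrightarrow> (\<exists>Q. fs ! fst d = AU Q)" using d set_dirs[of "fst d" "snd d" fs] by simp_all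
  have om: "cinner (omega (fst d) (snd d)) (L (hx fs k s i j)) = dl d k s i j" if "i < fdim fs k" "j < fdim fs k" for s i j
    unfolding dl_def using omega_hx[OF k d'(1) that d'(2)] by (simp only: prod.collapse)
  show "cinner (tens G \<xi> (omega (fst d) (snd d))) (tens G (L x) (L (hx fs k s i j))) = dl d k s i j * cinner \<xi> (L x)"
    by (simp add: tens_cinner om[OF ij])
  show "cinner (tens G \<xi> (omega (fst d) (snd d))) (Theta G (tens G (L x) (L (hx fs k s i j)))) =
      (if sdir fs d (k, \<not> s) then 1 else 0) * cinner \<xi> (L (x * hx fs k s i j))"
  proof (cases s)
    case False
    have "cinner (tens G \<xi> (omega (fst d) (snd d))) (Theta G (tens G (L x) (L (hx fs k False i j)))) =
      (\<Sum>l<fdim fs k. if l = j then (if sdir fs d (k, True) then 1 else 0) * cinner \<xi> (L (x * hx fs k False i j)) else 0)"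
      unfolding Theta_hx(1)[OF k ij] cinner_sum_right using ij by (intro sum.cong refl) (auto simp: tens_cinner om dl_def)
    then show ?thesis using ij False by simp
  next
    case True
    have "cinner (tens G \<xi> (omega (fst d) (snd d))) (Theta G (tens G (L x) (L (hx fs k True i j)))) =
      (\<Sum>l<fdim fs k. if l = j then (if sdir fs d (k, False) then 1 else 0) * cinner \<xi> (L (x * hx fs k True i j)) else 0)"
      unfolding Theta_hx(2)[OF k ij] cinner_sum_right using ij mu_pos[OF k refl ij(2)] by (intro sum.cong refl) (auto simp: tens_cinner cinner_scaleC_right om dl_def)
    then show ?thesis using ij True by simp
  qed
qed

text \<open>Two reversals of \<Lambda>(z) \<otimes> \<Lambda>(u_ij) give a double sum that does not
  collapse by itself. The weights in \<open>omega\<close> are those for which the sum over i = j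
  becomes an orthogonality relation.\<close>

lemma Theta_Theta_omega:
  assumes k: "k < length fs"
  shows "Theta G (Theta G (tens G (L z) (omega k s))) = tens G (L z) (omega k s)"
proof -
  let ?n = "fdim fs k"
  note T = bounded_clinear_Theta
  have eL: "(\<Sum>i<?n. L (z * (f i :: falg))) = (if l = m then scaleC c (L z) else 0)"
    if "eqS fs (\<Sum>i<?n. f i) (if l = m then cst c else 0)" for f :: "nat \<Rightarrow> falg" and c and l m :: nat
  proof -
    have "(\<Sum>i<?n. L (z * f i)) = L (z * (\<Sum>i<?n. f i))" by (simp add: sum_distrib_left L_sum)
    also have "\<dots> = L (z * (if l = m then cst c else 0))" by (intro L_eqS eqS_mult eqS_refl that)
    also have "\<dots> = (if l = m then scaleC c (L z) else 0)" by (simp add: cst_commute L_0 L_scaleF flip: scaleF_def)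
    finally show ?thesis .
  qed
  show ?thesis
  proof (cases s)
    case False
    let ?c = "\<lambda>i. complex_of_real (hmuinv fs k * hmu fs k i)"
    have "Theta G (Theta G (tens G (L z) (omega k False))) = (\<Sum>i<?n. \<Sum>l<?n. \<Sum>m<?n.
        scaleC (?c i) (scaleC (of_real (hmu fs k l / hmu fs k m)) (tens G (L (z * hx fs k False i l * hx fs k True i m)) (L (hx fs k False l m)))))"
      unfolding omega_def by (simp add: tens_sum_right tens_scaleC_right bounded_clinear_sum[OF T] bounded_clinear_scaleC[OF T] Theta_hx[OF k] H.scale_sum_right)
    also have "\<dots> = (\<Sum>l<?n. \<Sum>m<?n. \<Sum>i<?n.
        scaleC (?c i) (scaleC (of_real (hmu fs k l / hmu fs k m)) (tens G (L (z * hx fs k False i l * hx fs k True i m)) (L (hx fs k False l m)))))"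
      by (subst sum.swap) (intro sum.cong refl sum.swap)
    also have "\<dots> = (\<Sum>l<?n. \<Sum>m<?n. scaleC (of_real (hmuinv fs k * (hmu fs k l / hmu fs k m)))
      (tens G (\<Sum>i<?n. L (z * scaleF (of_real (hmu fs k i)) (hx fs k False i l * hx fs k True i m))) (L (hx fs k False l m))))"
      by (intro sum.cong refl) (simp add: tens_sum_left H.scale_sum_right mult_scaleF_right L_scaleF tens_scaleC_left mult.assoc mult_ac)
    also have "\<dots> = (\<Sum>l<?n. \<Sum>m<?n. if m = l then scaleC (?c l) (tens G (L z) (L (hx fs k False l l))) else 0)"
    proof (intro sum.cong refl)
      fix l m assume "l \<in> {..<?n}" "m \<in> {..<?n}"
      then have lm: "l < ?n" "m < ?n" by auto
      show "scaleC (of_real (hmuinv fs k * (hmu fs k l / hmu fs k m)))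
        (tens G (\<Sum>i<?n. L (z * scaleF (of_real (hmu fs k i)) (hx fs k False i l * hx fs k True i m))) (L (hx fs k False l m))) =
        (if m = l then scaleC (?c l) (tens G (L z) (L (hx fs k False l l))) else 0)"
        unfolding eL[OF rls(4)[OF k refl lm]] using mu_pos[OF k refl lm(1)] by (auto simp: tens_scaleC_left tens_0_left)
    qed
    also have "\<dots> = tens G (L z) (omega k False)" by (simp add: omega_def tens_sum_right tens_scaleC_right)
    finally show ?thesis by (simp add: False)
  next
    case True
    let ?c = "\<lambda>i. complex_of_real (hmusum fs k / hmu fs k i)"
    have "Theta G (Theta G (tens G (L z) (omega k True))) = (\<Sum>i<?n. \<Sum>l<?n. \<Sum>m<?n.
        scaleC (?c i) (scaleC (of_real (hmu fs k i / hmu fs k l)) (tens G (L (z * hx fs k True i l * hx fs k False i m)) (L (hx fs k True l m)))))"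
      unfolding omega_def by (simp add: tens_sum_right tens_scaleC_right bounded_clinear_sum[OF T] bounded_clinear_scaleC[OF T] Theta_hx[OF k] H.scale_sum_right)
    also have "\<dots> = (\<Sum>l<?n. \<Sum>m<?n. \<Sum>i<?n.
        scaleC (?c i) (scaleC (of_real (hmu fs k i / hmu fs k l)) (tens G (L (z * hx fs k True i l * hx fs k False i m)) (L (hx fs k True l m)))))"
      by (subst sum.swap) (intro sum.cong refl sum.swap)
    also have "\<dots> = (\<Sum>l<?n. \<Sum>m<?n. scaleC (?c l)
      (tens G (\<Sum>i<?n. L (z * (hx fs k True i l * hx fs k False i m))) (L (hx fs k True l m))))"
    proof (intro sum.cong refl)
      fix l m
      have "?c i * of_real (hmu fs k i / hmu fs k l) = ?c l" if "i < ?n" for i using mu_pos[OF k refl that] by simp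
      then show "(\<Sum>i<?n. scaleC (?c i) (scaleC (of_real (hmu fs k i / hmu fs k l)) (tens G (L (z * hx fs k True i l * hx fs k False i m)) (L (hx fs k True l m))))) =
        scaleC (?c l) (tens G (\<Sum>i<?n. L (z * (hx fs k True i l * hx fs k False i m))) (L (hx fs k True l m)))"
        unfolding tens_sum_left H.scale_sum_right by (intro sum.cong refl) (simp only: scaleC_scaleC lessThan_iff mult.assoc)
    qed
    also have "\<dots> = (\<Sum>l<?n. \<Sum>m<?n. if m = l then scaleC (?c l) (tens G (L z) (L (hx fs k True l l))) else 0)"
    proof (intro sum.cong refl)
      fix l m assume "l \<in> {..<?n}" "m \<in> {..<?n}"
      then have lm: "l < ?n" "m < ?n" by auto
      have "eqS fs (\<Sum>i<?n. hx fs k True i l * hx fs k False i m) (if l = m then cst 1 else 0)"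
        unfolding cst_1 by (rule rls(2)[OF k refl lm])
      from eL[OF this]
      show "scaleC (?c l) (tens G (\<Sum>i<?n. L (z * (hx fs k True i l * hx fs k False i m))) (L (hx fs k True l m))) =
        (if m = l then scaleC (?c l) (tens G (L z) (L (hx fs k True l l))) else 0)"
        by (auto simp: tens_0_left)
    qed
    also have "\<dots> = tens G (L z) (omega k True)" by (simp add: omega_def tens_sum_right tens_scaleC_right)
    finally show ?thesis by (simp add: True)
  qed
qed

section \<open>Edges over the algebra and their boundaries\<close>

definition edges :: "(falg \<times> nat \<times> bool \<times> nat \<times> nat) list \<Rightarrow> 'b"
  where "edges ts = (\<Sum>(x, k, s, i, j)\<leftarrow>ts. tens G (L x) (L (hx fs k s i j)))"

definition edges_ok :: "(falg \<times> nat \<times> bool \<times> nat \<times> nat) list \<Rightarrow> bool"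
  where "edges_ok ts \<longleftrightarrow> (\<forall>(x, k, s, i, j)\<in>set ts. k < length fs \<and> i < fdim fs k \<and> j < fdim fs k)"

lemma Kalg_edges:
  assumes "t \<in> Kalg fs G"
  shows "\<exists>ts. edges_ok ts \<and> t = edges ts"
proof -
  define P where "P t \<longleftrightarrow> (\<exists>ts. edges_ok ts \<and> t = edges ts)" for t
  have P0: "P 0" unfolding P_def by (rule exI[of _ "[]"]) (simp add: edges_ok_def edges_def)
  have Padd: "P (s + t)" if st: "P s" "P t" for s t
  proof -
    from st obtain us vs where "edges_ok us" "s = edges us" "edges_ok vs" "t = edges vs" unfolding P_def by blast
    then show ?thesis unfolding P_def by (intro exI[of _ "us @ vs"]) (auto simp: edges_ok_def edges_def)
  qed
  have Psc: "P (scaleC c t)" if "P t" for c t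
  proof -
    from that obtain us where us: "edges_ok us" "t = edges us" unfolding P_def by blast
    have "edges (map (\<lambda>(x, g). (scaleF c x, g)) us) = scaleC c (edges us)" for us
      by (induction us) (auto simp: edges_def L_scaleF tens_scaleC_left scaleC_add_right)
    then show ?thesis unfolding P_def using us by (intro exI[of _ "map (\<lambda>(x, g). (scaleF c x, g)) us"]) (auto simp: edges_ok_def)
  qed
  have Phx: "P (tens G (L x) v)" if "v \<in> hxs" for x v
  proof -
    from that obtain k s i j where v: "v = L (hx fs k s i j)" "k < length fs" "i < fdim fs k" "j < fdim fs k" unfolding hxs_def by blast
    then show ?thesis unfolding P_def by (intro exI[of _ "[(x, k, s, i, j)]"]) (simp add: edges_ok_def edges_def)
  qed
  have Pesp: "P (tens G (L x) \<eta>)" if "\<eta> \<in> espan" for x \<eta>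
    using that unfolding espan_hxs
    by (induction rule: H.span_induct_alt) (simp_all add: tens_0_right P0 tens_add_right tens_scaleC_right Padd Psc Phx)
  have "P t" using assms unfolding Kalg_def
  proof (induction rule: H.span_induct_alt)
    case (step c x y)
    then obtain u \<xi> where "x = tens G (L u) (p1 fs G \<xi>)" by auto
    then have "P x" using Pesp p1_in_espan by simp
    then show ?case using step by (intro Padd Psc)
  qed (rule P0)
  then show ?thesis by (simp only: P_def)
qed

text \<open>The component along \<open>omega\<close> of (1 - \<Theta>) applied to the edges,
  computed in the algebra. Lists of edges are kept instead of vectors because a map defined on \<S>
  cannot be applied to a vector.\<close>

definition bnd :: "nat \<times> bool \<Rightarrow> (falg \<times> nat \<times> bool \<times> nat \<times> nat) list \<Rightarrow> falg"
  where "bnd d ts = (\<Sum>(x, k, s, i, j)\<leftarrow>ts. scaleF (dl d k s i j) x - scaleF (if sdir fs d (k, \<not> s) then 1 else 0) (x * hx fs k s i j))"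

lemma subspace_Kspace: "H.subspace (Kspace fs G)"
  using Kspace_props(1) by (simp add: csubspace_subspace)

lemma omega_Kspace:
  assumes k: "k < length fs"
  shows "tens G (L z) (omega k s) \<in> Kspace fs G" "Theta G (tens G (L z) (omega k s)) \<in> Kspace fs G"
proof -
  note T = bounded_clinear_Theta
  show "tens G (L z) (omega k s) \<in> Kspace fs G"
    unfolding omega_def tens_sum_right tens_scaleC_right
    by (intro H.subspace_sum[OF subspace_Kspace] H.subspace_scale[OF subspace_Kspace] tens_hx_Kspace k) auto
  have "Theta G (tens G (L z) (L (hx fs k s i i))) \<in> Kspace fs G" if "i < fdim fs k" for i
  proof (cases s)
    case True
    have "Theta G (tens G (L z) (L (hx fs k True i i))) \<in> Kspace fs G"
      unfolding Theta_hx(2)[OF k that that]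
      by (intro H.subspace_sum[OF subspace_Kspace] H.subspace_scale[OF subspace_Kspace] tens_hx_Kspace k that) auto
    then show ?thesis using True by simp
  next
    case False
    have "Theta G (tens G (L z) (L (hx fs k False i i))) \<in> Kspace fs G"
      unfolding Theta_hx(1)[OF k that that]
      by (intro H.subspace_sum[OF subspace_Kspace] tens_hx_Kspace k that) auto
    then show ?thesis using False by simp
  qed
  then show "Theta G (tens G (L z) (omega k s)) \<in> Kspace fs G"
    unfolding omega_def tens_sum_right tens_scaleC_right bounded_clinear_sum[OF T] bounded_clinear_scaleC[OF T]
    by (intro H.subspace_sum[OF subspace_Kspace] H.subspace_scale[OF subspace_Kspace]) auto
qed

text \<open>Put a = \<Lambda>(z) \<otimes> \<omega> and let c be the projection of the edges. As
  \<Theta> applied twice fixes a, the difference a - \<Theta> a lies in K_g, where c may be replaced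
  by the edges. As \<Theta> is isometric and \<Theta> c = -c, the two halves of the difference
  contribute equally; hence the factor 2.\<close>

lemma path_inner:
  assumes ts: "edges_ok ts" and d: "d \<in> set (dirs fs)"
  shows "2 * cinner (tens G (L z) (omega (fst d) (snd d))) (orth_proj (Kg fs G) (edges ts)) = cinner (L z) (L (bnd d ts))"
proof -
  note T = bounded_clinear_Theta
  have k: "fst d < length fs" using d set_dirs[of "fst d" "snd d" fs] by simp
  define a where "a = tens G (L z) (omega (fst d) (snd d))"
  define c where "c = orth_proj (Kg fs G) (edges ts)"
  have ThTh: "Theta G (Theta G a) = a" unfolding a_def by (rule Theta_Theta_omega[OF k])
  have "a - Theta G a \<in> Kg fs G"
    using H.subspace_diff[OF subspace_Kspace omega_Kspace[OF k], of z "snd d" z "snd d"]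
    unfolding a_def[symmetric] Kg_def by (simp add: ThTh bounded_clinear_diff[OF T])
  then have 1: "cinner (a - Theta G a) c = cinner (a - Theta G a) (edges ts)"
    unfolding c_def by (rule orth_proj(2)[OF Kg_props])
  have "c \<in> Kg fs G" unfolding c_def by (rule orth_proj(1)[OF Kg_props])
  then have "Theta G c = - c" by (simp add: Kg_def eq_neg_iff_add_eq_0)
  then have "- cinner (Theta G a) c = cinner a c" using Theta_cinner[of a c] by (simp add: cinner_minus_right)
  then have 2: "cinner (Theta G a) c = - cinner a c" by (metis minus_minus)
  have 3: "cinner (Theta G a) (edges ts) = cinner a (Theta G (edges ts))" using Theta_cinner[of "Theta G a" "edges ts"] by (simp add: ThTh)
  have "cinner a (edges us) - cinner a (Theta G (edges us)) = cinner (L z) (L (bnd d us))" if "edges_ok us" for us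
    using that
  proof (induction us)
    case Nil
    then show ?case by (simp add: edges_def bnd_def L_0 bounded_clinear_0[OF T])
  next
    case (Cons e us)
    obtain x k s i j where e: "e = (x, k, s, i, j)" by (cases e) auto
    have ok: "k < length fs" "i < fdim fs k" "j < fdim fs k" "edges_ok us" using Cons.prems by (auto simp: e edges_ok_def)
    let ?t = "tens G (L x) (L (hx fs k s i j))"
    define w where "w = scaleF (dl d k s i j) x - scaleF (if sdir fs d (k, \<not> s) then 1 else 0) (x * hx fs k s i j)"
    have A: "cinner a ?t - cinner a (Theta G ?t) = cinner (L z) (L w)"
      unfolding w_def a_def Theta_omega(1)[OF d ok(1-3)] Theta_omega(2)[OF d ok(1-3)] by (simp add: L_diff L_scaleF cinner_diff_right cinner_scaleC_right)
    have "edges (e # us) = ?t + edges us" "bnd d (e # us) = w + bnd d us"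
      by (simp_all add: e edges_def bnd_def w_def)
    then show ?case
      by (simp add: bounded_clinear_add[OF T] cinner_add_right L_add flip: A Cons.IH[OF ok(4)])
  qed
  from this[OF ts] show ?thesis using 1 2 3 by (simp add: cinner_diff_left flip: a_def c_def)
qed

definition omega_tot :: 'a where "omega_tot = (\<Sum>d\<in>set (dirs fs). omega (fst d) (snd d))"

lemma sum_dirs:
  assumes "k < length fs"
  shows "(\<Sum>d\<in>set (dirs fs). if sdir fs d (k, s) then c else 0) = (c :: 'c::comm_monoid_add)"
proof -
  obtain d where d: "d \<in> set (dirs fs)" "sdir fs d (k, s)" "\<And>d'. d' \<in> set (dirs fs) \<Longrightarrow> sdir fs d' (k, s) \<Longrightarrow> d' = d"
    using ex1_implies_ex[OF sdir_dirs[OF assms, of s]] sdir_dirs[OF assms, of s] by (metis (no_types, lifting))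
  have "(if sdir fs d' (k, s) then c else 0) = (if d' = d then c else 0)" if "d' \<in> set (dirs fs)" for d'
    using d(2) d(3)[OF that] by (cases "d' = d") auto
  then have "(\<Sum>d\<in>set (dirs fs). if sdir fs d (k, s) then c else 0) = (\<Sum>d'\<in>set (dirs fs). if d' = d then c else 0)"
    by (rule sum.cong[OF refl])
  then show ?thesis using d(1) by simp
qed

lemma omega_tot_hx:
  assumes k: "k < length fs" and ij: "i < fdim fs k" "j < fdim fs k"
  shows "cinner omega_tot (L (hx fs k s i j)) = (if i = j then 1 else 0)"
proof -
  have "cinner omega_tot (L (hx fs k s i j)) = (\<Sum>d\<in>set (dirs fs). if sdir fs d (k, s) then if i = j then 1 else 0 else 0)"
    unfolding omega_tot_def cinner_sum_left
  proof (intro sum.cong refl)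
    fix d assume "d \<in> set (dirs fs)"
    then have "fst d < length fs" "snd d \<longrightarrow> (\<exists>Q. fs ! fst d = AU Q)" using set_dirs[of "fst d" "snd d" fs] by simp_all
    then show "cinner (omega (fst d) (snd d)) (L (hx fs k s i j)) = (if sdir fs d (k, s) then if i = j then 1 else 0 else 0)"
      by (simp add: omega_hx[OF k _ ij])
  qed
  then show ?thesis by (simp only: sum_dirs[OF k])
qed

text \<open>The endpoint of a reversed edge is its starting point: on \<Lambda>(x) \<otimes>
  \<Lambda>(u_ij) unitarity contracts the sum to \<Lambda>(x) or 0, which is \<epsilon>(u_ij)
  \<Lambda>(x). Density and boundedness extend this to K.\<close>

lemma target_Theta:
  assumes "\<zeta> \<in> Kspace fs G"
  shows "cinner \<xi> (target G (Theta G \<zeta>)) = cinner (tens G \<xi> omega_tot) \<zeta>"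
proof -
  note T = bounded_clinear_Theta and E = target_bounded
  note lin = bounded_clinear_0[OF T] bounded_clinear_add[OF T] bounded_clinear_scaleC[OF T] bounded_clinear_0[OF E] bounded_clinear_add[OF E] bounded_clinear_scaleC[OF E]
    cinner_add_right cinner_scaleC_right
  have TE: "bounded_clinear (\<lambda>\<zeta>. target G (Theta G \<zeta>))" by (rule bounded_clinear_compose[OF E T])
  have 1: "target G (Theta G (tens G (L x) (L (hx fs k s i j)))) = (if i = j then L x else 0)"
    if k: "k < length fs" and ij: "i < fdim fs k" "j < fdim fs k" for x k s i j
  proof (cases s)
    case False
    have "target G (Theta G (tens G (L x) (L (hx fs k False i j)))) = (\<Sum>l<fdim fs k. L (x * hx fs k False i l * hx fs k True j l))"
      unfolding Theta_hx(1)[OF k ij] bounded_clinear_sum[OF E]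
      by (intro sum.cong refl) (simp add: target_gns hx_range_p1[OF k] ij)
    also have "\<dots> = L (x * (\<Sum>l<fdim fs k. hx fs k False i l * hx fs k True j l))" by (simp add: sum_distrib_left L_sum mult.assoc)
    also have "\<dots> = L (x * (if i = j then 1 else 0))" by (intro L_eqS eqS_mult eqS_refl rls(1)[OF k refl] ij)
    finally show ?thesis using False by (simp add: L_0 if_distrib cong: if_cong)
  next
    case True
    have "target G (Theta G (tens G (L x) (L (hx fs k True i j)))) = (\<Sum>l<fdim fs k. scaleC (of_real (hmu fs k j / hmu fs k l)) (L (x * hx fs k True i l * hx fs k False j l)))"
      unfolding Theta_hx(2)[OF k ij] bounded_clinear_sum[OF E] bounded_clinear_scaleC[OF E]
      by (intro sum.cong refl) (simp add: target_gns hx_range_p1[OF k] ij)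
    also have "\<dots> = scaleC (of_real (hmu fs k j)) (L (x * (\<Sum>l<fdim fs k. scaleF (inverse (of_real (hmu fs k l))) (hx fs k True i l * hx fs k False j l))))"
      by (simp add: sum_distrib_left L_sum mult.assoc H.scale_sum_right mult_scaleF_right L_scaleF divide_inverse)
    also have "\<dots> = scaleC (of_real (hmu fs k j)) (L (x * (if i = j then cst (inverse (of_real (hmu fs k i))) else 0)))"
      by (intro arg_cong[of _ _ "scaleC _"] L_eqS eqS_mult eqS_refl rls(3)[OF k refl] ij)
    also have "\<dots> = (if i = j then L x else 0)" using mu_pos[OF k refl ij(2)] by (simp add: L_0 cst_commute L_scaleF flip: scaleF_def)
    finally show ?thesis using True by simp
  qed
  have 2: "cinner \<xi> (target G (Theta G (tens G \<eta> v))) = cinner (tens G \<xi> omega_tot) (tens G \<eta> v)" if v: "v \<in> hxs" for \<eta> v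
  proof (rule dense_eqI[OF gns_dense, of "\<lambda>\<eta>. cinner \<xi> (target G (Theta G (tens G \<eta> v)))" "\<lambda>\<eta>. cinner (tens G \<xi> omega_tot) (tens G \<eta> v)"])
    from v obtain k s i j where v: "v = L (hx fs k s i j)" "k < length fs" "i < fdim fs k" "j < fdim fs k" unfolding hxs_def by blast
    have c: "continuous_on UNIV (\<lambda>\<eta>. target G (Theta G (tens G \<eta> v)))"
      by (rule bounded_clinear_continuous[OF bounded_clinear_compose[OF TE tens_linear_left]])
    show "continuous_on UNIV (\<lambda>\<eta>. cinner \<xi> (target G (Theta G (tens G \<eta> v))))"
      by (rule continuous_on_cinner_right[OF c])
    show "continuous_on UNIV (\<lambda>\<eta>. cinner (tens G \<xi> omega_tot) (tens G \<eta> v))"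
      by (rule continuous_on_cinner_right[OF bounded_clinear_continuous[OF tens_linear_left]])
    fix \<eta> assume "\<eta> \<in> range L"
    then obtain x where "\<eta> = L x" by blast
    then show "cinner \<xi> (target G (Theta G (tens G \<eta> v))) = cinner (tens G \<xi> omega_tot) (tens G \<eta> v)"
      using 1[OF v(2-4)] omega_tot_hx[OF v(2-4)] by (simp add: v(1) tens_cinner)
  qed
  have 3: "cinner \<xi> (target G (Theta G (tens G \<eta> v))) = cinner (tens G \<xi> omega_tot) (tens G \<eta> v)" if "v \<in> espan" for \<eta> v
    using that unfolding espan_hxs
    by (induction rule: H.span_induct_alt) (simp_all add: lin tens_0_right tens_add_right tens_scaleC_right 2)
  have 4: "cinner \<xi> (target G (Theta G z)) = cinner (tens G \<xi> omega_tot) z" if "z \<in> H.span {tens G \<xi> \<eta> | \<xi> \<eta>. \<eta> \<in> range (p1 fs G)}" for z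
    using that
  proof (induction rule: H.span_induct_alt)
    case (step c x y)
    then obtain \<eta> v where "x = tens G \<eta> (p1 fs G v)" by auto
    then have "cinner \<xi> (target G (Theta G x)) = cinner (tens G \<xi> omega_tot) x" using 3 p1_in_espan by simp
    then show ?case using step by (simp add: lin)
  qed (simp add: lin)
  have "closed {z. cinner \<xi> (target G (Theta G z)) = cinner (tens G \<xi> omega_tot) z}"
    by (intro closed_Collect_eq continuous_on_cinner_right bounded_clinear_continuous[OF TE] continuous_on_id)
  then have "Kspace fs G \<subseteq> {z. cinner \<xi> (target G (Theta G z)) = cinner (tens G \<xi> omega_tot) z}"
    unfolding Kspace_def using 4 by (intro closure_minimal) auto
  then show ?thesis using assms by blast
qed

definition bnd_tot :: "(falg \<times> nat \<times> bool \<times> nat \<times> nat) list \<Rightarrow> falg"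
  where "bnd_tot ts = (\<Sum>(x, k, s, i, j)\<leftarrow>ts. x * (hx fs k s i j - (if i = j then 1 else 0)))"

text \<open>Each letter is in exactly one direction and so is its conjugate; the components
  therefore add up to start minus end.\<close>

lemma sum_bnd:
  assumes "edges_ok ts"
  shows "(\<Sum>d\<in>set (dirs fs). bnd d ts) = - bnd_tot ts"
  using assms
proof (induction ts)
  case (Cons e ts)
  obtain x k s i j where e: "e = (x, k, s, i, j)" by (cases e) auto
  have ok: "k < length fs" "edges_ok ts" using Cons.prems by (auto simp: e edges_ok_def)
  have "(\<Sum>d\<in>set (dirs fs). dl d k s i j) = (\<Sum>d\<in>set (dirs fs). if sdir fs d (k, s) then if i = j then 1 else 0 else 0)"
    by (intro sum.cong refl) (auto simp: dl_def)
  then have 1: "(\<Sum>d\<in>set (dirs fs). dl d k s i j) = (if i = j then 1 else 0)" by (simp only: sum_dirs[OF ok(1)])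
  have "(\<Sum>d\<in>set (dirs fs). bnd d (e # ts)) = scaleF (\<Sum>d\<in>set (dirs fs). dl d k s i j) x
    - scaleF (\<Sum>d\<in>set (dirs fs). if sdir fs d (k, \<not> s) then 1 else 0) (x * hx fs k s i j) + (\<Sum>d\<in>set (dirs fs). bnd d ts)"
    by (simp only: bnd_def e list.map sum_list.Cons case_prod_conv sum.distrib sum_subtractf F.scale_sum_left)
  also have "\<dots> = - bnd_tot (e # ts)"
    unfolding 1 sum_dirs[OF ok(1)] Cons.IH[OF ok(2)] by (simp add: e bnd_tot_def right_diff_distrib)
  finally show ?case .
qed (simp add: bnd_def bnd_tot_def)

text \<open>Since \<Theta> c = -c, the endpoint formula computes the sum over all directions of the
  components of c, and the path property prescribes it. This gives 2y as a total boundary, though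
  only as an equality of vectors.\<close>

lemma path_representation:
  assumes c: "c \<in> Kg' fs G" and y: "target G c = L y"
  obtains ts where "edges_ok ts" "L (scaleF 2 y) = L (bnd_tot ts)"
    "\<And>d z. d \<in> set (dirs fs) \<Longrightarrow> 2 * cinner (tens G (L z) (omega (fst d) (snd d))) c = cinner (L z) (L (bnd d ts))"
proof -
  obtain t where t: "t \<in> Kalg fs G" "c = orth_proj (Kg fs G) t" using c by (auto simp: Kg'_def)
  obtain ts where ts: "edges_ok ts" "t = edges ts" using Kalg_edges[OF t(1)] by blast
  have 1: "2 * cinner (tens G (L z) (omega (fst d) (snd d))) c = cinner (L z) (L (bnd d ts))" if "d \<in> set (dirs fs)" for d z
    unfolding t(2) ts(2) by (rule path_inner[OF ts(1) that])
  have cK: "c \<in> Kg fs G" unfolding t(2) by (rule orth_proj(1)[OF Kg_props])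
  then have Tc: "Theta G c = - c" "c \<in> Kspace fs G" by (auto simp: Kg_def eq_neg_iff_add_eq_0)
  have "cinner (L z) (L (scaleF 2 y) - L (bnd_tot ts)) = 0" for z
  proof -
    have "- (2 * cinner (L z) (L y)) = 2 * cinner (L z) (target G (Theta G c))"
      unfolding Tc(1) bounded_clinear_minus[OF target_bounded] y cinner_minus_right by simp
    also have "\<dots> = (\<Sum>d\<in>set (dirs fs). 2 * cinner (tens G (L z) (omega (fst d) (snd d))) c)"
      unfolding target_Theta[OF Tc(2)] omega_tot_def tens_sum_right cinner_sum_left sum_distrib_left ..
    also have "\<dots> = (\<Sum>d\<in>set (dirs fs). cinner (L z) (L (bnd d ts)))" by (intro sum.cong refl 1)
    also have "\<dots> = cinner (L z) (L (- bnd_tot ts))" by (simp only: sum_bnd[OF ts(1), symmetric] L_sum cinner_sum_right)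
    finally show ?thesis
      by (simp add: linearF_minus[OF linearF_L] cinner_minus_right cinner_diff_right L_scaleF cinner_scaleC_right)
  qed
  then have "L (scaleF 2 y) - L (bnd_tot ts) = 0" by (intro dense_cinner_zero[OF gns_dense]) auto
  then show thesis using that[OF ts(1) _ 1] by simp
qed

end

section \<open>A cocycle with values in the Hopf algebra\<close>

context
  fixes fs :: "factor list" and d :: "nat \<times> bool"
begin

definition de :: "nat \<Rightarrow> bool \<Rightarrow> complex"
  where "de k s = (if sdir fs d (k, s) then 1 else 0)"

text \<open>A generator in direction d has the value \<epsilon>; one whose conjugate is in direction
  d is sent to its negative; a self-dual generator in direction d receives both contributions. The
  values are dictated by \<open>bnd\<close>: the cocycle has to send x(u - \<epsilon>(u)) to the
  component of the edge from x along u.\<close>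

fun ag :: "gen \<Rightarrow> falg" where
  "ag (Gen k i j) = cst (de k False * eps fs (gx k False i j)) - scaleF (de k True) (gx k False i j)"
| "ag (StarGen k i j) = cst (de k True * eps fs (gx k True i j)) - scaleF (de k False) (gx k True i j)"

fun aw :: "gen list \<Rightarrow> falg" where
  "aw [] = 0"
| "aw (g # w) = scaleF (eps fs (mon (Word w))) (ag g) + mon (Word [g]) * aw w"

definition a0 :: "falg \<Rightarrow> falg"
  where "a0 = lext scaleF (\<lambda>w. aw (letters w))"

lemma linearF_a0: "linearF scaleF a0"
  unfolding a0_def by (rule F.linearF_lext)

lemmas a0_add = linearF_add[OF linearF_a0] and a0_scaleF = linearF_scale[OF linearF_a0]
  and a0_sum = linearF_sum[OF linearF_a0] and a0_diff = linearF_diff[OF linearF_a0]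
  and a0_0 = linearF_0[OF linearF_a0]

lemma a0_mon: "a0 (mon (Word w)) = aw w"
  by (simp add: a0_def F.lext_mon)

lemma aw_append: "aw (v @ w) = mon (Word v) * aw w + scaleF (eps fs (mon (Word w))) (aw v)"
proof (induction v)
  case (Cons g v)
  then show ?case
    by (simp add: mon_Cons[of g v] mon_append eps_mult F.scale_right_distrib distrib_left mult_scaleF_right mult.assoc mult.commute add.assoc)
qed (simp add: mon_Nil)

lemma a0_mult: "a0 (x * y) = x * a0 y + scaleF (eps fs y) (a0 x)"
proof (induction x rule: falg_induct)
  case (mon v)
  show ?case
  proof (induction y rule: falg_induct)
    case (mon w)
    obtain v' w' where vw: "v = Word v'" "w = Word w'" by (cases v, cases w) auto
    then show ?case by (simp add: a0_mon aw_append flip: mon_append)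
  next
    case (scale c y)
    then show ?case by (simp add: mult_scaleF_right a0_scaleF eps_scaleF F.scale_right_distrib)
  next
    case (add y z)
    then show ?case by (simp add: distrib_left a0_add eps_add F.scale_left_distrib algebra_simps)
  qed
next
  case (scale c x)
  then show ?case by (simp add: mult_scaleF_left a0_scaleF F.scale_right_distrib mult.commute)
next
  case (add x z)
  then show ?case by (simp add: distrib_right a0_add F.scale_right_distrib algebra_simps)
qed

lemma a0_1: "a0 1 = 0" and a0_cst: "a0 (cst c) = 0"
proof -
  show 1: "a0 1 = 0" using a0_mon[of "[]"] by (simp add: mon_Nil)
  show "a0 (cst c) = 0" using a0_scaleF[of c 1] by (simp add: scaleF_1_cst 1)
qed

lemma a0_gx: "a0 (gx k s i j) = cst (de k s * eps fs (gx k s i j)) - scaleF (de k (\<not> s)) (gx k s i j)"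
  by (cases s) (simp_all add: gx_def a0_mon mon_Nil)

text \<open>x behaves as if the cocycle were e(\<epsilon> - id). The set of such x is a linear space
  containing the constants, and on a relator, where \<epsilon> vanishes, the property says that the
  cocycle only multiplies by -e.\<close>

definition ascal :: "complex \<Rightarrow> falg \<Rightarrow> bool"
  where "ascal e x \<longleftrightarrow> a0 x = scaleF e (cst (eps fs x) - x)"

lemma ascal_cst: "ascal e (cst c)"
  by (simp add: ascal_def a0_cst)

lemma ascal_diff:
  assumes "ascal e x" "ascal e y" shows "ascal e (x - y)"
  unfolding ascal_def a0_diff assms[unfolded ascal_def] linearF_diff[OF linearF_eps] cst_diff F.scale_right_diff_distrib
  by (simp add: algebra_simps)

lemma ascal_scaleF: "ascal e x \<Longrightarrow> ascal e (scaleF c x)"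
  by (simp add: ascal_def a0_scaleF eps_scaleF F.scale_right_diff_distrib mult.commute flip: scaleF_cst)

lemma ascal_sum: "(\<And>i. i \<in> A \<Longrightarrow> ascal e (f i)) \<Longrightarrow> ascal e (\<Sum>i\<in>A. f i)"
  by (simp add: ascal_def a0_sum linearF_sum[OF linearF_eps] cst_sum F.scale_sum_right flip: sum_subtractf)

text \<open>The contributions of the conjugate direction to the two factors cancel, and those of the
  direction itself telescope.\<close>

lemma ascal_prod: "ascal (de k s) (gx k s a b * gx k (\<not> s) c d')"
proof -
  let ?g = "gx k s a b" and ?h = "gx k (\<not> s) c d'"
  have "a0 (?g * ?h) = ?g * (cst (de k (\<not> s) * eps fs ?h) - scaleF (de k s) ?h) + scaleF (eps fs ?h) (cst (de k s * eps fs ?g) - scaleF (de k (\<not> s)) ?g)"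
    by (simp add: a0_mult a0_gx)
  also have "\<dots> = scaleF (de k s) (cst (eps fs (?g * ?h)) - ?g * ?h)"
    by (simp add: eps_mult right_diff_distrib F.scale_right_diff_distrib mult_scaleF_right cst_commute[of ?g] scaleF_cst mult_ac flip: scaleF_def)
  finally show ?thesis by (simp add: ascal_def)
qed

lemma ascal_AO: "fs ! k = AO Q \<Longrightarrow> ascal (de k False) (gx k s i j)"
proof -
  assume "fs ! k = AO Q"
  then have "de k s = de k False" "de k (\<not> s) = de k False" by (auto simp: de_def sdir_def)
  then show ?thesis by (simp add: ascal_def a0_gx F.scale_right_diff_distrib scaleF_cst)
qed

end

context valid_cayley_graph begin

text \<open>Relators are built from constants and products of an entry with an adjoint, or are
  linear in the entries of an \<open>AO\<close> factor; in all cases \<open>ascal\<close> applies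
  with one common e. The intersection \<open>J\<close> with the ideal is used because multiplying
  the cocycle identity out needs \<epsilon> to vanish on x.\<close>

lemma a0_ideal:
  assumes "x \<in> rel_ideal fs" shows "a0 fs d x \<in> rel_ideal fs"
proof -
  let ?I = "rel_ideal fs"
  define J where "J = {x \<in> ?I. a0 fs d x \<in> ?I}"
  have eps0: "eps fs x = 0" if "x \<in> ?I" for x using eps_kills that by (simp add: kills_def)
  note I = rel_ideal.zero[of fs] rel_ideal.add[of _ fs] rel_ideal.mult_left[of _ fs] rel_ideal.mult_right[of _ fs]
  have sc: "scaleF c x \<in> ?I" if "x \<in> ?I" for c x using that by (simp add: scaleF_def I)
  have J: "ideal J"
    unfolding ideal_def J_def by (auto simp: I a0_0 a0_add a0_mult eps0 sc)
  have asc: "x \<in> J" if "x \<in> ?I" "ascal fs d e x" for e x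
    using that ideal_minus[OF ideal_rel_ideal sc[OF that(1), of e]] by (simp add: J_def ascal_def eps0)
  note A = ascal_diff ascal_cst ascal_sum ascal_scaleF[unfolded scaleF_def] ascal_prod[of fs d _ False, simplified] ascal_prod[of fs d _ True, simplified]
  have A01: "ascal fs d e (if b then 1 else 0)" for e b
    using ascal_cst[of fs d e 1] ascal_cst[of fs d e 0] by simp
  have r: "r \<in> J" if k: "k < length fs" and ij: "i < fdim fs k" "j < fdim fs k" and "r \<in> rels fs k i j" for k i j r
  proof -
    have "r \<in> ?I" using rels_in_ideal[OF k valid[OF k] ij] that(4) by blast
    moreover have "ascal fs d (de fs d k False) r \<or> ascal fs d (de fs d k True) r"
      using that(4) unfolding rels_def Let_def by (auto intro!: A A01 simp del: if_split)
    ultimately show ?thesis using asc by blast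
  qed
  have "rel_ideal fs \<subseteq> J"
  proof (rule rel_ideal_subset[OF valid J])
    show "gx k s i j \<in> J" if "\<not> (i < fdim fs k \<and> j < fdim fs k)" for k s i j
    proof -
      have g: "gx k s i j \<in> ?I" by (rule gx_unused[OF that])
      then show ?thesis using ideal_minus[OF ideal_rel_ideal sc[OF g]] by (simp add: J_def a0_gx eps0)
    qed
    show "rels fs k i j \<subseteq> J" if "k < length fs" "i < fdim fs k" "j < fdim fs k" for k i j
      using r[OF that] by blast
    show "(\<Sum>l<fdim fs k. gx k False i l * gx k True j l) - (if i = j then 1 else 0) \<in> J"
      "(\<Sum>l<fdim fs k. gx k True l i * gx k False l j) - (if i = j then 1 else 0) \<in> J"
      if "k < length fs" "i < fdim fs k" "j < fdim fs k" for k i j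
      by (rule r[OF that]; simp add: rels_def Let_def)+
    show "ao_rel fs k i j \<in> J \<and> starF (ao_rel fs k i j) \<in> J"
      if k: "k < length fs" and Q: "fs ! k = AO Q" and ij: "i < fdim fs k" "j < fdim fs k" for k Q i j
    proof -
      note m = ao_rel_in_ideal[OF k valid[OF k] ij Q]
      have "starF (ao_rel fs k i j) = gx k True i j - (\<Sum>a<fdim fs k. \<Sum>b<fdim fs k. scaleF (cnj (fmat (fs ! k) $$ (i, a) * inv_mat (fmat (fs ! k)) $$ (b, j))) (gx k False a b))"
        unfolding ao_rel_def starF_diff starF_sum scaleF_def[symmetric] starF_scaleF starF_gx by (simp only: not_False_eq_True not_True_eq_False)
      then have "ascal fs d (de fs d k False) (starF (ao_rel fs k i j))"
        by (simp only:) (intro ascal_diff ascal_sum ascal_scaleF ascal_AO[OF Q])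
      moreover have "ascal fs d (de fs d k False) (ao_rel fs k i j)"
        unfolding ao_rel_def scaleF_def[symmetric] by (intro ascal_diff ascal_sum ascal_scaleF ascal_AO[OF Q])
      ultimately show ?thesis using asc[OF m] asc[OF rel_ideal.star[OF m]] by blast
    qed
  qed
  then show ?thesis using assms by (auto simp: J_def)
qed

lemma a0_hx:
  assumes k: "k < length fs" and ij: "i < fdim fs k" "j < fdim fs k"
  shows "a0 fs d (hx fs k s i j) = cst (dl d k s i j) - scaleF (if sdir fs d (k, \<not> s) then 1 else 0) (hx fs k s i j)"
proof -
  have A: "a0 fs d x = cst (de fs d k s * eps fs x) - scaleF (de fs d k (\<not> s)) x"
    if "x = (\<Sum>a<fdim fs k. \<Sum>b<fdim fs k. scaleF (c a b) (gx k s a b))" for x c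
    unfolding that by (simp add: a0_sum a0_scaleF a0_gx linearF_sum[OF linearF_eps] eps_scaleF sum_distrib_left cst_sum F.scale_sum_right sum_subtractf F.scale_right_diff_distrib scaleF_cst mult_ac)
  have "a0 fs d (hx fs k s i j) = cst (de fs d k s * eps fs (hx fs k s i j)) - scaleF (de fs d k (\<not> s)) (hx fs k s i j)"
  proof (cases s)
    case True
    show ?thesis by (rule A) (simp only: True hx_index_star[OF k valid[OF k] refl refl ij])
  next
    case False
    show ?thesis by (rule A) (simp only: False hx_index[OF k valid[OF k] refl refl ij])
  qed
  then show ?thesis by (simp add: de_def dl_def eps_hx[OF k valid[OF k] refl refl ij])
qed

text \<open>The path property writes \<open>x - \<epsilon>(x)\<close> as a boundary of edges, on which both sides can be computed.\<close>

lemma path_cocycle_inner: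
  assumes c: "path_cocycle fs G c" and d: "d \<in> set (dirs fs)"
  shows "cinner (tens G (L z) (omega (fst d) (snd d))) (c x) = cinner (L z) (L (a0 fs d x))"
proof -
  define y where "y = x - cst (eps fs x)"
  have "c x \<in> Kg' fs G" and "target G (c x) = L x - scaleC (eps fs x) (L 1)"
    using c by (auto simp: path_cocycle_def)
  moreover have "L x - scaleC (eps fs x) (L 1) = L y" by (simp add: y_def L_diff flip: L_scaleF scaleF_1_cst)
  ultimately obtain ts where ts: "edges_ok ts" "L (scaleF 2 y) = L (bnd_tot ts)"
    "\<And>d z. d \<in> set (dirs fs) \<Longrightarrow> 2 * cinner (tens G (L z) (omega (fst d) (snd d))) (c x) = cinner (L z) (L (bnd d ts))"
    by (metis path_representation)
  \<comment> \<open>The two elements agree only under \<Lambda>. That the cocycle does not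
    distinguish them is the content of \<open>null_functional\<close>.\<close>
  have "null (scaleF 2 y - bnd_tot ts)" by (simp add: null_iff L_diff ts(2))
  moreover have "linearF scaleC (\<lambda>x. L (a0 fs d x))" by (rule linearF_compose[OF linearF_L linearF_a0])
  moreover have "L (a0 fs d a) = 0" if "a \<in> rel_ideal fs" for a
    using L_eqS[of "a0 fs d a" 0] a0_ideal[OF that] by (simp add: eqS_0_iff L_0)
  ultimately have "L (a0 fs d (scaleF 2 y - bnd_tot ts)) = 0" by (rule null_functional[OF H.cvector_space_axioms, rotated -1])
  moreover have "a0 fs d (scaleF 2 y) = scaleF 2 (a0 fs d x)" by (simp add: y_def a0_scaleF a0_diff a0_cst)
  moreover have "a0 fs d (bnd_tot us) = bnd d us" if "edges_ok us" for us
    using that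
  proof (induction us)
    case (Cons e us)
    obtain x k s i j where e: "e = (x, k, s, i, j)" by (cases e) auto
    have ok: "k < length fs" "i < fdim fs k" "j < fdim fs k" "edges_ok us" using Cons.prems by (auto simp: e edges_ok_def)
    have i1: "(if i = j then 1 else 0) = cst (if i = j then 1 else 0)" by simp
    have "a0 fs d (x * (hx fs k s i j - (if i = j then 1 else 0))) = x * a0 fs d (hx fs k s i j)"
      unfolding i1 by (simp only: a0_mult a0_diff a0_cst linearF_diff[OF linearF_eps] eps_cst eps_hx[OF ok(1) valid[OF ok(1)] refl refl ok(2,3)]) simp
    also have "\<dots> = scaleF (dl d k s i j) x - scaleF (if sdir fs d (k, \<not> s) then 1 else 0) (x * hx fs k s i j)"
      unfolding a0_hx[OF ok(1-3)] by (simp only: right_diff_distrib mult_scaleF_right cst_commute[of x] scaleF_def[symmetric])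
    finally show ?case using Cons.IH[OF ok(4)] by (simp add: e bnd_tot_def bnd_def a0_add)
  qed (simp add: bnd_tot_def bnd_def a0_0)
  ultimately have "L (scaleF 2 (a0 fs d x)) = L (bnd d ts)" using ts(1) by (simp add: a0_diff L_diff)
  then have "2 * cinner (tens G (L z) (omega (fst d) (snd d))) (c x) = 2 * cinner (L z) (L (a0 fs d x))"
    using ts(3)[OF d, of z] by (metis L_scaleF cinner_scaleC_right)
  then show ?thesis by simp
qed

text \<open>Cauchy-Schwarz, with the vector \<Lambda>(a(x)) itself as first leg of the test
  vector.\<close>

lemma path_cocycle_norm:
  assumes c: "path_cocycle fs G c" and d: "d \<in> set (dirs fs)"
  shows "norm (L (a0 fs d x)) \<le> norm (omega (fst d) (snd d)) * norm (c x)"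
proof (cases "L (a0 fs d x) = 0")
  case False
  let ?v = "L (a0 fs d x)" and ?w = "omega (fst d) (snd d)"
  have nt: "norm (tens G \<xi> \<eta>) = norm \<xi> * norm \<eta>" for \<xi> \<eta>
  proof -
    have "complex_of_real ((norm (tens G \<xi> \<eta>))\<^sup>2) = complex_of_real ((norm \<xi> * norm \<eta>)\<^sup>2)"
      by (simp only: cinner_self[symmetric] tens_cinner power_mult_distrib of_real_mult)
    then have "(norm (tens G \<xi> \<eta>))\<^sup>2 = (norm \<xi> * norm \<eta>)\<^sup>2" by (simp only: of_real_eq_iff)
    then show ?thesis by (simp add: power2_eq_iff_nonneg)
  qed
  have "(norm ?v)\<^sup>2 = cmod (cinner ?v ?v)" by (simp add: cinner_self norm_power)
  also have "\<dots> = cmod (cinner (tens G ?v ?w) (c x))" by (simp only: path_cocycle_inner[OF c d])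
  also have "\<dots> \<le> norm ?v * norm ?w * norm (c x)" using Cauchy_Schwarz_cinner[of "tens G ?v ?w" "c x"] by (simp add: nt)
  finally have "norm ?v * norm ?v \<le> norm ?v * (norm ?w * norm (c x))" by (simp add: power2_eq_square mult.assoc)
  then show ?thesis using False by simp
qed simp

end

section \<open>Growth of the path cocycle\<close>

lemma starF_prod_sum:
  assumes "\<And>l l'. eqS fs (\<Sum>i\<in>A. starF (u i) * u i) 1"
  shows "eqS fs (\<Sum>i\<in>A. starF (u i * y) * (u i * y')) (starF y * y')"
proof -
  have "(\<Sum>i\<in>A. starF (u i * y) * (u i * y')) = starF y * (\<Sum>i\<in>A. starF (u i) * u i) * y'"
    by (simp add: starF_mult sum_distrib_left sum_distrib_right mult.assoc)
  also have "eqS fs \<dots> (starF y * 1 * y')" by (intro eqS_mult eqS_refl assms)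
  finally show ?thesis by simp
qed

section \<open>Sums along columns\<close>

context valid_cayley_graph begin

lemma gx_column:
  assumes "k < length fs" "i < fdim fs k" "j < fdim fs k"
  shows "eqS fs (\<Sum>l<fdim fs k. gx k True l i * gx k False l j) (if i = j then 1 else 0)"
  using rels_in_ideal[OF assms(1) valid[OF assms(1)] assms(2,3)] by (simp add: rels_def Let_def eqS_def)

lemma wmat_column:
  assumes "set t \<subseteq> {..<length fs}" "J \<in> idx fs t"
  shows "eqS fs (\<Sum>I\<in>idx fs t. starF (wmat t I J) * wmat t I J) 1"
  using assms
proof (induction t arbitrary: J)
  case (Cons k t)
  obtain j J' where J: "J = j # J'" "j < fdim fs k" "J' \<in> idx fs t" using Cons.prems(2) by (rule idx_ConsE)
  have k: "k < length fs" using Cons.prems(1) by simp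
  have "(\<Sum>I\<in>idx fs (k # t). starF (wmat (k # t) I J) * wmat (k # t) I J) =
    (\<Sum>I\<in>idx fs t. \<Sum>i<fdim fs k. starF (gx k False i j * wmat t I J') * (gx k False i j * wmat t I J'))"
    unfolding sum_idx_Cons J(1) wmat.simps by (rule sum.swap)
  also have "eqS fs \<dots> (\<Sum>I\<in>idx fs t. starF (wmat t I J') * wmat t I J')"
    by (intro eqS_sum starF_prod_sum) (use gx_column[OF k J(2) J(2)] in simp)
  also have "eqS fs \<dots> 1" using Cons J by (intro Cons.IH) auto
  finally show ?case .
qed (simp add: starF_1)

lemma eps_wmat: "I \<in> idx fs t \<Longrightarrow> J \<in> idx fs t \<Longrightarrow> eps fs (wmat t I J) = (if I = J then 1 else 0)"
proof (induction t arbitrary: I J)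
  case (Cons k t)
  from Cons.prems(1) obtain i I' where I: "I = i # I'" "i < fdim fs k" "I' \<in> idx fs t" by (rule idx_ConsE)
  from Cons.prems(2) obtain j J' where J: "J = j # J'" "j < fdim fs k" "J' \<in> idx fs t" by (rule idx_ConsE)
  show ?case using Cons.IH[OF I(3) J(3)] I(2) J(2) by (simp add: I(1) J(1) eps_mult eps_gx)
qed simp

text \<open>A column w of a unitary matrix with entries in \<S> acts as an isometry from H to a
  finite direct sum of copies of H. The same holds on K by \<open>act_family\<close>.\<close>

lemma lreg_family:
  assumes fin: "finite A" and w: "eqS fs (\<Sum>i\<in>A. starF (w i) * w i) 1"
  shows "(\<Sum>i\<in>A. cinner (lreg G (w i) x) (lreg G (w i) y)) = cinner x y"
proof -
  have c1: "continuous_on UNIV (\<lambda>y. \<Sum>i\<in>A. cinner (lreg G (w i) x) (lreg G (w i) y))" for x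
    by (intro continuous_on_sum continuous_on_cinner_right bounded_clinear_continuous[OF lreg_bounded])
  have c2: "continuous_on UNIV (\<lambda>x. \<Sum>i\<in>A. cinner (lreg G (w i) x) (lreg G (w i) y))" for y
    by (intro continuous_on_sum continuous_on_cinner_left bounded_clinear_continuous[OF lreg_bounded])
  have 0: "(\<Sum>i\<in>A. cinner (lreg G (w i) (L a)) (lreg G (w i) (L b))) = cinner (L a) (L b)" for a b
  proof -
    have "(\<Sum>i\<in>A. cinner (lreg G (w i) (L a)) (lreg G (w i) (L b))) = h (\<Sum>i\<in>A. starF (w i * a) * (w i * b))"
      by (simp add: lreg_gns gns_cinner h_sum)
    also have "\<dots> = cinner (L a) (L b)" unfolding gns_cinner by (intro h_eqS starF_prod_sum w)
    finally show ?thesis .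
  qed
  have 1: "(\<Sum>i\<in>A. cinner (lreg G (w i) x) (lreg G (w i) (L b))) = cinner x (L b)" for x b
    by (rule dense_eqI[where f = "\<lambda>x. \<Sum>i\<in>A. cinner (lreg G (w i) x) (lreg G (w i) (L b))" and g = "\<lambda>x. cinner x (L b)", OF gns_dense c2 continuous_on_cinner_left[OF continuous_on_id]]) (auto simp: 0)
  show ?thesis
    by (rule dense_eqI[where f = "\<lambda>y. \<Sum>i\<in>A. cinner (lreg G (w i) x) (lreg G (w i) y)" and g = "\<lambda>y. cinner x y", OF gns_dense c1 continuous_on_cinner_right[OF continuous_on_id]]) (auto simp: 1)
qed

lemma act_family:
  assumes fin: "finite A" and w: "eqS fs (\<Sum>i\<in>A. starF (w i) * w i) 1"
  shows "(\<Sum>i\<in>A. (norm (act G (w i) \<zeta>))\<^sup>2) = (norm \<zeta>)\<^sup>2"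
proof -
  have "(\<Sum>i\<in>A. cinner (tensop G (lreg G (w i)) id \<zeta>) (tensop G (lreg G (w i)) id \<zeta>)) = cinner \<zeta> \<zeta>"
    by (rule tensop_family) (simp_all add: lreg_bounded lreg_family[OF assms] bounded_clinear_id)
  then have "complex_of_real (\<Sum>i\<in>A. (norm (act G (w i) \<zeta>))\<^sup>2) = complex_of_real ((norm \<zeta>)\<^sup>2)"
    by (simp only: cinner_self act_def of_real_sum)
  then show ?thesis by (simp only: of_real_eq_iff)
qed

text \<open>The translated vectors of a column have total squared norm that of \<xi>, and the counit
  term only occurs on the diagonal, with the same contribution. The constant 4 comes from bounding
  the square of a sum of two terms.\<close>

lemma trivial_bound:
  assumes c: "\<And>x. c x = act G x \<xi> - scaleC (eps fs x) \<xi>" and t: "set t \<subseteq> {..<length fs}" and J: "J \<in> idx fs t"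
  shows "(\<Sum>I\<in>idx fs t. (norm (c (wmat t I J)))\<^sup>2) \<le> 4 * (norm \<xi>)\<^sup>2"
proof -
  have sq: "(norm (a - b))\<^sup>2 \<le> 2 * (norm a)\<^sup>2 + 2 * (norm b)\<^sup>2" for a b :: 'b
  proof -
    have "(norm (a - b))\<^sup>2 \<le> (norm a + norm b)\<^sup>2" by (intro power_mono norm_triangle_ineq4) simp
    also have "\<dots> \<le> 2 * (norm a)\<^sup>2 + 2 * (norm b)\<^sup>2" using sum_squares_ge_zero[of "norm a - norm b" 0] by (simp add: power2_eq_square algebra_simps)
    finally show ?thesis .
  qed
  have "(\<Sum>I\<in>idx fs t. (norm (c (wmat t I J)))\<^sup>2) \<le> (\<Sum>I\<in>idx fs t. 2 * (norm (act G (wmat t I J) \<xi>))\<^sup>2 + 2 * (if I = J then (norm \<xi>)\<^sup>2 else 0))"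
  proof (rule sum_mono)
    fix I assume I: "I \<in> idx fs t"
    show "(norm (c (wmat t I J)))\<^sup>2 \<le> 2 * (norm (act G (wmat t I J) \<xi>))\<^sup>2 + 2 * (if I = J then (norm \<xi>)\<^sup>2 else 0)"
      using sq[of "act G (wmat t I J) \<xi>" "scaleC (eps fs (wmat t I J)) \<xi>"] by (simp add: c eps_wmat[OF I J] split: if_splits)
  qed
  also have "\<dots> = 4 * (norm \<xi>)\<^sup>2"
    using act_family[OF finite_idx wmat_column[OF t J], of \<xi>] J by (simp add: sum.distrib flip: sum_distrib_left)
  finally show ?thesis .
qed

end

context valid_cayley_graph begin

context
  fixes d :: "nat \<times> bool"
begin

definition growth :: "nat list \<Rightarrow> nat list \<Rightarrow> real"
  where "growth t J = (\<Sum>I\<in>idx fs t. (norm (L (a0 fs d (wmat t I J))))\<^sup>2)"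

lemma growth_Nil: "growth [] [] = 0"
  by (simp add: growth_def a0_1 L_0)

lemma a0_wmat:
  assumes "I \<in> idx fs t" "J \<in> idx fs t"
  shows "a0 fs d (wmat (k # t) (i # I) (j # J)) = gx k False i j * a0 fs d (wmat t I J) + scaleF (if I = J then 1 else 0) (a0 fs d (gx k False i j))"
  by (simp add: a0_mult eps_wmat[OF assms])

text \<open>Prepending a letter multiplies the old values by a column of u, which preserves the sum
  of squares, and adds a new value in the single row I = J. The mixed terms in that row are assumed
  to cancel.\<close>

lemma growth_Cons:
  assumes k: "k < length fs" and j: "j < fdim fs k" and t: "set t \<subseteq> {..<length fs}" and J: "J \<in> idx fs t"
    and cross: "(\<Sum>i<fdim fs k. cinner (L (gx k False i j * a0 fs d (wmat t J J))) (L (a0 fs d (gx k False i j)))) = 0"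
  shows "growth (k # t) (j # J) = growth t J + (\<Sum>i<fdim fs k. (norm (L (a0 fs d (gx k False i j))))\<^sup>2)"
proof -
  let ?n = "fdim fs k" let ?A = "idx fs t"
  define u where "u i = gx k False i j" for i
  define y where "y I = a0 fs d (wmat t I J)" for I
  define r where "r i = L (a0 fs d (u i))" for i
  have z: "L (a0 fs d (wmat (k # t) (i # I) (j # J))) = L (u i * y I) + (if I = J then r i else 0)" if "I \<in> ?A" for i I
    unfolding a0_wmat[OF that J] by (simp add: L_add L_0 u_def y_def r_def)
  have "complex_of_real (growth (k # t) (j # J)) = (\<Sum>i<?n. \<Sum>I\<in>?A. cinner (L (u i * y I) + (if I = J then r i else 0)) (L (u i * y I) + (if I = J then r i else 0)))"
    unfolding growth_def sum_idx_Cons of_real_sum cinner_self[symmetric] by (intro sum.cong refl) (simp only: z)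
  also have "\<dots> = (\<Sum>i<?n. \<Sum>I\<in>?A. cinner (L (u i * y I)) (L (u i * y I)) + (if I = J then cinner (L (u i * y J)) (r i) + cinner (r i) (L (u i * y J)) + cinner (r i) (r i) else 0))"
    by (intro sum.cong refl) (simp add: cinner_add_left cinner_add_right)
  also have "\<dots> = (\<Sum>i<?n. \<Sum>I\<in>?A. cinner (L (u i * y I)) (L (u i * y I))) +
      (\<Sum>i<?n. cinner (L (u i * y J)) (r i)) + (\<Sum>i<?n. cinner (r i) (L (u i * y J))) + (\<Sum>i<?n. cinner (r i) (r i))"
    using J by (simp add: sum.distrib)
  also have "(\<Sum>i<?n. cinner (L (u i * y J)) (r i)) = 0" using cross by (simp add: u_def y_def r_def)
  also have "(\<Sum>i<?n. cinner (r i) (L (u i * y J))) = cnj (\<Sum>i<?n. cinner (L (u i * y J)) (r i))"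
    unfolding cnj_sum by (intro sum.cong refl cinner_commute)
  also have "(\<Sum>i<?n. cinner (L (u i * y J)) (r i)) = 0" using cross by (simp add: u_def y_def r_def)
  also have "(\<Sum>i<?n. \<Sum>I\<in>?A. cinner (L (u i * y I)) (L (u i * y I))) = (\<Sum>I\<in>?A. cinner (L (y I)) (L (y I)))"
  proof -
    have "(\<Sum>i<?n. cinner (L (u i * y I)) (L (u i * y I))) = cinner (L (y I)) (L (y I))" for I
    proof -
      have "(\<Sum>i<?n. cinner (L (u i * y I)) (L (u i * y I))) = h (\<Sum>i<?n. starF (u i * y I) * (u i * y I))" by (simp add: gns_cinner h_sum)
      also have "\<dots> = cinner (L (y I)) (L (y I))" unfolding gns_cinner
        by (intro h_eqS starF_prod_sum) (use gx_column[OF k j j] in \<open>simp add: u_def\<close>)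
      finally show ?thesis .
    qed
    then show ?thesis by (subst sum.swap) simp
  qed
  finally have "complex_of_real (growth (k # t) (j # J)) = complex_of_real (growth t J + (\<Sum>i<?n. (norm (r i))\<^sup>2))"
    by (simp add: growth_def cinner_self y_def)
  then show ?thesis by (simp only: of_real_eq_iff r_def u_def)
qed

end

lemma growth_le:
  assumes c: "path_cocycle fs G c" and d: "d \<in> set (dirs fs)"
  shows "growth d t J \<le> (norm (omega (fst d) (snd d)))\<^sup>2 * (\<Sum>I\<in>idx fs t. (norm (c (wmat t I J)))\<^sup>2)"
  unfolding growth_def sum_distrib_left
proof (rule sum_mono)
  fix I
  have "(norm (L (a0 fs d (wmat t I J))))\<^sup>2 \<le> (norm (omega (fst d) (snd d)) * norm (c (wmat t I J)))\<^sup>2"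
    by (intro power_mono path_cocycle_norm[OF c d]) simp
  then show "(norm (L (a0 fs d (wmat t I J))))\<^sup>2 \<le> (norm (omega (fst d) (snd d)))\<^sup>2 * (norm (c (wmat t I J)))\<^sup>2"
    by (simp add: power_mult_distrib)
qed

lemma norm_L1: "norm (L 1) = 1"
  using cinner_self[of "L 1"] by (simp add: gns_cinner h_1 power2_eq_1_iff flip: of_real_power) (use norm_ge_zero[of "L 1"] in linarith)

subsection \<open>A factor of type \<open>A\<^sub>u\<close>\<close>

context
  fixes k Q
  assumes k: "k < length fs" and Q: "fs ! k = AU Q"
begin

lemma a0_AU: "a0 fs (k, False) (gx k False i j) = cst (eps fs (gx k False i j))"
  by (simp add: a0_gx de_def sdir_def Q)

text \<open>The cocycle value of a word consists of products of at most n letters u, and z has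
  positive degree, so the product has positive degree throughout. The rescaling automorphism then
  forces h to vanish; the exponent is a successor so that the weight is not 1.\<close>

lemma haar_a0_AU:
  assumes \<sigma>: "\<And>x y. \<sigma> (x * y) = \<sigma> x * \<sigma> y" "\<And>x. h (\<sigma> x) = h x"
    "\<And>i j. i < fdim fs k \<Longrightarrow> j < fdim fs k \<Longrightarrow> \<sigma> (gx k False i j) = scaleF 2 (gx k False i j)"
    and IJ: "I \<in> idx fs (replicate n k)" "J \<in> idx fs (replicate n k)"
  shows "\<sigma> z = scaleF (2 ^ Suc m) z \<Longrightarrow> h (z * a0 fs (k, False) (wmat (replicate n k) I J)) = 0"
  using IJ
proof (induction n arbitrary: I J z m)
  case 0
  then show ?case by (simp add: a0_1 h_0)
next
  case (Suc n)
  from Suc.prems(2) obtain i I' where I: "I = i # I'" "i < fdim fs k" "I' \<in> idx fs (replicate n k)" unfolding replicate_Suc by (rule idx_ConsE)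
  from Suc.prems(3) obtain j J' where J: "J = j # J'" "j < fdim fs k" "J' \<in> idx fs (replicate n k)" unfolding replicate_Suc by (rule idx_ConsE)
  have "h z = 2 ^ Suc m * h z" using \<sigma>(2)[of z] Suc.prems(1) by (metis h_scaleF)
  moreover have "(2 :: complex) ^ Suc m \<noteq> 1"
  proof
    assume "(2 :: complex) ^ Suc m = 1"
    then have "cmod (2 ^ Suc m) = 1" by simp
    then have "(2 :: real) ^ Suc m = 1" by (simp only: norm_power norm_numeral)
    then show False using one_less_power[of "2::real" "Suc m"] by simp
  qed
  ultimately have hz: "h z = 0" by simp
  have "\<sigma> (z * gx k False i j) = scaleF (2 ^ Suc (Suc m)) (z * gx k False i j)"
    using Suc.prems(1) \<sigma>(3)[OF I(2) J(2)] by (simp add: \<sigma>(1) mult_scaleF_left mult_scaleF_right)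
  from Suc.IH[OF this I(3) J(3)] have "h (z * gx k False i j * a0 fs (k, False) (wmat (replicate n k) I' J')) = 0" .
  then show ?case
    unfolding I(1) J(1) replicate_Suc a0_wmat[OF I(3) J(3)] a0_AU
    by (simp add: distrib_left h_add mult.assoc mult_scaleF_right h_scaleF cst_commute hz flip: scaleF_def)
qed

text \<open>On a letter the cocycle is the counit, so a column adds exactly the squared norm of
  \<Lambda>(1), which is 1.\<close>

lemma growth_AU: "J \<in> idx fs (replicate n k) \<Longrightarrow> growth (k, False) (replicate n k) J = real n"
proof (induction n arbitrary: J)
  case 0
  then show ?case by (simp add: growth_Nil)
next
  case (Suc n)
  from Suc.prems obtain j J' where J: "J = j # J'" "j < fdim fs k" "J' \<in> idx fs (replicate n k)" unfolding replicate_Suc by (rule idx_ConsE)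
  obtain \<sigma> where \<sigma>: "linearF scaleF \<sigma>" "\<sigma> 1 = 1" "\<And>x y. \<sigma> (x * y) = \<sigma> x * \<sigma> y" "\<And>x. h (\<sigma> x) = h x"
    "\<And>k' s i j. i < fdim fs k' \<Longrightarrow> j < fdim fs k' \<Longrightarrow> \<sigma> (gx k' s i j) = scaleF (if k' = k then if s then 1 / 2 else 2 else 1) (gx k' s i j)"
    by (rule haar_scaling[of 2 k]) (use Q in \<open>auto intro: that\<close>)
  have \<sigma>': "\<sigma> (gx k False i j) = scaleF 2 (gx k False i j)" if "i < fdim fs k" "j < fdim fs k" for i j using \<sigma>(5)[OF that, of False] by simp
  let ?y = "a0 fs (k, False) (wmat (replicate n k) J' J')"
  have "\<sigma> (gx k False j j) = scaleF (2 ^ Suc 0) (gx k False j j)" using \<sigma>'[OF J(2,2)] by simp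
  from haar_a0_AU[OF \<sigma>(3,4) \<sigma>' J(3,3) this] have h0: "h (gx k False j j * ?y) = 0" .
  have "(\<Sum>i<fdim fs k. cinner (L (gx k False i j * ?y)) (L (a0 fs (k, False) (gx k False i j)))) =
    (\<Sum>i<fdim fs k. if i = j then cinner (L (gx k False j j * ?y)) (L 1) else 0)"
    using J(2) by (intro sum.cong refl) (simp add: a0_AU eps_gx L_0)
  also have "\<dots> = cnj (h (gx k False j j * ?y))" using J(2) by (simp add: gns_cinner h_starF)
  finally have cross: "(\<Sum>i<fdim fs k. cinner (L (gx k False i j * ?y)) (L (a0 fs (k, False) (gx k False i j)))) = 0" by (simp add: h0)
  have "(\<Sum>i<fdim fs k. (norm (L (a0 fs (k, False) (gx k False i j))))\<^sup>2) = (\<Sum>i<fdim fs k. if i = j then 1 else 0)"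
    using J(2) by (intro sum.cong refl) (simp add: a0_AU eps_gx L_0 norm_L1)
  then have "(\<Sum>i<fdim fs k. (norm (L (a0 fs (k, False) (gx k False i j))))\<^sup>2) = 1" using J(2) by simp
  then show ?case
    unfolding replicate_Suc J(1) using growth_Cons[OF k J(2) _ J(3) cross] Suc.IH[OF J(3)] k by (auto simp: set_replicate_conv_if)
qed

end

end

subsection \<open>Two factors of type \<open>A\<^sub>o\<close>\<close>

lemma idx_snoc: "A \<in> idx fs s \<Longrightarrow> i < fdim fs k \<Longrightarrow> A @ [i] \<in> idx fs (s @ [k])"
proof (induction s arbitrary: A)
  case (Cons k' s)
  from Cons.prems(1) obtain a A' where "A = a # A'" "a < fdim fs k'" "A' \<in> idx fs s" by (rule idx_ConsE)
  then show ?case using Cons by simp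
qed simp

lemma wmat_snoc:
  assumes "length A = length s" "length B = length s"
  shows "wmat (s @ [k]) (A @ [i]) (B @ [j]) = wmat s A B * gx k False i j"
proof -
  have "length s = length A" "length A = length B" using assms by simp_all
  then show ?thesis by (induction s A B rule: list_induct3) (simp_all add: mult.assoc)
qed

lemma idx_exists: "(\<And>k. k \<in> set t \<Longrightarrow> 0 < fdim fs k) \<Longrightarrow> map (\<lambda>_. 0) t \<in> idx fs t"
  by (induction t) auto

fun alt :: "nat \<Rightarrow> nat \<Rightarrow> nat \<Rightarrow> nat list" where
  "alt k k' 0 = []"
| "alt k k' (Suc n) = k # k' # alt k k' n"

lemma set_alt: "set (alt k k' n) \<subseteq> {k, k'}"
  by (induction n) auto

context valid_cayley_graph begin

lemma delta_wmat: "I \<in> idx fs t \<Longrightarrow> J \<in> idx fs t \<Longrightarrow> delta fs (wmat t I J) = (\<Sum>K\<in>idx fs t. tensF (wmat t I K) (wmat t K J))"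
proof (induction t arbitrary: I J)
  case Nil
  then show ?case by (simp flip: one_falg2)
next
  case (Cons k t)
  from Cons.prems(1) obtain i I' where I: "I = i # I'" "i < fdim fs k" "I' \<in> idx fs t" by (rule idx_ConsE)
  from Cons.prems(2) obtain j J' where J: "J = j # J'" "j < fdim fs k" "J' \<in> idx fs t" by (rule idx_ConsE)
  show ?case
    by (simp add: I J delta_mult delta_gx Cons.IH[OF I(3) J(3)] sum_idx_Cons sum_product tensF_mult)
qed

text \<open>A functional of \<open>word_functional\<close> kills 1, so applying it to the invariance
  of h on the word gives a linear relation between the values of h along a row. Such relations exist
  for all admissible blocks, and these separate.\<close>

lemma haar_alternating:
  assumes s: "s \<noteq> []" "set s \<subseteq> {..<length fs}" "successively (\<noteq>) s" and IJ: "I \<in> idx fs s" "J \<in> idx fs s"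
  shows "h (wmat s I J) = 0"
proof (rule pmat_separating[OF valid s(2) _ IJ(2), where F = "\<lambda>K. h (wmat s I K)"])
  fix Xs J assume Xs: "length Xs = length s" "\<And>i. i < length s \<Longrightarrow> stepX fs (s ! i) (fdim fs (s ! i)) (Xs ! i)" and J: "J \<in> idx fs s"
  have s': "Suc i < length s \<Longrightarrow> s ! i \<noteq> s ! Suc i" for i using s(3) by (simp add: successively_conv_nth)
  have "\<exists>f. kills fs f \<and> (\<forall>I\<in>idx fs s. \<forall>J\<in>idx fs s. f (wmat s I J) = pmat Xs I J) \<and>
      (\<forall>t' I J. length t' < length s \<longrightarrow> I \<in> idx fs t' \<longrightarrow> J \<in> idx fs t' \<longrightarrow> f (wmat t' I J) = 0)"
    by (rule word_functional[OF valid s(2) s' Xs])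
  then obtain f where f: "kills fs f" "\<forall>I\<in>idx fs s. \<forall>J\<in>idx fs s. f (wmat s I J) = pmat Xs I J"
      "\<forall>t' I J. length t' < length s \<longrightarrow> I \<in> idx fs t' \<longrightarrow> J \<in> idx fs t' \<longrightarrow> f (wmat t' I J) = 0" by (elim exE conjE)
  have lin: "linearF (*) f" using f(1) by (simp add: kills_def)
  have f1: "f 1 = 0" using f(3)[rule_format, of "[]" "[]" "[]"] s(1) by simp
  have "f (sl h (delta fs (wmat s I J))) = f (cst (h (wmat s I J)))" by (rule kills_eqS[OF f(1) haar_invariance(1)])
  also have "\<dots> = 0" using linearF_scale[OF lin, of "h (wmat s I J)" 1] by (simp add: scaleF_1_cst f1)
  finally have "f (sl h (delta fs (wmat s I J))) = 0" .
  moreover have "f (sl h (delta fs (wmat s I J))) = (\<Sum>K\<in>idx fs s. h (wmat s I K) * f (wmat s K J))"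
    unfolding delta_wmat[OF IJ(1) J] by (simp add: sl_sum sl_tensF[OF linearF_h] linearF_sum[OF lin] linearF_scale[OF lin])
  moreover have "\<dots> = (\<Sum>K\<in>idx fs s. h (wmat s I K) * pmat Xs K J)" using f(2) J by (intro sum.cong refl) simp
  ultimately show "(\<Sum>K\<in>idx fs s. h (wmat s I K) * pmat Xs K J) = 0" by simp
qed

context
  fixes k k' Q Q'
  assumes k: "k < length fs" "k' < length fs" "k \<noteq> k'" and Q: "fs ! k = AO Q"
begin

lemma a0_AO: "a0 fs (k, False) (gx k False i j) = cst (eps fs (gx k False i j)) - gx k False i j"
  and a0_other: "a0 fs (k, False) (gx k' False i j) = 0"
  using k(3) by (simp_all add: a0_gx de_def sdir_def Q)

lemma a0_alt:
  assumes "i < fdim fs k" "j < fdim fs k" "i' < fdim fs k'" "j' < fdim fs k'" "I \<in> idx fs (alt k k' n)" "J \<in> idx fs (alt k k' n)"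
  shows "a0 fs (k, False) (wmat (k' # alt k k' n) (i' # I) (j' # J)) = gx k' False i' j' * a0 fs (k, False) (wmat (alt k k' n) I J)"
    and "a0 fs (k, False) (wmat (alt k k' (Suc n)) (i # i' # I) (j # j' # J)) = gx k False i j * (gx k' False i' j' * a0 fs (k, False) (wmat (alt k k' n) I J))
      + scaleF (if i' # I = j' # J then 1 else 0) (cst (eps fs (gx k False i j)) - gx k False i j)"
proof -
  show 1: "a0 fs (k, False) (wmat (k' # alt k k' n) (i' # I) (j' # J)) = gx k' False i' j' * a0 fs (k, False) (wmat (alt k k' n) I J)"
    by (simp only: a0_wmat[OF assms(5,6)] a0_other F.scale_zero_right add_0_right)
  have "i' # I \<in> idx fs (k' # alt k k' n)" "j' # J \<in> idx fs (k' # alt k k' n)" using assms by simp_all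
  then show "a0 fs (k, False) (wmat (alt k k' (Suc n)) (i # i' # I) (j # j' # J)) = gx k False i j * (gx k' False i' j' * a0 fs (k, False) (wmat (alt k k' n) I J))
      + scaleF (if i' # I = j' # J then 1 else 0) (cst (eps fs (gx k False i j)) - gx k False i j)"
    unfolding alt.simps(2) by (simp only: a0_wmat a0_AO 1)
qed

text \<open>Each step of the induction appends k and k' to the prefix. As the prefix does not end in
  k and the two factors differ, all words that appear remain alternating and nonempty, and h
  vanishes on them.\<close>

lemma haar_a0_AO:
  assumes "I \<in> idx fs (alt k k' n)" "J \<in> idx fs (alt k k' n)"
  shows "s \<noteq> [] \<Longrightarrow> set s \<subseteq> {..<length fs} \<Longrightarrow> successively (\<noteq>) s \<Longrightarrow> last s \<noteq> k \<Longrightarrow> A \<in> idx fs s \<Longrightarrow> B \<in> idx fs s \<Longrightarrow>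
    h (wmat s A B * a0 fs (k, False) (wmat (alt k k' n) I J)) = 0"
  using assms
proof (induction n arbitrary: I J s A B)
  case 0
  then show ?case by (simp add: a0_1 h_0)
next
  case (Suc n)
  from Suc.prems(7) obtain i i' I' where I: "I = i # i' # I'" "i < fdim fs k" "i' < fdim fs k'" "I' \<in> idx fs (alt k k' n)"
    unfolding alt.simps(2) by (elim idx_ConsE) blast
  from Suc.prems(8) obtain j j' J' where J: "J = j # j' # J'" "j < fdim fs k" "j' < fdim fs k'" "J' \<in> idx fs (alt k k' n)"
    unfolding alt.simps(2) by (elim idx_ConsE) blast
  note len = length_idx[OF Suc.prems(5)] length_idx[OF Suc.prems(6)]
  have w1: "wmat s A B * gx k False i j = wmat (s @ [k]) (A @ [i]) (B @ [j])" by (rule wmat_snoc[OF len, symmetric])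
  have w2: "wmat s A B * gx k False i j * gx k' False i' j' = wmat (s @ [k, k']) (A @ [i, i']) (B @ [j, j'])"
    unfolding w1 using wmat_snoc[of "A @ [i]" "s @ [k]" "B @ [j]" k' i' j'] len by simp
  have s1: "successively (\<noteq>) (s @ [k])" "successively (\<noteq>) (s @ [k, k'])"
    using Suc.prems(1,3,4) k(3) by (simp_all add: successively_append_iff)
  have idx1: "A @ [i] \<in> idx fs (s @ [k])" "B @ [j] \<in> idx fs (s @ [k])" using idx_snoc Suc.prems(5,6) I(2) J(2) by auto
  have idx2: "A @ [i, i'] \<in> idx fs (s @ [k, k'])" "B @ [j, j'] \<in> idx fs (s @ [k, k'])"
    using idx_snoc[OF idx1(1) I(3)] idx_snoc[OF idx1(2) J(3)] by simp_all
  have h1: "h (wmat s A B) = 0" by (rule haar_alternating[OF Suc.prems(1-3,5,6)])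
  have h2: "h (wmat s A B * gx k False i j) = 0"
    unfolding w1 using Suc.prems(2) k(1) by (intro haar_alternating s1 idx1) auto
  have "h (wmat (s @ [k, k']) (A @ [i, i']) (B @ [j, j']) * a0 fs (k, False) (wmat (alt k k' n) I' J')) = 0"
    using Suc.prems(2) k by (intro Suc.IH s1 idx2 I J) auto
  then have h3: "h (wmat s A B * gx k False i j * gx k' False i' j' * a0 fs (k, False) (wmat (alt k k' n) I' J')) = 0" unfolding w2 .
  show ?case
    unfolding I(1) J(1) a0_alt(2)[OF I(2) J(2) I(3) J(3) I(4) J(4)]
    using h1 h2 h3 by (simp add: distrib_left right_diff_distrib h_add h_diff mult_scaleF_right h_scaleF mult.assoc cst_commute[of "wmat _ _ _"] flip: scaleF_def)
qed

text \<open>A letter of k' contributes nothing. A letter of k has the values \<epsilon>(u_ij) -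
  u_ij, whose squared norms over a column sum to 1 + 1, because h(u_ij) = 0 makes \<Lambda>(1) and
  \<Lambda>(u_ij) orthogonal.\<close>

lemma growth_AO: "J \<in> idx fs (alt k k' n) \<Longrightarrow> growth (k, False) (alt k k' n) J = 2 * real n"
proof (induction n arbitrary: J)
  case 0
  then show ?case by (simp add: growth_Nil)
next
  case (Suc n)
  from Suc.prems obtain j j' J' where J: "J = j # j' # J'" "j < fdim fs k" "j' < fdim fs k'" "J' \<in> idx fs (alt k k' n)"
    unfolding alt.simps(2) by (elim idx_ConsE) blast
  have J2: "j' # J' \<in> idx fs (k' # alt k k' n)" using J by simp
  have st: "set (alt k k' n) \<subseteq> {..<length fs}" "set (k' # alt k k' n) \<subseteq> {..<length fs}"
    using set_alt[of k k' n] k by auto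
  let ?a = "a0 fs (k, False)" let ?y = "?a (wmat (alt k k' n) J' J')"
  have g': "growth (k, False) (k' # alt k k' n) (j' # J') = 2 * real n"
    using growth_Cons[OF k(2) J(3) st(1) J(4), of "(k, False)"] Suc.IH[OF J(4)] by (simp add: a0_other L_0)
  define y where "y = ?a (wmat (k' # alt k k' n) (j' # J') (j' # J'))"
  have y: "y = gx k' False j' j' * ?y" unfolding y_def using a0_alt(1)[OF J(2,2,3,3,4,4)] .
  have w1: "wmat [k'] [j'] [j'] = gx k' False j' j'" and w2: "wmat [k, k'] [j, j'] [j, j'] = gx k False j j * gx k' False j' j'" by simp_all
  have hy: "h y = 0" unfolding y w1[symmetric]
    by (rule haar_a0_AO[OF J(4,4)]) (use k J in simp_all)
  have huy: "h (gx k False j j * y) = 0" unfolding y mult.assoc[symmetric] w2[symmetric]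
    by (rule haar_a0_AO[OF J(4,4)]) (use k J in simp_all)
  have hu: "h (gx k False i j) = 0" if "i < fdim fs k" for i
    using haar_alternating[of "[k]" "[i]" "[j]"] that J(2) k(1) by simp
  let ?n = "fdim fs k"
  have e: "?a (gx k False i j) = (if i = j then 1 else 0) - gx k False i j" if "i < ?n" for i
    using that by (simp add: a0_AO eps_gx)
  have col: "(\<Sum>i<?n. cinner (L (gx k False i j * x)) (L (gx k False i j * z))) = h (starF x * z)" for x z
  proof -
    have "(\<Sum>i<?n. cinner (L (gx k False i j * x)) (L (gx k False i j * z))) = h (\<Sum>i<?n. starF (gx k False i j * x) * (gx k False i j * z))"
      by (simp add: gns_cinner h_sum)
    also have "\<dots> = h (starF x * z)" by (intro h_eqS starF_prod_sum) (use gx_column[OF k(1) J(2,2)] in simp)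
    finally show ?thesis .
  qed
  \<comment> \<open>The counit part leaves one term, h of a product of positive length; in the other
    part the column sums to h of the adjoint of y. Both vanish by \<open>haar_a0_AO\<close>.\<close>
  have "(\<Sum>i<?n. cinner (L (gx k False i j * y)) (L (?a (gx k False i j)))) =
    (\<Sum>i<?n. (if i = j then cinner (L (gx k False j j * y)) (L 1) else 0) - cinner (L (gx k False i j * y)) (L (gx k False i j * 1)))"
    by (intro sum.cong refl) (simp add: e L_diff L_0 cinner_diff_right)
  also have "\<dots> = cinner (L (gx k False j j * y)) (L 1) - h (starF y * 1)"
    unfolding sum_subtractf col using J(2) by simp
  also have "\<dots> = 0" using huy hy by (simp add: gns_cinner h_starF flip: starF_mult)
  finally have cross: "(\<Sum>i<?n. cinner (L (gx k False i j * y)) (L (?a (gx k False i j)))) = 0" .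
  have "complex_of_real (\<Sum>i<?n. (norm (L (?a (gx k False i j))))\<^sup>2) =
    (\<Sum>i<?n. (if i = j then 1 else 0) + cinner (L (gx k False i j * 1)) (L (gx k False i j * 1)))"
    unfolding of_real_sum cinner_self[symmetric]
  proof (intro sum.cong refl)
    fix i assume "i \<in> {..<?n}"
    then have i: "i < ?n" by simp
    have "cinner (L 1) (L (gx k False i j)) = 0" "cinner (L (gx k False i j)) (L 1) = 0" "cinner (L 1) (L 1) = 1"
      using hu[OF i] h_starF[of "gx k False i j"] by (simp_all add: gns_cinner h_1)
    then show "cinner (L (?a (gx k False i j))) (L (?a (gx k False i j))) = (if i = j then 1 else 0) + cinner (L (gx k False i j * 1)) (L (gx k False i j * 1))"
      unfolding e[OF i] by (auto simp: L_diff L_0 cinner_diff_right cinner_diff_left cinner_minus_left cinner_minus_right linearF_minus[OF linearF_L])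
  qed
  also have "\<dots> = complex_of_real 2" unfolding sum.distrib col using J(2) by (simp add: h_1)
  finally have r: "(\<Sum>i<?n. (norm (L (?a (gx k False i j))))\<^sup>2) = 2" by (simp only: of_real_eq_iff)
  show ?case
    unfolding alt.simps(2) J(1) growth_Cons[OF k(1) J(2) st(2) J2 cross[unfolded y_def]] r g' by simp
qed

end

text \<open>With an \<open>AU\<close> factor its own powers suffice. Otherwise all factors are
  \<open>AO\<close>, and there are at least two of them, so words alternating between the first two
  are available.\<close>

lemma unbounded_growth:
  assumes "fs \<noteq> []" "\<nexists>Q. fs = [AO Q]"
  shows "\<exists>d\<in>set (dirs fs). \<forall>n. \<exists>t J. set t \<subseteq> {..<length fs} \<and> J \<in> idx fs t \<and> real n \<le> growth d t J"
proof (cases "\<exists>k Q. k < length fs \<and> fs ! k = AU Q")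
  case True
  then obtain k Q where k: "k < length fs" "fs ! k = AU Q" by blast
  have "set (replicate n k) \<subseteq> {..<length fs}" for n using k(1) by auto
  moreover have "map (\<lambda>_. 0) (replicate n k) \<in> idx fs (replicate n k)" for n
    using n_pos[OF k(1) refl] by (intro idx_exists) auto
  ultimately have "set (replicate n k) \<subseteq> {..<length fs} \<and> map (\<lambda>_. 0) (replicate n k) \<in> idx fs (replicate n k) \<and> real n \<le> growth (k, False) (replicate n k) (map (\<lambda>_. 0) (replicate n k))" for n
    by (simp only: growth_AU[OF k] simp_thms order_refl)
  moreover have "(k, False) \<in> set (dirs fs)" using k by (simp add: set_dirs)
  ultimately show ?thesis by blast
next
  case False
  have AO: "\<exists>Q. fs ! k = AO Q" if "k < length fs" for k using False that by (cases "fs ! k") auto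
  have len: "1 < length fs"
  proof (rule ccontr)
    assume "\<not> 1 < length fs"
    then obtain f where "fs = [f]" using assms(1) by (cases fs) auto
    then show False using AO[of 0] assms(2) by auto
  qed
  have "0 < length fs" using len by linarith
  from AO[OF this] obtain Q where Q: "fs ! 0 = AO Q" by (elim exE)
  have k: "0 < length fs" "1 < length fs" "(0::nat) \<noteq> 1" using len by linarith+
  have "set (alt 0 1 n) \<subseteq> {..<length fs}" for n using set_alt[of 0 1 n] k by auto
  moreover have "map (\<lambda>_. 0) (alt 0 1 n) \<in> idx fs (alt 0 1 n)" for n
    using n_pos[OF k(1) refl] n_pos[OF k(2) refl] set_alt[of 0 1 n] by (intro idx_exists) auto
  ultimately have "set (alt 0 1 n) \<subseteq> {..<length fs} \<and> map (\<lambda>_. 0) (alt 0 1 n) \<in> idx fs (alt 0 1 n) \<and> real n \<le> growth (0, False) (alt 0 1 n) (map (\<lambda>_. 0) (alt 0 1 n))" for n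
    using growth_AO[OF k Q] by simp
  moreover have "(0, False) \<in> set (dirs fs)" using k by (simp add: set_dirs)
  ultimately show ?thesis by blast
qed

lemma path_cocycle_nontrivial:
  assumes "fs \<noteq> []" "\<nexists>Q. fs = [AO Q]" and c: "path_cocycle fs G c"
  shows "\<not> trivial_cocycle fs G c"
proof
  assume "trivial_cocycle fs G c"
  then obtain \<xi> where \<xi>: "\<And>x. c x = act G x \<xi> - scaleC (eps fs x) \<xi>" by (auto simp: trivial_cocycle_def)
  from unbounded_growth[OF assms(1,2)] obtain d where d: "d \<in> set (dirs fs)"
    "\<forall>n. \<exists>t J. set t \<subseteq> {..<length fs} \<and> J \<in> idx fs t \<and> real n \<le> growth d t J" by (elim bexE)
  let ?w = "norm (omega (fst d) (snd d))"
  from reals_Archimedean2[of "?w\<^sup>2 * (4 * (norm \<xi>)\<^sup>2)"] obtain n where n: "?w\<^sup>2 * (4 * (norm \<xi>)\<^sup>2) < real n" by (elim exE)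
  from d(2)[rule_format, of n] obtain t J where t: "set t \<subseteq> {..<length fs}" "J \<in> idx fs t" "real n \<le> growth d t J"
    by (elim exE conjE)
  have "growth d t J \<le> ?w\<^sup>2 * (\<Sum>I\<in>idx fs t. (norm (c (wmat t I J)))\<^sup>2)" by (rule growth_le[OF c d(1)])
  also have "\<dots> \<le> ?w\<^sup>2 * (4 * (norm \<xi>)\<^sup>2)" by (intro mult_left_mono trivial_bound[OF \<xi> t(1,2)]) simp
  finally show False using n t(3) by simp
qed

subsection \<open>The quantum dimension\<close>

text \<open>Since \<open>omega\<close> implements the counit on its own components, its squared norm
  is the sum of its coefficients. The resulting number is the quantum dimension by
  \<open>qdim_umat\<close>.\<close>

lemma norm_omega:
  assumes k: "k < length fs"
  shows "norm (omega k False) = sqrt (hmuinv fs k * hmusum fs k)"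
proof -
  let ?n = "fdim fs k"
  have hm: "0 < hmuinv fs k" "0 < hmusum fs k" using hmuinv_pos[OF k refl] hmusum_pos[OF k refl] .
  have "cinner (omega k False) (omega k False) = (\<Sum>i<?n. of_real (hmuinv fs k * hmu fs k i) * cinner (omega k False) (L (hx fs k False i i)))"
    by (subst (2) omega_def) (simp add: cinner_sum_right cinner_scaleC_right)
  also have "\<dots> = (\<Sum>i<?n. of_real (hmuinv fs k * hmu fs k i))"
    by (intro sum.cong refl) (simp add: omega_hx_same[OF k])
  also have "\<dots> = of_real (hmuinv fs k * hmusum fs k)" by (simp add: hmusum_def sum_distrib_left)
  finally have "(norm (omega k False))\<^sup>2 = hmuinv fs k * hmusum fs k" by (simp only: cinner_self of_real_eq_iff)
  then show ?thesis by (simp add: real_sqrt_unique)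
qed

text \<open>The description of \<open>qdim\<close> is meaningful only if the trace is unique. A
  modular matrix need not be diagonal in the chosen basis, but functionals dual to the u_ij recover
  all products of an entry of F with an entry of its inverse, hence the product of the two
  traces.\<close>

lemma qdim_umat:
  assumes k: "k < length fs"
  shows "qdim fs (antip G) (umat fs k) = sqrt (hmuinv fs k * hmusum fs k)"
proof -
  let ?n = "fdim fs k" let ?u = "umat fs k" let ?T = "sqrt (hmuinv fs k * hmusum fs k)"
  have Tpos: "0 < ?T" using hmuinv_pos[OF k refl] hmusum_pos[OF k refl] by simp
  obtain F0 where F0: "is_modular_mat fs (antip G) ?u F0" "mtrace F0 = of_real ?T" using modular_mat_exists[OF k refl] by blast
  have u: "?u \<in> carrier_mat ?n ?n" "\<And>i j. i < ?n \<Longrightarrow> j < ?n \<Longrightarrow> ?u $$ (i, j) = gx k False i j" by (auto simp: umat_gmat)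
  have entry: "F $$ (a, i) * inv_mat F $$ (j, b) = f (antip G (antip G (gx k False a b)))"
    if F: "is_modular_mat fs (antip G) ?u F" and f: "kills fs f" "\<forall>p<?n. \<forall>q<?n. f (gx k False p q) = (if p = i \<and> q = j then 1 else 0)"
      and ab: "a < ?n" "b < ?n" "i < ?n" "j < ?n" for F f a b i j
  proof -
    have Fc: "F \<in> carrier_mat ?n ?n" "invertible_mat F" using F by (auto simp: is_modular_mat_def pos_mat_def umat_gmat)
    note Fi = invertible_inv_mat[OF Fc(2,1)]
    have lin: "linearF (*) f" using f(1) by (simp add: kills_def)
    have e: "eqS fs (antip G (antip G (gx k False a b))) ((cmat F * ?u * cmat (inv_mat F)) $$ (a, b))"
    proof -
      have "mat_eqS fs (map_mat (\<lambda>x. antip G (antip G x)) ?u) (cmat F * ?u * cmat (inv_mat F))" using F by (simp add: is_modular_mat_def)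
      then show ?thesis using ab u by (simp add: mat_eqS_def del: index_mult_mat(1))
    qed
    have cu: "cmat F * ?u \<in> carrier_mat ?n ?n" using Fc u by (intro mult_carrier_mat[of _ ?n ?n _ ?n]) auto
    have "(cmat F * ?u * cmat (inv_mat F)) $$ (a, b) = (\<Sum>q<?n. (cmat F * ?u) $$ (a, q) * cmat (inv_mat F) $$ (q, b))"
      using ab cu Fi by (subst mult_mat_index) (auto simp del: index_mult_mat(1))
    also have "\<dots> = (\<Sum>q<?n. \<Sum>p<?n. scaleF (F $$ (a, p) * inv_mat F $$ (q, b)) (gx k False p q))"
    proof (intro sum.cong refl)
      fix q assume "q \<in> {..<?n}"
      then have q: "q < ?n" by simp
      have "(cmat F * ?u) $$ (a, q) = (\<Sum>p<?n. cst (F $$ (a, p)) * gx k False p q)"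
        using ab q Fc u by (subst mult_mat_index) auto
      moreover have "cmat (inv_mat F) $$ (q, b) = cst (inv_mat F $$ (q, b))" using q ab Fi by simp
      ultimately show "(cmat F * ?u) $$ (a, q) * cmat (inv_mat F) $$ (q, b) = (\<Sum>p<?n. scaleF (F $$ (a, p) * inv_mat F $$ (q, b)) (gx k False p q))"
        by (simp only: sum_distrib_right cst_sandwich)
    qed
    finally have "f (antip G (antip G (gx k False a b))) = (\<Sum>q<?n. \<Sum>p<?n. (F $$ (a, p) * inv_mat F $$ (q, b)) * f (gx k False p q))"
      using kills_eqS[OF f(1) e] by (simp add: linearF_sum[OF lin] linearF_scale[OF lin])
    also have "\<dots> = (\<Sum>q<?n. \<Sum>p<?n. (F $$ (a, p) * inv_mat F $$ (q, b)) * (if p = i \<and> q = j then 1 else 0))"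
      using f(2) by (intro sum.cong refl) simp
    also have "\<dots> = (\<Sum>q<?n. (F $$ (a, i) * inv_mat F $$ (q, b)) * (if q = j then 1 else 0))"
      using ab by (intro sum.cong refl) (simp add: sum_pick)
    also have "\<dots> = F $$ (a, i) * inv_mat F $$ (j, b)" using ab by (subst sum.cong[OF refl, of _ _ "\<lambda>q. if q = j then F $$ (a, i) * inv_mat F $$ (j, b) else 0"]) auto
    finally show ?thesis by simp
  qed
  have unique: "mtrace F = of_real ?T" if F: "is_modular_mat fs (antip G) ?u F" for F
  proof -
    have Fc: "F \<in> carrier_mat ?n ?n" "invertible_mat F" "mtrace F = mtrace (inv_mat F)" "pos_mat ?n F"
      using F by (auto simp: is_modular_mat_def pos_mat_def umat_gmat)
    have F0c: "F0 \<in> carrier_mat ?n ?n" "invertible_mat F0" "mtrace F0 = mtrace (inv_mat F0)"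
      using F0(1) by (auto simp: is_modular_mat_def pos_mat_def umat_gmat)
    note Fi = invertible_inv_mat[OF Fc(2,1)] and F0i = invertible_inv_mat[OF F0c(2,1)]
    have "F $$ (i, i) * inv_mat F $$ (j, j) = F0 $$ (i, i) * inv_mat F0 $$ (j, j)" if ij: "i < ?n" "j < ?n" for i j
    proof -
      have "\<exists>f. kills fs f \<and> (\<forall>p<?n. \<forall>q<?n. f (gx k False p q) = (if p = i \<and> q = j then 1 else 0))"
        by (rule gen_functional[OF valid k])
      then obtain f where f: "kills fs f" "\<forall>p<?n. \<forall>q<?n. f (gx k False p q) = (if p = i \<and> q = j then 1 else 0)" by (elim exE conjE)
      show ?thesis by (simp only: entry[OF F f ij ij] entry[OF F0(1) f ij ij])
    qed
    then have "(\<Sum>i<?n. \<Sum>j<?n. F $$ (i, i) * inv_mat F $$ (j, j)) = (\<Sum>i<?n. \<Sum>j<?n. F0 $$ (i, i) * inv_mat F0 $$ (j, j))"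
      by (intro sum.cong refl) simp
    then have "mtrace F * mtrace (inv_mat F) = mtrace F0 * mtrace (inv_mat F0)"
      using Fc(1) F0c(1) Fi(1) F0i(1) by (simp add: mtrace_def sum_product)
    \<comment> \<open>The equality of the two traces makes the product a square, so the trace is
      known up to sign; positivity of the diagonal entries decides the sign.\<close>
    then have "mtrace F * mtrace F = mtrace F0 * mtrace F0" by (simp only: Fc(3)[symmetric] F0c(3)[symmetric])
    then have "mtrace F = of_real ?T \<or> mtrace F = - of_real ?T" unfolding F0(2) by (simp only: square_eq_iff)
    moreover have "0 \<le> Re (mtrace F)"
    proof -
      have "0 \<le> Re (F $$ (i, i))" if i: "i < ?n" for i
      proof -
        have "0 \<le> (F *\<^sub>v unit_vec ?n i) \<bullet>c unit_vec ?n i" using Fc(4) by (simp add: pos_mat_def)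
        also have "(F *\<^sub>v unit_vec ?n i) \<bullet>c unit_vec ?n i = F $$ (i, i)"
        proof -
          have "(F *\<^sub>v unit_vec ?n i) \<bullet>c unit_vec ?n i = (\<Sum>p<?n. (F *\<^sub>v unit_vec ?n i) $ p * cnj (unit_vec ?n i $ p))"
            by (simp add: scalar_prod_def atLeast0LessThan)
          also have "\<dots> = (\<Sum>p<?n. if p = i then F $$ (i, i) else 0)"
            using i Fc(1) by (intro sum.cong refl) (simp add: scalar_prod_right_unit)
          finally show ?thesis using i by simp
        qed
        finally show ?thesis by (simp add: less_eq_complex_def)
      qed
      then have "0 \<le> (\<Sum>i<?n. Re (F $$ (i, i)))" by (intro sum_nonneg) simp
      then show ?thesis using Fc(1) by (simp add: mtrace_def)
    qed
    ultimately show ?thesis using Tpos by auto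
  qed
  show ?thesis unfolding qdim_def
  proof (rule the_equality)
    show "\<exists>F. is_modular_mat fs (antip G) ?u F \<and> mtrace F = of_real ?T" by (rule exI[of _ F0], rule conjI, rule F0(1), rule F0(2))
    fix t :: real assume "\<exists>F. is_modular_mat fs (antip G) ?u F \<and> mtrace F = of_real t"
    then obtain F where F: "is_modular_mat fs (antip G) ?u F" "mtrace F = of_real t" by (elim exE conjE)
    have "complex_of_real t = of_real ?T" unfolding F(2)[symmetric] by (rule unique[OF F(1)])
    then show "t = ?T" by (simp only: of_real_eq_iff)
  qed
qed

end

section \<open>The lower bound for the tensor powers\<close>

lemma vmat_norm_column:
  assumes fin: "finite I" and J: "J \<in> I"
  shows "L2_set (\<lambda>i. norm (A i J)) I \<le> vmat_norm I A"
proof -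
  let ?\<xi> = "\<lambda>j. if j = J then 1 else 0 :: complex"
  let ?f = "\<lambda>\<xi>. L2_set (\<lambda>i. norm (\<Sum>j\<in>I. scaleC (\<xi> j) (A i j))) I"
  have "bdd_above (?f ` {\<xi>. L2_set (\<lambda>j. cmod (\<xi> j)) I \<le> 1})"
  proof (rule bdd_aboveI2)
    fix \<xi> :: "'a \<Rightarrow> complex" assume "\<xi> \<in> {\<xi>. L2_set (\<lambda>j. cmod (\<xi> j)) I \<le> 1}"
    then have \<xi>: "cmod (\<xi> j) \<le> 1" if "j \<in> I" for j
      using member_le_L2_set[OF fin that, of "\<lambda>j. cmod (\<xi> j)"] by simp
    have "?f \<xi> \<le> (\<Sum>i\<in>I. norm (\<Sum>j\<in>I. scaleC (\<xi> j) (A i j)))" by (rule L2_set_le_sum) simp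
    also have "\<dots> \<le> (\<Sum>i\<in>I. \<Sum>j\<in>I. norm (A i j))"
      by (intro sum_mono order_trans[OF norm_sum]) (use \<xi> in \<open>simp add: norm_scaleC mult_left_le_one_le\<close>)
    finally show "?f \<xi> \<le> (\<Sum>i\<in>I. \<Sum>j\<in>I. norm (A i j))" .
  qed
  moreover have "L2_set (\<lambda>j. cmod (?\<xi> j)) I \<le> 1"
    unfolding L2_set_def using fin J by (simp add: if_distrib[of "\<lambda>x. x\<^sup>2"] if_distrib[of cmod] cong: if_cong)
  ultimately have "?f ?\<xi> \<le> vmat_norm I A" unfolding vmat_norm_def by (intro cSUP_upper) auto
  moreover have "(\<Sum>j\<in>I. scaleC (?\<xi> j) (A i j)) = A i J" for i
  proof -
    have "(\<Sum>j\<in>I. scaleC (?\<xi> j) (A i j)) = (\<Sum>j\<in>I. if j = J then A i J else 0)" by (intro sum.cong refl) auto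
    then show ?thesis using fin J by simp
  qed
  ultimately show ?thesis by simp
qed

lemma multi_indices_idx: "multi_indices (fdim fs k) n = idx fs (replicate n k)"
proof (induction n)
  case 0
  show ?case by (auto simp: multi_indices_def)
next
  case (Suc n)
  have "v \<in> multi_indices (fdim fs k) (Suc n) \<longleftrightarrow> v \<in> idx fs (replicate (Suc n) k)" for v
    using Suc by (cases v) (auto simp: multi_indices_def idx.simps(2))
  then show ?case by blast
qed

lemma tensor_power_wmat:
  assumes "v \<in> idx fs (replicate n k)" "w \<in> idx fs (replicate n k)"
  shows "tensor_power_entry (umat fs k) v w = wmat (replicate n k) v w"
  using assms
proof (induction n arbitrary: v w)
  case 0
  then show ?case by (simp add: tensor_power_entry_def)
next
  case (Suc n)
  from Suc.prems(1) obtain i v' where v: "v = i # v'" "i < fdim fs k" "v' \<in> idx fs (replicate n k)" unfolding replicate_Suc by (rule idx_ConsE)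
  from Suc.prems(2) obtain j w' where w: "w = j # w'" "j < fdim fs k" "w' \<in> idx fs (replicate n k)" unfolding replicate_Suc by (rule idx_ConsE)
  show ?case using Suc.IH[OF v(3) w(3)] v(2) w(2) by (simp add: v(1) w(1) tensor_power_entry_def umat_gmat)
qed

text \<open>The column indexed by zeros already has the growth n, and the norm of a matrix dominates
  that of each column. The factor in front is the norm of \<open>omega\<close>.\<close>

lemma path_cocycle_growth:
  fixes G :: "('h::complex_hilbert, 'k::complex_hilbert) cayley_data"
  assumes "valid_cayley_graph fs G" and k: "k < length fs" "fs ! k = AU Q" and c: "path_cocycle fs G c"
  shows "sqrt (real n) \<le> qdim fs (antip G) (umat fs k) *
    vmat_norm (multi_indices (fdim fs k) n) (\<lambda>v w. c (tensor_power_entry (umat fs k) v w))"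
proof -
  interpret valid_cayley_graph fs G by fact
  let ?A = "idx fs (replicate n k)" let ?w = "norm (omega k False)"
  define J where "J = map (\<lambda>_. 0 :: nat) (replicate n k)"
  have J: "J \<in> ?A" unfolding J_def using n_pos[OF k(1) refl] by (intro idx_exists) auto
  have d: "(k, False) \<in> set (dirs fs)" using k by (simp add: set_dirs)
  have "real n \<le> ?w\<^sup>2 * (\<Sum>I\<in>?A. (norm (c (wmat (replicate n k) I J)))\<^sup>2)"
    using growth_le[OF c d, of "replicate n k" J] growth_AU[OF k J] by simp
  then have "sqrt (real n) \<le> ?w * L2_set (\<lambda>I. norm (c (wmat (replicate n k) I J))) ?A"
    using real_sqrt_le_mono by (fastforce simp: L2_set_def real_sqrt_mult)
  also have "L2_set (\<lambda>I. norm (c (wmat (replicate n k) I J))) ?A = L2_set (\<lambda>v. norm (c (tensor_power_entry (umat fs k) v J))) ?A"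
    by (intro L2_set_cong refl) (simp add: tensor_power_wmat J)
  also have "?w * L2_set (\<lambda>v. norm (c (tensor_power_entry (umat fs k) v J))) ?A \<le> ?w * vmat_norm ?A (\<lambda>v w. c (tensor_power_entry (umat fs k) v w))"
    by (rule mult_left_mono[OF vmat_norm_column[OF finite_idx J] norm_ge_zero])
  finally show ?thesis by (simp add: multi_indices_idx qdim_umat[OF k(1)] norm_omega[OF k(1)])
qed

theorem proposition4p5:
  shows "(\<exists>C :: real \<Rightarrow> real. (\<forall>m. 0 < C m) \<and>
      (\<forall>(N::nat) (G :: ('h::complex_hilbert, 'k::complex_hilbert) cayley_data) c (n::nat).
        1 \<le> N \<and> N \<noteq> 2 \<and> quantum_cayley_graph [AU (1\<^sub>m N)] G \<and> path_cocycle [AU (1\<^sub>m N)] G c \<and> 1 \<le> n \<longrightarrow>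
        (let \<gamma> = umat [AU (1\<^sub>m N)] 0 in
          C (qdim [AU (1\<^sub>m N)] (antip G) \<gamma>) * sqrt (real (n + 1))
          \<le> vmat_norm (multi_indices N n) (\<lambda>v w. c (tensor_power_entry \<gamma> v w)))))
    \<and> (\<forall>fs (G :: ('h, 'k) cayley_data) c.
        fs \<noteq> [] \<and> (\<forall>f\<in>set fs. valid_factor f) \<and> (\<nexists>Q. fs = [AO Q]) \<and>
        (\<forall>\<gamma>\<in>set (directions fs). qdim fs (antip G) \<gamma> \<noteq> 2) \<and>
        quantum_cayley_graph fs G \<and> path_cocycle fs G c \<longrightarrow>
        \<not> trivial_cocycle fs G c)"
proof (intro conjI exI[of _ "\<lambda>m. 1 / (2 * (1 + \<bar>m\<bar>))"] allI impI)
  \<comment> \<open>The growth estimate gives 1/m in front of the square root of n. Passing to n + 1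
    costs the factor 2, and 1 + \<bar>m\<bar> in place of m keeps the constant positive and defined
    for every real m.\<close>
  show "0 < 1 / (2 * (1 + \<bar>m\<bar>))" for m :: real by simp
next
  fix N :: nat and G :: "('h, 'k) cayley_data" and c and n :: nat
  let ?fs = "[AU (1\<^sub>m N)]"
  assume *: "1 \<le> N \<and> N \<noteq> 2 \<and> quantum_cayley_graph ?fs G \<and> path_cocycle ?fs G c \<and> 1 \<le> n"
  have "invertible_mat (1\<^sub>m N :: complex mat)" by (rule inv_mat_eqI(1)[of _ N "1\<^sub>m N"]) auto
  then have v: "valid_cayley_graph ?fs G"
    using * by (auto simp: valid_cayley_graph_def valid_cayley_graph_axioms_def)
  let ?m = "qdim ?fs (antip G) (umat ?fs 0)"
    and ?V = "vmat_norm (multi_indices N n) (\<lambda>v w. c (tensor_power_entry (umat ?fs 0) v w))"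
  have dim: "fdim ?fs 0 = N" by (simp add: fdim_def)
  have 1: "sqrt (real n) \<le> ?m * ?V"
    using path_cocycle_growth[OF v, of 0 "1\<^sub>m N" c n] * by (simp add: dim)
  have n: "1 \<le> sqrt (real n)" using * by simp
  have V0: "0 \<le> ?V"
  proof -
    have "0 \<le> ?m" using valid_cayley_graph.qdim_umat[OF v, of 0] valid_cayley_graph.hmuinv_pos[OF v _ refl, of 0] valid_cayley_graph.hmusum_pos[OF v _ refl, of 0] by simp
    then show ?thesis using 1 n by (smt (verit) mult_nonneg_nonpos)
  qed
  \<comment> \<open>Here n \<ge> 1 is used, in the form n + 1 \<le> 4n.\<close>
  have "sqrt (real (n + 1)) \<le> 2 * sqrt (real n)"
  proof -
    have "real (n + 1) \<le> 2\<^sup>2 * real n" using * by simp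
    then show ?thesis using real_sqrt_le_mono[of "real (n + 1)" "2\<^sup>2 * real n"] by (simp add: real_sqrt_mult)
  qed
  also have "sqrt (real n) \<le> (1 + \<bar>?m\<bar>) * ?V" by (rule order_trans[OF 1 mult_right_mono[OF _ V0]]) simp
  finally have "sqrt (real (n + 1)) \<le> 2 * ((1 + \<bar>?m\<bar>) * ?V)" by simp
  then have "1 / (2 * (1 + \<bar>?m\<bar>)) * sqrt (real (n + 1)) \<le> ?V"
    by (simp add: pos_divide_le_eq algebra_simps)
  then show "let \<gamma> = umat ?fs 0 in 1 / (2 * (1 + \<bar>qdim ?fs (antip G) \<gamma>\<bar>)) * sqrt (real (n + 1))
      \<le> vmat_norm (multi_indices N n) (\<lambda>v w. c (tensor_power_entry \<gamma> v w))"
    by (simp only: Let_def)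
next
  fix fs and G :: "('h, 'k) cayley_data" and c
  assume *: "fs \<noteq> [] \<and> (\<forall>f\<in>set fs. valid_factor f) \<and> (\<nexists>Q. fs = [AO Q]) \<and>
        (\<forall>\<gamma>\<in>set (directions fs). qdim fs (antip G) \<gamma> \<noteq> 2) \<and>
        quantum_cayley_graph fs G \<and> path_cocycle fs G c"
  then have "valid_cayley_graph fs G"
    by (auto simp: valid_cayley_graph_def valid_cayley_graph_axioms_def)
  then show "\<not> trivial_cocycle fs G c"
    by (rule valid_cayley_graph.path_cocycle_nontrivial) (use * in auto)
qed

end
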